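(* For each $n\in\mathbb{N}$, let $q_n\in\mathbb{N}$ and let $F_n\in C_{q_n}$ (the $q_n$-th Poisson Wiener chaos associated with $\eta$) satisfy $$\lim_{n\to\infty}\mathbb{E}[F_n^2]=1\quad\text{and}\quad\lim_{n\to\infty}\mathbb{E}[F_n^4]=3\,.$$ Then the sequence $(F_n)_{n\in\mathbb{N}}$ converges in distribution to a standard normal random variable $N$.
   Context: $\mathbb{N}=\{1,2,\dots\}$. $(\mathcal{Z},\mathscr{Z},\mu)$ is a $\sigma$-finite measure space and $\eta$ is a Poisson random measure on it with control $\mu$, defined on a probability space $(\Omega,\mathcal{F},\mathbb{P})$: for pairwise disjoint $B_1,\dots,B_m\in\mathscr{Z}$ the variables $\eta(B_1),\dots,\eta(B_m)$ are independent, and $\eta(B)$ is Poisson distributed with mean $\mu(B)$ for all $B\in\mathscr{Z}$. The compensated measure is $\widehat\eta(B)=\eta(B)-\mu(B)$ for $\mu(B)<\infty$. Multiple integrals: for $q\ge1$ and $f\in L^2(\mu^q)$, $I^\eta_q(f)$ is the multiple Wiener-It\^o integral of order $q$ of $f$ with respect to $\widehat\eta$; $I^\eta_0(c)=c$ for $c\in\mathbb{R}$. Concretely, for symmetric $f\in L^1(\mu^q)\cap L^2(\mu^q)$, $I_q^\eta(f)=\sum_{k=0}^q(-1)^{q-k}\binom{q}{k}\int\int f\,d\eta^{(k)}\,d\mu^{q-k}$, where $\eta^{(k)}$ is the $k$-th factorial measure of $\eta$ (sum of unit masses at $k$-tuples of atoms of $\eta$ with distinct indices); this extends by $L^2$-continuity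 to symmetric $f\in L^2(\mu^q)$, and $I_q^\eta(f)=I_q^\eta(\tilde f)$ with $\tilde f$ the symmetrization of $f$. One has $\mathbb{E}[I^\eta_p(f)I^\eta_q(g)]=\delta_{p,q}\,p!\,\langle\tilde f,\tilde g\rangle_{L^2(\mu^p)}$. The $q$-th Poisson Wiener chaos is $C_q=\{I_q^\eta(f): f\in L^2(\mu^q)\}$. *)

theory Defs
  imports "HOL-Probability.Probability"
begin

section \<open>Poisson random measures\<close>

text \<open>
  \<open>atom_enumeration \<xi> I x\<close>: the measure \<open>\<xi>\<close> is the sum of the unit masses at \<open>x i\<close>, \<open>i \<in> I\<close>;
  an atom of multiplicity \<open>m\<close> is listed under \<open>m\<close> distinct indices.
\<close>

definition atom_enumeration :: "'z measure \<Rightarrow> nat set \<Rightarrow> (nat \<Rightarrow> 'z) \<Rightarrow> bool" where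
  "atom_enumeration \<xi> I x \<longleftrightarrow> x \<in> I \<rightarrow> space \<xi> \<and> \<xi> = distr (count_space I) \<xi> x"

text \<open>
  \<open>has_poisson_law M Y m\<close>: under the probability measure \<open>M\<close> the \<open>[0,\<infinity>]\<close>-valued variable \<open>Y\<close> is
  Poisson distributed with mean \<open>m \<in> [0,\<infinity>]\<close>, with the usual convention that mean \<open>\<infinity>\<close> means
  \<open>Y = \<infinity>\<close> almost surely. (The library's \<open>poisson_pmf\<close> only covers means in \<open>(0,\<infinity>)\<close>.)
\<close>

definition has_poisson_law :: "'w measure \<Rightarrow> ('w \<Rightarrow> ennreal) \<Rightarrow> ennreal \<Rightarrow> bool" where
  "has_poisson_law M Y m \<longleftrightarrow> Y \<in> borel_measurable M \<and>
     (if m = \<infinity> then AE \<omega> in M. Y \<omega> = \<infinity>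
      else \<forall>k::nat. measure M {\<omega> \<in> space M. Y \<omega> = of_nat k}
                      = enn2real m ^ k / fact k * exp (- enn2real m))"

locale poisson_random_measure = prob_space M + control: sigma_finite_measure \<mu>
  for M :: "'w measure" and \<mu> :: "'z measure" +
  fixes \<eta> :: "'w \<Rightarrow> 'z measure"
  assumes sets_eta: "\<And>\<omega>. \<omega> \<in> space M \<Longrightarrow> sets (\<eta> \<omega>) = sets \<mu>"
    and eta_atoms: "AE \<omega> in M. \<exists>I x. atom_enumeration (\<eta> \<omega>) I x"
    and eta_poisson: "\<And>B. B \<in> sets \<mu> \<Longrightarrow> has_poisson_law M (\<lambda>\<omega>. emeasure (\<eta> \<omega>) B) (emeasure \<mu> B)"
    and eta_indep: "\<And>(m::nat) B. B ` {..<m} \<subseteq> sets \<mu> \<Longrightarrow> disjoint_family_on B {..<m} \<Longrightarrow>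
       indep_vars (\<lambda>_. borel) (\<lambda>i \<omega>. emeasure (\<eta> \<omega>) (B i)) {..<m}"


section \<open>Multiple Wiener-Ito integrals\<close>

text \<open>
  The factorial measure of order \<open>k\<close>: the sum of the unit masses at the \<open>k\<close>-tuples
  \<open>(x (i 0), \<dots>, x (i (k - 1)))\<close> with pairwise distinct indices \<open>i j \<in> I\<close>. For \<open>\<sigma>\<close>-finite \<open>\<xi>\<close>
  it does not depend on the chosen enumeration: the masses of boxes with sides of finite mass are
  determined by \<open>\<xi>\<close> through inclusion and exclusion.
\<close>

definition factorial_measure :: "'z measure \<Rightarrow> nat \<Rightarrow> (nat \<Rightarrow> 'z) measure" where
  "factorial_measure \<xi> k =
     (let (I, x) = (SOME (I, x). atom_enumeration \<xi> I x)
      in distr (count_space {i \<in> {..<k} \<rightarrow>\<^sub>E I. inj_on i {..<k}}) (PiM {..<k} (\<lambda>_. \<xi>))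
           (\<lambda>i. \<lambda>j\<in>{..<k}. x (i j)))"

abbreviation power_measure :: "'z measure \<Rightarrow> nat \<Rightarrow> (nat \<Rightarrow> 'z) measure" where
  "power_measure \<mu> q \<equiv> PiM {..<q} (\<lambda>_. \<mu>)"

definition L2 :: "'a measure \<Rightarrow> ('a \<Rightarrow> real) set" where
  "L2 N = {f \<in> borel_measurable N. integrable N (\<lambda>x. (f x)\<^sup>2)}"

text \<open>A kernel of order \<open>q\<close> is a function on \<open>space (power_measure \<mu> q)\<close>; permuting its arguments
  amounts to precomposing the tuple with a permutation of \<open>{..<q}\<close>.\<close>

definition symmetric_kernel :: "'z measure \<Rightarrow> nat \<Rightarrow> ((nat \<Rightarrow> 'z) \<Rightarrow> real) \<Rightarrow> bool" where
  "symmetric_kernel \<mu> q f \<longleftrightarrow>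
     (\<forall>x \<in> space (power_measure \<mu> q). \<forall>\<pi>. \<pi> permutes {..<q} \<longrightarrow> f (x \<circ> \<pi>) = f x)"

definition symmetrization :: "nat \<Rightarrow> ((nat \<Rightarrow> 'z) \<Rightarrow> real) \<Rightarrow> (nat \<Rightarrow> 'z) \<Rightarrow> real" where
  "symmetrization q f x = (\<Sum>\<pi> | \<pi> permutes {..<q}. f (x \<circ> \<pi>)) / fact q"

text \<open>
  The pathwise formula for symmetric \<open>f \<in> L\<^sup>1(\<mu>\<^sup>q) \<inter> L\<^sup>2(\<mu>\<^sup>q)\<close>: the first \<open>k\<close> arguments are integrated
  with respect to the factorial measure of \<open>\<eta>\<close>, the remaining \<open>q - k\<close> ones with respect to \<open>\<mu>\<close>.
\<close>

definition pathwise_integral ::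
  "'z measure \<Rightarrow> ('w \<Rightarrow> 'z measure) \<Rightarrow> nat \<Rightarrow> ((nat \<Rightarrow> 'z) \<Rightarrow> real) \<Rightarrow> 'w \<Rightarrow> real" where
  "pathwise_integral \<mu> \<eta> q f \<omega> =
     (\<Sum>k\<le>q. (-1) ^ (q - k) * real (q choose k) *
        (\<integral>y. (\<integral>x. f (merge {..<k} {k..<q} (x, y)) \<partial>factorial_measure (\<eta> \<omega>) k)
           \<partial>PiM {k..<q} (\<lambda>_. \<mu>)))"

text \<open>
  \<open>has_multiple_integral M \<mu> \<eta> q f F\<close>: the random variable \<open>F\<close> is a version of \<open>I\<^sub>q(f)\<close>, i.e.\ it is
  the limit in \<open>L\<^sup>2(M)\<close> of the pathwise integrals of some symmetric kernels
  \<open>g n \<in> L\<^sup>1(\<mu>\<^sup>q) \<inter> L\<^sup>2(\<mu>\<^sup>q)\<close> that converge in \<open>L\<^sup>2(\<mu>\<^sup>q)\<close> to the symmetrization of \<open>f\<close>.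
  By the isometry property the limit does not depend on the sequence, up to null sets.
  The \<open>L\<^sup>2(M)\<close> distance is a \<open>[0,\<infinity>]\<close>-valued integral because the pathwise integrals are
  in general measurable only up to modification on a null set.
\<close>

definition has_multiple_integral ::
  "'w measure \<Rightarrow> 'z measure \<Rightarrow> ('w \<Rightarrow> 'z measure) \<Rightarrow> nat \<Rightarrow> ((nat \<Rightarrow> 'z) \<Rightarrow> real)
     \<Rightarrow> ('w \<Rightarrow> real) \<Rightarrow> bool" where
  "has_multiple_integral M \<mu> \<eta> q f F \<longleftrightarrow> F \<in> L2 M \<and>
     (\<exists>g. (\<forall>n::nat. symmetric_kernel \<mu> q (g n) \<and> integrable (power_measure \<mu> q) (g n)
                \<and> g n \<in> L2 (power_measure \<mu> q)) \<and>
          (\<lambda>n. \<integral>\<^sup>+x. ennreal ((g n x - symmetrization q f x)\<^sup>2) \<partial>power_measure \<mu> q)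
             \<longlonglongrightarrow> 0 \<and>
          (\<lambda>n. \<integral>\<^sup>+\<omega>. ennreal ((pathwise_integral \<mu> \<eta> q (g n) \<omega> - F \<omega>)\<^sup>2) \<partial>M) \<longlonglongrightarrow> 0)"

definition poisson_chaos ::
  "'w measure \<Rightarrow> 'z measure \<Rightarrow> ('w \<Rightarrow> 'z measure) \<Rightarrow> nat \<Rightarrow> ('w \<Rightarrow> real) set" where
  "poisson_chaos M \<mu> \<eta> q =
     {F. \<exists>f \<in> L2 (power_measure \<mu> q). has_multiple_integral M \<mu> \<eta> q f F}"

end

(* Conditioning on the counts of finitely many disjoint cells turns F into a homogeneous Charlier
   polynomial in finitely many independent Poisson variables, and by density of simple kernels and
   truncation the error is small in the fourth mean.  For such an F of order q the birth-death
   dynamics of the counts has eigenvalue q, so E F g(F) is 1/q times the energy (carre du champ)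
   pairing of F with g(F).  The square of F only has chaos orders up to 2q, and its part of order 2q
   has second moment at least 2 (E F^2)^2; together with the quartic energy identity this bounds
   |E F g(F) - (E F^2) E g'(F)| by a function of E F^4 - 3 (E F^2)^2, uniformly in q.  Taking g to
   be sine and cosine gives an approximate differential equation for the characteristic function
   of F, and Levy's continuity theorem concludes. *)
theory Submission
  imports Defs "HOL-Combinatorics.Permutations"
begin

section \<open>Difference calculus on counting vectors\<close>

text \<open>Two obstacles shape the argument. Functions of counts obey no chain rule. The carre du
  champ, however, weighs a test function by its average over both ends of a jump, so the trapezoidal
  rule is the natural substitute: its error is cubic in the jump of \<open>F\<close>, and the energy
  pairing makes it quartic. The quartic energy is at most \<open>4 * q\<close> times the excess of
  the fourth moment, so small jumps are no separate condition. Secondly, Poisson chaos is not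
  hypercontractive: closeness in \<open>L2\<close> does not give closeness of fourth moments. Hence
  \<open>F\<close> and an \<open>L2\<close> approximant are truncated first, and conditioning on the
  counts, a contraction in the fourth mean, leads back from the truncated approximant to a variable
  of pure order \<open>q\<close>, for which the exact eigenvalue is available. The errors in the
  energy identity carry a factor \<open>q\<close> that cancels against this eigenvalue. The constant
  3 splits as 1 + 2: order 0 of the square of \<open>F\<close> contributes 1, and the top order
  contributes at least 2, because all contractions enter it with nonnegative sign and two families
  of pairings alone give that amount.\<close>

definition raise :: "'i \<Rightarrow> ('i \<Rightarrow> nat) \<Rightarrow> 'i \<Rightarrow> nat" where
  "raise i x = x(i := Suc (x i))"

definition lower :: "'i \<Rightarrow> ('i \<Rightarrow> nat) \<Rightarrow> 'i \<Rightarrow> nat" where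
  "lower i x = x(i := x i - 1)"

definition diff :: "'i \<Rightarrow> (('i \<Rightarrow> nat) \<Rightarrow> real) \<Rightarrow> ('i \<Rightarrow> nat) \<Rightarrow> real" where
  "diff i u x = u (raise i x) - u x"

text \<open>The adjoint of \<open>diff i\<close> under the Poisson law with mean
  \<open>lam i\<close>. At \<open>x i = 0\<close> the truncated subtraction in \<open>lower\<close>
  does no harm, since the factor \<open>real (x i)\<close> vanishes.\<close>

definition create :: "('i \<Rightarrow> real) \<Rightarrow> 'i \<Rightarrow> (('i \<Rightarrow> nat) \<Rightarrow> real) \<Rightarrow> ('i \<Rightarrow> nat) \<Rightarrow> real" where
  "create lam i v x = real (x i) * v (lower i x) - lam i * v x"

text \<open>Integration over the \<open>n\<close>-th power of the discrete measure with masses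
  \<open>lam i\<close>; words play the role of tuples. The recursion on the first letter matches
  those of \<open>chaos\<close> and \<open>fold diff\<close>.\<close>

primrec wsum :: "'i set \<Rightarrow> ('i \<Rightarrow> real) \<Rightarrow> nat \<Rightarrow> ('i list \<Rightarrow> real) \<Rightarrow> real" where
  "wsum I lam 0 f = f []"
| "wsum I lam (Suc n) f = (\<Sum>i\<in>I. lam i * wsum I lam n (\<lambda>z. f (i # z)))"

text \<open>The multiple integral of order \<open>n\<close> with kernel \<open>h\<close> in the
  variables \<open>x i\<close>. No weight \<open>lam\<close> appears, because \<open>create\<close>
  already integrates against the compensated count.\<close>

primrec chaos :: "'i set \<Rightarrow> ('i \<Rightarrow> real) \<Rightarrow> nat \<Rightarrow> ('i list \<Rightarrow> real) \<Rightarrow> ('i \<Rightarrow> nat) \<Rightarrow> real" where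
  "chaos I lam 0 h = (\<lambda>x. h [])"
| "chaos I lam (Suc n) h = (\<lambda>x. \<Sum>i\<in>I. create lam i (chaos I lam n (\<lambda>z. h (i # z))) x)"

text \<open>Multivariate Charlier polynomials. With \<open>lam = (\<lambda>_. 0)\<close> they are
  products of falling factorials, the form in which factorial measures enter later.\<close>

primrec charlier :: "('i \<Rightarrow> real) \<Rightarrow> 'i list \<Rightarrow> ('i \<Rightarrow> nat) \<Rightarrow> real" where
  "charlier lam [] = (\<lambda>x. 1)"
| "charlier lam (i # z) = create lam i (charlier lam z)"

definition sym_kernel :: "('i list \<Rightarrow> real) \<Rightarrow> bool" where
  "sym_kernel h \<longleftrightarrow> (\<forall>z z'. mset z = mset z' \<longrightarrow> h z = h z')"

text \<open>The states reachable from zero by raising coordinates in \<open>I\<close>; only there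
  does a function follow from its value at zero and its differences along \<open>I\<close>.\<close>

definition supported :: "'i set \<Rightarrow> ('i \<Rightarrow> nat) set" where
  "supported I = {x. \<forall>i. i \<notin> I \<longrightarrow> x i = 0}"

lemma sym_kernelD: "sym_kernel h \<Longrightarrow> mset z = mset z' \<Longrightarrow> h z = h z'"
  unfolding sym_kernel_def by blast

lemma sym_kernel_Cons: "sym_kernel h \<Longrightarrow> sym_kernel (\<lambda>z. h (i # z))"
  unfolding sym_kernel_def using mset.simps(2) by metis

section \<open>Commutation rules for raising, lowering, differences and creation operators\<close>

lemma raise_apply: "raise i x j = (if j = i then Suc (x j) else x j)"
  by (simp add: raise_def)

lemma lower_apply: "lower i x j = (if j = i then x j - 1 else x j)"
  by (simp add: lower_def)

lemma lower_raise [simp]: "lower i (raise i x) = x"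
  by (rule ext) (simp add: raise_apply lower_apply)

lemma raise_lower: "x i > 0 \<Longrightarrow> raise i (lower i x) = x"
  by (rule ext) (simp add: raise_apply lower_apply)

lemma raise_commute: "raise i (raise j x) = raise j (raise i x)"
  by (rule ext) (simp add: raise_apply)

lemma lower_commute: "lower i (lower j x) = lower j (lower i x)"
  by (rule ext) (simp add: lower_apply)

lemma raise_lower_commute: "i \<noteq> j \<Longrightarrow> raise i (lower j x) = lower j (raise i x)"
  by (rule ext) (simp add: lower_apply raise_apply)

lemma supported_raise: "x \<in> supported I \<Longrightarrow> i \<in> I \<Longrightarrow> raise i x \<in> supported I"
  by (auto simp: supported_def raise_apply)

lemma supported_zero: "(\<lambda>_. 0) \<in> supported I"
  by (auto simp: supported_def)

lemma diff_sum: "diff i (\<lambda>x. \<Sum>j\<in>J. f j x) = (\<lambda>x. \<Sum>j\<in>J. diff i (f j) x)"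
  by (rule ext) (simp add: diff_def sum_subtractf)

lemma diff_scale: "diff i (\<lambda>x. c * u x) = (\<lambda>x. c * diff i u x)"
  by (rule ext) (simp add: diff_def algebra_simps)

lemma diff_const: "diff i (\<lambda>x. c) = (\<lambda>x. 0)"
  by (rule ext) (simp add: diff_def)

lemma diff_mult: "diff i (\<lambda>x. u x * v x) =
    (\<lambda>x. diff i u x * v x + u x * diff i v x + diff i u x * diff i v x)"
  by (rule ext) (simp add: diff_def algebra_simps)

lemma diff_commute: "diff i \<circ> diff j = diff j \<circ> diff i"
  by (rule ext)+ (simp add: diff_def raise_commute algebra_simps)

lemma fold_diff_mset: "mset z = mset z' \<Longrightarrow> fold diff z u = fold diff z' u"
  using fold_multiset_equiv[of z diff z'] diff_commute by metis

lemma fold_diff_sum: "fold diff z (\<lambda>x. \<Sum>j\<in>J. f j x) = (\<lambda>x. \<Sum>j\<in>J. fold diff z (f j) x)"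
  by (induction z arbitrary: f) (simp_all add: diff_sum)

lemma fold_diff_scale: "fold diff z (\<lambda>x. c * u x) = (\<lambda>x. c * fold diff z u x)"
  by (induction z arbitrary: u) (simp_all add: diff_scale)

lemma fold_diff_add: "fold diff z (\<lambda>x. u x + v x) = (\<lambda>x. fold diff z u x + fold diff z v x)"
proof -
  have *: "diff i (\<lambda>x. u x + v x) = (\<lambda>x. diff i u x + diff i v x)" for i and u v :: "_ \<Rightarrow> real"
    by (rule ext) (simp add: diff_def)
  show ?thesis by (induction z arbitrary: u v) (simp_all add: *)
qed

lemma fold_diff_minus: "fold diff z (\<lambda>x. u x - v x) = (\<lambda>x. fold diff z u x - fold diff z v x)"
  using fold_diff_add[of z u "\<lambda>x. -1 * v x"] fold_diff_scale[of z "-1" v] by simp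

lemma create_scale: "create lam i (\<lambda>x. c * u x) = (\<lambda>x. c * create lam i u x)"
  by (rule ext) (simp add: create_def algebra_simps)

lemma create_zero: "create lam i (\<lambda>x. 0) = (\<lambda>x. 0)"
  by (rule ext) (simp add: create_def)

lemma create_commute: "create lam i \<circ> create lam j = create lam j \<circ> create lam i"
proof (cases "i = j")
  case False
  then show ?thesis
    by (intro ext) (simp add: create_def lower_commute[of i j] lower_apply algebra_simps)
qed simp

text \<open>The canonical commutation relation: \<open>diff\<close> and \<open>create\<close> act as annihilation and creation operators.\<close>

lemma diff_create:
  "diff i (create lam j v) = (\<lambda>x. create lam j (diff i v) x + (if i = j then v x else 0))"
proof (cases "i = j")
  case True
  show ?thesis
  proof (rule ext)
    fix x
    show "diff i (create lam j v) x = create lam j (diff i v) x + (if i = j then v x else 0)"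
      using True
      by (cases "x j = 0") (simp_all add: diff_def create_def raise_apply raise_lower algebra_simps)
  qed
next
  case False
  then show ?thesis
    by (intro ext) (simp add: diff_def create_def raise_apply raise_lower_commute algebra_simps)
qed

lemma charlier_foldr: "charlier lam z = foldr (create lam) z (\<lambda>x. 1)"
  by (induction z) simp_all

lemma charlier_mset: "mset z = mset z' \<Longrightarrow> charlier lam z = charlier lam z'"
  using fold_multiset_equiv[of "rev z" "create lam" "rev z'"] create_commute
  by (metis charlier_foldr foldr_conv_fold mset_rev)

section \<open>Sums over words and differences of discrete chaos\<close>

lemma wsum_sum: "wsum I lam n (\<lambda>z. \<Sum>j\<in>J. f j z) = (\<Sum>j\<in>J. wsum I lam n (f j))"
proof (induction n arbitrary: f)
  case (Suc n)
  show ?case by (simp add: Suc sum_distrib_left) (rule sum.swap)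
qed simp

lemma wsum_scale: "wsum I lam n (\<lambda>z. c * f z) = c * wsum I lam n f"
  by (induction n arbitrary: f) (simp_all add: sum_distrib_left algebra_simps)

lemma wsum_scale_right: "wsum I lam n (\<lambda>z. f z * c) = wsum I lam n f * c"
  using wsum_scale[of I lam n c f] by (simp add: mult.commute)

lemma wsum_add: "wsum I lam n (\<lambda>z. f z + g z) = wsum I lam n f + wsum I lam n g"
  by (induction n arbitrary: f g) (simp_all add: sum.distrib algebra_simps)

lemma wsum_minus: "wsum I lam n (\<lambda>z. f z - g z) = wsum I lam n f - wsum I lam n g"
  by (induction n arbitrary: f g) (simp_all add: sum_subtractf right_diff_distrib)

lemma wsum_cong:
  assumes "\<And>z. set z \<subseteq> I \<Longrightarrow> length z = n \<Longrightarrow> f z = g z"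
  shows "wsum I lam n f = wsum I lam n g"
  using assms
proof (induction n arbitrary: f g)
  case (Suc n)
  show ?case
    unfolding wsum.simps
  proof (rule sum.cong[OF refl])
    fix i assume "i \<in> I"
    then have "wsum I lam n (\<lambda>z. f (i # z)) = wsum I lam n (\<lambda>z. g (i # z))"
      by (intro Suc.IH Suc.prems) auto
    then show "lam i * wsum I lam n (\<lambda>z. f (i # z)) = lam i * wsum I lam n (\<lambda>z. g (i # z))"
      by simp
  qed
qed simp

lemma wsum_nonneg:
  assumes "\<And>i. i \<in> I \<Longrightarrow> lam i \<ge> 0" "\<And>z. set z \<subseteq> I \<Longrightarrow> length z = n \<Longrightarrow> f z \<ge> 0"
  shows "wsum I lam n f \<ge> 0"
  using assms
proof (induction n arbitrary: f)
  case (Suc n)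
  show ?case
    unfolding wsum.simps
    by (intro sum_nonneg mult_nonneg_nonneg Suc.IH Suc.prems) auto
qed simp

lemma wsum_weight:
  "wsum I lam n f = wsum I (\<lambda>_. 1) n (\<lambda>z. prod_list (map lam z) * f z)"
  by (induction n arbitrary: f) (simp_all add: wsum_scale[symmetric] mult.assoc)

lemma wsum_swap:
  "wsum I lam n (\<lambda>a. wsum J mu m (\<lambda>b. f a b)) = wsum J mu m (\<lambda>b. wsum I lam n (\<lambda>a. f a b))"
  by (induction n arbitrary: f) (simp_all add: wsum_sum wsum_scale)

lemma wsum_append:
  "wsum I lam (m + n) f = wsum I lam m (\<lambda>a. wsum I lam n (\<lambda>b. f (a @ b)))"
  by (induction m arbitrary: f) simp_all

lemma chaos_wsum: "chaos I lam n h x = wsum I (\<lambda>_. 1) n (\<lambda>z. h z * charlier lam z x)"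
proof (induction n arbitrary: h x)
  case (Suc n)
  have "chaos I lam n h = (\<lambda>x. wsum I (\<lambda>_. 1) n (\<lambda>z. h z * charlier lam z x))" for h
    using Suc.IH by (intro ext)
  moreover have "create lam i (\<lambda>x. wsum I (\<lambda>_. 1) n (\<lambda>z. h (i # z) * charlier lam z x)) x
    = wsum I (\<lambda>_. 1) n (\<lambda>z. h (i # z) * create lam i (charlier lam z) x)" for i
    by (simp add: create_def wsum_scale[symmetric] wsum_minus[symmetric] algebra_simps)
  ultimately show ?case by simp
qed simp

text \<open>Moving \<open>diff i\<close> past the creation operators leaves one term per operator,
  namely the one that it cancels; symmetry of \<open>h\<close> makes these \<open>Suc n\<close>
  terms equal.\<close>

lemma diff_chaos:
  assumes "finite I" "sym_kernel h" "i \<in> I"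
  shows "diff i (chaos I lam (Suc n) h) = (\<lambda>x. real (Suc n) * chaos I lam n (\<lambda>z. h (i # z)) x)"
  using assms(2)
proof (induction n arbitrary: h)
  case 0
  show ?case
    using assms by (intro ext) (simp add: diff_sum diff_create diff_const create_zero sum.delta')
next
  case (Suc n)
  have 1: "diff i (chaos I lam (Suc n) (\<lambda>z. h (j # z)))
      = (\<lambda>x. real (Suc n) * chaos I lam n (\<lambda>z. h (i # j # z)) x)" for j
  proof -
    have "(\<lambda>z. h (j # i # z)) = (\<lambda>z. h (i # j # z))"
      using Suc.prems by (intro ext sym_kernelD) auto
    then show ?thesis using Suc.IH[OF sym_kernel_Cons[OF Suc.prems]] by metis
  qed
  have "diff i (chaos I lam (Suc (Suc n)) h) = (\<lambda>x. \<Sum>j\<in>I.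
      create lam j (\<lambda>x. real (Suc n) * chaos I lam n (\<lambda>z. h (i # j # z)) x) x
      + (if i = j then chaos I lam (Suc n) (\<lambda>z. h (j # z)) x else 0))"
    unfolding chaos.simps(2)[of I lam "Suc n"] diff_sum diff_create 1 ..
  also have "\<dots> = (\<lambda>x. real (Suc n) * chaos I lam (Suc n) (\<lambda>z. h (i # z)) x
      + chaos I lam (Suc n) (\<lambda>z. h (i # z)) x)"
    unfolding create_scale sum.distrib using assms
    by (simp add: sum_distrib_left sum.delta')
  finally show ?case by (simp add: algebra_simps)
qed

text \<open>The top differences recover the kernel on words in \<open>I\<close>. The isometry and
  the chaos decomposition both rest on this.\<close>

lemma fold_diff_chaos:
  assumes "finite I" "sym_kernel h" "set z \<subseteq> I" "length z = n"
  shows "fold diff z (chaos I lam n h) = (\<lambda>x. fact n * h z)"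
  using assms(2-)
proof (induction n arbitrary: h z)
  case (Suc n)
  then obtain i y where z: "z = i # y" by (cases z) auto
  have "fold diff z (chaos I lam (Suc n) h)
    = (\<lambda>x. real (Suc n) * fold diff y (chaos I lam n (\<lambda>z. h (i # z))) x)"
    using Suc.prems z diff_chaos[OF assms(1) Suc.prems(1), of i] fold_diff_scale by auto
  then show ?case using Suc.IH[OF sym_kernel_Cons[OF Suc.prems(1)], of y] Suc.prems z
    by (auto simp: mult.assoc)
qed simp

subsection \<open>Degree\<close>

text \<open>Polynomial degree expressed through vanishing differences, so that no normal form of
  polynomials in the counts is involved.\<close>

primrec deg_lt :: "'i set \<Rightarrow> nat \<Rightarrow> (('i \<Rightarrow> nat) \<Rightarrow> real) \<Rightarrow> bool" where
  "deg_lt I 0 u \<longleftrightarrow> (\<forall>x\<in>supported I. u x = 0)"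
| "deg_lt I (Suc n) u \<longleftrightarrow> (\<forall>i\<in>I. deg_lt I n (diff i u))"

lemma deg_lt_iff:
  "deg_lt I n u \<longleftrightarrow>
    (\<forall>z. set z \<subseteq> I \<longrightarrow> length z = n \<longrightarrow> (\<forall>x\<in>supported I. fold diff z u x = 0))"
proof (induction n arbitrary: u)
  case (Suc n)
  show ?case
  proof
    assume *: "deg_lt I (Suc n) u"
    show "\<forall>z. set z \<subseteq> I \<longrightarrow> length z = Suc n \<longrightarrow> (\<forall>x\<in>supported I. fold diff z u x = 0)"
    proof (intro allI impI ballI)
      fix z x assume z: "set z \<subseteq> I" "length z = Suc n" and x: "x \<in> supported I"
      then obtain i y where "z = i # y" by (cases z) auto
      then show "fold diff z u x = 0" using * z x Suc[of "diff i u"] by auto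
    qed
  next
    assume *: "\<forall>z. set z \<subseteq> I \<longrightarrow> length z = Suc n \<longrightarrow> (\<forall>x\<in>supported I. fold diff z u x = 0)"
    have "fold diff z (diff i u) x = 0"
      if "i \<in> I" "set z \<subseteq> I" "length z = n" "x \<in> supported I" for i z x
      using *[rule_format, of "i # z" x] that by simp
    then show "deg_lt I (Suc n) u" unfolding deg_lt.simps Suc by blast
  qed
qed simp

lemma deg_lt_Suc: "deg_lt I n u \<Longrightarrow> deg_lt I (Suc n) u"
proof (induction n arbitrary: u)
  case 0
  then show ?case by (auto simp: diff_def supported_raise)
qed auto

lemma deg_lt_mono: "deg_lt I n u \<Longrightarrow> n \<le> m \<Longrightarrow> deg_lt I m u"
  by (induction m) (auto simp: le_Suc_eq simp del: deg_lt.simps intro: deg_lt_Suc)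

lemma deg_lt_add: "deg_lt I n u \<Longrightarrow> deg_lt I n v \<Longrightarrow> deg_lt I n (\<lambda>x. u x + v x)"
  by (auto simp: deg_lt_iff fold_diff_add)

text \<open>A bound on the total degree of a pair of factors. It drops by one when either factor is
  differenced, so a single induction handles all three terms of the discrete Leibniz rule, including
  the product of two differences.\<close>

definition prod_deg_lt ::
  "'i set \<Rightarrow> nat \<Rightarrow> (('i \<Rightarrow> nat) \<Rightarrow> real) \<Rightarrow> (('i \<Rightarrow> nat) \<Rightarrow> real) \<Rightarrow> bool" where
  "prod_deg_lt I n u v \<longleftrightarrow> (\<forall>z y. set z \<subseteq> I \<longrightarrow> set y \<subseteq> I \<longrightarrow> n \<le> length z + length y \<longrightarrow>
     (\<forall>x\<in>supported I. \<forall>x'\<in>supported I. fold diff z u x * fold diff y v x' = 0))"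

lemma prod_deg_lt_diff_left: "prod_deg_lt I (Suc n) u v \<Longrightarrow> i \<in> I \<Longrightarrow> prod_deg_lt I n (diff i u) v"
  unfolding prod_deg_lt_def
proof (intro allI impI ballI)
  fix z y x x'
  assume *: "\<forall>z y. set z \<subseteq> I \<longrightarrow> set y \<subseteq> I \<longrightarrow> Suc n \<le> length z + length y \<longrightarrow>
     (\<forall>x\<in>supported I. \<forall>x'\<in>supported I. fold diff z u x * fold diff y v x' = 0)"
    "i \<in> I" "set z \<subseteq> I" "set y \<subseteq> I" "n \<le> length z + length y" "x \<in> supported I" "x' \<in> supported I"
  show "fold diff z (diff i u) x * fold diff y v x' = 0"
    using *(1)[rule_format, of "i # z" y x x'] *(2-) by simp
qed

lemma prod_deg_lt_commute: "prod_deg_lt I n u v \<Longrightarrow> prod_deg_lt I n v u"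
  unfolding prod_deg_lt_def
proof (intro allI impI ballI)
  fix z y x x'
  assume *: "\<forall>z y. set z \<subseteq> I \<longrightarrow> set y \<subseteq> I \<longrightarrow> n \<le> length z + length y \<longrightarrow>
     (\<forall>x\<in>supported I. \<forall>x'\<in>supported I. fold diff z u x * fold diff y v x' = 0)"
    "set z \<subseteq> I" "set y \<subseteq> I" "n \<le> length z + length y" "x \<in> supported I" "x' \<in> supported I"
  show "fold diff z v x * fold diff y u x' = 0"
    using *(1)[rule_format, of y z x' x] *(2-) by auto
qed

lemma prod_deg_lt_diff_right: "prod_deg_lt I (Suc n) u v \<Longrightarrow> i \<in> I \<Longrightarrow> prod_deg_lt I n u (diff i v)"
  by (rule prod_deg_lt_commute[OF prod_deg_lt_diff_left[OF prod_deg_lt_commute]])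

lemma prod_deg_lt_Suc: "prod_deg_lt I n u v \<Longrightarrow> prod_deg_lt I (Suc n) u v"
  unfolding prod_deg_lt_def using Suc_leD by meson

lemma prod_deg_lt_mult: "prod_deg_lt I n u v \<Longrightarrow> deg_lt I n (\<lambda>x. u x * v x)"
proof (induction n arbitrary: u v)
  case 0
  show ?case
    using 0[unfolded prod_deg_lt_def, rule_format, of "[]" "[]"] by auto
next
  case (Suc n)
  have "deg_lt I n (diff i (\<lambda>x. u x * v x))" if i: "i \<in> I" for i
  proof -
    have "prod_deg_lt I n (diff i u) (diff i v)"
      using prod_deg_lt_diff_left[OF prod_deg_lt_Suc[OF prod_deg_lt_diff_right[OF Suc.prems i]] i] .
    then show ?thesis
      unfolding diff_mult using prod_deg_lt_diff_left[OF Suc.prems i] prod_deg_lt_diff_right[OF Suc.prems i]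
      by (simp add: deg_lt_add Suc.IH)
  qed
  then show ?case by simp
qed

lemma deg_lt_fold_diff_zero:
  assumes "deg_lt I n u" "set z \<subseteq> I" "n \<le> length z" "x \<in> supported I"
  shows "fold diff z u x = 0"
  using deg_lt_mono[OF assms(1,3)] assms by (auto simp: deg_lt_iff)

lemma deg_lt_prod_deg_lt:
  assumes "deg_lt I (Suc n) u" "deg_lt I (Suc m) v"
  shows "prod_deg_lt I (Suc (n + m)) u v"
  unfolding prod_deg_lt_def
proof (intro allI impI ballI)
  fix z y x x'
  assume *: "set z \<subseteq> I" "set y \<subseteq> I" "Suc (n + m) \<le> length z + length y"
    "x \<in> supported I" "x' \<in> supported I"
  then have "Suc n \<le> length z \<or> Suc m \<le> length y" by linarith
  then show "fold diff z u x * fold diff y v x' = 0"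
    using deg_lt_fold_diff_zero[OF assms(1) *(1) _ *(4)] deg_lt_fold_diff_zero[OF assms(2) *(2) _ *(5)]
    by auto
qed

lemma deg_lt_chaos:
  assumes "finite I" "sym_kernel h"
  shows "deg_lt I (Suc n) (chaos I lam n h)"
proof (induction n)
  case 0
  show ?case by (simp add: diff_const)
next
  have "deg_lt I (Suc n) (chaos I lam n h)" if "sym_kernel h" for h n
    using that
  proof (induction n arbitrary: h)
    case (Suc n)
    have "deg_lt I (Suc n) (diff i (chaos I lam (Suc n) h))" if "i \<in> I" for i
      unfolding diff_chaos[OF assms(1) Suc.prems that]
      using Suc.IH[OF sym_kernel_Cons[OF Suc.prems]]
      by (auto simp: deg_lt_iff fold_diff_scale simp del: deg_lt.simps)
    then show ?case by simp
  qed (simp add: diff_const)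
  then show "deg_lt I (Suc (Suc n)) (chaos I lam (Suc n) h)" for n using assms by blast
qed

text \<open>Every supported state arises from the zero state by raising coordinates of
  \<open>I\<close>, and no such step changes \<open>u\<close>.\<close>

lemma deg_lt_one_const:
  assumes "finite I" "deg_lt I (Suc 0) u" "x \<in> supported I"
  shows "u x = u (\<lambda>_. 0)"
  using assms(3)
proof (induction "\<Sum>i\<in>I. x i" arbitrary: x)
  case 0
  then have "x = (\<lambda>_. 0)" using assms(1) by (auto simp: supported_def fun_eq_iff)
  then show ?case by simp
next
  case (Suc n)
  then obtain i where i: "i \<in> I" "x i > 0"
    by (metis gr0I less_numeral_extra(3) sum.neutral zero_less_Suc)
  define y where "y = lower i x"
  have x: "x = raise i y" using i by (simp add: y_def raise_lower)
  have y: "y \<in> supported I" using Suc.prems by (auto simp: y_def supported_def lower_apply)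
  have "(\<Sum>j\<in>I. x j) = Suc (\<Sum>j\<in>I. y j)"
    using assms(1) i by (simp add: x raise_apply sum.remove[of I i])
  then have "n = (\<Sum>j\<in>I. y j)" using Suc.hyps(2) by simp
  from Suc.hyps(1)[OF this y] have "u y = u (\<lambda>_. 0)" .
  moreover have "u x = u y" using assms(2) i y by (auto simp: x diff_def)
  ultimately show ?case by simp
qed

text \<open>The differences of order \<open>n\<close> are constant and hence define a kernel;
  subtracting its chaos lowers the degree. The top kernel is recorded explicitly because the lower
  bound for the top order of a square needs it.\<close>

lemma chaos_decomposition:
  assumes "finite I" "deg_lt I (Suc n) u"
  shows "\<exists>h. (\<forall>p. sym_kernel (h p)) \<and>
    (\<forall>x\<in>supported I. u x = (\<Sum>p\<le>n. chaos I lam p (h p) x)) \<and>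
    (\<forall>z. set z \<subseteq> I \<longrightarrow> h n z = fold diff z u (\<lambda>_. 0) / fact n)"
  using assms(2)
proof (induction n arbitrary: u)
  case 0
  let ?h = "\<lambda>p z. if set z \<subseteq> I then fold diff z u (\<lambda>_. 0) else 0"
  have "sym_kernel (?h p)" for p
    unfolding sym_kernel_def using fold_diff_mset mset_eq_setD by metis
  then show ?case using deg_lt_one_const[OF assms(1) 0] by (intro exI[of _ ?h]) auto
next
  case (Suc n)
  \<comment> \<open>The factorial undoes the one in \<open>fold_diff_chaos\<close>, so that the
    differences of order \<open>Suc n\<close> of \<open>v\<close> below vanish.\<close>
  define k where "k z = (if set z \<subseteq> I then fold diff z u (\<lambda>_. 0) / fact (Suc n) else 0)" for z
  have k: "sym_kernel k"
    unfolding sym_kernel_def k_def using fold_diff_mset mset_eq_setD by metis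
  define v where "v = (\<lambda>x. u x - chaos I lam (Suc n) k x)"
  have "deg_lt I (Suc n) v"
    unfolding deg_lt_iff
  proof (intro allI impI ballI)
    fix z x assume z: "set z \<subseteq> I" "length z = Suc n" and x: "x \<in> supported I"
    have "deg_lt I (Suc 0) (fold diff z u)"
      unfolding deg_lt_iff
    proof (intro allI impI ballI)
      fix y x assume y: "set y \<subseteq> I" "length y = Suc 0" "x \<in> supported I"
      have "fold diff (z @ y) u x = 0"
        using Suc.prems[unfolded deg_lt_iff, rule_format, of "z @ y" x] y z by simp
      then show "fold diff y (fold diff z u) x = 0" by simp
    qed
    then have "fold diff z u x = fold diff z u (\<lambda>_. 0)"
      using deg_lt_one_const[OF assms(1) _ x] by blast
    then show "fold diff z v x = 0"
      unfolding v_def fold_diff_minus fold_diff_chaos[OF assms(1) k z] using z by (simp add: k_def)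
  qed
  from Suc.IH[OF this] obtain h where h: "\<And>p. sym_kernel (h p)"
    "\<And>x. x \<in> supported I \<Longrightarrow> v x = (\<Sum>p\<le>n. chaos I lam p (h p) x)" by blast
  show ?case
    using h k by (intro exI[of _ "h(Suc n := k)"]) (force simp: v_def k_def)
qed

section \<open>Poisson vectors\<close>

text \<open>Polynomial growth in the total count. The class is stable under all operators used here
  and integrable for every Poisson vector on \<open>I\<close>, which settles the integrability
  questions of the discrete part.\<close>

definition tempered :: "'i set \<Rightarrow> (('i \<Rightarrow> nat) \<Rightarrow> real) \<Rightarrow> bool" where
  "tempered I u \<longleftrightarrow> (\<exists>C k. \<forall>x. \<bar>u x\<bar> \<le> C * (1 + (\<Sum>i\<in>I. real (x i))) ^ k)"

lemma temperedE:
  assumes "tempered I u"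
  obtains C k where "C \<ge> 0" "\<And>x. \<bar>u x\<bar> \<le> C * (1 + (\<Sum>i\<in>I. real (x i))) ^ k"
proof -
  obtain C k where *: "\<And>x. \<bar>u x\<bar> \<le> C * (1 + (\<Sum>i\<in>I. real (x i))) ^ k"
    using assms unfolding tempered_def by blast
  have "\<bar>u x\<bar> \<le> \<bar>C\<bar> * (1 + (\<Sum>i\<in>I. real (x i))) ^ k" for x
    using *[of x] by (rule order_trans) (intro mult_right_mono, auto intro!: zero_le_power add_nonneg_nonneg sum_nonneg)
  then show thesis using that[of "\<bar>C\<bar>" k] by simp
qed

lemma tempered_bounded: "(\<And>x. \<bar>u x\<bar> \<le> C) \<Longrightarrow> tempered I u"
  unfolding tempered_def by (intro exI[of _ C] exI[of _ 0]) simp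

lemma tempered_const: "tempered I (\<lambda>x. c)"
  by (rule tempered_bounded[of _ "\<bar>c\<bar>"]) simp

lemma tempered_le: "tempered I v \<Longrightarrow> (\<And>x. \<bar>u x\<bar> \<le> \<bar>v x\<bar>) \<Longrightarrow> tempered I u"
  unfolding tempered_def using order_trans by meson

lemma tempered_add:
  assumes "tempered I u" "tempered I v"
  shows "tempered I (\<lambda>x. u x + v x)"
proof -
  obtain C k where u: "C \<ge> 0" "\<And>x. \<bar>u x\<bar> \<le> C * (1 + (\<Sum>i\<in>I. real (x i))) ^ k"
    using temperedE[OF assms(1)] by blast
  obtain D l where v: "D \<ge> 0" "\<And>x. \<bar>v x\<bar> \<le> D * (1 + (\<Sum>i\<in>I. real (x i))) ^ l"
    using temperedE[OF assms(2)] by blast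
  have "\<bar>u x + v x\<bar> \<le> (C + D) * (1 + (\<Sum>i\<in>I. real (x i))) ^ (k + l)" for x
  proof -
    let ?T = "1 + (\<Sum>i\<in>I. real (x i))"
    have "?T \<ge> 1" by (simp add: sum_nonneg)
    then have "C * ?T ^ k \<le> C * ?T ^ (k + l)" "D * ?T ^ l \<le> D * ?T ^ (k + l)"
      using u(1) v(1) by (auto intro!: mult_left_mono power_increasing)
    then show ?thesis using u(2)[of x] v(2)[of x] unfolding distrib_right by linarith
  qed
  then show ?thesis unfolding tempered_def by blast
qed

lemma tempered_mult:
  assumes "tempered I u" "tempered I v"
  shows "tempered I (\<lambda>x. u x * v x)"
proof -
  obtain C k where u: "C \<ge> 0" "\<And>x. \<bar>u x\<bar> \<le> C * (1 + (\<Sum>i\<in>I. real (x i))) ^ k"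
    using temperedE[OF assms(1)] by blast
  obtain D l where v: "D \<ge> 0" "\<And>x. \<bar>v x\<bar> \<le> D * (1 + (\<Sum>i\<in>I. real (x i))) ^ l"
    using temperedE[OF assms(2)] by blast
  have "\<bar>u x * v x\<bar> \<le> (C * D) * (1 + (\<Sum>i\<in>I. real (x i))) ^ (k + l)" for x
  proof -
    let ?T = "1 + (\<Sum>i\<in>I. real (x i))"
    have "?T \<ge> 0" by (simp add: sum_nonneg)
    then have "\<bar>u x\<bar> * \<bar>v x\<bar> \<le> (C * ?T ^ k) * (D * ?T ^ l)"
      using u v by (intro mult_mono) auto
    then show ?thesis by (simp add: abs_mult power_add ac_simps)
  qed
  then show ?thesis unfolding tempered_def by blast
qed

lemma tempered_scale: "tempered I u \<Longrightarrow> tempered I (\<lambda>x. c * u x)"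
  by (rule tempered_mult[OF tempered_const])

lemma tempered_minus: "tempered I u \<Longrightarrow> tempered I v \<Longrightarrow> tempered I (\<lambda>x. u x - v x)"
  using tempered_add[of I u "\<lambda>x. -1 * v x"] tempered_scale[of I v "-1"] by simp

lemma tempered_power: "tempered I u \<Longrightarrow> tempered I (\<lambda>x. u x ^ n)"
  by (induction n) (simp_all add: tempered_const tempered_mult)

lemma tempered_sum: "(\<And>j. j \<in> J \<Longrightarrow> tempered I (f j)) \<Longrightarrow> tempered I (\<lambda>x. \<Sum>j\<in>J. f j x)"
  by (induction J rule: infinite_finite_induct) (simp_all add: tempered_const tempered_add)

lemma tempered_coordinate:
  assumes "finite I" "i \<in> I"
  shows "tempered I (\<lambda>x. real (x i))"
proof -
  have "real (x i) \<le> (\<Sum>i\<in>I. real (x i))" for x :: "'a \<Rightarrow> nat"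
    using assms by (intro member_le_sum) auto
  then have "\<bar>real (x i)\<bar> \<le> 1 * (1 + (\<Sum>i\<in>I. real (x i))) ^ 1" for x :: "'a \<Rightarrow> nat"
    by (simp add: add_increasing)
  then show ?thesis unfolding tempered_def by blast
qed

lemma tempered_raise:
  assumes "finite I" "tempered I u" "i \<in> I"
  shows "tempered I (\<lambda>x. u (raise i x))"
proof -
  obtain C k where u: "C \<ge> 0" "\<And>x. \<bar>u x\<bar> \<le> C * (1 + (\<Sum>i\<in>I. real (x i))) ^ k"
    using temperedE[OF assms(2)] by blast
  have "\<bar>u (raise i x)\<bar> \<le> (C * 2 ^ k) * (1 + (\<Sum>i\<in>I. real (x i))) ^ k" for x
  proof -
    let ?T = "1 + (\<Sum>i\<in>I. real (x i))"
    have "(\<Sum>j\<in>I. real (raise i x j)) = 1 + (\<Sum>i\<in>I. real (x i))"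
      using assms by (simp add: raise_apply sum.remove[of I i])
    then have "\<bar>u (raise i x)\<bar> \<le> C * (1 + ?T) ^ k" using u(2)[of "raise i x"] by simp
    also have "\<dots> \<le> C * (2 * ?T) ^ k"
      using u(1) by (intro mult_left_mono power_mono) (auto simp: sum_nonneg)
    finally show ?thesis unfolding power_mult_distrib by (simp only: mult.assoc)
  qed
  then show ?thesis unfolding tempered_def by blast
qed

lemma tempered_lower:
  assumes "finite I" "tempered I u"
  shows "tempered I (\<lambda>x. u (lower i x))"
proof -
  obtain C k where u: "C \<ge> 0" "\<And>x. \<bar>u x\<bar> \<le> C * (1 + (\<Sum>i\<in>I. real (x i))) ^ k"
    using temperedE[OF assms(2)] by blast
  have "\<bar>u (lower i x)\<bar> \<le> C * (1 + (\<Sum>i\<in>I. real (x i))) ^ k" for x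
  proof -
    have "(\<Sum>j\<in>I. real (lower i x j)) \<le> (\<Sum>j\<in>I. real (x j))"
      by (intro sum_mono) (simp add: lower_apply)
    then have "C * (1 + (\<Sum>j\<in>I. real (lower i x j))) ^ k \<le> C * (1 + (\<Sum>j\<in>I. real (x j))) ^ k"
      using u(1) by (intro mult_left_mono power_mono) (simp_all add: sum_nonneg)
    then show ?thesis using u(2)[of "lower i x"] by linarith
  qed
  then show ?thesis unfolding tempered_def by (intro exI allI)
qed

lemma tempered_diff: "finite I \<Longrightarrow> tempered I u \<Longrightarrow> i \<in> I \<Longrightarrow> tempered I (diff i u)"
  unfolding diff_def[abs_def] by (intro tempered_minus tempered_raise)

lemma tempered_fold_diff: "finite I \<Longrightarrow> tempered I u \<Longrightarrow> set z \<subseteq> I \<Longrightarrow> tempered I (fold diff z u)"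
  by (induction z arbitrary: u) (auto intro: tempered_diff)

lemma tempered_create: "finite I \<Longrightarrow> tempered I u \<Longrightarrow> i \<in> I \<Longrightarrow> tempered I (create lam i u)"
  unfolding create_def[abs_def]
  by (intro tempered_minus tempered_mult[OF tempered_coordinate] tempered_scale)
    (simp_all add: tempered_lower)

lemma tempered_chaos: "finite I \<Longrightarrow> tempered I (chaos I lam n h)"
proof (induction n arbitrary: h)
  case (Suc n)
  then show ?case unfolding chaos.simps by (intro tempered_sum tempered_create)
qed (simp add: tempered_const)

lemma tempered_charlier: "finite I \<Longrightarrow> set z \<subseteq> I \<Longrightarrow> tempered I (charlier lam z)"
  by (induction z) (simp_all add: tempered_const tempered_create)

lemma tempered_abs: "tempered I u \<Longrightarrow> tempered I (\<lambda>x. \<bar>u x\<bar>)"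
  by (simp add: tempered_def)

text \<open>The detailed balance relation \<open>balance\<close> characterizes vectors of independent Poisson variables
  with means \<open>lam i\<close>; it also covers vanishing means.\<close>

locale poisson_vector =
  fixes p :: "('i \<Rightarrow> nat) pmf" and I :: "'i set" and lam :: "'i \<Rightarrow> real"
  assumes finite_I: "finite I"
    and lam_nonneg: "\<And>i. i \<in> I \<Longrightarrow> 0 \<le> lam i"
    and set_pmf_supported: "set_pmf p \<subseteq> supported I"
    and balance: "\<And>i x. i \<in> I \<Longrightarrow> pmf p (raise i x) * real (Suc (x i)) = lam i * pmf p x"
begin

section \<open>Mecke equation, duality and isometry for Poisson vectors\<close>

abbreviation E :: "(('i \<Rightarrow> nat) \<Rightarrow> real) \<Rightarrow> real" where
  "E u \<equiv> integral\<^sup>L (measure_pmf p) u"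

text \<open>Terms with \<open>x i = 0\<close> vanish, and on the other states \<open>raise i\<close>
  is a bijective substitution under which \<open>balance\<close> turns the factor \<open>x i\<close>
  into the weight \<open>lam i\<close>. Nonnegative integrands come first, because finiteness of
  moments is derived from this.\<close>

lemma mecke_nn:
  assumes "i \<in> I"
  shows "(\<integral>\<^sup>+x. ennreal (real (x i)) * f (lower i x) \<partial>p) = ennreal (lam i) * (\<integral>\<^sup>+x. f x \<partial>p)"
proof -
  have bij: "bij_betw (raise i) UNIV {x. x i > 0}"
    by (rule bij_betwI[where g = "lower i"]) (auto simp: raise_apply raise_lower)
  have "(\<integral>\<^sup>+x. ennreal (real (x i)) * f (lower i x) \<partial>p)
      = (\<integral>\<^sup>+x. ennreal (pmf p x) * (ennreal (real (x i)) * f (lower i x)) \<partial>count_space UNIV)"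
    by (rule nn_integral_measure_pmf)
  also have "\<dots> = (\<integral>\<^sup>+x. ennreal (pmf p x) * (ennreal (real (x i)) * f (lower i x)) \<partial>count_space {x. x i > 0})"
    by (rule nn_integral_count_space_eq) auto
  also have "\<dots> = (\<integral>\<^sup>+x. ennreal (pmf p (raise i x)) * (ennreal (real (raise i x i)) * f (lower i (raise i x))) \<partial>count_space UNIV)"
    by (rule nn_integral_bij_count_space[OF bij, symmetric])
  also have "\<dots> = (\<integral>\<^sup>+x. ennreal (lam i) * (ennreal (pmf p x) * f x) \<partial>count_space UNIV)"
  proof (rule nn_integral_cong)
    fix x
    have "ennreal (pmf p (raise i x)) * ennreal (real (raise i x i)) = ennreal (lam i) * ennreal (pmf p x)"
      using balance[OF assms, of x] lam_nonneg[OF assms]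
      by (simp add: ennreal_mult[symmetric] raise_apply del: of_nat_Suc)
    then show "ennreal (pmf p (raise i x)) * (ennreal (real (raise i x i)) * f (lower i (raise i x)))
        = ennreal (lam i) * (ennreal (pmf p x) * f x)"
      by (simp add: mult.assoc[symmetric])
  qed
  also have "\<dots> = ennreal (lam i) * (\<integral>\<^sup>+x. f x \<partial>p)"
    by (simp add: nn_integral_cmult nn_integral_measure_pmf)
  finally show ?thesis .
qed

text \<open>One factor of the total is expanded and each \<open>x i\<close> removed by the Mecke
  equation, which adds one point to the argument. That costs at most a factor \<open>2 ^ k\<close>,
  so finiteness passes from \<open>k\<close> to \<open>Suc k\<close>.\<close>

lemma moment_finite: "(\<integral>\<^sup>+x. ennreal ((1 + (\<Sum>i\<in>I. real (x i))) ^ k) \<partial>p) < \<infinity>"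
proof (induction k)
  case 0
  show ?case by simp
next
  case (Suc k)
  let ?T = "\<lambda>x. 1 + (\<Sum>i\<in>I. real (x i))"
  have T: "?T x \<ge> 1" for x :: "'i \<Rightarrow> nat" by (simp add: sum_nonneg)
  have "(\<integral>\<^sup>+x. ennreal (?T x ^ Suc k) \<partial>p)
      = (\<integral>\<^sup>+x. ennreal (?T x ^ k) + (\<Sum>i\<in>I. ennreal (real (x i)) * ennreal (?T x ^ k)) \<partial>p)"
  proof (rule nn_integral_cong)
    fix x
    have "?T x ^ Suc k = ?T x ^ k + (\<Sum>i\<in>I. real (x i) * ?T x ^ k)"
      by (simp add: distrib_right sum_distrib_right)
    then show "ennreal (?T x ^ Suc k) = ennreal (?T x ^ k) + (\<Sum>i\<in>I. ennreal (real (x i)) * ennreal (?T x ^ k))"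
      using T[of x] by (simp add: ennreal_mult[symmetric] sum_ennreal ennreal_plus[symmetric] sum_nonneg del: ennreal_plus)
  qed
  also have "\<dots> = (\<integral>\<^sup>+x. ennreal (?T x ^ k) \<partial>p) + (\<Sum>i\<in>I. (\<integral>\<^sup>+x. ennreal (real (x i)) * ennreal (?T x ^ k) \<partial>p))"
    by (simp add: nn_integral_add nn_integral_sum)
  also have "\<dots> < \<infinity>"
  proof -
    have "(\<integral>\<^sup>+x. ennreal (real (x i)) * ennreal (?T x ^ k) \<partial>p) < \<infinity>" if i: "i \<in> I" for i
    proof -
      \<comment> \<open>Undoing the lowering brings the integrand into the form of
        \<open>mecke_nn\<close>; when \<open>x i = 0\<close> both sides are zero.\<close>
      have "(\<integral>\<^sup>+x. ennreal (real (x i)) * ennreal (?T x ^ k) \<partial>p)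
          = (\<integral>\<^sup>+x. ennreal (real (x i)) * ennreal (?T (raise i (lower i x)) ^ k) \<partial>p)"
        by (rule nn_integral_cong) (metis mult_zero_left of_nat_0 ennreal_0 gr0I raise_lower)
      also have "\<dots> = ennreal (lam i) * (\<integral>\<^sup>+x. ennreal (?T (raise i x) ^ k) \<partial>p)"
        by (rule mecke_nn[OF i])
      also have "\<dots> \<le> ennreal (lam i) * (\<integral>\<^sup>+x. ennreal (2 ^ k) * ennreal (?T x ^ k) \<partial>p)"
      proof (intro mult_left_mono nn_integral_mono)
        fix x
        have "?T (raise i x) = 1 + ?T x"
          using finite_I i by (simp add: raise_apply sum.remove[of I i])
        then have "?T (raise i x) ^ k \<le> (2 * ?T x) ^ k"
          using T[of x] by (intro power_mono) auto
        then show "ennreal (?T (raise i x) ^ k) \<le> ennreal (2 ^ k) * ennreal (?T x ^ k)"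
          unfolding power_mult_distrib using T[of x] by (simp add: ennreal_mult[symmetric] ennreal_leI)
      qed auto
      also have "\<dots> < \<infinity>"
        using Suc by (simp add: nn_integral_cmult ennreal_mult_less_top)
      finally show ?thesis .
    qed
    then show ?thesis using Suc finite_I by (simp add: less_top[symmetric])
  qed
  finally show ?case .
qed

lemma integrable_tempered: "tempered I u \<Longrightarrow> integrable p u"
proof -
  assume "tempered I u"
  then obtain C k where u: "C \<ge> 0" "\<And>x. \<bar>u x\<bar> \<le> C * (1 + (\<Sum>i\<in>I. real (x i))) ^ k"
    using temperedE by blast
  have "(\<integral>\<^sup>+x. ennreal (norm (u x)) \<partial>p) \<le> (\<integral>\<^sup>+x. ennreal C * ennreal ((1 + (\<Sum>i\<in>I. real (x i))) ^ k) \<partial>p)"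
    using u by (intro nn_integral_mono) (auto simp: ennreal_mult'[symmetric] intro!: ennreal_leI)
  also have "\<dots> < \<infinity>"
    using moment_finite[of k] by (simp add: nn_integral_cmult ennreal_mult_less_top)
  finally show ?thesis by (intro integrableI_bounded) auto
qed

lemma expectation_cong:
  "(\<And>x. x \<in> supported I \<Longrightarrow> u x = v x) \<Longrightarrow> E u = E v"
  using set_pmf_supported by (intro integral_cong_AE) (auto simp: AE_measure_pmf_iff)

lemma mecke:
  assumes "tempered I f" "i \<in> I"
  shows "E (\<lambda>x. real (x i) * f (lower i x)) = lam i * E f"
proof -
  have pos: "E (\<lambda>x. real (x i) * f (lower i x)) = lam i * E f"
    if "tempered I f" "\<And>x. f x \<ge> 0" for f
  proof -
    have "ennreal (E (\<lambda>x. real (x i) * f (lower i x))) = (\<integral>\<^sup>+x. ennreal (real (x i) * f (lower i x)) \<partial>p)"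
      using that assms finite_I
      by (intro nn_integral_eq_integral[symmetric] integrable_tempered
            tempered_mult[OF tempered_coordinate]) (simp_all add: tempered_lower)
    also have "\<dots> = ennreal (lam i) * (\<integral>\<^sup>+x. ennreal (f x) \<partial>p)"
      using mecke_nn[OF assms(2), of "\<lambda>x. ennreal (f x)"] that by (simp add: ennreal_mult)
    also have "\<dots> = ennreal (lam i * E f)"
      using that lam_nonneg[OF assms(2)]
      by (subst nn_integral_eq_integral) (auto simp: ennreal_mult integrable_tempered)
    finally show ?thesis
      using that lam_nonneg[OF assms(2)] by (subst (asm) ennreal_inj) auto
  qed
  let ?g = "\<lambda>x. max 0 (f x)" and ?h = "\<lambda>x. max 0 (- f x)"
  have t: "tempered I ?g" "tempered I ?h"
    using assms(1) by (auto intro: tempered_le)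
  have "E (\<lambda>x. real (x i) * f (lower i x))
      = E (\<lambda>x. real (x i) * ?g (lower i x) - real (x i) * ?h (lower i x))"
    by (rule Bochner_Integration.integral_cong) (auto simp: max_def algebra_simps)
  also have "\<dots> = E (\<lambda>x. real (x i) * ?g (lower i x)) - E (\<lambda>x. real (x i) * ?h (lower i x))"
    using t finite_I assms(2)
      tempered_lower[OF finite_I t(1), of i] tempered_lower[OF finite_I t(2), of i]
    by (intro Bochner_Integration.integral_diff integrable_tempered tempered_mult[OF tempered_coordinate])
  also have "\<dots> = lam i * (E ?g - E ?h)"
    using pos[OF t(1)] pos[OF t(2)] by (simp add: algebra_simps)
  also have "E ?g - E ?h = E (\<lambda>x. ?g x - ?h x)"
    using t by (intro Bochner_Integration.integral_diff[symmetric] integrable_tempered)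
  also have "\<dots> = E f"
    by (rule Bochner_Integration.integral_cong) (auto simp: max_def)
  finally show ?thesis .
qed

text \<open>Creation and difference are dual: the Mecke equation moves \<open>v\<close> from the
  lowered state to the current one, and the test function, which was not lowered, is then seen at
  the raised state.\<close>

lemma integration_by_parts:
  assumes "tempered I v" "tempered I \<phi>" "i \<in> I"
  shows "E (\<lambda>x. create lam i v x * \<phi> x) = lam i * E (\<lambda>x. v x * diff i \<phi> x)"
proof -
  have r: "tempered I (\<lambda>x. v x * \<phi> (raise i x))"
    using assms finite_I by (intro tempered_mult tempered_raise)
  have "E (\<lambda>x. create lam i v x * \<phi> x)
      = E (\<lambda>x. real (x i) * (v (lower i x) * \<phi> (raise i (lower i x))) - lam i * (v x * \<phi> x))"
  proof (rule Bochner_Integration.integral_cong[OF refl])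
    fix x
    show "create lam i v x * \<phi> x
      = real (x i) * (v (lower i x) * \<phi> (raise i (lower i x))) - lam i * (v x * \<phi> x)"
      by (cases "x i = 0") (simp_all add: create_def raise_lower algebra_simps)
  qed
  also have "\<dots> = E (\<lambda>x. real (x i) * (v (lower i x) * \<phi> (raise i (lower i x))))
      - E (\<lambda>x. lam i * (v x * \<phi> x))"
    using assms finite_I r tempered_lower[OF finite_I r, of i]
    by (intro Bochner_Integration.integral_diff integrable_tempered tempered_mult[OF tempered_coordinate]
          tempered_scale tempered_mult[OF assms(1,2)]) auto
  also have "\<dots> = lam i * E (\<lambda>x. v x * \<phi> (raise i x)) - lam i * E (\<lambda>x. v x * \<phi> x)"
    using mecke[OF r assms(3)] by simp
  also have "\<dots> = lam i * E (\<lambda>x. v x * \<phi> (raise i x) - v x * \<phi> x)"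
    using r tempered_mult[OF assms(1,2)]
    by (subst Bochner_Integration.integral_diff) (auto simp: integrable_tempered algebra_simps)
  finally show ?thesis by (simp add: diff_def algebra_simps)
qed

text \<open>Iterated duality: each creation operator passes to the test function as a difference and
  leaves one weight \<open>lam i\<close>.\<close>

lemma expectation_chaos_mult:
  assumes "tempered I \<phi>"
  shows "E (\<lambda>x. chaos I lam n h x * \<phi> x) = wsum I lam n (\<lambda>z. h z * E (fold diff z \<phi>))"
  using assms
proof (induction n arbitrary: h \<phi>)
  case (Suc n)
  have "E (\<lambda>x. chaos I lam (Suc n) h x * \<phi> x)
      = E (\<lambda>x. \<Sum>i\<in>I. create lam i (chaos I lam n (\<lambda>z. h (i # z))) x * \<phi> x)"
    by (simp add: sum_distrib_right)
  also have "\<dots> = (\<Sum>i\<in>I. E (\<lambda>x. create lam i (chaos I lam n (\<lambda>z. h (i # z))) x * \<phi> x))"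
    using Suc.prems finite_I
    by (intro Bochner_Integration.integral_sum integrable_tempered tempered_mult tempered_create tempered_chaos)
  also have "\<dots> = (\<Sum>i\<in>I. lam i * wsum I lam n (\<lambda>z. h (i # z) * E (fold diff z (diff i \<phi>))))"
    using Suc.prems finite_I
    by (intro sum.cong refl) (simp add: integration_by_parts tempered_chaos tempered_diff Suc.IH)
  finally show ?case by simp
qed simp

lemma chaos_inner:
  assumes "sym_kernel h" "sym_kernel k"
  shows "E (\<lambda>x. chaos I lam n k x * chaos I lam n h x) = fact n * wsum I lam n (\<lambda>z. k z * h z)"
proof -
  have "E (\<lambda>x. chaos I lam n k x * chaos I lam n h x) = wsum I lam n (\<lambda>z. k z * (fact n * h z))"
    unfolding expectation_chaos_mult[OF tempered_chaos[OF finite_I]]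
    by (rule wsum_cong) (simp add: fold_diff_chaos finite_I assms)
  also have "\<dots> = wsum I lam n (\<lambda>z. fact n * (k z * h z))"
    by (simp add: ac_simps)
  finally show ?thesis by (simp only: wsum_scale)
qed

text \<open>The Dirichlet form of the birth-death dynamics of the counts.\<close>

definition energy :: "(('i \<Rightarrow> nat) \<Rightarrow> real) \<Rightarrow> (('i \<Rightarrow> nat) \<Rightarrow> real) \<Rightarrow> real" where
  "energy u v = (\<Sum>i\<in>I. lam i * E (\<lambda>x. diff i u x * diff i v x))"

lemma energy_commute: "energy u v = energy v u"
  by (simp add: energy_def mult.commute)

text \<open>Integrating one creation operator by parts leaves a chaos of order one less, which is
  the difference of the original chaos up to the factor \<open>n\<close>. Hence order
  \<open>n\<close> belongs to the eigenvalue \<open>n\<close>.\<close>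

lemma energy_chaos:
  assumes "sym_kernel h" "tempered I v"
  shows "energy (chaos I lam n h) v = real n * E (\<lambda>x. chaos I lam n h x * v x)"
proof (cases n)
  case 0
  then show ?thesis by (simp add: energy_def diff_const)
next
  case (Suc m)
  have "E (\<lambda>x. chaos I lam n h x * v x)
      = E (\<lambda>x. \<Sum>i\<in>I. create lam i (chaos I lam m (\<lambda>z. h (i # z))) x * v x)"
    by (simp add: sum_distrib_right Suc)
  also have "\<dots> = (\<Sum>i\<in>I. E (\<lambda>x. create lam i (chaos I lam m (\<lambda>z. h (i # z))) x * v x))"
    using assms finite_I
    by (intro Bochner_Integration.integral_sum integrable_tempered tempered_mult tempered_create tempered_chaos)
  also have "\<dots> = (\<Sum>i\<in>I. lam i * E (\<lambda>x. chaos I lam m (\<lambda>z. h (i # z)) x * diff i v x))"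
    using assms finite_I by (intro sum.cong refl integration_by_parts tempered_chaos)
  also have "real n * \<dots> = energy (chaos I lam n h) v"
    unfolding energy_def sum_distrib_left
    using assms finite_I by (intro sum.cong refl) (simp add: Suc diff_chaos mult.assoc del: of_nat_Suc chaos.simps)
  finally show ?thesis by simp
qed

text \<open>Both are eigenfunctions of the symmetric form \<open>energy\<close>, for the different
  eigenvalues \<open>n\<close> and \<open>m\<close>.\<close>

lemma chaos_orthogonal:
  assumes "sym_kernel h" "sym_kernel k" "n \<noteq> m"
  shows "E (\<lambda>x. chaos I lam n h x * chaos I lam m k x) = 0"
proof -
  have "E (\<lambda>x. chaos I lam m k x * chaos I lam n h x) = E (\<lambda>x. chaos I lam n h x * chaos I lam m k x)"
    by (simp only: mult.commute)
  then have "real n * E (\<lambda>x. chaos I lam n h x * chaos I lam m k x)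
      = real m * E (\<lambda>x. chaos I lam n h x * chaos I lam m k x)"
    using energy_chaos[OF assms(1) tempered_chaos[OF finite_I], of n lam m k]
      energy_chaos[OF assms(2) tempered_chaos[OF finite_I], of m lam n h]
    by (auto simp: energy_commute[of "chaos I lam n h"])
  then show ?thesis using assms(3) by (metis mult_cancel_right of_nat_eq_iff)
qed

end

section \<open>The leading term of a squared chaos\<close>

lemma fold_diff_append_Cons: "fold diff (a @ i # b) u = fold diff (a @ b) (diff i u)"
proof -
  have "fold diff (a @ i # b) u = fold diff (i # a @ b) u" by (rule fold_diff_mset) simp
  then show ?thesis by simp
qed

lemma wsum_const_one: "finite I \<Longrightarrow> wsum I (\<lambda>_. 1) n f = (\<Sum>w | set w \<subseteq> I \<and> length w = n. f w)"
proof (induction n arbitrary: f)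
  case (Suc n)
  have *: "{w. set w \<subseteq> I \<and> length w = Suc n} = (\<lambda>(i, w). i # w) ` (I \<times> {w. set w \<subseteq> I \<and> length w = n})"
    by (auto simp: length_Suc_conv image_iff)
  have "(\<Sum>w | set w \<subseteq> I \<and> length w = Suc n. f w)
      = (\<Sum>(i, w) \<in> I \<times> {w. set w \<subseteq> I \<and> length w = n}. f (i # w))"
    unfolding * by (subst sum.reindex) (auto simp: inj_on_def intro!: sum.cong)
  also have "\<dots> = (\<Sum>i\<in>I. \<Sum>w | set w \<subseteq> I \<and> length w = n. f (i # w))"
    by (rule sum.cartesian_product[symmetric])
  finally show ?case using Suc by simp
qed (simp add: conj_commute cong: conj_cong)

lemma card_words_count:
  assumes "a \<noteq> b"
  shows "card {w. set w \<subseteq> {a, b} \<and> length w = n \<and> count_list w a = k} = n choose k"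
proof (induction n arbitrary: k)
  case 0
  have "{w. set w \<subseteq> {a, b} \<and> length w = 0 \<and> count_list w a = k} = (if k = 0 then {[]} else {})"
    by auto
  then show ?case by simp
next
  case (Suc n)
  let ?W = "\<lambda>n k. {w. set w \<subseteq> {a, b} \<and> length w = n \<and> count_list w a = k}"
  have fin: "finite (?W n k)" for n k
    by (rule finite_subset[OF _ finite_lists_length_eq[of "{a, b}" n]]) auto
  have *: "?W (Suc n) k = (if k = 0 then {} else Cons a ` ?W n (k - 1)) \<union> Cons b ` ?W n k"
    using assms by (auto simp: length_Suc_conv image_iff)
  show ?case
  proof (cases k)
    case 0
    then have "?W (Suc n) k = Cons b ` ?W n k" using * by (simp only: if_True simp_thms Un_empty_left)
    then have "card (?W (Suc n) k) = card (Cons b ` ?W n k)" by (rule arg_cong)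
    also have "\<dots> = card (?W n k)" by (rule card_image) simp
    finally show ?thesis using Suc.IH[of k] 0 by simp
  next
    case (Suc m)
    have "card (?W (Suc n) k) = card (Cons a ` ?W n m \<union> Cons b ` ?W n k)"
      unfolding * using Suc by simp
    also have "\<dots> = card (Cons a ` ?W n m) + card (Cons b ` ?W n k)"
      using assms fin by (intro card_Un_disjoint) auto
    also have "\<dots> = card (?W n m) + card (?W n k)"
      by (simp add: card_image)
    finally show ?thesis using Suc.IH[of m] Suc.IH[of k] Suc by simp
  qed
qed

text \<open>A letter of \<open>w\<close> says which factor of the product \<open>u v\<close> and which factor of \<open>u' v'\<close> the
  corresponding difference operator hits: \<open>True\<close> stands for the first one.\<close>

primrec word_sum :: "'i set \<Rightarrow> ('i \<Rightarrow> real) \<Rightarrow> (bool \<times> bool) list \<Rightarrow>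
    (('i \<Rightarrow> nat) \<Rightarrow> real) \<Rightarrow> (('i \<Rightarrow> nat) \<Rightarrow> real) \<Rightarrow> (('i \<Rightarrow> nat) \<Rightarrow> real) \<Rightarrow> (('i \<Rightarrow> nat) \<Rightarrow> real) \<Rightarrow> real" where
  "word_sum I lam [] u v u' v' = u (\<lambda>_. 0) * v (\<lambda>_. 0) * u' (\<lambda>_. 0) * v' (\<lambda>_. 0)"
| "word_sum I lam (l # w) u v u' v' = (\<Sum>i\<in>I. lam i * word_sum I lam w
     (if fst l then diff i u else u) (if fst l then v else diff i v)
     (if snd l then diff i u' else u') (if snd l then v' else diff i v'))"

lemma sum_bool_pairs:
  "(\<Sum>l\<in>(UNIV :: (bool \<times> bool) set). f l)
    = f (True, True) + f (True, False) + f (False, True) + (f (False, False) :: real)"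
proof -
  have "(UNIV :: (bool \<times> bool) set) = {(True, True), (True, False), (False, True), (False, False)}"
    by auto
  then have "(\<Sum>l\<in>UNIV. f l) = (\<Sum>l\<in>{(True, True), (True, False), (False, True), (False, False)}. f l)"
    by (rule arg_cong)
  then show ?thesis by (simp add: add.assoc)
qed

text \<open>At top order the product of two differences in the Leibniz rule has too low a degree to
  contribute, so differences act as derivations. Each of the \<open>n\<close> letters then chooses
  one factor on either side, which gives one summand per word.\<close>

lemma top_product_word_sum:
  assumes "prod_deg_lt I (Suc n) u v" "prod_deg_lt I (Suc n) u' v'"
  shows "wsum I lam n (\<lambda>z. fold diff z (\<lambda>x. u x * v x) (\<lambda>_. 0) * fold diff z (\<lambda>x. u' x * v' x) (\<lambda>_. 0))
    = wsum UNIV (\<lambda>_. 1) n (\<lambda>w. word_sum I lam w u v u' v')"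
  using assms
proof (induction n arbitrary: u v u' v')
  case (Suc n)
  let ?o = "\<lambda>_. 0 :: nat"
  have split: "fold diff z (diff i (\<lambda>x. u x * v x)) ?o
      = fold diff z (\<lambda>x. diff i u x * v x) ?o + fold diff z (\<lambda>x. u x * diff i v x) ?o"
    if "prod_deg_lt I (Suc (Suc n)) u v" "i \<in> I" "set z \<subseteq> I" "length z = n" for i z u v
  proof -
    have "prod_deg_lt I n (diff i u) (diff i v)"
      by (rule prod_deg_lt_diff_left[OF prod_deg_lt_diff_right[OF that(1,2)] that(2)])
    then have "fold diff z (\<lambda>x. diff i u x * diff i v x) ?o = 0"
      using that deg_lt_fold_diff_zero[OF prod_deg_lt_mult] by (metis order_refl supported_zero)
    then show ?thesis by (simp add: diff_mult fold_diff_add)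
  qed
  have "wsum I lam n (\<lambda>z. fold diff (i # z) (\<lambda>x. u x * v x) ?o * fold diff (i # z) (\<lambda>x. u' x * v' x) ?o)
      = wsum UNIV (\<lambda>_. 1) n (\<lambda>w. word_sum I lam w (diff i u) v (diff i u') v')
      + wsum UNIV (\<lambda>_. 1) n (\<lambda>w. word_sum I lam w (diff i u) v u' (diff i v'))
      + wsum UNIV (\<lambda>_. 1) n (\<lambda>w. word_sum I lam w u (diff i v) (diff i u') v')
      + wsum UNIV (\<lambda>_. 1) n (\<lambda>w. word_sum I lam w u (diff i v) u' (diff i v'))" if i: "i \<in> I" for i
  proof -
    note d = prod_deg_lt_diff_left[OF Suc.prems(1) i] prod_deg_lt_diff_right[OF Suc.prems(1) i]
      prod_deg_lt_diff_left[OF Suc.prems(2) i] prod_deg_lt_diff_right[OF Suc.prems(2) i]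
    let ?P = "\<lambda>u v z. fold diff z (\<lambda>x. u x * v x) ?o"
    have "wsum I lam n (\<lambda>z. fold diff (i # z) (\<lambda>x. u x * v x) ?o * fold diff (i # z) (\<lambda>x. u' x * v' x) ?o)
      = wsum I lam n (\<lambda>z. ?P (diff i u) v z * ?P (diff i u') v' z + ?P (diff i u) v z * ?P u' (diff i v') z
          + ?P u (diff i v) z * ?P (diff i u') v' z + ?P u (diff i v) z * ?P u' (diff i v') z)"
    proof (rule wsum_cong)
      fix z assume z: "set z \<subseteq> I" "length z = n"
      show "fold diff (i # z) (\<lambda>x. u x * v x) ?o * fold diff (i # z) (\<lambda>x. u' x * v' x) ?o
        = ?P (diff i u) v z * ?P (diff i u') v' z + ?P (diff i u) v z * ?P u' (diff i v') z
          + ?P u (diff i v) z * ?P (diff i u') v' z + ?P u (diff i v) z * ?P u' (diff i v') z"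
        unfolding fold_simps split[OF Suc.prems(1) i z] split[OF Suc.prems(2) i z]
        by (simp add: distrib_left distrib_right)
    qed
    then show ?thesis
      unfolding wsum_add Suc.IH[OF d(1) d(3)] Suc.IH[OF d(1) d(4)] Suc.IH[OF d(2) d(3)] Suc.IH[OF d(2) d(4)] .
  qed
  then show ?case
    by (simp add: sum_bool_pairs wsum_sum wsum_scale distrib_left sum.distrib)
qed (simp add: mult.assoc)

text \<open>When all four functions are one chaos of order \<open>q\<close> and each receives
  \<open>q\<close> letters, these are inner products of contractions of its kernel, up to
  factorials.\<close>

definition contraction :: "'i set \<Rightarrow> ('i \<Rightarrow> real) \<Rightarrow> nat \<Rightarrow> nat \<Rightarrow> nat \<Rightarrow> nat \<Rightarrow>
    (('i \<Rightarrow> nat) \<Rightarrow> real) \<Rightarrow> (('i \<Rightarrow> nat) \<Rightarrow> real) \<Rightarrow> (('i \<Rightarrow> nat) \<Rightarrow> real) \<Rightarrow> (('i \<Rightarrow> nat) \<Rightarrow> real) \<Rightarrow> real" where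
  "contraction I lam a b c d u v u' v' =
    wsum I lam a (\<lambda>A. wsum I lam b (\<lambda>B. wsum I lam c (\<lambda>C. wsum I lam d (\<lambda>G.
      fold diff (A @ B) u (\<lambda>_. 0) * fold diff (C @ G) v (\<lambda>_. 0) *
      fold diff (A @ C) u' (\<lambda>_. 0) * fold diff (B @ G) v' (\<lambda>_. 0)))))"

text \<open>Difference operators commute, so a word matters only through the numbers of its four
  letters.\<close>

lemma word_sum_contraction:
  "word_sum I lam w u v u' v' = contraction I lam (count_list w (True, True)) (count_list w (True, False))
     (count_list w (False, True)) (count_list w (False, False)) u v u' v'"
proof (induction w arbitrary: u v u' v')
  case (Cons l w)
  show ?case
    by (cases l; cases "fst l"; cases "snd l")
      (simp_all add: Cons.IH contraction_def fold_diff_append_Cons wsum_sum wsum_scale del: fold_append)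
qed (simp add: contraction_def)

text \<open>For fixed \<open>B\<close> and \<open>C\<close> the sums over \<open>A\<close> and
  \<open>G\<close> separate and coincide, which leaves the squared norm of a contraction.\<close>

lemma contraction_balanced:
  "contraction I lam a b b a u u u u
    = wsum I lam b (\<lambda>B. wsum I lam b (\<lambda>C.
        (wsum I lam a (\<lambda>A. fold diff (A @ B) u (\<lambda>_. 0) * fold diff (A @ C) u (\<lambda>_. 0)))\<^sup>2))"
proof -
  let ?f = "\<lambda>A B. fold diff (A @ B) u (\<lambda>_. 0)"
  have sym: "?f A B = ?f B A" for A B
    by (metis fold_diff_mset mset_append union_commute)
  have "contraction I lam a b b a u u u u
      = wsum I lam a (\<lambda>A. wsum I lam b (\<lambda>B. wsum I lam b (\<lambda>C. wsum I lam a (\<lambda>G.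
          (?f A B * ?f A C) * (?f G C * ?f G B)))))"
    unfolding contraction_def
    by (intro wsum_cong) (subst sym[of _ "_ :: 'a list"], simp only: sym ac_simps)
  also have "\<dots> = wsum I lam b (\<lambda>B. wsum I lam b (\<lambda>C. wsum I lam a (\<lambda>A. wsum I lam a (\<lambda>G.
          (?f A B * ?f A C) * (?f G C * ?f G B)))))"
    by (simp only: wsum_swap[of I lam a I lam b])
  also have "\<dots> = wsum I lam b (\<lambda>B. wsum I lam b (\<lambda>C.
        (wsum I lam a (\<lambda>A. ?f A B * ?f A C)) * (wsum I lam a (\<lambda>G. ?f G C * ?f G B))))"
    by (simp only: wsum_scale wsum_scale_right)
  also have "\<dots> = wsum I lam b (\<lambda>B. wsum I lam b (\<lambda>C. (wsum I lam a (\<lambda>A. ?f A B * ?f A C))\<^sup>2))"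
    by (simp only: power2_eq_square mult.commute[of "?f _ _" "?f _ _"])
  finally show ?thesis .
qed

text \<open>Either each factor receives exactly \<open>q\<close> letters, and the word contributes a
  sum of squares, or some factor receives more than \<open>q\<close> and is annihilated.\<close>

lemma word_sum_nonneg:
  assumes lam: "\<And>i. i \<in> I \<Longrightarrow> 0 \<le> lam i" and u: "deg_lt I (Suc q) u" and w: "length w = 2 * q"
  shows "0 \<le> word_sum I lam w u u u u"
proof -
  define a b c d where abcd: "a = count_list w (True, True)" "b = count_list w (True, False)"
    "c = count_list w (False, True)" "d = count_list w (False, False)"
  have "(\<Sum>l\<in>UNIV. real (count_list w l)) = real (length w)"
    using sum_count_set[of w UNIV] by (simp flip: of_nat_sum)
  then have sum: "a + b + c + d = 2 * q" by (simp add: abcd w sum_bool_pairs)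
  have z: "fold diff z u (\<lambda>_. 0) = 0" if "set z \<subseteq> I" "length z > q" for z
    using deg_lt_fold_diff_zero[OF u that(1) _ supported_zero] that(2) by simp
  show ?thesis
  proof (cases "a + b = q \<and> a + c = q")
    case True
    then have "c = b" "d = a" using sum by auto
    then show ?thesis
      unfolding word_sum_contraction abcd[symmetric]
      by (auto simp: contraction_balanced intro!: wsum_nonneg lam)
  next
    case False
    \<comment> \<open>The four counts add up to \<open>2 * q\<close>, so a deficit in one factor is
      a surplus in its partner.\<close>
    then have "a + b > q \<or> c + d > q \<or> a + c > q \<or> b + d > q" using sum by linarith
    then have "contraction I lam a b c d u u u u = wsum I lam a (\<lambda>A. wsum I lam b (\<lambda>B. wsum I lam c (\<lambda>C. wsum I lam d (\<lambda>G. 0))))"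
      unfolding contraction_def by (intro wsum_cong) (auto simp: z simp del: fold_append)
    then show ?thesis
      unfolding word_sum_contraction abcd[symmetric] using wsum_scale[of I lam _ 0 "\<lambda>_. 0"] by simp
  qed
qed

text \<open>By nonnegativity it suffices to keep two kinds of words: those that pair the factors of
  one square with those of the other in order, and those that pair them crosswise. Each kind has
  \<open>2 * q choose q\<close> words, and on each of these words the sum factorizes into two copies
  of the squared norm.\<close>

lemma top_square_ge:
  assumes lam: "\<And>i. i \<in> I \<Longrightarrow> 0 \<le> lam i" and u: "deg_lt I (Suc q) u" and q: "q \<ge> 1"
  shows "2 * real (2 * q choose q) * (wsum I lam q (\<lambda>z. (fold diff z u (\<lambda>_. 0))\<^sup>2))\<^sup>2
    \<le> wsum I lam (2 * q) (\<lambda>z. (fold diff z (\<lambda>x. u x * u x) (\<lambda>_. 0))\<^sup>2)"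
proof -
  let ?X = "\<lambda>w. word_sum I lam w u u u u"
  let ?W = "\<lambda>a b. {w :: (bool \<times> bool) list. set w \<subseteq> {a, b} \<and> length w = 2 * q \<and> count_list w a = q}"
  let ?S = "wsum I lam q (\<lambda>z. (fold diff z u (\<lambda>_. 0))\<^sup>2)"
  let ?W1 = "?W (True, True) (False, False)" and ?W2 = "?W (True, False) (False, True)"
  have pd: "prod_deg_lt I (Suc (2 * q)) u u"
    using deg_lt_prod_deg_lt[OF u u] by (simp add: mult_2)
  have tot: "wsum I lam (2 * q) (\<lambda>z. (fold diff z (\<lambda>x. u x * u x) (\<lambda>_. 0))\<^sup>2)
      = (\<Sum>w | set w \<subseteq> UNIV \<and> length w = 2 * q. ?X w)"
    unfolding power2_eq_square top_product_word_sum[OF pd pd] by (rule wsum_const_one) simp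
  have cnt: "count_list w b = q" if "w \<in> ?W a b" "a \<noteq> b" for w a b
  proof -
    have "(\<Sum>l\<in>{a, b}. count_list w l) = length w" using that sum_count_set[of w "{a, b}"] by simp
    then show ?thesis using that by simp
  qed
  have zero: "count_list w c = 0" if "w \<in> ?W a b" "c \<noteq> a" "c \<noteq> b" for w a b c
    using that by (auto simp: count_list_0_iff)
  have X1: "?X w = ?S\<^sup>2" if "w \<in> ?W1" for w
    using zero[OF that, of "(True, False)"] zero[OF that, of "(False, True)"] cnt[OF that] that
    unfolding word_sum_contraction by (simp add: contraction_balanced power2_eq_square)
  have X2: "?X w = ?S\<^sup>2" if "w \<in> ?W2" for w
    using zero[OF that, of "(True, True)"] zero[OF that, of "(False, False)"] cnt[OF that] that
    unfolding word_sum_contraction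
    by (simp add: contraction_balanced power_mult_distrib wsum_scale wsum_scale_right)
      (simp add: power2_eq_square)
  have fin: "finite {w :: (bool \<times> bool) list. set w \<subseteq> UNIV \<and> length w = 2 * q}"
    by (rule finite_lists_length_eq) simp
  \<comment> \<open>Only the empty word could belong to both kinds, and \<open>q \<ge> 1\<close>
    excludes it.\<close>
  have disj: "?W1 \<inter> ?W2 = {}"
  proof (rule ccontr)
    assume "?W1 \<inter> ?W2 \<noteq> {}"
    then obtain w where w: "set w \<subseteq> {(True, True), (False, False)}" "set w \<subseteq> {(True, False), (False, True)}"
      "length w = 2 * q" by blast
    then have "w = []" by (cases w) auto
    then show False using w(3) q by simp
  qed
  have "2 * real (2 * q choose q) * ?S\<^sup>2 = (\<Sum>w\<in>?W1. ?X w) + (\<Sum>w\<in>?W2. ?X w)"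
    using X1 X2 card_words_count[of "(True, True)" "(False, False)" "2 * q" q]
      card_words_count[of "(True, False)" "(False, True)" "2 * q" q] by simp
  also have "\<dots> = (\<Sum>w\<in>?W1 \<union> ?W2. ?X w)"
    by (rule sum.union_disjoint[symmetric]) (use disj in \<open>auto intro: finite_subset[OF _ fin]\<close>)
  also have "\<dots> \<le> (\<Sum>w | set w \<subseteq> UNIV \<and> length w = 2 * q. ?X w)"
    by (rule sum_mono2[OF fin]) (auto intro!: word_sum_nonneg lam u)
  finally show ?thesis unfolding tot .
qed

section \<open>The fourth moment bound\<close>

text \<open>Takes the place of the Cauchy-Schwarz inequality in later estimates; \<open>m\<close> is
  chosen as the expected size of \<open>y\<close>.\<close>

lemma abs_le_half_square_add:
  fixes y m :: real
  assumes "m > 0"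
  shows "\<bar>y\<bar> \<le> y\<^sup>2 / (2 * m) + m / 2"
proof -
  have "2 * m * \<bar>y\<bar> \<le> y\<^sup>2 + m\<^sup>2" using sum_squares_bound[of m "\<bar>y\<bar>"] by simp
  then show ?thesis using assms by (simp add: field_simps power2_eq_square)
qed

context poisson_vector
begin

section \<open>Energy identities and the moment inequality for one chaos\<close>

lemma energy_cong_left:
  assumes "\<And>x. x \<in> supported I \<Longrightarrow> u x = u' x"
  shows "energy u v = energy u' v"
  unfolding energy_def diff_def
  by (intro sum.cong refl arg_cong2[where f = "(*)"] expectation_cong) (simp add: assms supported_raise)

lemma energy_sum_left:
  assumes "\<And>p. p \<in> P \<Longrightarrow> tempered I (f p)" "tempered I v"
  shows "energy (\<lambda>x. \<Sum>p\<in>P. f p x) v = (\<Sum>p\<in>P. energy (f p) v)"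
proof -
  have "E (\<lambda>x. diff i (\<lambda>x. \<Sum>p\<in>P. f p x) x * diff i v x) = (\<Sum>p\<in>P. E (\<lambda>x. diff i (f p) x * diff i v x))"
    if "i \<in> I" for i
    unfolding diff_sum sum_distrib_right using assms finite_I that
    by (intro Bochner_Integration.integral_sum integrable_tempered tempered_mult tempered_diff)
  then have "energy (\<lambda>x. \<Sum>p\<in>P. f p x) v
      = (\<Sum>i\<in>I. \<Sum>p\<in>P. lam i * E (\<lambda>x. diff i (f p) x * diff i v x))"
    unfolding energy_def by (intro sum.cong refl) (simp add: sum_distrib_left)
  also have "\<dots> = (\<Sum>p\<in>P. energy (f p) v)"
    unfolding energy_def by (rule sum.swap)
  finally show ?thesis .
qed

text \<open>Both identities are polynomial identities in the values \<open>a\<close> and \<open>b\<close> before and after a jump, e.g.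
  \<open>(b - a)^4 = 4 (b^3 - a^3) (b - a) - 3 (b^2 - a^2)^2\<close>.\<close>

lemma quartic_energy:
  assumes "tempered I F"
  shows "(\<Sum>i\<in>I. lam i * E (\<lambda>x. diff i F x ^ 4))
    = 4 * energy (\<lambda>x. F x ^ 3) F - 3 * energy (\<lambda>x. (F x)\<^sup>2) (\<lambda>x. (F x)\<^sup>2)"
proof -
  have *: "E (\<lambda>x. diff i F x ^ 4) = 4 * E (\<lambda>x. diff i (\<lambda>x. F x ^ 3) x * diff i F x)
      - 3 * E (\<lambda>x. diff i (\<lambda>x. (F x)\<^sup>2) x * diff i (\<lambda>x. (F x)\<^sup>2) x)" if i: "i \<in> I" for i
  proof -
    have "E (\<lambda>x. diff i F x ^ 4) = E (\<lambda>x. 4 * (diff i (\<lambda>x. F x ^ 3) x * diff i F x)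
      - 3 * (diff i (\<lambda>x. (F x)\<^sup>2) x * diff i (\<lambda>x. (F x)\<^sup>2) x))"
      by (rule Bochner_Integration.integral_cong) (simp_all add: diff_def algebra_simps eval_nat_numeral)
    also have "\<dots> = E (\<lambda>x. 4 * (diff i (\<lambda>x. F x ^ 3) x * diff i F x))
      - E (\<lambda>x. 3 * (diff i (\<lambda>x. (F x)\<^sup>2) x * diff i (\<lambda>x. (F x)\<^sup>2) x))"
      using assms finite_I i
      by (intro Bochner_Integration.integral_diff integrable_tempered tempered_scale tempered_mult[OF tempered_diff tempered_diff] tempered_power)
    finally show ?thesis by simp
  qed
  show ?thesis
    unfolding energy_def sum_distrib_left sum_subtractf[symmetric]
    by (intro sum.cong refl) (simp only: *, simp add: algebra_simps)
qed

lemma carre_du_champ_energy: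
  assumes "tempered I F" "tempered I \<psi>"
  shows "(\<Sum>i\<in>I. lam i * E (\<lambda>x. (diff i F x)\<^sup>2 * (\<psi> x + \<psi> (raise i x)) / 2))
    = energy F (\<lambda>x. F x * \<psi> x) - energy (\<lambda>x. (F x)\<^sup>2) \<psi> / 2"
proof -
  have *: "E (\<lambda>x. (diff i F x)\<^sup>2 * (\<psi> x + \<psi> (raise i x)) / 2) = E (\<lambda>x. diff i F x * diff i (\<lambda>x. F x * \<psi> x) x)
      - E (\<lambda>x. diff i (\<lambda>x. (F x)\<^sup>2) x * diff i \<psi> x) / 2" if i: "i \<in> I" for i
  proof -
    have "E (\<lambda>x. (diff i F x)\<^sup>2 * (\<psi> x + \<psi> (raise i x)) / 2) = E (\<lambda>x. diff i F x * diff i (\<lambda>x. F x * \<psi> x) x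
      - (1 / 2) * (diff i (\<lambda>x. (F x)\<^sup>2) x * diff i \<psi> x))"
      by (rule Bochner_Integration.integral_cong) (simp_all add: diff_def field_simps power2_eq_square)
    also have "\<dots> = E (\<lambda>x. diff i F x * diff i (\<lambda>x. F x * \<psi> x) x)
      - E (\<lambda>x. (1 / 2) * (diff i (\<lambda>x. (F x)\<^sup>2) x * diff i \<psi> x))"
      using assms finite_I i
      by (intro Bochner_Integration.integral_diff integrable_tempered tempered_scale tempered_mult[OF tempered_diff tempered_diff] tempered_power
        tempered_mult[OF assms])
    finally show ?thesis by simp
  qed
  show ?thesis
    unfolding energy_def sum_divide_distrib sum_subtractf[symmetric]
    by (intro sum.cong refl) (simp only: *, simp add: algebra_simps)
qed

lemma expectation_square_chaos_sum:
  assumes "\<And>p. sym_kernel (h p)" "finite P"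
  shows "E (\<lambda>x. (\<Sum>p\<in>P. c p * chaos I lam p (h p) x) * (\<Sum>p\<in>P. d p * chaos I lam p (h p) x))
    = (\<Sum>p\<in>P. c p * d p * E (\<lambda>x. (chaos I lam p (h p) x)\<^sup>2))"
proof -
  let ?G = "\<lambda>p x. chaos I lam p (h p) x"
  have t: "tempered I (?G p)" for p by (rule tempered_chaos[OF finite_I])
  have "E (\<lambda>x. (\<Sum>p\<in>P. c p * ?G p x) * (\<Sum>p\<in>P. d p * ?G p x))
      = E (\<lambda>x. \<Sum>p\<in>P. \<Sum>r\<in>P. (c p * d r) * (?G p x * ?G r x))"
    unfolding sum_product by (intro Bochner_Integration.integral_cong refl sum.cong) (simp add: ac_simps)
  also have "\<dots> = (\<Sum>p\<in>P. \<Sum>r\<in>P. E (\<lambda>x. (c p * d r) * (?G p x * ?G r x)))"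
    using t by (subst Bochner_Integration.integral_sum,
        (intro integrable_tempered tempered_sum tempered_scale tempered_mult; simp),
        intro sum.cong refl Bochner_Integration.integral_sum integrable_tempered tempered_scale tempered_mult)
  also have "\<dots> = (\<Sum>p\<in>P. \<Sum>r\<in>P. if r = p then c p * d p * E (\<lambda>x. (?G p x)\<^sup>2) else 0)"
    by (intro sum.cong refl) (auto simp: power2_eq_square chaos_orthogonal assms)
  finally show ?thesis using assms(2) by (simp add: sum.delta)
qed

text \<open>The number \<open>\<alpha>\<close> dominates the root of the excess of the fourth
  moment; taking it positive avoids a discussion of the sign of the excess and permits division. The
  trapezoidal hypothesis on \<open>g\<close> has the shape of the symmetrized carre du champ, where
  \<open>g'\<close> is averaged over both ends of a jump.\<close>

theorem fourth_moment_bound: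
  fixes g g' :: "real \<Rightarrow> real"
  assumes f: "sym_kernel f" and q: "q \<ge> 1"
    and F: "F = chaos I lam q f"
    and s: "s = E (\<lambda>x. (F x)\<^sup>2)" and K: "K = E (\<lambda>x. F x ^ 4)"
    and \<alpha>: "\<alpha> > 0" "K - 3 * s\<^sup>2 \<le> \<alpha>\<^sup>2"
    and g: "\<And>y. \<bar>g y\<bar> \<le> 1" and g': "\<And>y. \<bar>g' y\<bar> \<le> c1"
    and trapezoid: "\<And>a b. \<bar>g b - g a - (b - a) * (g' a + g' b) / 2\<bar> \<le> c3 * \<bar>b - a\<bar> ^ 3"
    and c3: "c3 \<ge> 0"
  shows "\<bar>E (\<lambda>x. F x * g (F x)) - s * E (\<lambda>x. g' (F x))\<bar> \<le> c1 * \<alpha> + 4 * c3 * \<alpha>\<^sup>2"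
proof -
  let ?o = "\<lambda>_. 0 :: nat"
  have tF: "tempered I F" unfolding F by (rule tempered_chaos[OF finite_I])
  have tF2: "tempered I (\<lambda>x. (F x)\<^sup>2)" by (rule tempered_power[OF tF])
  have dF: "deg_lt I (Suc q) F" unfolding F by (rule deg_lt_chaos[OF finite_I f])
  have "deg_lt I (Suc (2 * q)) (\<lambda>x. (F x)\<^sup>2)"
    using prod_deg_lt_mult[OF deg_lt_prod_deg_lt[OF dF dF]] by (simp only: power2_eq_square mult_2)
  from chaos_decomposition[OF finite_I this, of lam] obtain h where
    h: "\<And>p. sym_kernel (h p)"
    and dec: "\<And>x. x \<in> supported I \<Longrightarrow> (F x)\<^sup>2 = (\<Sum>p\<le>2 * q. chaos I lam p (h p) x)"
    and htop: "\<And>z. set z \<subseteq> I \<Longrightarrow> h (2 * q) z = fold diff z (\<lambda>x. (F x)\<^sup>2) ?o / fact (2 * q)"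
    by blast
  define G where "G p = chaos I lam p (h p)" for p
  define a where "a p = E (\<lambda>x. (G p x)\<^sup>2)" for p
  have tG: "tempered I (G p)" for p unfolding G_def by (rule tempered_chaos[OF finite_I])
  have a0: "a p \<ge> 0" for p by (simp add: a_def)
  have EG: "E (\<lambda>x. (\<Sum>p\<le>2 * q. c p * G p x) * (\<Sum>p\<le>2 * q. d p * G p x)) = (\<Sum>p\<le>2 * q. c p * d p * a p)" for c d
    unfolding G_def a_def by (rule expectation_square_chaos_sum[OF h]) simp
  have EGF: "E (\<lambda>x. G p x * (F x)\<^sup>2) = a p" if "p \<le> 2 * q" for p
  proof -
    have "E (\<lambda>x. G p x * (F x)\<^sup>2)
        = E (\<lambda>x. (\<Sum>r\<le>2 * q. (if r = p then 1 else 0) * G r x) * (\<Sum>r\<le>2 * q. 1 * G r x))"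
      using that dec by (intro expectation_cong) (simp add: G_def if_distrib[of "\<lambda>c. c * _"] sum.delta cong: if_cong)
    also have "\<dots> = a p" unfolding EG using that by (simp add: if_distrib[of "\<lambda>c. c * _"] cong: if_cong)
    finally show ?thesis .
  qed
  have K_sum: "K = (\<Sum>p\<le>2 * q. a p)"
  proof -
    have "K = E (\<lambda>x. (\<Sum>p\<le>2 * q. 1 * G p x) * (\<Sum>p\<le>2 * q. 1 * G p x))"
      unfolding K
    proof (rule expectation_cong)
      fix x assume "x \<in> supported I"
      then have "(\<Sum>p\<le>2 * q. 1 * G p x) = (F x)\<^sup>2" using dec by (simp add: G_def)
      moreover have "F x ^ 4 = (F x)\<^sup>2 * (F x)\<^sup>2" by (simp add: eval_nat_numeral)
      ultimately show "F x ^ 4 = (\<Sum>p\<le>2 * q. 1 * G p x) * (\<Sum>p\<le>2 * q. 1 * G p x)"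
        by (simp only:)
    qed
    then show ?thesis unfolding EG by simp
  qed
  have energy_F2: "energy (\<lambda>x. (F x)\<^sup>2) \<psi> = (\<Sum>p\<le>2 * q. real p * E (\<lambda>x. G p x * \<psi> x))" if "tempered I \<psi>" for \<psi>
  proof -
    have "energy (\<lambda>x. (F x)\<^sup>2) \<psi> = energy (\<lambda>x. \<Sum>p\<le>2 * q. G p x) \<psi>"
      using dec by (intro energy_cong_left) (simp add: G_def)
    also have "\<dots> = (\<Sum>p\<le>2 * q. energy (G p) \<psi>)" using that tG by (intro energy_sum_left)
    also have "\<dots> = (\<Sum>p\<le>2 * q. real p * E (\<lambda>x. G p x * \<psi> x))"
      unfolding G_def using that h by (simp add: energy_chaos)
    finally show ?thesis .
  qed
  have energy_F: "energy F \<psi> = real q * E (\<lambda>x. F x * \<psi> x)" if "tempered I \<psi>" for \<psi>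
    unfolding F using f that by (rule energy_chaos)
  have E_F2: "E (\<lambda>x. (F x)\<^sup>2 * \<psi> x) = (\<Sum>p\<le>2 * q. E (\<lambda>x. G p x * \<psi> x))" if "tempered I \<psi>" for \<psi>
  proof -
    have "E (\<lambda>x. (F x)\<^sup>2 * \<psi> x) = E (\<lambda>x. \<Sum>p\<le>2 * q. G p x * \<psi> x)"
      using dec by (intro expectation_cong) (simp add: G_def sum_distrib_right)
    then show ?thesis
      using tG that by (simp add: Bochner_Integration.integral_sum integrable_tempered tempered_mult)
  qed
  \<comment> \<open>All other components are orthogonal to constants, so the component of order 0 is
    the mean of the square.\<close>
  have G0: "G 0 x = s" for x
  proof -
    have one: "chaos I lam 0 (\<lambda>_. 1) = (\<lambda>_. 1)" "sym_kernel (\<lambda>_. 1)" by (simp_all add: sym_kernel_def)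
    have "E (G p) = 0" if "p \<noteq> 0" for p
      using chaos_orthogonal[OF h one(2) that] one(1) by (simp add: G_def)
    moreover have "s = (\<Sum>p\<le>2 * q. E (G p))"
      using E_F2[OF tempered_const, of 1] by (simp add: s)
    ultimately have "s = E (G 0)" by (simp add: sum.atMost_shift)
    then show ?thesis by (simp add: G_def)
  qed
  have a_0: "a 0 = s\<^sup>2" by (simp add: a_def G0)
  \<comment> \<open>In \<open>top_square_ge\<close> the kernel of \<open>F\<close> enters through
    its top differences, each carrying \<open>fact q\<close>; together with
    \<open>fact (2 * q)\<close> from the isometry these cancel against the binomial
    coefficient.\<close>
  have a_top: "a (2 * q) \<ge> 2 * s\<^sup>2"
  proof -
    let ?W = "wsum I lam q (\<lambda>z. (f z)\<^sup>2)"
    have s_W: "s = fact q * ?W"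
      unfolding s F by (simp only: power2_eq_square chaos_inner[OF f f])
    have "wsum I lam q (\<lambda>z. (fold diff z F ?o)\<^sup>2) = wsum I lam q (\<lambda>z. (fact q)\<^sup>2 * (f z)\<^sup>2)"
      unfolding F by (rule wsum_cong) (simp add: fold_diff_chaos finite_I f power_mult_distrib)
    also have "\<dots> = fact q * s" by (simp add: wsum_scale s_W power2_eq_square)
    finally have 1: "2 * real (2 * q choose q) * (fact q * s)\<^sup>2
        \<le> wsum I lam (2 * q) (\<lambda>z. (fold diff z (\<lambda>x. F x * F x) ?o)\<^sup>2)"
      using top_square_ge[of I lam q F, OF lam_nonneg dF q] by simp
    have "a (2 * q) = fact (2 * q) * wsum I lam (2 * q) (\<lambda>z. (h (2 * q) z)\<^sup>2)"
      unfolding a_def G_def by (simp only: power2_eq_square chaos_inner[OF h h])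
    also have "wsum I lam (2 * q) (\<lambda>z. (h (2 * q) z)\<^sup>2)
        = wsum I lam (2 * q) (\<lambda>z. (1 / (fact (2 * q))\<^sup>2) * (fold diff z (\<lambda>x. F x * F x) ?o)\<^sup>2)"
      by (rule wsum_cong) (simp add: htop power_divide power2_eq_square)
    finally have "a (2 * q) = wsum I lam (2 * q) (\<lambda>z. (fold diff z (\<lambda>x. F x * F x) ?o)\<^sup>2) / fact (2 * q)"
      unfolding wsum_scale by (simp add: power2_eq_square)
    then have "a (2 * q) \<ge> 2 * real (2 * q choose q) * (fact q * s)\<^sup>2 / fact (2 * q)"
      using 1 by (simp add: divide_right_mono)
    moreover have "real (2 * q choose q) = fact (2 * q) / (fact q * fact q)"
      using binomial_fact[of q "2 * q", where ?'a = real] by (simp add: mult_2)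
    ultimately show ?thesis by (simp add: power2_eq_square)
  qed
  \<comment> \<open>Order 0 takes \<open>s\<^sup>2\<close> and the top order at least twice that, so
    the orders between share at most the excess over \<open>3 * s\<^sup>2\<close>.\<close>
  have mid: "(\<Sum>p\<in>{1..<2 * q}. a p) \<le> K - 3 * s\<^sup>2"
  proof -
    have "{..2 * q} = insert 0 (insert (2 * q) {1..<2 * q})" using q by auto
    then have "K = a 0 + (a (2 * q) + (\<Sum>p\<in>{1..<2 * q}. a p))" unfolding K_sum using q by simp
    then show ?thesis using a_0 a_top by simp
  qed
  \<comment> \<open>The carre du champ of \<open>F\<close>: half of the generator applied to the
    square, minus \<open>F\<close> times the generator applied to \<open>F\<close>, where the
    generator acts on order \<open>p\<close> as multiplication by \<open>- p\<close>.\<close>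
  define \<Gamma> where "\<Gamma> x = (\<Sum>p\<le>2 * q. (2 * real q - real p) / 2 * G p x)" for x
  have t\<Gamma>: "tempered I \<Gamma>" unfolding \<Gamma>_def[abs_def] by (intro tempered_sum tempered_scale tG)
  have E\<Gamma>: "E (\<lambda>x. \<Gamma> x * \<psi> x) = (\<Sum>i\<in>I. lam i * E (\<lambda>x. (diff i F x)\<^sup>2 * (\<psi> x + \<psi> (raise i x)) / 2))"
    if "tempered I \<psi>" for \<psi>
  proof -
    have "E (\<lambda>x. \<Gamma> x * \<psi> x) = (\<Sum>p\<le>2 * q. E (\<lambda>x. (2 * real q - real p) / 2 * (G p x * \<psi> x)))"
      unfolding \<Gamma>_def sum_distrib_right mult.assoc
      using tG that by (intro Bochner_Integration.integral_sum integrable_tempered tempered_scale tempered_mult)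
    also have "\<dots> = (\<Sum>p\<le>2 * q. (2 * real q - real p) / 2 * E (\<lambda>x. G p x * \<psi> x))"
      by (simp only: integral_mult_right_zero)
    also have "\<dots> = real q * (\<Sum>p\<le>2 * q. E (\<lambda>x. G p x * \<psi> x)) - (\<Sum>p\<le>2 * q. real p * E (\<lambda>x. G p x * \<psi> x)) / 2"
      by (simp add: sum_distrib_left sum_divide_distrib sum_subtractf[symmetric] diff_divide_distrib left_diff_distrib)
    also have "\<dots> = real q * E (\<lambda>x. F x * (F x * \<psi> x)) - energy (\<lambda>x. (F x)\<^sup>2) \<psi> / 2"
      using E_F2[OF that] energy_F2[OF that] by (simp add: power2_eq_square mult.assoc)
    also have "\<dots> = energy F (\<lambda>x. F x * \<psi> x) - energy (\<lambda>x. (F x)\<^sup>2) \<psi> / 2"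
      using energy_F[OF tempered_mult[OF tF that]] by simp
    finally show ?thesis using carre_du_champ_energy[OF tF that] by simp
  qed
  \<comment> \<open>Order 0 gives the mean \<open>real q * s\<close>, the top order has coefficient
    0, and all coefficients between lie in the interval from 0 to \<open>q\<close>. Hence only the
    sum bounded by \<open>mid\<close> enters.\<close>
  have var\<Gamma>: "E (\<lambda>x. (\<Gamma> x - real q * s)\<^sup>2) \<le> (real q)\<^sup>2 * \<alpha>\<^sup>2"
  proof -
    let ?c = "\<lambda>p. if p = 0 then 0 else (2 * real q - real p) / 2"
    have "\<Gamma> x - real q * s = (\<Sum>p\<le>2 * q. ?c p * G p x)" for x
    proof -
      have "(\<Sum>p\<le>2 * q. (if p = 0 then real q * s else 0)) = real q * s" by simp
      then have "\<Gamma> x - real q * s = (\<Sum>p\<le>2 * q. (2 * real q - real p) / 2 * G p x - (if p = 0 then real q * s else 0))"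
        unfolding \<Gamma>_def sum_subtractf by simp
      also have "\<dots> = (\<Sum>p\<le>2 * q. ?c p * G p x)" by (intro sum.cong refl) (auto simp: G0)
      finally show ?thesis .
    qed
    then have "E (\<lambda>x. (\<Gamma> x - real q * s)\<^sup>2) = (\<Sum>p\<le>2 * q. ?c p * ?c p * a p)"
      by (simp only: power2_eq_square EG)
    also have "\<dots> = (\<Sum>p\<in>{1..<2 * q}. ?c p * ?c p * a p)"
      by (rule sum.mono_neutral_right) auto
    also have "\<dots> \<le> (\<Sum>p\<in>{1..<2 * q}. (real q)\<^sup>2 * a p)"
    proof (intro sum_mono mult_right_mono a0)
      fix p assume "p \<in> {1..<2 * q}"
      then have "0 \<le> ?c p" "?c p \<le> real q" by (auto simp: field_simps)
      then show "?c p * ?c p \<le> (real q)\<^sup>2" unfolding power2_eq_square by (intro mult_mono) auto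
    qed
    also have "\<dots> = (real q)\<^sup>2 * (\<Sum>p\<in>{1..<2 * q}. a p)" by (simp add: sum_distrib_left)
    also have "\<dots> \<le> (real q)\<^sup>2 * \<alpha>\<^sup>2" using mid \<alpha> by (intro mult_left_mono) auto
    finally show ?thesis .
  qed
  \<comment> \<open>The sum of \<open>real p * a p\<close> enters with a negative sign, so all its
    summands but the top one may be dropped; \<open>a_top\<close> then produces exactly the excess
    of the fourth moment.\<close>
  have quartic: "(\<Sum>i\<in>I. lam i * E (\<lambda>x. diff i F x ^ 4)) \<le> 4 * real q * \<alpha>\<^sup>2"
  proof -
    have "(\<Sum>i\<in>I. lam i * E (\<lambda>x. diff i F x ^ 4)) = 4 * (real q * K) - 3 * (\<Sum>p\<le>2 * q. real p * a p)"
      unfolding quartic_energy[OF tF] energy_commute[of "\<lambda>x. F x ^ 3"] energy_F[OF tempered_power[OF tF]]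
        energy_F2[OF tF2] using EGF by (simp add: K eval_nat_numeral)
    also have "\<dots> \<le> 4 * (real q * K) - 3 * (2 * real q * a (2 * q))"
    proof -
      have "real (2 * q) * a (2 * q) \<le> (\<Sum>p\<le>2 * q. real p * a p)"
        using a0 by (intro member_le_sum) auto
      then show ?thesis by simp
    qed
    also have "\<dots> \<le> 4 * (real q * K) - 3 * (2 * real q * (2 * s\<^sup>2))"
      using a_top by (intro diff_mono mult_left_mono) auto
    also have "\<dots> = 4 * real q * (K - 3 * s\<^sup>2)" by (simp add: algebra_simps)
    also have "\<dots> \<le> 4 * real q * \<alpha>\<^sup>2" using \<alpha> by (intro mult_left_mono) auto
    finally show ?thesis .
  qed
  have tg: "tempered I (\<lambda>x. g (F x))" by (rule tempered_bounded[OF g])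
  have tg': "tempered I (\<lambda>x. g' (F x))" by (rule tempered_bounded[OF g'])
  \<comment> \<open>Jump by jump, the defect of the chain rule is the jump of \<open>F\<close> times
    the trapezoidal error of \<open>g\<close>, hence of fourth order in the jump.\<close>
  have err: "\<bar>energy F (\<lambda>x. g (F x)) - E (\<lambda>x. \<Gamma> x * g' (F x))\<bar> \<le> c3 * (4 * real q * \<alpha>\<^sup>2)"
  proof -
    have each: "\<bar>E (\<lambda>x. diff i F x * diff i (\<lambda>x. g (F x)) x) - E (\<lambda>x. (diff i F x)\<^sup>2 * (g' (F x) + g' (F (raise i x))) / 2)\<bar>
        \<le> c3 * E (\<lambda>x. diff i F x ^ 4)" (is "\<bar>?L\<bar> \<le> _") if i: "i \<in> I" for i
    proof -
      let ?r = "\<lambda>x. diff i F x * diff i (\<lambda>x. g (F x)) x - (diff i F x)\<^sup>2 * (g' (F x) + g' (F (raise i x))) / 2"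
      have td: "tempered I (diff i F)" by (rule tempered_diff[OF finite_I tF i])
      have t1: "tempered I (\<lambda>x. diff i F x * diff i (\<lambda>x. g (F x)) x)"
        by (rule tempered_mult[OF td tempered_diff[OF finite_I tg i]])
      have t2: "tempered I (\<lambda>x. (1 / 2) * ((diff i F x)\<^sup>2 * (g' (F x) + g' (F (raise i x)))))"
        by (intro tempered_scale tempered_mult[OF tempered_power[OF td]] tempered_add[OF tg'] tempered_raise[OF finite_I tg' i])
      have tb: "tempered I (\<lambda>x. c3 * diff i F x ^ 4)" by (intro tempered_scale tempered_power td)
      have L: "?L = E ?r"
        using t1 t2 by (intro Bochner_Integration.integral_diff[symmetric] integrable_tempered) simp_all
      have "\<bar>E ?r\<bar> \<le> E (\<lambda>x. \<bar>?r x\<bar>)" by (rule integral_abs_bound)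
      also have "\<dots> \<le> E (\<lambda>x. c3 * diff i F x ^ 4)"
      proof (rule integral_mono)
        show "integrable p (\<lambda>x. \<bar>?r x\<bar>)"
          using integrable_tempered[OF tempered_abs[OF tempered_minus[OF t1 t2]]] by simp
        show "integrable p (\<lambda>x. c3 * diff i F x ^ 4)" by (rule integrable_tempered[OF tb])
        fix x
        define \<delta> where "\<delta> = diff i F x"
        have "?r x = \<delta> * (g (F (raise i x)) - g (F x) - (F (raise i x) - F x) * (g' (F x) + g' (F (raise i x))) / 2)"
          unfolding \<delta>_def diff_def power2_eq_square by (simp add: algebra_simps)
        then have "\<bar>?r x\<bar> \<le> \<bar>\<delta>\<bar> * (c3 * \<bar>\<delta>\<bar> ^ 3)"
          unfolding \<delta>_def diff_def using trapezoid[where b = "F (raise i x)" and a = "F x"]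
          by (simp add: abs_mult mult_left_mono)
        also have "\<dots> = c3 * \<bar>\<delta>\<bar> ^ 4" by (simp add: eval_nat_numeral)
        also have "\<dots> = c3 * \<delta> ^ 4" by (simp add: power_even_abs)
        finally show "\<bar>?r x\<bar> \<le> c3 * diff i F x ^ 4" unfolding \<delta>_def .
      qed
      finally show ?thesis unfolding L by simp
    qed
    have "\<bar>energy F (\<lambda>x. g (F x)) - E (\<lambda>x. \<Gamma> x * g' (F x))\<bar>
        = \<bar>\<Sum>i\<in>I. lam i * (E (\<lambda>x. diff i F x * diff i (\<lambda>x. g (F x)) x)
            - E (\<lambda>x. (diff i F x)\<^sup>2 * (g' (F x) + g' (F (raise i x))) / 2))\<bar>"
      unfolding E\<Gamma>[OF tg'] energy_def by (simp add: sum_subtractf right_diff_distrib)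
    also have "\<dots> \<le> (\<Sum>i\<in>I. lam i * (c3 * E (\<lambda>x. diff i F x ^ 4)))"
      by (rule order_trans[OF sum_abs], rule sum_mono)
        (use each lam_nonneg in \<open>simp add: abs_mult mult_left_mono\<close>)
    also have "\<dots> = c3 * (\<Sum>i\<in>I. lam i * E (\<lambda>x. diff i F x ^ 4))"
      by (simp add: sum_distrib_left ac_simps)
    also have "\<dots> \<le> c3 * (4 * real q * \<alpha>\<^sup>2)"
      using quartic c3 by (rule mult_left_mono)
    finally show ?thesis .
  qed
  have fluct: "\<bar>E (\<lambda>x. \<Gamma> x * g' (F x)) - real q * s * E (\<lambda>x. g' (F x))\<bar> \<le> c1 * (real q * \<alpha>)"
  proof -
    \<comment> \<open>The choice \<open>?m = real q * \<alpha>\<close> matches the bound on the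
      variance, so that both halves of the estimate become equal.\<close>
    let ?X = "\<lambda>x. \<Gamma> x - real q * s" and ?m = "real q * \<alpha>"
    have m: "?m > 0" using q \<alpha> by simp
    have c1: "c1 \<ge> 0" using g'[of 0] by linarith
    have tX: "tempered I ?X" by (intro tempered_minus t\<Gamma> tempered_const)
    let ?Y = "\<lambda>x. c1 / (2 * ?m) * (?X x)\<^sup>2 + c1 * ?m / 2"
    have tY: "tempered I ?Y" by (intro tempered_add tempered_scale tempered_power tX tempered_const)
    have "E (\<lambda>x. \<Gamma> x * g' (F x)) - real q * s * E (\<lambda>x. g' (F x))
        = E (\<lambda>x. \<Gamma> x * g' (F x)) - E (\<lambda>x. real q * s * g' (F x))" by simp
    also have "\<dots> = E (\<lambda>x. \<Gamma> x * g' (F x) - real q * s * g' (F x))"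
      using t\<Gamma> tg' by (intro Bochner_Integration.integral_diff[symmetric] integrable_tempered tempered_mult[OF t\<Gamma>] tempered_scale)
    also have "\<dots> = E (\<lambda>x. ?X x * g' (F x))" by (simp add: left_diff_distrib)
    finally have X: "E (\<lambda>x. \<Gamma> x * g' (F x)) - real q * s * E (\<lambda>x. g' (F x)) = E (\<lambda>x. ?X x * g' (F x))" .
    have "\<bar>E (\<lambda>x. ?X x * g' (F x))\<bar> \<le> E (\<lambda>x. \<bar>?X x * g' (F x)\<bar>)" by (rule integral_abs_bound)
    also have "\<dots> \<le> E ?Y"
    proof (rule integral_mono)
      show "integrable p (\<lambda>x. \<bar>?X x * g' (F x)\<bar>)"
        by (rule integrable_tempered[OF tempered_abs[OF tempered_mult[OF tX tg']]])
      show "integrable p ?Y" by (rule integrable_tempered[OF tY])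
      fix x
      have "\<bar>?X x\<bar> \<le> (?X x)\<^sup>2 / (2 * ?m) + ?m / 2" by (rule abs_le_half_square_add[OF m])
      then have "c1 * \<bar>?X x\<bar> \<le> c1 * ((?X x)\<^sup>2 / (2 * ?m) + ?m / 2)"
        using c1 by (rule mult_left_mono)
      moreover have "\<bar>?X x * g' (F x)\<bar> \<le> \<bar>?X x\<bar> * c1"
        unfolding abs_mult using g' by (intro mult_left_mono) auto
      ultimately show "\<bar>?X x * g' (F x)\<bar> \<le> ?Y x"
        by (simp add: distrib_left mult.commute[of c1])
    qed
    also have "E ?Y = c1 / (2 * ?m) * E (\<lambda>x. (?X x)\<^sup>2) + c1 * ?m / 2"
      using integrable_tempered[OF tempered_scale[OF tempered_power[OF tX, of 2], of "c1 / (2 * ?m)"]] by simp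
    also have "\<dots> \<le> c1 / (2 * ?m) * ?m\<^sup>2 + c1 * ?m / 2"
      using var\<Gamma> c1 m by (intro add_right_mono mult_left_mono) (simp_all add: power_mult_distrib)
    also have "\<dots> = c1 * ?m" using m by (simp add: power2_eq_square field_simps)
    finally show ?thesis unfolding X .
  qed
  \<comment> \<open>Every error carries the factor \<open>q\<close>, which is also the eigenvalue;
    dividing by it makes the bound independent of the order.\<close>
  have "real q * \<bar>E (\<lambda>x. F x * g (F x)) - s * E (\<lambda>x. g' (F x))\<bar>
      = \<bar>energy F (\<lambda>x. g (F x)) - real q * s * E (\<lambda>x. g' (F x))\<bar>"
    unfolding energy_F[OF tg] using abs_mult[of "real q" "E (\<lambda>x. F x * g (F x)) - s * E (\<lambda>x. g' (F x))"]
    by (simp add: algebra_simps)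
  also have "\<dots> \<le> real q * (c1 * \<alpha> + 4 * c3 * \<alpha>\<^sup>2)"
    using err fluct by (simp add: algebra_simps)
  finally show ?thesis using q by simp
qed

end

section \<open>Comparison of characteristic functions\<close>

lemma iexp_add: "iexp (a + b) = iexp a * iexp b"
  by (simp add: exp_add[symmetric] distrib_left)

lemma iexp_taylor1: "cmod (iexp (a + k) - iexp a - \<i> * complex_of_real k * iexp a) \<le> k\<^sup>2 / 2"
proof -
  have "iexp (a + k) - iexp a - \<i> * complex_of_real k * iexp a
      = iexp a * (iexp k - (\<Sum>j\<le>1. (\<i> * k) ^ j / fact j))"
    unfolding iexp_add by (simp add: algebra_simps)
  then show ?thesis using iexp_approx1[of k 1] by (simp add: norm_mult eval_nat_numeral)
qed

text \<open>The trapezoidal rule cancels the terms of first and second order. What is left is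
  \<open>r2 - \<i> * k * r1 / 2\<close> with Taylor remainders \<open>r1\<close> and
  \<open>r2\<close>, at most 1/6 + 1/4 times the cube of the step.\<close>

lemma iexp_trapezoid:
  "cmod (iexp b - iexp a - \<i> * complex_of_real (b - a) * (iexp a + iexp b) / 2) \<le> \<bar>b - a\<bar> ^ 3"
proof -
  define k where "k = b - a"
  define r1 where "r1 = iexp k - (\<Sum>j\<le>1. (\<i> * k) ^ j / fact j)"
  define r2 where "r2 = iexp k - (\<Sum>j\<le>2. (\<i> * k) ^ j / fact j)"
  have r: "cmod r1 \<le> \<bar>k\<bar>\<^sup>2 / 2" "cmod r2 \<le> \<bar>k\<bar> ^ 3 / 6"
    using iexp_approx1[of k 1] iexp_approx1[of k 2] by (simp_all add: r1_def r2_def eval_nat_numeral)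
  have e0: "iexp k = 1 + \<i> * k + r1" by (simp add: r1_def)
  have r12: "r2 = r1 + complex_of_real k * complex_of_real k / 2"
  proof -
    have "(\<i> * complex_of_real k) * (\<i> * complex_of_real k) = (\<i> * \<i>) * (complex_of_real k * complex_of_real k)"
      by (simp only: ac_simps)
    then show ?thesis by (simp add: r1_def r2_def eval_nat_numeral)
  qed
  have b: "iexp b = iexp a * iexp k" unfolding iexp_add[symmetric] k_def by simp
  have "iexp b - iexp a - \<i> * complex_of_real (b - a) * (iexp a + iexp b) / 2
      = iexp a * (r2 - \<i> * k * r1 / 2)"
    unfolding b e0 k_def[symmetric] r12 by (simp add: field_simps)
  then have "cmod (iexp b - iexp a - \<i> * complex_of_real (b - a) * (iexp a + iexp b) / 2)
      = cmod (r2 - \<i> * k * r1 / 2)" by (simp add: norm_mult)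
  also have "\<dots> \<le> cmod r2 + \<bar>k\<bar> * cmod r1 / 2"
    by (rule order_trans[OF norm_triangle_ineq4]) (simp add: norm_mult norm_divide)
  also have "\<dots> \<le> \<bar>k\<bar> ^ 3 / 6 + \<bar>k\<bar> * (\<bar>k\<bar>\<^sup>2 / 2) / 2"
    using r by (intro add_mono divide_right_mono mult_left_mono) auto
  also have "\<bar>k\<bar> * (\<bar>k\<bar>\<^sup>2 / 2) / 2 = \<bar>k\<bar> ^ 3 / 4" by (simp add: eval_nat_numeral)
  also have "\<bar>k\<bar> ^ 3 / 6 + \<bar>k\<bar> ^ 3 / 4 \<le> \<bar>k\<bar> ^ 3"
    using zero_le_power[of "\<bar>k\<bar>" 3] by linarith
  finally show ?thesis by (simp add: k_def)
qed

lemma iexp_Re_Im [simp]: "Re (iexp x) = cos x" "Im (iexp x) = sin x"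
  by (simp_all add: exp_Euler[symmetric] Re_exp Im_exp)

lemma cos_taylor1: fixes a k :: real shows "\<bar>cos (a + k) - cos a + k * sin a\<bar> \<le> k\<^sup>2 / 2"
  using order_trans[OF abs_Re_le_cmod iexp_taylor1[of a k]] by (simp del: of_real_add)

lemma sin_taylor1: fixes a k :: real shows "\<bar>sin (a + k) - sin a - k * cos a\<bar> \<le> k\<^sup>2 / 2"
  using order_trans[OF abs_Im_le_cmod iexp_taylor1[of a k]] by (simp del: of_real_add)

lemma cos_trapezoid: fixes a b t :: real shows "\<bar>cos (t * b) - cos (t * a) - (b - a) * (- t * sin (t * a) + - t * sin (t * b)) / 2\<bar>
    \<le> \<bar>t\<bar> ^ 3 * \<bar>b - a\<bar> ^ 3"
proof -
  have "cos (t * b) - cos (t * a) - (b - a) * (- t * sin (t * a) + - t * sin (t * b)) / 2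
    = Re (iexp (t * b) - iexp (t * a) - \<i> * complex_of_real (t * b - t * a) * (iexp (t * a) + iexp (t * b)) / 2)"
    by (simp del: of_real_mult of_real_diff) (simp add: algebra_simps)
  then show ?thesis
    using order_trans[OF abs_Re_le_cmod iexp_trapezoid[of "t * b" "t * a"]]
    by (simp only: right_diff_distrib[symmetric] abs_mult power_mult_distrib)
qed

lemma sin_trapezoid: fixes a b t :: real shows "\<bar>sin (t * b) - sin (t * a) - (b - a) * (t * cos (t * a) + t * cos (t * b)) / 2\<bar>
    \<le> \<bar>t\<bar> ^ 3 * \<bar>b - a\<bar> ^ 3"
proof -
  have "sin (t * b) - sin (t * a) - (b - a) * (t * cos (t * a) + t * cos (t * b)) / 2
    = Im (iexp (t * b) - iexp (t * a) - \<i> * complex_of_real (t * b - t * a) * (iexp (t * a) + iexp (t * b)) / 2)"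
    by (simp del: of_real_mult of_real_diff) (simp add: algebra_simps)
  then show ?thesis
    using order_trans[OF abs_Im_le_cmod iexp_trapezoid[of "t * b" "t * a"]]
    by (simp only: right_diff_distrib[symmetric] abs_mult power_mult_distrib)
qed

text \<open>Serves to differentiate under the expectation: the second moment of the variable
  controls the quadratic remainder.\<close>

lemma DERIV_quadratic_remainder:
  fixes f :: "real \<Rightarrow> real"
  assumes "\<And>h. \<bar>f (x + h) - f x - h * D\<bar> \<le> c * h\<^sup>2"
  shows "DERIV f x :> D"
  unfolding DERIV_def
proof (rule LIM_zero_cancel)
  show "(\<lambda>h. (f (x + h) - f x) / h - D) \<midarrow>0\<rightarrow> 0"
  proof (rule Lim_null_comparison)
    have "norm ((f (x + h) - f x) / h - D) \<le> c * \<bar>h\<bar>" if "h \<noteq> 0" for h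
    proof -
      have "\<bar>(f (x + h) - f x) / h - D\<bar> = \<bar>f (x + h) - f x - h * D\<bar> / \<bar>h\<bar>"
        using that by (simp add: abs_divide[symmetric] diff_divide_distrib)
      also have "\<dots> \<le> c * h\<^sup>2 / \<bar>h\<bar>" using assms by (intro divide_right_mono) auto
      also have "h\<^sup>2 = \<bar>h\<bar> * \<bar>h\<bar>" by (simp add: power2_eq_square)
      also have "c * (\<bar>h\<bar> * \<bar>h\<bar>) / \<bar>h\<bar> = c * \<bar>h\<bar>" using that by (simp del: abs_mult_self_eq)
      finally show ?thesis by simp
    qed
    then show "\<forall>\<^sub>F h in at 0. norm ((f (x + h) - f x) / h - D) \<le> c * \<bar>h\<bar>"
      by (simp add: eventually_at_filter)
    show "((\<lambda>h. c * \<bar>h\<bar>) \<longlongrightarrow> 0) (at 0)" by (auto intro!: tendsto_eq_intros)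
  qed
qed

text \<open>After multiplication by the integrating factor \<open>exp (s * u\<^sup>2 / 2)\<close>
  the defect of the equation becomes a derivative. The factor is largest at the ends of the range,
  in particular at \<open>t\<close>, so multiplying back by its inverse there removes the
  exponential from the mean value bound.\<close>

lemma gaussian_ode_bound:
  fixes \<phi> D :: "real \<Rightarrow> real"
  assumes D: "\<And>u. DERIV \<phi> u :> D u" and s: "s \<ge> 0"
    and B: "\<And>u. \<bar>u\<bar> \<le> \<bar>t\<bar> \<Longrightarrow> \<bar>D u + s * u * \<phi> u\<bar> \<le> B"
  shows "\<bar>\<phi> t - \<phi> 0 * exp (- s * t\<^sup>2 / 2)\<bar> \<le> B * \<bar>t\<bar>"
proof -
  let ?P = "\<lambda>u. exp (s * u\<^sup>2 / 2) * \<phi> u"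
  let ?P' = "\<lambda>u. exp (s * u\<^sup>2 / 2) * (D u + s * u * \<phi> u)"
  have B0: "B \<ge> 0" using B[of 0] by simp
  have d: "DERIV ?P u :> ?P' u" for u
    by (rule derivative_eq_intros D refl | simp add: algebra_simps)+
  have "norm (?P t - ?P 0) \<le> (exp (s * t\<^sup>2 / 2) * B) * norm (t - 0)"
  proof (rule field_differentiable_bound[of "closed_segment 0 t" ?P ?P'])
    fix u assume u: "u \<in> closed_segment 0 t"
    then have u': "\<bar>u\<bar> \<le> \<bar>t\<bar>" by (auto simp: closed_segment_eq_real_ivl split: if_splits)
    show "(?P has_field_derivative ?P' u) (at u within closed_segment 0 t)"
      using d by (rule has_field_derivative_at_within)
    have "u\<^sup>2 \<le> t\<^sup>2" using u' by (simp add: abs_le_square_iff)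
    then have "exp (s * u\<^sup>2 / 2) \<le> exp (s * t\<^sup>2 / 2)"
      using s by (simp add: mult_left_mono)
    then show "norm (?P' u) \<le> exp (s * t\<^sup>2 / 2) * B"
      using B[OF u'] by (simp add: abs_mult mult_mono)
  qed auto
  then have "exp (- s * t\<^sup>2 / 2) * \<bar>?P t - \<phi> 0\<bar> \<le> exp (- s * t\<^sup>2 / 2) * (exp (s * t\<^sup>2 / 2) * B * \<bar>t\<bar>)"
    by (intro mult_left_mono) auto
  also have "\<dots> = B * \<bar>t\<bar>" by (simp add: mult.assoc[symmetric] exp_add[symmetric])
  finally have le: "exp (- s * t\<^sup>2 / 2) * \<bar>?P t - \<phi> 0\<bar> \<le> B * \<bar>t\<bar>" .
  have "exp (- s * t\<^sup>2 / 2) * \<bar>?P t - \<phi> 0\<bar> = \<bar>exp (- s * t\<^sup>2 / 2) * (?P t - \<phi> 0)\<bar>"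
    by (simp add: abs_mult)
  also have "exp (- s * t\<^sup>2 / 2) * (?P t - \<phi> 0) = \<phi> t - \<phi> 0 * exp (- s * t\<^sup>2 / 2)"
    by (simp add: right_diff_distrib mult.assoc[symmetric] exp_add[symmetric])
  finally show ?thesis using le by simp
qed

lemma (in prob_space) expectation_cos_sin_deriv:
  fixes X :: "'a \<Rightarrow> real"
  assumes [measurable]: "X \<in> borel_measurable M" and X: "integrable M X" and X2: "integrable M (\<lambda>\<omega>. (X \<omega>)\<^sup>2)"
  shows "DERIV (\<lambda>u. expectation (\<lambda>\<omega>. cos (u * X \<omega>))) u :> - expectation (\<lambda>\<omega>. X \<omega> * sin (u * X \<omega>))"
    and "DERIV (\<lambda>u. expectation (\<lambda>\<omega>. sin (u * X \<omega>))) u :> expectation (\<lambda>\<omega>. X \<omega> * cos (u * X \<omega>))"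
proof -
  have i: "integrable M (\<lambda>\<omega>. cos (v * X \<omega>))" "integrable M (\<lambda>\<omega>. sin (v * X \<omega>))" for v
    by (rule integrable_const_bound[of _ 1]; simp)+
  have j: "integrable M (\<lambda>\<omega>. X \<omega> * sin (u * X \<omega>))" "integrable M (\<lambda>\<omega>. X \<omega> * cos (u * X \<omega>))"
    by (rule Bochner_Integration.integrable_bound[OF X]; simp add: abs_mult mult_left_le)+
  let ?c = "expectation (\<lambda>\<omega>. (X \<omega>)\<^sup>2) / 2"
  show "DERIV (\<lambda>u. expectation (\<lambda>\<omega>. cos (u * X \<omega>))) u :> - expectation (\<lambda>\<omega>. X \<omega> * sin (u * X \<omega>))"
  proof (rule DERIV_quadratic_remainder[of _ _ _ ?c])
    fix h
    have eq: "expectation (\<lambda>\<omega>. cos ((u + h) * X \<omega>)) - expectation (\<lambda>\<omega>. cos (u * X \<omega>))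
        - h * - expectation (\<lambda>\<omega>. X \<omega> * sin (u * X \<omega>))
      = expectation (\<lambda>\<omega>. cos ((u + h) * X \<omega>) - cos (u * X \<omega>) + h * (X \<omega> * sin (u * X \<omega>)))"
      using i j by simp
    have "\<bar>expectation (\<lambda>\<omega>. cos ((u + h) * X \<omega>) - cos (u * X \<omega>) + h * (X \<omega> * sin (u * X \<omega>)))\<bar> \<le> expectation (\<lambda>\<omega>. \<bar>cos ((u + h) * X \<omega>) - cos (u * X \<omega>) + h * (X \<omega> * sin (u * X \<omega>))\<bar>)"
      by (rule integral_abs_bound)
    also have "\<dots> \<le> expectation (\<lambda>\<omega>. h\<^sup>2 / 2 * (X \<omega>)\<^sup>2)"
    proof (rule integral_mono)
      show "integrable M (\<lambda>\<omega>. \<bar>cos ((u + h) * X \<omega>) - cos (u * X \<omega>) + h * (X \<omega> * sin (u * X \<omega>))\<bar>)"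
        using i j by simp
      show "integrable M (\<lambda>\<omega>. h\<^sup>2 / 2 * (X \<omega>)\<^sup>2)" using X2 by simp
      show "\<bar>cos ((u + h) * X \<omega>) - cos (u * X \<omega>) + h * (X \<omega> * sin (u * X \<omega>))\<bar> \<le> h\<^sup>2 / 2 * (X \<omega>)\<^sup>2" for \<omega>
        using cos_taylor1[of "u * X \<omega>" "h * X \<omega>"] by (simp add: algebra_simps power_mult_distrib)
    qed
    finally show "\<bar>expectation (\<lambda>\<omega>. cos ((u + h) * X \<omega>)) - expectation (\<lambda>\<omega>. cos (u * X \<omega>))
        - h * - expectation (\<lambda>\<omega>. X \<omega> * sin (u * X \<omega>))\<bar> \<le> ?c * h\<^sup>2" unfolding eq by (simp add: mult.commute)
  qed
  show "DERIV (\<lambda>u. expectation (\<lambda>\<omega>. sin (u * X \<omega>))) u :> expectation (\<lambda>\<omega>. X \<omega> * cos (u * X \<omega>))"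
  proof (rule DERIV_quadratic_remainder[of _ _ _ ?c])
    fix h
    have eq: "expectation (\<lambda>\<omega>. sin ((u + h) * X \<omega>)) - expectation (\<lambda>\<omega>. sin (u * X \<omega>))
        - h * expectation (\<lambda>\<omega>. X \<omega> * cos (u * X \<omega>))
      = expectation (\<lambda>\<omega>. sin ((u + h) * X \<omega>) - sin (u * X \<omega>) - h * (X \<omega> * cos (u * X \<omega>)))"
      using i j by simp
    have "\<bar>expectation (\<lambda>\<omega>. sin ((u + h) * X \<omega>) - sin (u * X \<omega>) - h * (X \<omega> * cos (u * X \<omega>)))\<bar> \<le> expectation (\<lambda>\<omega>. \<bar>sin ((u + h) * X \<omega>) - sin (u * X \<omega>) - h * (X \<omega> * cos (u * X \<omega>))\<bar>)"
      by (rule integral_abs_bound)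
    also have "\<dots> \<le> expectation (\<lambda>\<omega>. h\<^sup>2 / 2 * (X \<omega>)\<^sup>2)"
    proof (rule integral_mono)
      show "integrable M (\<lambda>\<omega>. \<bar>sin ((u + h) * X \<omega>) - sin (u * X \<omega>) - h * (X \<omega> * cos (u * X \<omega>))\<bar>)"
        using i j by simp
      show "integrable M (\<lambda>\<omega>. h\<^sup>2 / 2 * (X \<omega>)\<^sup>2)" using X2 by simp
      show "\<bar>sin ((u + h) * X \<omega>) - sin (u * X \<omega>) - h * (X \<omega> * cos (u * X \<omega>))\<bar> \<le> h\<^sup>2 / 2 * (X \<omega>)\<^sup>2" for \<omega>
        using sin_taylor1[of "u * X \<omega>" "h * X \<omega>"] by (simp add: algebra_simps power_mult_distrib)
    qed
    finally show "\<bar>expectation (\<lambda>\<omega>. sin ((u + h) * X \<omega>)) - expectation (\<lambda>\<omega>. sin (u * X \<omega>))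
        - h * expectation (\<lambda>\<omega>. X \<omega> * cos (u * X \<omega>))\<bar> \<le> ?c * h\<^sup>2" unfolding eq by (simp add: mult.commute)
  qed
qed

text \<open>Sine as test function controls the derivative of the cosine part, and cosine that of the
  sine part. Scaling by \<open>u\<close> gives \<open>c1 = \<bar>u\<bar>\<close> and
  \<open>c3 = \<bar>u\<bar> ^ 3\<close>; both grow with \<open>\<bar>u\<bar>\<close>, so one bound
  at \<open>t\<close> serves the whole range of the differential equation.\<close>

theorem (in poisson_vector) chaos_cos_sin_bound:
  assumes f: "sym_kernel f" and q: "q \<ge> 1"
    and F: "F = chaos I lam q f"
    and s: "s = E (\<lambda>x. (F x)\<^sup>2)" and K: "K = E (\<lambda>x. F x ^ 4)"
    and \<alpha>: "\<alpha> > 0" "K - 3 * s\<^sup>2 \<le> \<alpha>\<^sup>2"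
  shows "\<bar>E (\<lambda>x. cos (t * F x)) - exp (- s * t\<^sup>2 / 2)\<bar> \<le> (\<bar>t\<bar> * \<alpha> + 4 * \<bar>t\<bar> ^ 3 * \<alpha>\<^sup>2) * \<bar>t\<bar>"
    and "\<bar>E (\<lambda>x. sin (t * F x))\<bar> \<le> (\<bar>t\<bar> * \<alpha> + 4 * \<bar>t\<bar> ^ 3 * \<alpha>\<^sup>2) * \<bar>t\<bar>"
proof -
  have tF: "tempered I F" unfolding F by (rule tempered_chaos[OF finite_I])
  note d = measure_pmf.expectation_cos_sin_deriv[of F p, OF _ integrable_tempered[OF tF]
      integrable_tempered[OF tempered_power[OF tF]], simplified]
  have s0: "s \<ge> 0" unfolding s by simp
  have mono: "\<bar>u\<bar> * \<alpha> + 4 * \<bar>u\<bar> ^ 3 * \<alpha>\<^sup>2 \<le> \<bar>t\<bar> * \<alpha> + 4 * \<bar>t\<bar> ^ 3 * \<alpha>\<^sup>2" if "\<bar>u\<bar> \<le> \<bar>t\<bar>" for u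
    using that \<alpha> by (intro add_mono mult_right_mono mult_left_mono power_mono) auto
  have b1: "\<bar>- E (\<lambda>x. F x * sin (u * F x)) + s * u * E (\<lambda>x. cos (u * F x))\<bar> \<le> \<bar>t\<bar> * \<alpha> + 4 * \<bar>t\<bar> ^ 3 * \<alpha>\<^sup>2"
    if "\<bar>u\<bar> \<le> \<bar>t\<bar>" for u
  proof -
    have "\<bar>E (\<lambda>x. F x * sin (u * F x)) - s * E (\<lambda>x. u * cos (u * F x))\<bar> \<le> \<bar>u\<bar> * \<alpha> + 4 * \<bar>u\<bar> ^ 3 * \<alpha>\<^sup>2"
      by (rule fourth_moment_bound[where g = "\<lambda>y. sin (u * y)" and g' = "\<lambda>y. u * cos (u * y)", OF f q F s K \<alpha>])
        (simp_all add: abs_mult mult_left_le sin_trapezoid[simplified])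
    then show ?thesis using mono[OF that]
      by (simp add: mult.assoc abs_minus_commute[of "E (\<lambda>x. F x * sin (u * F x))"])
  qed
  have b2: "\<bar>E (\<lambda>x. F x * cos (u * F x)) + s * u * E (\<lambda>x. sin (u * F x))\<bar> \<le> \<bar>t\<bar> * \<alpha> + 4 * \<bar>t\<bar> ^ 3 * \<alpha>\<^sup>2"
    if "\<bar>u\<bar> \<le> \<bar>t\<bar>" for u
  proof -
    have "\<bar>E (\<lambda>x. F x * cos (u * F x)) - s * E (\<lambda>x. - u * sin (u * F x))\<bar> \<le> \<bar>u\<bar> * \<alpha> + 4 * \<bar>u\<bar> ^ 3 * \<alpha>\<^sup>2"
      by (rule fourth_moment_bound[where g = "\<lambda>y. cos (u * y)" and g' = "\<lambda>y. - u * sin (u * y)", OF f q F s K \<alpha>])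
        (use cos_trapezoid in \<open>simp_all add: abs_mult mult_left_le\<close>)
    then show ?thesis using mono[OF that] by (simp add: mult.assoc)
  qed
  show "\<bar>E (\<lambda>x. cos (t * F x)) - exp (- s * t\<^sup>2 / 2)\<bar> \<le> (\<bar>t\<bar> * \<alpha> + 4 * \<bar>t\<bar> ^ 3 * \<alpha>\<^sup>2) * \<bar>t\<bar>"
    using gaussian_ode_bound[OF d(1) s0 b1] by simp
  show "\<bar>E (\<lambda>x. sin (t * F x))\<bar> \<le> (\<bar>t\<bar> * \<alpha> + 4 * \<bar>t\<bar> ^ 3 * \<alpha>\<^sup>2) * \<bar>t\<bar>"
    using gaussian_ode_bound[OF d(2) s0 b2] by simp
qed

section \<open>Counts of disjoint cells\<close>

text \<open>Cells are nonempty so that a cell of a finer family lies in at most one cell of a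
  coarser one. They need not cover the space.\<close>

definition cells :: "'z measure \<Rightarrow> 'z set set \<Rightarrow> bool" where
  "cells \<mu> \<A> \<longleftrightarrow> finite \<A> \<and> \<A> \<subseteq> sets \<mu> \<and> disjoint \<A> \<and> {} \<notin> \<A> \<and> (\<forall>A\<in>\<A>. emeasure \<mu> A < \<infinity>)"

context poisson_random_measure
begin

text \<open>Infinite masses are sent to 0; for sets of finite mean this concerns only a null
  event.\<close>

definition count :: "'w \<Rightarrow> 'z set \<Rightarrow> nat" where
  "count \<omega> B = nat \<lfloor>enn2real (emeasure (\<eta> \<omega>) B)\<rfloor>"

definition counts :: "'z set set \<Rightarrow> 'w \<Rightarrow> 'z set \<Rightarrow> nat" where
  "counts \<A> \<omega> B = (if B \<in> \<A> then count \<omega> B else 0)"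

definition counts_pmf :: "'z set set \<Rightarrow> ('z set \<Rightarrow> nat) pmf" where
  "counts_pmf \<A> = Abs_pmf (distr M (count_space UNIV) (counts \<A>))"

lemma count_measurable [measurable]:
  assumes "B \<in> sets \<mu>"
  shows "(\<lambda>\<omega>. count \<omega> B) \<in> measurable M (count_space UNIV)"
proof -
  have [measurable]: "(\<lambda>\<omega>. emeasure (\<eta> \<omega>) B) \<in> borel_measurable M"
    using eta_poisson[OF assms] by (simp add: has_poisson_law_def)
  show ?thesis unfolding count_def by measurable
qed

lemma count_of_nat: "emeasure (\<eta> \<omega>) B = of_nat k \<Longrightarrow> count \<omega> B = k"
  by (simp add: count_def)

text \<open>The Poisson weights add up to 1, so no probability is left for values outside the
  natural numbers.\<close>

lemma emeasure_eta_eq_count: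
  assumes "B \<in> sets \<mu>" "emeasure \<mu> B < \<infinity>"
  shows "AE \<omega> in M. emeasure (\<eta> \<omega>) B = of_nat (count \<omega> B)"
proof -
  let ?m = "enn2real (emeasure \<mu> B)"
  have law: "has_poisson_law M (\<lambda>\<omega>. emeasure (\<eta> \<omega>) B) (emeasure \<mu> B)"
    by (rule eta_poisson[OF assms(1)])
  then have [measurable]: "(\<lambda>\<omega>. emeasure (\<eta> \<omega>) B) \<in> borel_measurable M"
    by (simp add: has_poisson_law_def)
  let ?S = "\<lambda>k. {\<omega> \<in> space M. emeasure (\<eta> \<omega>) B = of_nat k}"
  have S: "prob (?S k) = ?m ^ k / fact k * exp (- ?m)" for k
    using law assms(2) by (simp add: has_poisson_law_def less_top)
  have "(\<lambda>k. prob (?S k)) sums prob (\<Union>k. ?S k)"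
    by (rule finite_measure_UNION) (auto simp: disjoint_family_on_def)
  moreover have "(\<lambda>k. prob (?S k)) sums 1"
  proof -
    have "(\<lambda>k. ?m ^ k / fact k * exp (- ?m)) sums (exp ?m * exp (- ?m))"
      using exp_converges[of ?m] by (intro sums_mult2) (simp add: divide_inverse mult.commute)
    then show ?thesis by (simp add: S exp_minus_inverse)
  qed
  ultimately have "prob (\<Union>k. ?S k) = 1" by (rule sums_unique2)
  moreover have "(\<Union>k. ?S k) \<in> events" by auto
  ultimately have "AE \<omega> in M. \<omega> \<in> (\<Union>k. ?S k)" by (simp add: prob_eq_1)
  then show ?thesis by (auto simp: count_of_nat)
qed

lemma prob_count_eq:
  assumes "B \<in> sets \<mu>" "emeasure \<mu> B < \<infinity>"
  shows "prob {\<omega> \<in> space M. emeasure (\<eta> \<omega>) B = of_nat k}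
    = measure \<mu> B ^ k / fact k * exp (- measure \<mu> B)"
  using eta_poisson[OF assms(1)] assms(2) by (simp add: has_poisson_law_def less_top measure_def[of \<mu>])

context
  fixes \<A> assumes \<A>: "cells \<mu> \<A>"
begin

lemma cells_finite: "finite \<A>"
  using \<A> by (simp add: cells_def)

lemma counts_supported: "counts \<A> \<omega> \<in> supported \<A>"
  by (simp add: counts_def supported_def)

text \<open>Vectors of counts live in a function type carrying the discrete \<sigma>-algebra. Since
  they take only countably many values, all preimages are measurable and the law is a
  \<open>pmf\<close>.\<close>

lemma countable_supported: "countable (supported \<A> :: ('z set \<Rightarrow> nat) set)"
proof -
  have "countable (\<A> \<rightarrow>\<^sub>E (UNIV :: nat set))"
    by (rule countable_PiE[OF cells_finite]) simp
  moreover have "inj_on (\<lambda>x. restrict x \<A>) (supported \<A> :: ('z set \<Rightarrow> nat) set)"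
  proof (rule inj_onI)
    fix x y :: "'z set \<Rightarrow> nat"
    assume *: "x \<in> supported \<A>" "y \<in> supported \<A>" "restrict x \<A> = restrict y \<A>"
    show "x = y"
    proof
      fix B show "x B = y B"
        using *(1,2) fun_cong[OF *(3), of B] unfolding restrict_def supported_def
        by (cases "B \<in> \<A>") auto
    qed
  qed
  moreover have "(\<lambda>x. restrict x \<A>) ` supported \<A> \<subseteq> \<A> \<rightarrow>\<^sub>E (UNIV :: nat set)" by auto
  ultimately show ?thesis using countable_subset countable_image_inj_on by blast
qed

lemma counts_measurable [measurable]: "counts \<A> \<in> measurable M (count_space UNIV)"
proof (rule measurableI)
  have 1: "counts \<A> -` {x} \<inter> space M \<in> events" if "x \<in> supported \<A>" for x
  proof -
    have [measurable]: "(\<lambda>\<omega>. count \<omega> B) \<in> measurable M (count_space UNIV)" if "B \<in> \<A>" for B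
      using that \<A> by (intro count_measurable) (auto simp: cells_def)
    have "counts \<A> -` {x} \<inter> space M = {\<omega> \<in> space M. \<forall>B\<in>\<A>. count \<omega> B = x B}"
      using that by (auto simp: counts_def fun_eq_iff supported_def)
    also have "\<dots> \<in> events" using cells_finite by measurable
    finally show ?thesis .
  qed
  fix X :: "('z set \<Rightarrow> nat) set"
  have "counts \<A> -` X \<inter> space M = (\<Union>x\<in>X \<inter> supported \<A>. counts \<A> -` {x} \<inter> space M)"
    using counts_supported by auto
  also have "\<dots> \<in> events"
    using countable_supported 1 by (intro sets.countable_UN') (auto intro: countable_subset)
  finally show "counts \<A> -` X \<inter> space M \<in> events" .
qed simp

lemma counts_pmf: "measure_pmf (counts_pmf \<A>) = distr M (count_space UNIV) (counts \<A>)"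
proof -
  interpret D: prob_space "distr M (count_space UNIV) (counts \<A>)"
    by (rule prob_space_distr) simp
  have "AE x in distr M (count_space UNIV) (counts \<A>). x \<in> supported \<A>"
    by (simp add: AE_distr_iff counts_supported)
  then have "AE x in distr M (count_space UNIV) (counts \<A>). measure (distr M (count_space UNIV) (counts \<A>)) {x} \<noteq> 0"
    using countable_supported by (subst D.AE_support_countable) auto
  then show ?thesis
    unfolding counts_pmf_def by (intro Abs_pmf_inverse) (simp add: D.prob_space_axioms)
qed

lemma expectation_counts:
  fixes u :: "('z set \<Rightarrow> nat) \<Rightarrow> real"
  shows "measure_pmf.expectation (counts_pmf \<A>) u = expectation (\<lambda>\<omega>. u (counts \<A> \<omega>))"
  unfolding counts_pmf by (rule integral_distr) simp_all

lemma integrable_counts: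
  fixes u :: "('z set \<Rightarrow> nat) \<Rightarrow> real"
  shows "integrable (counts_pmf \<A>) u \<longleftrightarrow> integrable M (\<lambda>\<omega>. u (counts \<A> \<omega>))"
  unfolding counts_pmf by (rule integrable_distr_eq) simp_all

lemma pmf_counts: "pmf (counts_pmf \<A>) x = prob {\<omega> \<in> space M. counts \<A> \<omega> = x}"
proof -
  have "pmf (counts_pmf \<A>) x = measure (distr M (count_space UNIV) (counts \<A>)) {x}"
    by (simp add: pmf.rep_eq counts_pmf)
  also have "\<dots> = prob (counts \<A> -` {x} \<inter> space M)"
    by (rule measure_distr) simp_all
  also have "counts \<A> -` {x} \<inter> space M = {\<omega> \<in> space M. counts \<A> \<omega> = x}" by auto
  finally show ?thesis .
qed

lemma pmf_counts_prod:
  assumes "x \<in> supported \<A>"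
  shows "pmf (counts_pmf \<A>) x = (\<Prod>A\<in>\<A>. measure \<mu> A ^ x A / fact (x A) * exp (- measure \<mu> A))"
proof -
  obtain e where e: "bij_betw e {..<card \<A>} \<A>"
    using ex_bij_betw_nat_finite[OF cells_finite] by (auto simp: atLeast0LessThan)
  let ?m = "card \<A>" and ?Y = "\<lambda>i \<omega>. emeasure (\<eta> \<omega>) (e i)"
  have e\<A>: "e i \<in> \<A>" if "i < ?m" for i using e that by (auto simp: bij_betw_def)
  have fin: "e i \<in> sets \<mu>" "emeasure \<mu> (e i) < \<infinity>" if "i < ?m" for i
    using e\<A>[OF that] \<A> by (auto simp: cells_def)
  have disj: "disjoint_family_on e {..<?m}"
    unfolding disjoint_family_on_def
  proof (intro ballI impI)
    fix i j assume ij: "i \<in> {..<?m}" "j \<in> {..<?m}" "i \<noteq> j"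
    then have "e i \<noteq> e j" using e by (auto simp: bij_betw_def inj_on_def)
    then show "e i \<inter> e j = {}" using \<A> e\<A> ij by (auto simp: cells_def disjoint_def)
  qed
  have ind: "indep_vars (\<lambda>_. borel) ?Y {..<?m}"
    by (rule eta_indep[OF _ disj]) (use fin in auto)
  have meas: "?Y i \<in> borel_measurable M" if "i < ?m" for i
    using eta_poisson[OF fin(1)[OF that]] by (simp add: has_poisson_law_def)
  have all: "AE \<omega> in M. \<forall>i\<in>{..<?m}. ?Y i \<omega> = of_nat (count \<omega> (e i))"
    by (rule AE_finite_allI) (use fin in \<open>auto intro: emeasure_eta_eq_count\<close>)
  have "prob {\<omega> \<in> space M. counts \<A> \<omega> = x} = prob {\<omega> \<in> space M. \<forall>i\<in>{..<?m}. ?Y i \<omega> = of_nat (x (e i))}"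
  proof (rule finite_measure_eq_AE)
    show "AE \<omega> in M. \<omega> \<in> {\<omega> \<in> space M. counts \<A> \<omega> = x} \<longleftrightarrow> \<omega> \<in> {\<omega> \<in> space M. \<forall>i\<in>{..<?m}. ?Y i \<omega> = of_nat (x (e i))}"
      using all AE_space
    proof eventually_elim
      case (elim \<omega>)
      have "counts \<A> \<omega> = x \<longleftrightarrow> (\<forall>B\<in>\<A>. count \<omega> B = x B)"
        using assms by (auto simp: counts_def fun_eq_iff supported_def)
      also have "\<dots> \<longleftrightarrow> (\<forall>B\<in>e ` {..<?m}. count \<omega> B = x B)"
        by (simp only: bij_betw_imp_surj_on[OF e])
      also have "\<dots> \<longleftrightarrow> (\<forall>i\<in>{..<?m}. count \<omega> (e i) = x (e i))" by blast
      finally show ?case using elim by auto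
    qed
    show "{\<omega> \<in> space M. counts \<A> \<omega> = x} \<in> events"
      using measurable_sets[OF counts_measurable, of "{x}"] by (simp add: vimage_def Int_def conj_commute)
    show "{\<omega> \<in> space M. \<forall>i\<in>{..<?m}. ?Y i \<omega> = of_nat (x (e i))} \<in> events"
      by (rule sets.sets_Collect_finite_All) (use meas in auto)
  qed
  also have "\<dots> = (\<Prod>i<?m. prob {\<omega> \<in> space M. ?Y i \<omega> = of_nat (x (e i))})"
  \<comment> \<open>\<open>indep_varsD\<close> speaks of nonempty index sets; without cells both
    sides are 1.\<close>
  proof (cases "?m = 0")
    case True
    then show ?thesis by (simp add: prob_space)
  next
    case False
    have "prob (\<Inter>i\<in>{..<?m}. ?Y i -` {of_nat (x (e i))} \<inter> space M)
        = (\<Prod>i\<in>{..<?m}. prob (?Y i -` {of_nat (x (e i))} \<inter> space M))"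
      by (rule indep_varsD[OF ind]) (use False in auto)
    moreover have "(\<Inter>i\<in>{..<?m}. ?Y i -` {of_nat (x (e i))} \<inter> space M)
        = {\<omega> \<in> space M. \<forall>i\<in>{..<?m}. ?Y i \<omega> = of_nat (x (e i))}" using False by auto
    moreover have "?Y i -` {of_nat (x (e i))} \<inter> space M = {\<omega> \<in> space M. ?Y i \<omega> = of_nat (x (e i))}" for i
      by auto
    ultimately show ?thesis by simp
  qed
  also have "\<dots> = (\<Prod>i<?m. measure \<mu> (e i) ^ x (e i) / fact (x (e i)) * exp (- measure \<mu> (e i)))"
    by (intro prod.cong refl prob_count_eq) (use fin in auto)
  also have "\<dots> = (\<Prod>A\<in>\<A>. measure \<mu> A ^ x A / fact (x A) * exp (- measure \<mu> A))"
    by (rule prod.reindex_bij_betw[OF e])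
  finally show ?thesis by (simp add: pmf_counts)
qed

text \<open>For product weights detailed balance is the ratio of two consecutive Poisson weights;
  off the supported states both sides vanish.\<close>

lemma poisson_vector_counts: "poisson_vector (counts_pmf \<A>) \<A> (measure \<mu>)"
proof
  show "finite \<A>" by (rule cells_finite)
  show "0 \<le> measure \<mu> A" for A by simp
  show supp: "set_pmf (counts_pmf \<A>) \<subseteq> supported \<A>"
  proof
    fix x assume "x \<in> set_pmf (counts_pmf \<A>)"
    then have "prob {\<omega> \<in> space M. counts \<A> \<omega> = x} \<noteq> 0" by (simp add: set_pmf_iff pmf_counts)
    then obtain \<omega> where "counts \<A> \<omega> = x" by (metis (mono_tags, lifting) Collect_empty_eq measure_empty)
    then show "x \<in> supported \<A>" using counts_supported by blast
  qed
  fix A x assume A: "A \<in> \<A>"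
  show "pmf (counts_pmf \<A>) (raise A x) * real (Suc (x A)) = measure \<mu> A * pmf (counts_pmf \<A>) x"
  proof (cases "x \<in> supported \<A>")
    case True
    have "(\<Prod>B\<in>\<A> - {A}. measure \<mu> B ^ raise A x B / fact (raise A x B) * exp (- measure \<mu> B))
        = (\<Prod>B\<in>\<A> - {A}. measure \<mu> B ^ x B / fact (x B) * exp (- measure \<mu> B))"
      by (rule prod.cong) (auto simp: raise_apply)
    then show ?thesis
      using A True supported_raise[OF True A]
      by (simp add: pmf_counts_prod prod.remove[OF cells_finite A] raise_apply field_simps del: of_nat_Suc)
  next
    case False
    then have "raise A x \<notin> supported \<A>" using A by (auto simp: supported_def raise_apply)
    then show ?thesis using False supp by (metis mult_zero_left mult_zero_right pmf_eq_0_set_pmf subsetD)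
  qed
qed

end

end

section \<open>Factorial measures\<close>

lemma cells_disjoint: "cells \<mu> \<A> \<Longrightarrow> A \<in> \<A> \<Longrightarrow> B \<in> \<A> \<Longrightarrow> A \<noteq> B \<Longrightarrow> A \<inter> B = {}"
  unfolding cells_def using disjointD by blast

lemma charlier_cong: "(\<And>A. A \<in> set z \<Longrightarrow> x A = y A) \<Longrightarrow> charlier lam z x = charlier lam z y"
proof (induction z arbitrary: x y)
  case (Cons i z)
  have "charlier lam z (lower i x) = charlier lam z (lower i y)" "charlier lam z x = charlier lam z y"
    using Cons.prems by (auto intro!: Cons.IH simp: lower_apply)
  then show ?case using Cons.prems by (simp add: create_def)
qed simp

text \<open>A letter appended at the end contributes the number of points of \<open>i\<close> not
  yet used, as when a tuple with distinct indices is chosen entry by entry.\<close>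

lemma charlier_zero_snoc:
  "charlier (\<lambda>_. 0) (z @ [i]) x = charlier (\<lambda>_. 0) z x * (real (x i) - real (count_list z i))"
proof (induction z arbitrary: x)
  case (Cons j z)
  show ?case
  proof (cases "x j = 0")
    case False
    have "real (lower j x i) - real (count_list z i) = real (x i) - real (count_list (j # z) i)"
      using False by (auto simp: lower_apply of_nat_diff)
    then show ?thesis using Cons.IH[of "lower j x"] by (simp add: create_def)
  qed (simp add: create_def)
qed (simp add: create_def)

text \<open>Injective tuples are extended by one index at a time. Since the index sets of different
  cells are disjoint, the indices of \<open>E A\<close> already taken are exactly those at positions
  labelled \<open>A\<close>; this matches \<open>charlier_zero_snoc\<close>.\<close>

lemma card_injections_charlier:
  fixes E :: "'a \<Rightarrow> nat set"
  assumes fin: "\<And>A. A \<in> set z \<Longrightarrow> finite (E A)" and sub: "\<And>A. A \<in> set z \<Longrightarrow> E A \<subseteq> I"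
    and disj: "\<And>A B. A \<in> set z \<Longrightarrow> B \<in> set z \<Longrightarrow> A \<noteq> B \<Longrightarrow> E A \<inter> E B = {}"
  defines "S \<equiv> \<lambda>z. {i \<in> {..<length z} \<rightarrow>\<^sub>E I. inj_on i {..<length z} \<and> (\<forall>j<length z. i j \<in> E (z ! j))}"
  shows "finite (S z) \<and> real (card (S z)) = charlier (\<lambda>_. 0) z (\<lambda>A. card (E A))"
  using fin sub disj
proof (induction z rule: rev_induct)
  case Nil
  have "S [] = {\<lambda>_. undefined}" by (auto simp: S_def)
  then show ?case by simp
next
  case (snoc A z)
  let ?k = "length z"
  have IH: "finite (S z)" "real (card (S z)) = charlier (\<lambda>_. 0) z (\<lambda>A. card (E A))"
    using snoc.IH snoc.prems by auto
  define R where "R i = i ` {j. j < ?k \<and> z ! j = A}" for i :: "nat \<Rightarrow> nat"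
  have finA: "finite (E A)" using snoc.prems by simp
  have R: "R i \<subseteq> E A" "card (R i) = count_list z A" if "i \<in> S z" for i
  proof -
    show "R i \<subseteq> E A" using that by (auto simp: S_def R_def)
    have "card (R i) = card {j. j < ?k \<and> z ! j = A}"
      unfolding R_def using that by (intro card_image) (auto simp: S_def inj_on_def)
    also have "\<dots> = length (filter (\<lambda>B. B = A) z)" by (simp add: length_filter_conv_card)
    also have "\<dots> = count_list z A" by (induction z) auto
    finally show "card (R i) = count_list z A" .
  qed
  have S: "S (z @ [A]) = (\<lambda>(i, e). i(?k := e)) ` (SIGMA i:S z. E A - R i)"
  proof (intro set_eqI iffI)
    fix i assume i: "i \<in> S (z @ [A])"
    have lt: "{..<length (z @ [A])} = insert ?k {..<?k}" by auto
    have i1: "i \<in> {..<length (z @ [A])} \<rightarrow>\<^sub>E I" "inj_on i {..<length (z @ [A])}"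
      "\<And>j. j < length (z @ [A]) \<Longrightarrow> i j \<in> E ((z @ [A]) ! j)"
      using i by (auto simp: S_def)
    define i' where "i' = i(?k := undefined)"
    have "i j \<in> E (z ! j)" if "j < ?k" for j using i1(3)[of j] that by (simp add: nth_append)
    then have "i' \<in> S z"
      using i1(1,2) unfolding S_def i'_def lt by (auto simp: inj_on_def PiE_iff extensional_def)
    moreover have "i ?k \<in> E A" using i1(3)[of ?k] by simp
    moreover have "i ?k \<notin> R i'"
    proof
      assume "i ?k \<in> R i'"
      then obtain j where j: "j < ?k" "i ?k = i j" by (auto simp: R_def i'_def split: if_splits)
      then show False using inj_onD[OF i1(2) j(2)] by simp
    qed
    moreover have "i = i'(?k := i ?k)" by (simp add: i'_def)
    ultimately show "i \<in> (\<lambda>(i, e). i(?k := e)) ` (SIGMA i:S z. E A - R i)"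
      by (auto intro!: image_eqI[where x = "(i', i ?k)"])
  next
    fix i assume "i \<in> (\<lambda>(i, e). i(?k := e)) ` (SIGMA i:S z. E A - R i)"
    then obtain i' e where i: "i = i'(?k := e)" "i' \<in> S z" "e \<in> E A" "e \<notin> R i'" by auto
    have i': "i' \<in> {..<?k} \<rightarrow>\<^sub>E I" "inj_on i' {..<?k}" "\<And>j. j < ?k \<Longrightarrow> i' j \<in> E (z ! j)"
      using i(2) by (auto simp: S_def)
    have ne: "e \<noteq> i' j" if j: "j < ?k" for j
    proof (cases "z ! j = A")
      case True
      then show ?thesis using i(4) j by (auto simp: R_def)
    next
      case False
      then have "E (z ! j) \<inter> E A = {}" using snoc.prems(3)[of "z ! j" A] j by simp
      then show ?thesis using i'(3)[OF j] i(3) by auto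
    qed
    have lt: "{..<length (z @ [A])} = insert ?k {..<?k}" by auto
    have "i \<in> {..<length (z @ [A])} \<rightarrow>\<^sub>E I"
      unfolding lt i(1) using i'(1) i(3) snoc.prems(2)[of A] by (auto simp: PiE_iff extensional_def)
    moreover have "inj_on i {..<length (z @ [A])}"
      unfolding lt i(1) using i'(2) ne by (fastforce simp: inj_on_def)
    moreover have "i j \<in> E ((z @ [A]) ! j)" if "j < length (z @ [A])" for j
      using that i(1,3) i'(3)[of j] by (cases "j = ?k") (auto simp: nth_append)
    ultimately show "i \<in> S (z @ [A])" by (simp add: S_def)
  qed
  have inj: "inj_on (\<lambda>(i, e). i(?k := e)) (SIGMA i:S z. E A - R i)"
  proof (rule inj_onI, clarify)
    fix i e i' e' assume *: "i \<in> S z" "i' \<in> S z" "i(?k := e) = i'(?k := e')"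
    have "i j = i' j" for j
    proof (cases "j = ?k")
      case True
      then show ?thesis using *(1,2) by (simp add: S_def PiE_iff extensional_def)
    next
      case False
      then show ?thesis using fun_cong[OF *(3), of j] by simp
    qed
    then show "i = i' \<and> e = e'" using fun_cong[OF *(3), of ?k] by (simp add: fun_eq_iff)
  qed
  have "card (S (z @ [A])) = card (SIGMA i:S z. E A - R i)"
    unfolding S by (rule card_image[OF inj])
  also have "\<dots> = (\<Sum>i\<in>S z. card (E A - R i))"
    using IH(1) finA by (intro card_SigmaI) auto
  also have "real \<dots> = (\<Sum>i\<in>S z. real (card (E A)) - real (count_list z A))"
    unfolding of_nat_sum
  proof (intro sum.cong refl)
    fix i assume "i \<in> S z"
    from R[OF this] show "real (card (E A - R i)) = real (card (E A)) - real (count_list z A)"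
      using finA by (metis card_Diff_subset card_mono finite_subset of_nat_diff)
  qed
  also have "\<dots> = charlier (\<lambda>_. 0) (z @ [A]) (\<lambda>A. card (E A))"
    by (simp add: charlier_zero_snoc IH(2))
  finally have "real (card (S (z @ [A]))) = charlier (\<lambda>_. 0) (z @ [A]) (\<lambda>A. card (E A))" .
  moreover have "finite (S (z @ [A]))"
    unfolding S using IH(1) finA by (intro finite_imageI finite_SigmaI finite_Diff)
  ultimately show ?case by blast
qed

section \<open>One realization of the point process and its index tuples\<close>

locale enumerated_measure = control: sigma_finite_measure \<mu> for \<mu> :: "'z measure" +
  fixes \<xi> :: "'z measure"
  assumes sets_xi: "sets \<xi> = sets \<mu>" and enumeration: "\<exists>I x. atom_enumeration \<xi> I x"
begin

text \<open>The same choice as in \<open>factorial_measure\<close>, so that both refer to one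
  enumeration.\<close>

definition idx :: "nat set" where "idx = fst (SOME (I, x). atom_enumeration \<xi> I x)"
definition pt :: "nat \<Rightarrow> 'z" where "pt = snd (SOME (I, x). atom_enumeration \<xi> I x)"

definition tuples :: "nat \<Rightarrow> (nat \<Rightarrow> nat) set" where
  "tuples k = {i \<in> {..<k} \<rightarrow>\<^sub>E idx. inj_on i {..<k}}"

text \<open>The product of the factorial measure of order \<open>k\<close> with \<open>\<mu>\<^sup>q\<^sup>-\<^sup>k\<close>; it is built on the
  tuples of indices, since the factorial measure itself need not be \<open>\<sigma>\<close>-finite.\<close>

definition mixed :: "nat \<Rightarrow> nat \<Rightarrow> (nat \<Rightarrow> 'z) measure" where
  "mixed k q = distr (PiM {k..<q} (\<lambda>_. \<mu>) \<Otimes>\<^sub>M count_space (tuples k)) (power_measure \<mu> q)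
     (\<lambda>p. merge {..<k} {k..<q} (\<lambda>j\<in>{..<k}. pt (snd p j), fst p))"

lemma enumeration_idx: "atom_enumeration \<xi> idx pt"
proof -
  obtain I x where "atom_enumeration \<xi> I x" using enumeration by blast
  then have "case (SOME (I, x). atom_enumeration \<xi> I x) of (I, x) \<Rightarrow> atom_enumeration \<xi> I x"
    by (intro someI[of "\<lambda>(I, x). atom_enumeration \<xi> I x" "(I, x)"]) simp
  then show ?thesis by (simp add: idx_def pt_def case_prod_beta)
qed

lemma space_xi: "space \<xi> = space \<mu>"
  by (rule sets_eq_imp_space_eq[OF sets_xi])

lemma pt_space: "i \<in> idx \<Longrightarrow> pt i \<in> space \<mu>"
  using enumeration_idx by (auto simp: atom_enumeration_def space_xi)

lemma emeasure_xi:
  assumes "A \<in> sets \<mu>"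
  shows "emeasure \<xi> A = emeasure (count_space idx) {i \<in> idx. pt i \<in> A}"
proof -
  have "emeasure \<xi> A = emeasure (distr (count_space idx) \<xi> pt) A"
    using enumeration_idx by (simp add: atom_enumeration_def)
  also have "\<dots> = emeasure (count_space idx) (pt -` A \<inter> space (count_space idx))"
    using assms enumeration_idx by (intro emeasure_distr) (auto simp: sets_xi atom_enumeration_def)
  also have "pt -` A \<inter> space (count_space idx) = {i \<in> idx. pt i \<in> A}" by auto
  finally show ?thesis .
qed

lemma countable_tuples: "countable (tuples k)"
proof (rule countable_subset)
  show "tuples k \<subseteq> {..<k} \<rightarrow>\<^sub>E idx" by (auto simp: tuples_def)
  show "countable ({..<k} \<rightarrow>\<^sub>E idx)" by (rule countable_PiE) auto
qed

lemma tuples_space: "i \<in> tuples k \<Longrightarrow> (\<lambda>j\<in>{..<k}. pt (i j)) \<in> space (PiM {..<k} (\<lambda>_. \<mu>))"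
  by (auto simp: space_PiM tuples_def intro!: pt_space)

lemma factorial_measure_eq:
  "factorial_measure \<xi> k = distr (count_space (tuples k)) (PiM {..<k} (\<lambda>_. \<mu>)) (\<lambda>i. \<lambda>j\<in>{..<k}. pt (i j))"
proof -
  have "sets (PiM {..<k} (\<lambda>_. \<xi>)) = sets (PiM {..<k} (\<lambda>_. \<mu>))"
    by (rule sets_PiM_cong) (simp_all add: sets_xi)
  then show ?thesis
    unfolding factorial_measure_def tuples_def idx_def pt_def Let_def case_prod_beta
    by (intro distr_cong) auto
qed

lemma embed_measurable:
  assumes "k \<le> q"
  shows "(\<lambda>p. merge {..<k} {k..<q} (\<lambda>j\<in>{..<k}. pt (snd p j), fst p))
    \<in> measurable (PiM {k..<q} (\<lambda>_. \<mu>) \<Otimes>\<^sub>M count_space (tuples k)) (power_measure \<mu> q)"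
proof -
  have [measurable]: "(\<lambda>i. \<lambda>j\<in>{..<k}. pt (i j)) \<in> measurable (count_space (tuples k)) (PiM {..<k} (\<lambda>_. \<mu>))"
    using tuples_space by auto
  have "{..<k} \<union> {k..<q} = {..<q}" using assms by auto
  then have [measurable]: "merge {..<k} {k..<q} \<in> measurable (PiM {..<k} (\<lambda>_. \<mu>) \<Otimes>\<^sub>M PiM {k..<q} (\<lambda>_. \<mu>)) (power_measure \<mu> q)"
    using measurable_merge[of "{..<k}" "{k..<q}" "\<lambda>_. \<mu>"] by simp
  show ?thesis by measurable
qed

lemma sets_mixed [simp]: "sets (mixed k q) = sets (power_measure \<mu> q)"
  by (simp add: mixed_def)

lemma measurable_mixed [simp]: "measurable (mixed k q) = measurable (power_measure \<mu> q)"
  by (intro ext measurable_cong_sets) simp_all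

text \<open>Fubini is applied to index tuples, which are countable and therefore \<sigma>-finite
  under counting, before anything is pushed forward to points.\<close>

lemma integral_mixed:
  fixes f :: "(nat \<Rightarrow> 'z) \<Rightarrow> real"
  assumes k: "k \<le> q" and f: "integrable (mixed k q) f"
  shows "(\<integral>y. (\<integral>x. f (merge {..<k} {k..<q} (x, y)) \<partial>factorial_measure \<xi> k) \<partial>PiM {k..<q} (\<lambda>_. \<mu>))
    = (\<integral>x. f x \<partial>mixed k q)"
proof -
  interpret P: product_sigma_finite "\<lambda>_ :: nat. \<mu>"
    by (rule product_sigma_finite.intro) (rule control.sigma_finite_measure_axioms)
  interpret S: sigma_finite_measure "PiM {k..<q} (\<lambda>_. \<mu>)" by (rule P.sigma_finite) simp
  interpret T: sigma_finite_measure "count_space (tuples k)"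
    by (rule sigma_finite_measure_count_space_countable[OF countable_tuples])
  interpret ST: pair_sigma_finite "PiM {k..<q} (\<lambda>_. \<mu>)" "count_space (tuples k)" ..
  have fm [measurable]: "f \<in> borel_measurable (power_measure \<mu> q)" using borel_measurable_integrable[OF f] by simp
  let ?e = "\<lambda>p. merge {..<k} {k..<q} (\<lambda>j\<in>{..<k}. pt (snd p j), fst p)"
  have "integrable (PiM {k..<q} (\<lambda>_. \<mu>) \<Otimes>\<^sub>M count_space (tuples k)) (\<lambda>p. f (?e p))"
    using f embed_measurable[OF k] unfolding mixed_def by (subst (asm) integrable_distr_eq) auto
  from ST.integral_fst'[OF this]
  have "(\<integral>y. (\<integral>i. f (?e (y, i)) \<partial>count_space (tuples k)) \<partial>PiM {k..<q} (\<lambda>_. \<mu>)) = (\<integral>x. f x \<partial>mixed k q)"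
    unfolding mixed_def using embed_measurable[OF k] by (simp add: integral_distr)
  moreover have "(\<integral>x. f (merge {..<k} {k..<q} (x, y)) \<partial>factorial_measure \<xi> k)
      = (\<integral>i. f (?e (y, i)) \<partial>count_space (tuples k))" if y: "y \<in> space (PiM {k..<q} (\<lambda>_. \<mu>))" for y
  proof -
    have [measurable]: "(\<lambda>i. \<lambda>j\<in>{..<k}. pt (i j)) \<in> measurable (count_space (tuples k)) (PiM {..<k} (\<lambda>_. \<mu>))"
      using tuples_space by auto
    have "{..<k} \<union> {k..<q} = {..<q}" using k by auto
    then have [measurable]: "merge {..<k} {k..<q} \<in> measurable (PiM {..<k} (\<lambda>_. \<mu>) \<Otimes>\<^sub>M PiM {k..<q} (\<lambda>_. \<mu>)) (power_measure \<mu> q)"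
      using measurable_merge[of "{..<k}" "{k..<q}" "\<lambda>_. \<mu>"] by simp
    have "(\<lambda>x. f (merge {..<k} {k..<q} (x, y))) \<in> borel_measurable (PiM {..<k} (\<lambda>_. \<mu>))"
      using y by measurable
    then show ?thesis unfolding factorial_measure_eq by (subst integral_distr) (auto intro: tuples_space)
  qed
  ultimately show ?thesis by (simp cong: Bochner_Integration.integral_cong)
qed

lemma emeasure_mixed_box:
  assumes k: "k \<le> q" and B: "\<And>j. B j \<in> sets \<mu>"
  shows "emeasure (mixed k q) (PiE {..<q} B)
    = (\<Prod>j\<in>{k..<q}. emeasure \<mu> (B j)) * emeasure (count_space (tuples k)) {i \<in> tuples k. \<forall>j<k. pt (i j) \<in> B j}"
proof -
  interpret P: product_sigma_finite "\<lambda>_ :: nat. \<mu>"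
    by (rule product_sigma_finite.intro) (rule control.sigma_finite_measure_axioms)
  interpret T: sigma_finite_measure "count_space (tuples k)"
    by (rule sigma_finite_measure_count_space_countable[OF countable_tuples])
  let ?e = "\<lambda>p. merge {..<k} {k..<q} (\<lambda>j\<in>{..<k}. pt (snd p j), fst p)"
  let ?P = "PiM {k..<q} (\<lambda>_. \<mu>) \<Otimes>\<^sub>M count_space (tuples k)"
  have "emeasure (mixed k q) (PiE {..<q} B) = emeasure ?P (?e -` PiE {..<q} B \<inter> space ?P)"
    unfolding mixed_def using embed_measurable[OF k] B
    by (intro emeasure_distr) (auto intro!: sets_PiM_I_finite)
  also have "?e -` PiE {..<q} B \<inter> space ?P = PiE {k..<q} B \<times> {i \<in> tuples k. \<forall>j<k. pt (i j) \<in> B j}"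
  proof (intro set_eqI iffI)
    fix p assume p: "p \<in> ?e -` PiE {..<q} B \<inter> space ?P"
    then have 1: "?e p j \<in> B j" if "j < q" for j using that by auto
    have "fst p j \<in> B j" if "j \<in> {k..<q}" for j
      using 1[of j] that by (auto simp: merge_def)
    moreover have "pt (snd p j) \<in> B j" if "j < k" for j
      using 1[of j] that k by (auto simp: merge_def)
    moreover have "fst p \<in> extensional {k..<q}" "snd p \<in> tuples k"
      using p by (auto simp: space_pair_measure space_PiM PiE_def)
    ultimately show "p \<in> PiE {k..<q} B \<times> {i \<in> tuples k. \<forall>j<k. pt (i j) \<in> B j}"
      by (cases p) (auto simp: PiE_def)
  next
    fix p assume p: "p \<in> PiE {k..<q} B \<times> {i \<in> tuples k. \<forall>j<k. pt (i j) \<in> B j}"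
    have "fst p \<in> space (PiM {k..<q} (\<lambda>_. \<mu>))"
      unfolding space_PiM
    proof (rule PiE_I)
      fix j assume "j \<in> {k..<q}"
      then have "fst p j \<in> B j" using p by auto
      then show "fst p j \<in> space \<mu>" using sets.sets_into_space[OF B] by blast
    qed (use p in \<open>auto simp: PiE_iff extensional_def\<close>)
    then show "p \<in> ?e -` PiE {..<q} B \<inter> space ?P"
      using p k by (auto simp: space_pair_measure merge_def PiE_iff extensional_def)
  qed
  also have "emeasure ?P \<dots> = emeasure (PiM {k..<q} (\<lambda>_. \<mu>)) (PiE {k..<q} B)
      * emeasure (count_space (tuples k)) {i \<in> tuples k. \<forall>j<k. pt (i j) \<in> B j}"
    using B by (intro T.emeasure_pair_measure_Times sets_PiM_I_finite) auto
  also have "emeasure (PiM {k..<q} (\<lambda>_. \<mu>)) (PiE {k..<q} B) = (\<Prod>j\<in>{k..<q}. emeasure \<mu> (B j))"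
    by (rule P.emeasure_PiM) (use B in auto)
  finally show ?thesis .
qed

text \<open>On a box of cells the counts determine everything: the first \<open>k\<close> sides ask
  for the number of injective index tuples, a falling factorial, and the other sides contribute
  their \<open>\<mu>\<close>-measure.\<close>

lemma emeasure_mixed_cell:
  assumes \<A>: "cells \<mu> \<A>" and z: "set z \<subseteq> \<A>" "length z = q" and k: "k \<le> q"
    and N: "\<And>A. A \<in> \<A> \<Longrightarrow> emeasure \<xi> A = of_nat (N A)"
  shows "emeasure (mixed k q) (PiE {..<q} (\<lambda>j. z ! j))
    = ennreal (charlier (\<lambda>_. 0) (take k z) N * prod_list (map (measure \<mu>) (drop k z)))"
    and "0 \<le> charlier (\<lambda>_. 0) (take k z) N"
proof -
  define E where "E A = {i \<in> idx. pt i \<in> A}" for A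
  have A: "A \<in> sets \<mu>" "emeasure \<mu> A < \<infinity>" if "A \<in> \<A>" for A using that \<A> by (auto simp: cells_def)
  have E: "finite (E A)" "card (E A) = N A" if "A \<in> \<A>" for A
  proof -
    have *: "emeasure (count_space idx) (E A) = of_nat (N A)"
      using emeasure_xi[OF A(1)[OF that]] N[OF that] by (simp add: E_def)
    show "finite (E A)"
    proof (rule ccontr)
      assume "infinite (E A)"
      then have "emeasure (count_space idx) (E A) = \<infinity>" by (subst emeasure_count_space_infinite) (auto simp: E_def)
      then show False using * by simp
    qed
    then have "emeasure (count_space idx) (E A) = of_nat (card (E A))"
      by (subst emeasure_count_space_finite) (auto simp: E_def)
    then show "card (E A) = N A" using * by simp
  qed
  define y where "y = take k z"
  have ylen: "length y = k" using z k by (simp add: y_def)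
  have y: "set y \<subseteq> \<A>" using z set_take_subset[of k z] by (auto simp: y_def)
  let ?S = "{i \<in> {..<length y} \<rightarrow>\<^sub>E idx. inj_on i {..<length y} \<and> (\<forall>j<length y. i j \<in> E (y ! j))}"
  have "finite ?S \<and> real (card ?S) = charlier (\<lambda>_. 0) y (\<lambda>A. card (E A))"
  proof (rule card_injections_charlier)
    show "E A \<inter> E B = {}" if "A \<in> set y" "B \<in> set y" "A \<noteq> B" for A B
    proof -
      have "A \<inter> B = {}" using cells_disjoint[OF \<A>] that y by blast
      then show ?thesis by (auto simp: E_def)
    qed
  qed (use y E in \<open>auto simp: E_def\<close>)
  moreover have "?S = {i \<in> tuples k. \<forall>j<k. pt (i j) \<in> z ! j}"
    using k z by (auto simp: ylen tuples_def E_def y_def PiE_iff)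
  moreover have "charlier (\<lambda>_. 0) y (\<lambda>A. card (E A)) = charlier (\<lambda>_. 0) y N"
    by (rule charlier_cong) (use E y in auto)
  ultimately have S: "finite {i \<in> tuples k. \<forall>j<k. pt (i j) \<in> z ! j}"
    "real (card {i \<in> tuples k. \<forall>j<k. pt (i j) \<in> z ! j}) = charlier (\<lambda>_. 0) y N" by auto
  show nn: "0 \<le> charlier (\<lambda>_. 0) (take k z) N" using S(2) by (simp add: y_def[symmetric] flip: S(2))
  \<comment> \<open>Sides beyond \<open>q\<close> are filled with \<open>{}\<close>, because
    \<open>emeasure_mixed_box\<close> asks for measurable sides at every index.\<close>
  define B where "B j = (if j < q then z ! j else {})" for j
  have zB: "z ! j \<in> sets \<mu>" "emeasure \<mu> (z ! j) < \<infinity>" if "j < q" for j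
  proof -
    have "z ! j \<in> \<A>" using that z nth_mem[of j z] by auto
    then show "z ! j \<in> sets \<mu>" "emeasure \<mu> (z ! j) < \<infinity>" using A by auto
  qed
  have B: "B j \<in> sets \<mu>" for j using zB by (simp add: B_def)
  have "PiE {..<q} (\<lambda>j. z ! j) = PiE {..<q} B" by (rule PiE_cong) (simp add: B_def)
  then have "emeasure (mixed k q) (PiE {..<q} (\<lambda>j. z ! j))
      = (\<Prod>j\<in>{k..<q}. emeasure \<mu> (B j)) * emeasure (count_space (tuples k)) {i \<in> tuples k. \<forall>j<k. pt (i j) \<in> B j}"
    using emeasure_mixed_box[OF k B] by simp
  also have "{i \<in> tuples k. \<forall>j<k. pt (i j) \<in> B j} = {i \<in> tuples k. \<forall>j<k. pt (i j) \<in> z ! j}"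
    using k by (auto simp: B_def)
  also have "emeasure (count_space (tuples k)) \<dots> = ennreal (charlier (\<lambda>_. 0) y N)"
    using S by (subst emeasure_count_space_finite) (auto simp: ennreal_of_nat_eq_real_of_nat)
  also have "(\<Prod>j\<in>{k..<q}. emeasure \<mu> (B j)) = (\<Prod>j\<in>{k..<q}. ennreal (measure \<mu> (z ! j)))"
    using zB by (intro prod.cong refl) (simp add: B_def emeasure_eq_ennreal_measure less_top)
  also have "\<dots> = ennreal (\<Prod>j\<in>{k..<q}. measure \<mu> (z ! j))" by (rule prod_ennreal) simp
  also have "(\<Prod>j\<in>{k..<q}. measure \<mu> (z ! j)) = prod_list (map (measure \<mu>) (drop k z))"
  proof -
    have "prod_list (map (measure \<mu>) (drop k z)) = (\<Prod>j<q - k. measure \<mu> (z ! (k + j)))"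
      using z k by (simp add: prod.list_conv_set_nth atLeast0LessThan)
    also have "\<dots> = (\<Prod>j\<in>{k..<q}. measure \<mu> (z ! j))"
      using k by (intro prod.reindex_bij_witness[of _ "\<lambda>j. j - k" "\<lambda>j. k + j"]) auto
    finally show ?thesis by simp
  qed
  finally have eq: "emeasure (mixed k q) (PiE {..<q} (\<lambda>j. z ! j))
    = ennreal (prod_list (map (measure \<mu>) (drop k z))) * ennreal (charlier (\<lambda>_. 0) y N)" .
  show "emeasure (mixed k q) (PiE {..<q} (\<lambda>j. z ! j))
    = ennreal (charlier (\<lambda>_. 0) (take k z) N * prod_list (map (measure \<mu>) (drop k z)))"
  proof -
    have "0 \<le> prod_list (map (measure \<mu>) (drop k z))" by (rule prod_list_nonneg) auto
    then show ?thesis using nn eq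
      by (simp add: y_def ennreal_mult mult.commute)
  qed
qed

end

section \<open>Simple kernels\<close>

lemma wsum_snoc: "wsum I lam (Suc n) f = wsum I lam n (\<lambda>z. \<Sum>i\<in>I. lam i * f (z @ [i]))"
proof -
  have "wsum I lam (Suc n) f = wsum I lam (n + 1) f" by simp
  also have "\<dots> = wsum I lam n (\<lambda>z. wsum I lam 1 (\<lambda>b. f (z @ b)))" by (rule wsum_append)
  finally show ?thesis by simp
qed

text \<open>For symmetric kernels the noncommutative-looking product of the operators
  \<open>create 0 - lam\<close> expands by the binomial theorem.\<close>

lemma chaos_inclusion_exclusion:
  assumes "sym_kernel h"
  shows "chaos I lam q h x = (\<Sum>k\<le>q. (- 1) ^ (q - k) * real (q choose k) *
    wsum I (\<lambda>_. 1) q (\<lambda>z. h z * charlier (\<lambda>_. 0) (take k z) x * prod_list (map lam (drop k z))))"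
  using assms
proof (induction q arbitrary: h x)
  case (Suc q)
  define c where "c k = (- 1) ^ (q - k) * real (q choose k)" for k
  define T where "T k = wsum I (\<lambda>_. 1) (Suc q) (\<lambda>z. h z * charlier (\<lambda>_. 0) (take k z) x * prod_list (map lam (drop k z)))" for k
  have IH: "chaos I lam q (\<lambda>z. h (i # z)) y = (\<Sum>k\<le>q. c k *
      wsum I (\<lambda>_. 1) q (\<lambda>z. h (i # z) * charlier (\<lambda>_. 0) (take k z) y * prod_list (map lam (drop k z))))" for i y
    unfolding c_def by (rule Suc.IH[OF sym_kernel_Cons[OF Suc.prems]])
  have raise: "(\<Sum>i\<in>I. real (x i) * chaos I lam q (\<lambda>z. h (i # z)) (lower i x)) = (\<Sum>k\<le>q. c k * T (Suc k))"
  proof -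
    have "real (x i) * chaos I lam q (\<lambda>z. h (i # z)) (lower i x)
        = (\<Sum>k\<le>q. c k * wsum I (\<lambda>_. 1) q (\<lambda>z. h (i # z) * charlier (\<lambda>_. 0) (i # take k z) x * prod_list (map lam (drop k z))))" for i
      unfolding IH sum_distrib_left
    proof (intro sum.cong refl)
      fix k
      have "(\<lambda>z. h (i # z) * charlier (\<lambda>_. 0) (i # take k z) x * prod_list (map lam (drop k z)))
        = (\<lambda>z. real (x i) * (h (i # z) * charlier (\<lambda>_. 0) (take k z) (lower i x) * prod_list (map lam (drop k z))))"
        by (simp add: create_def ac_simps)
      then show "real (x i) * (c k * wsum I (\<lambda>_. 1) q (\<lambda>z. h (i # z) * charlier (\<lambda>_. 0) (take k z) (lower i x) * prod_list (map lam (drop k z))))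
        = c k * wsum I (\<lambda>_. 1) q (\<lambda>z. h (i # z) * charlier (\<lambda>_. 0) (i # take k z) x * prod_list (map lam (drop k z)))"
        by (simp add: wsum_scale)
    qed
    then show ?thesis by (simp add: T_def sum.swap[of _ I] sum_distrib_left)
  qed
  \<comment> \<open>The weight \<open>lam i\<close> has to land behind the letters evaluated by
    falling factorials; symmetry of \<open>h\<close> allows the removed first letter to be moved to
    the end.\<close>
  have scale: "(\<Sum>i\<in>I. lam i * chaos I lam q (\<lambda>z. h (i # z)) x) = (\<Sum>k\<le>q. c k * T k)"
  proof -
    have Tk: "T k = (\<Sum>i\<in>I. lam i * wsum I (\<lambda>_. 1) q (\<lambda>z. h (i # z) * charlier (\<lambda>_. 0) (take k z) x * prod_list (map lam (drop k z))))"
      if "k \<le> q" for k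
    proof -
      have "T k = wsum I (\<lambda>_. 1) q (\<lambda>z. \<Sum>i\<in>I. h (z @ [i]) * charlier (\<lambda>_. 0) (take k (z @ [i])) x * prod_list (map lam (drop k (z @ [i]))))"
        unfolding T_def wsum_snoc by simp
      also have "\<dots> = wsum I (\<lambda>_. 1) q (\<lambda>z. \<Sum>i\<in>I. lam i * (h (i # z) * charlier (\<lambda>_. 0) (take k z) x * prod_list (map lam (drop k z))))"
      proof (intro wsum_cong sum.cong refl)
        fix z :: "'a list" and i assume z: "length z = q"
        have "h (z @ [i]) = h (i # z)" by (rule sym_kernelD[OF Suc.prems]) simp
        then show "h (z @ [i]) * charlier (\<lambda>_. 0) (take k (z @ [i])) x * prod_list (map lam (drop k (z @ [i])))
          = lam i * (h (i # z) * charlier (\<lambda>_. 0) (take k z) x * prod_list (map lam (drop k z)))"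
          using z that by simp
      qed
      finally show ?thesis by (simp only: wsum_sum wsum_scale)
    qed
    have "(\<Sum>k\<le>q. c k * T k) = (\<Sum>k\<le>q. \<Sum>i\<in>I. lam i * (c k * wsum I (\<lambda>_. 1) q (\<lambda>z. h (i # z) * charlier (\<lambda>_. 0) (take k z) x * prod_list (map lam (drop k z)))))"
      by (intro sum.cong refl) (simp add: Tk sum_distrib_left ac_simps)
    then show ?thesis by (simp add: IH sum_distrib_left sum.swap[of _ I])
  qed
  have "chaos I lam (Suc q) h x = (\<Sum>k\<le>q. c k * T (Suc k)) - (\<Sum>k\<le>q. c k * T k)"
    by (simp add: create_def sum_subtractf raise scale)
  \<comment> \<open>Pascal's rule for \<open>Suc q choose Suc k\<close>: the part with
    \<open>q choose Suc k\<close> is the second sum, shifted by one and with opposite sign.\<close>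
  also have "\<dots> = (\<Sum>k\<le>Suc q. (- 1) ^ (Suc q - k) * real (Suc q choose k) * T k)"
  proof -
    have "(\<Sum>k\<le>Suc q. (- 1) ^ (Suc q - k) * real (Suc q choose k) * T k)
        = (- 1) ^ Suc q * T 0 + (\<Sum>k\<le>q. (- 1) ^ (q - k) * real (Suc q choose Suc k) * T (Suc k))"
      by (subst sum.atMost_Suc_shift) simp
    also have "(\<Sum>k\<le>q. (- 1) ^ (q - k) * real (Suc q choose Suc k) * T (Suc k))
        = (\<Sum>k\<le>q. c k * T (Suc k)) + (\<Sum>k\<le>q. (- 1) ^ (q - k) * real (q choose Suc k) * T (Suc k))"
      by (simp add: c_def sum.distrib[symmetric] algebra_simps)
    also have "(\<Sum>k\<le>q. (- 1) ^ (q - k) * real (q choose Suc k) * T (Suc k))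
        = - (\<Sum>k<q. c (Suc k) * T (Suc k))"
    proof -
      have "(\<Sum>k\<le>q. (- 1) ^ (q - k) * real (q choose Suc k) * T (Suc k))
          = (\<Sum>k<q. (- 1) ^ (q - k) * real (q choose Suc k) * T (Suc k))"
        by (rule sum.mono_neutral_right) auto
      also have "\<dots> = (\<Sum>k<q. - (c (Suc k) * T (Suc k)))"
        by (intro sum.cong refl) (simp add: c_def Suc_diff_Suc[symmetric])
      finally show ?thesis by (simp add: sum_negf)
    qed
    also have "(\<Sum>k<q. c (Suc k) * T (Suc k)) = (\<Sum>k\<le>q. c k * T k) - c 0 * T 0"
      by (cases q) (simp_all add: sum.atMost_shift lessThan_Suc_atMost del: sum.atMost_Suc)
    finally show ?thesis by (simp add: c_def)
  qed
  finally show ?case by (simp only: T_def)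
qed simp

section \<open>Kernels constant on boxes of cells, and their refinements\<close>

definition ker :: "'z set set \<Rightarrow> nat \<Rightarrow> ('z set list \<Rightarrow> real) \<Rightarrow> (nat \<Rightarrow> 'z) \<Rightarrow> real" where
  "ker \<A> q h x = wsum \<A> (\<lambda>_. 1) q (\<lambda>z. h z * indicator (PiE {..<q} (\<lambda>j. z ! j)) x)"

lemma ker_add: "ker \<A> q (\<lambda>z. h z + k z) x = ker \<A> q h x + ker \<A> q k x"
  by (simp add: ker_def wsum_add distrib_right)

lemma ker_minus: "ker \<A> q (\<lambda>z. h z - k z) x = ker \<A> q h x - ker \<A> q k x"
  by (simp add: ker_def wsum_minus left_diff_distrib)

lemma ker_scale: "ker \<A> q (\<lambda>z. c * h z) x = c * ker \<A> q h x"
  by (simp add: ker_def wsum_scale mult.assoc)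

text \<open>Boxes of different words of cells are disjoint, so a single summand survives.\<close>

lemma ker_cell:
  assumes \<A>: "cells \<mu> \<A>" and z: "set z \<subseteq> \<A>" "length z = q" and x: "x \<in> PiE {..<q} (\<lambda>j. z ! j)"
  shows "ker \<A> q h x = h z"
proof -
  have uniq: "w = z" if w: "set w \<subseteq> \<A>" "length w = q" "x \<in> PiE {..<q} (\<lambda>j. w ! j)" for w
  proof (rule nth_equalityI)
    fix j assume "j < length w"
    then have j: "j < q" using w by simp
    have "w ! j \<in> \<A>" "z ! j \<in> \<A>" using j w z by (auto simp: subset_iff)
    moreover have "x j \<in> w ! j" "x j \<in> z ! j" using j w x by auto
    ultimately show "w ! j = z ! j" using cells_disjoint[OF \<A>] by blast
  qed (use w z in simp)
  have fin: "finite \<A>" using \<A> by (simp add: cells_def)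
  have "ker \<A> q h x = (\<Sum>w | set w \<subseteq> \<A> \<and> length w = q. if w = z then h z else 0)"
    unfolding ker_def wsum_const_one[OF fin]
    by (intro sum.cong refl) (use uniq x in \<open>auto simp: indicator_def\<close>)
  also have "\<dots> = h z" using z finite_lists_length_eq[OF fin] by (simp add: sum.delta')
  finally show ?thesis .
qed

lemma ker_outside:
  assumes "\<And>z. set z \<subseteq> \<A> \<Longrightarrow> length z = q \<Longrightarrow> x \<notin> PiE {..<q} (\<lambda>j. z ! j)"
  shows "ker \<A> q h x = 0"
proof -
  have "ker \<A> q h x = wsum \<A> (\<lambda>_. 1) q (\<lambda>z. 0 * 0)"
    unfolding ker_def by (rule wsum_cong) (use assms in simp)
  then show ?thesis unfolding wsum_scale by simp
qed

lemma ker_mult: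
  assumes "cells \<mu> \<A>"
  shows "ker \<A> q (\<lambda>z. h z * k z) x = ker \<A> q h x * ker \<A> q k x"
proof (cases "\<exists>z. set z \<subseteq> \<A> \<and> length z = q \<and> x \<in> PiE {..<q} (\<lambda>j. z ! j)")
  case True
  then obtain z where "set z \<subseteq> \<A>" "length z = q" "x \<in> PiE {..<q} (\<lambda>j. z ! j)" by blast
  from ker_cell[OF assms this] show ?thesis by simp
next
  case False
  then show ?thesis by (simp add: ker_outside)
qed

definition subdivides :: "'z set set \<Rightarrow> 'z set set \<Rightarrow> bool" where
  "subdivides \<C> \<A> \<longleftrightarrow> (\<forall>A\<in>\<A>. (\<forall>C\<in>\<C>. C \<subseteq> A \<or> C \<inter> A = {}) \<and> A \<subseteq> \<Union>{C\<in>\<C>. C \<subseteq> A})"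

text \<open>Sets are inserted one at a time: the new set cuts every cell in two, and its part
  outside all cells becomes a further cell.\<close>

lemma ex_refinement:
  assumes "finite \<D>" "\<And>D. D \<in> \<D> \<Longrightarrow> D \<in> sets \<mu> \<and> emeasure \<mu> D < \<infinity>"
  shows "\<exists>\<C>. cells \<mu> \<C> \<and> subdivides \<C> \<D>"
  using assms
proof (induction \<D> rule: finite_induct)
  case empty
  have "cells \<mu> {} \<and> subdivides {} {}" by (simp add: cells_def subdivides_def)
  then show ?case by blast
next
  case (insert B \<D>)
  then obtain \<C> where \<C>: "cells \<mu> \<C>" "subdivides \<C> \<D>" by auto
  have B: "B \<in> sets \<mu>" "emeasure \<mu> B < \<infinity>" using insert.prems by auto
  have C: "finite \<C>" "\<And>C. C \<in> \<C> \<Longrightarrow> C \<in> sets \<mu>" "\<And>C. C \<in> \<C> \<Longrightarrow> emeasure \<mu> C < \<infinity>" "{} \<notin> \<C>"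
    using \<C>(1) by (auto simp: cells_def)
  define \<E> where "\<E> = ((\<lambda>C. C \<inter> B) ` \<C> \<union> (\<lambda>C. C - B) ` \<C> \<union> {B - \<Union>\<C>}) - {{}}"
  have "cells \<mu> \<E>"
    unfolding cells_def
  proof (intro conjI ballI)
    show "finite \<E>" using C by (simp add: \<E>_def)
    have U: "\<Union>\<C> \<in> sets \<mu>" using C by (intro sets.finite_Union) auto
    show "\<E> \<subseteq> sets \<mu>" using C B U by (auto simp: \<E>_def)
    show "{} \<notin> \<E>" by (simp add: \<E>_def)
    show "disjoint \<E>"
    proof (rule disjointI)
      fix X Y assume XY: "X \<in> \<E>" "Y \<in> \<E>" "X \<noteq> Y"
      have cases: "X = B - \<Union>\<C> \<or> (\<exists>C\<in>\<C>. X = C \<inter> B \<or> X = C - B)" if "X \<in> \<E>" for X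
        using that by (auto simp: \<E>_def)
      have dj: "C \<inter> D = {}" if "C \<in> \<C>" "D \<in> \<C>" "C \<noteq> D" for C D
        using cells_disjoint[OF \<C>(1) that] .
      show "X \<inter> Y = {}"
      proof (cases "X = B - \<Union>\<C> \<or> Y = B - \<Union>\<C>")
        case True
        then show ?thesis using cases[OF XY(1)] cases[OF XY(2)] XY(3) by auto
      next
        case False
        then obtain C D where CD: "C \<in> \<C>" "D \<in> \<C>" "X = C \<inter> B \<or> X = C - B" "Y = D \<inter> B \<or> Y = D - B"
          using cases[OF XY(1)] cases[OF XY(2)] by blast
        then show ?thesis using dj[of C D] XY(3) by (cases "C = D") auto
      qed
    qed
    fix X assume "X \<in> \<E>"
    then consider C where "C \<in> \<C>" "X \<subseteq> C" | "X \<subseteq> B" by (auto simp: \<E>_def)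
    then show "emeasure \<mu> X < \<infinity>"
    proof cases
      case 1
      then show ?thesis using emeasure_mono[of X C \<mu>] C(2,3)[of C] by auto
    next
      case 2
      then show ?thesis using emeasure_mono[of X B \<mu>] B by auto
    qed
  qed
  moreover have "subdivides \<E> (insert B \<D>)"
    unfolding subdivides_def
  proof (intro ballI)
    fix A assume A: "A \<in> insert B \<D>"
    show "(\<forall>X\<in>\<E>. X \<subseteq> A \<or> X \<inter> A = {}) \<and> A \<subseteq> \<Union>{X\<in>\<E>. X \<subseteq> A}"
    proof (cases "A = B")
      case True
      have "x \<in> \<Union>{X\<in>\<E>. X \<subseteq> B}" if "x \<in> B" for x
      proof (cases "x \<in> \<Union>\<C>")
        case True
        then obtain D where "D \<in> \<C>" "x \<in> D" by blast
        then show ?thesis using that by (intro UnionI[of "D \<inter> B"]) (auto simp: \<E>_def)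
      next
        case False
        then show ?thesis using that by (intro UnionI[of "B - \<Union>\<C>"]) (auto simp: \<E>_def)
      qed
      moreover have "X \<subseteq> B \<or> X \<inter> B = {}" if "X \<in> \<E>" for X using that by (auto simp: \<E>_def)
      ultimately show ?thesis using True by blast
    next
      case False
      then have AD: "A \<in> \<D>" using A by simp
      then have r: "\<forall>C\<in>\<C>. C \<subseteq> A \<or> C \<inter> A = {}" "A \<subseteq> \<Union>{C\<in>\<C>. C \<subseteq> A}" using \<C>(2) by (auto simp: subdivides_def)
      have "X \<subseteq> A \<or> X \<inter> A = {}" if X: "X \<in> \<E>" for X
      proof (cases "X = B - \<Union>\<C>")
        case True
        have "A \<subseteq> \<Union>\<C>" using r(2) by blast
        then show ?thesis using True by blast
      next
        case False
        then obtain C where "C \<in> \<C>" "X \<subseteq> C" using X by (auto simp: \<E>_def)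
        then show ?thesis using r(1) by blast
      qed
      moreover have "x \<in> \<Union>{X\<in>\<E>. X \<subseteq> A}" if x: "x \<in> A" for x
      proof -
        obtain D where D: "D \<in> \<C>" "D \<subseteq> A" "x \<in> D" using r(2) x by blast
        show ?thesis
        proof (cases "x \<in> B")
          case True
          then show ?thesis using D by (intro UnionI[of "D \<inter> B"]) (auto simp: \<E>_def)
        next
          case False
          then show ?thesis using D by (intro UnionI[of "D - B"]) (auto simp: \<E>_def)
        qed
      qed
      ultimately show ?thesis by blast
    qed
  qed
  ultimately show ?case by blast
qed

lemma subdivides_Un: "subdivides \<C> (\<A> \<union> \<B>) \<longleftrightarrow> subdivides \<C> \<A> \<and> subdivides \<C> \<B>"
  unfolding subdivides_def by (rule ball_Un)

text \<open>Meaningful only for a nonempty \<open>C\<close> inside some cell of \<open>\<A>\<close>;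
  on words, \<open>has_parents\<close> is the guard for this.\<close>

definition parent :: "'z set set \<Rightarrow> 'z set \<Rightarrow> 'z set" where
  "parent \<A> C = (THE A. A \<in> \<A> \<and> C \<subseteq> A)"

definition has_parents :: "'z set set \<Rightarrow> 'z set list \<Rightarrow> bool" where
  "has_parents \<A> z \<longleftrightarrow> (\<forall>C\<in>set z. \<exists>A\<in>\<A>. C \<subseteq> A)"

lemma parent_eq:
  assumes "cells \<mu> \<A>" "C \<noteq> {}" "A \<in> \<A>" "C \<subseteq> A"
  shows "parent \<A> C = A"
  unfolding parent_def
proof (rule the_equality)
  fix B assume "B \<in> \<A> \<and> C \<subseteq> B"
  then show "B = A" using cells_disjoint[OF assms(1), of A B] assms by blast
qed (use assms in simp)

text \<open>A fine box meets a coarse box only if each of its sides lies in the corresponding coarse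
  side. A word with an orphan letter has a box outside all coarse boxes and gets the value
  0.\<close>

lemma ker_refine:
  assumes \<A>: "cells \<mu> \<A>" and \<C>: "cells \<mu> \<C>" and r: "subdivides \<C> \<A>"
  shows "ker \<A> q h x = ker \<C> q (\<lambda>z. if has_parents \<A> z then h (map (parent \<A>) z) else 0) x"
    (is "_ = ker \<C> q ?h x")
proof (cases "\<exists>w. set w \<subseteq> \<A> \<and> length w = q \<and> x \<in> PiE {..<q} (\<lambda>j. w ! j)")
  case True
  then obtain w where w: "set w \<subseteq> \<A>" "length w = q" and x: "x \<in> PiE {..<q} (\<lambda>j. w ! j)" by blast
  have "\<exists>C\<in>\<C>. C \<subseteq> w ! j \<and> x j \<in> C" if "j < q" for j
  proof -
    have "w ! j \<in> \<A>" using that w by (auto simp: subset_iff)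
    then have "w ! j \<subseteq> \<Union>{C\<in>\<C>. C \<subseteq> w ! j}" using r unfolding subdivides_def by blast
    moreover have "x j \<in> w ! j" using x that by auto
    ultimately show ?thesis by blast
  qed
  then obtain c where c: "\<And>j. j < q \<Longrightarrow> c j \<in> \<C> \<and> c j \<subseteq> w ! j \<and> x j \<in> c j" by metis
  define z where "z = map c [0..<q]"
  have z: "set z \<subseteq> \<C>" "length z = q" "x \<in> PiE {..<q} (\<lambda>j. z ! j)"
    using c x by (auto simp: z_def PiE_iff)
  have par: "parent \<A> (c j) = w ! j" if "j < q" for j
    using c[OF that] that w by (intro parent_eq[OF \<A>]) auto
  have "has_parents \<A> z" unfolding has_parents_def
  proof
    fix C assume "C \<in> set z"
    then obtain j where j: "j < q" "C = c j" by (auto simp: z_def)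
    then have "w ! j \<in> \<A>" using w by (auto simp: subset_iff)
    then show "\<exists>A\<in>\<A>. C \<subseteq> A" using c[OF j(1)] j(2) by blast
  qed
  moreover have "map (parent \<A>) z = w" using w par by (intro nth_equalityI) (auto simp: z_def)
  ultimately show ?thesis using ker_cell[OF \<A> w x] ker_cell[OF \<C> z] by simp
next
  case False
  then have 0: "ker \<A> q h x = 0" by (intro ker_outside) blast
  show ?thesis
  proof (cases "\<exists>z. set z \<subseteq> \<C> \<and> length z = q \<and> x \<in> PiE {..<q} (\<lambda>j. z ! j)")
    case True
    then obtain z where z: "set z \<subseteq> \<C>" "length z = q" "x \<in> PiE {..<q} (\<lambda>j. z ! j)" by blast
    have "\<not> has_parents \<A> z"
    proof
      assume hp: "has_parents \<A> z"
      have 1: "parent \<A> C \<in> \<A> \<and> C \<subseteq> parent \<A> C" if C: "C \<in> set z" for C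
      proof -
        obtain A where A: "A \<in> \<A>" "C \<subseteq> A" using hp C by (auto simp: has_parents_def)
        have "C \<noteq> {}" using C z(1) \<C> by (auto simp: cells_def)
        then show ?thesis using parent_eq[OF \<A> _ A] A by simp
      qed
      have "x \<in> PiE {..<q} (\<lambda>j. map (parent \<A>) z ! j)"
      proof (rule PiE_I)
        fix j assume "j \<in> {..<q}"
        then have j: "j < length z" using z by simp
        have "x j \<in> z ! j" using z j by auto
        then have "x j \<in> parent \<A> (z ! j)" using 1[OF nth_mem[OF j]] by blast
        then show "x j \<in> map (parent \<A>) z ! j" using j by simp
      qed (use z in \<open>auto simp: PiE_iff extensional_def\<close>)
      moreover have "set (map (parent \<A>) z) \<subseteq> \<A>" using 1 by auto
      ultimately show False using False z(2) by (metis length_map)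
    qed
    then show ?thesis using 0 ker_cell[OF \<C> z] by simp
  next
    case False
    then show ?thesis using 0 by (simp add: ker_outside)
  qed
qed

lemma sym_kernel_refine:
  assumes "sym_kernel h"
  shows "sym_kernel (\<lambda>z. if has_parents \<A> z then h (map (parent \<A>) z) else 0)"
  unfolding sym_kernel_def
proof (intro allI impI)
  fix z z' :: "'a set list" assume m: "mset z = mset z'"
  then have "mset (map (parent \<A>) z) = mset (map (parent \<A>) z')" by simp
  then have "h (map (parent \<A>) z) = h (map (parent \<A>) z')" by (rule sym_kernelD[OF assms])
  moreover have "has_parents \<A> z = has_parents \<A> z'" using mset_eq_setD[OF m] by (simp add: has_parents_def)
  ultimately show "(if has_parents \<A> z then h (map (parent \<A>) z) else 0)
    = (if has_parents \<A> z' then h (map (parent \<A>) z') else 0)" by simp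
qed

text \<open>Makes sums and differences of kernels on different families of cells available, with
  symmetry preserved.\<close>

lemma ker_common_refinement:
  assumes "cells \<mu> \<A>" "cells \<mu> \<B>"
  obtains \<C> h' k' where "cells \<mu> \<C>" "\<And>x. ker \<A> q h x = ker \<C> q h' x" "\<And>x. ker \<B> q k x = ker \<C> q k' x"
    "sym_kernel h \<Longrightarrow> sym_kernel h'" "sym_kernel k \<Longrightarrow> sym_kernel k'" "subdivides \<C> \<A>" "subdivides \<C> \<B>"
proof -
  obtain \<C> where \<C>: "cells \<mu> \<C>" "subdivides \<C> (\<A> \<union> \<B>)"
  proof -
    have "D \<in> sets \<mu> \<and> emeasure \<mu> D < \<infinity>" if "D \<in> \<A> \<union> \<B>" for D
      using assms that by (auto simp: cells_def)
    moreover have "finite (\<A> \<union> \<B>)" using assms by (simp add: cells_def)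
    ultimately show thesis using ex_refinement[of "\<A> \<union> \<B>" \<mu>] that by blast
  qed
  then have r: "subdivides \<C> \<A>" "subdivides \<C> \<B>" by (simp_all add: subdivides_Un)
  show thesis
    by (rule that[OF \<C>(1) ker_refine[OF assms(1) \<C>(1) r(1)] ker_refine[OF assms(2) \<C>(1) r(2)]
        sym_kernel_refine sym_kernel_refine r])
qed

text \<open>The measure is left arbitrary because both the power of \<open>\<mu>\<close> and the
  random mixed measures are needed; they differ only in the masses \<open>c z\<close>.\<close>

lemma integral_ker:
  assumes fin: "finite \<A>" and sets: "\<And>z. set z \<subseteq> \<A> \<Longrightarrow> length z = q \<Longrightarrow> PiE {..<q} (\<lambda>j. z ! j) \<in> sets \<nu>"
    and c: "\<And>z. set z \<subseteq> \<A> \<Longrightarrow> length z = q \<Longrightarrow> emeasure \<nu> (PiE {..<q} (\<lambda>j. z ! j)) = ennreal (c z) \<and> c z \<ge> 0"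
  shows "integrable \<nu> (ker \<A> q h)" "(\<integral>x. ker \<A> q h x \<partial>\<nu>) = wsum \<A> (\<lambda>_. 1) q (\<lambda>z. h z * c z)"
proof -
  have each: "has_bochner_integral \<nu> (\<lambda>x. h z * indicator (PiE {..<q} (\<lambda>j. z ! j)) x) (h z * c z)"
    if "set z \<subseteq> \<A>" "length z = q" for z
  proof -
    have "measure \<nu> (PiE {..<q} (\<lambda>j. z ! j)) = c z" using c[OF that] by (simp add: measure_def)
    then have "has_bochner_integral \<nu> (indicator (PiE {..<q} (\<lambda>j. z ! j)) :: _ \<Rightarrow> real) (c z)"
      using has_bochner_integral_real_indicator[OF sets[OF that]] c[OF that] by simp
    then show ?thesis by (rule has_bochner_integral_mult_right)
  qed
  have "has_bochner_integral \<nu> (ker \<A> q h) (wsum \<A> (\<lambda>_. 1) q (\<lambda>z. h z * c z))"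
    unfolding ker_def[abs_def] wsum_const_one[OF fin]
    by (rule has_bochner_integral_sum) (use each in auto)
  then show "integrable \<nu> (ker \<A> q h)" "(\<integral>x. ker \<A> q h x \<partial>\<nu>) = wsum \<A> (\<lambda>_. 1) q (\<lambda>z. h z * c z)"
    by (auto simp: has_bochner_integral_iff)
qed

lemma cells_box_sets:
  assumes "cells \<mu> \<A>" "set z \<subseteq> \<A>" "length z = q"
  shows "PiE {..<q} (\<lambda>j. z ! j) \<in> sets (power_measure \<mu> q)"
proof (rule sets_PiM_I_finite)
  fix j assume "j \<in> {..<q}"
  then have "z ! j \<in> \<A>" using assms by (auto simp: subset_iff)
  then show "z ! j \<in> sets \<mu>" using assms by (auto simp: cells_def)
qed simp

lemma ker_measurable [measurable]:
  assumes "cells \<mu> \<A>"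
  shows "ker \<A> q h \<in> borel_measurable (power_measure \<mu> q)"
proof -
  have fin: "finite \<A>" using assms by (simp add: cells_def)
  show ?thesis
    unfolding ker_def[abs_def] wsum_const_one[OF fin]
    by (intro borel_measurable_sum borel_measurable_times borel_measurable_const borel_measurable_indicator)
      (use cells_box_sets[OF assms] in auto)
qed

lemma (in sigma_finite_measure) integral_ker_power:
  assumes "cells M \<A>"
  shows "integrable (power_measure M q) (ker \<A> q h)"
    "(\<integral>x. ker \<A> q h x \<partial>power_measure M q) = wsum \<A> (measure M) q h"
proof -
  interpret P: product_sigma_finite "\<lambda>_ :: nat. M"
    by (rule product_sigma_finite.intro) (rule sigma_finite_measure_axioms)
  have fin: "finite \<A>" using assms by (simp add: cells_def)
  have c: "emeasure (power_measure M q) (PiE {..<q} (\<lambda>j. z ! j)) = ennreal (prod_list (map (measure M) z)) \<and> prod_list (map (measure M) z) \<ge> 0"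
    if z: "set z \<subseteq> \<A>" "length z = q" for z
  proof -
    have zj: "z ! j \<in> sets M" "emeasure M (z ! j) < \<infinity>" if "j < q" for j
    proof -
      have "z ! j \<in> \<A>" using that z by (auto simp: subset_iff)
      then show "z ! j \<in> sets M" "emeasure M (z ! j) < \<infinity>" using assms by (auto simp: cells_def)
    qed
    have "emeasure (power_measure M q) (PiE {..<q} (\<lambda>j. z ! j)) = (\<Prod>j<q. emeasure M (z ! j))"
      by (rule P.emeasure_PiM) (use zj in auto)
    also have "\<dots> = (\<Prod>j<q. ennreal (measure M (z ! j)))"
      using zj by (intro prod.cong refl) (simp add: emeasure_eq_ennreal_measure less_top)
    also have "\<dots> = ennreal (\<Prod>j<q. measure M (z ! j))" by (rule prod_ennreal) simp
    also have "(\<Prod>j<q. measure M (z ! j)) = prod_list (map (measure M) z)"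
      using z by (simp add: prod.list_conv_set_nth atLeast0LessThan)
    finally show ?thesis using prod_list_nonneg[of "map (measure M) z"] by force
  qed
  show "integrable (power_measure M q) (ker \<A> q h)"
    by (rule integral_ker(1)[OF fin cells_box_sets[OF assms] c])
  have "(\<integral>x. ker \<A> q h x \<partial>power_measure M q) = wsum \<A> (\<lambda>_. 1) q (\<lambda>z. h z * prod_list (map (measure M) z))"
    by (rule integral_ker(2)[OF fin cells_box_sets[OF assms] c])
  then show "(\<integral>x. ker \<A> q h x \<partial>power_measure M q) = wsum \<A> (measure M) q h"
    by (simp add: wsum_weight[of _ "measure M"] mult.commute)
qed

context poisson_random_measure
begin

definition proper :: "'w \<Rightarrow> bool" where
  "proper \<omega> \<longleftrightarrow> enumerated_measure \<mu> (\<eta> \<omega>)"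

abbreviation mixed :: "'w \<Rightarrow> nat \<Rightarrow> nat \<Rightarrow> (nat \<Rightarrow> 'z) measure" where
  "mixed \<omega> k q \<equiv> enumerated_measure.mixed \<mu> (\<eta> \<omega>) k q"

lemma AE_proper: "AE \<omega> in M. proper \<omega>"
  using eta_atoms AE_space
proof eventually_elim
  case (elim \<omega>)
  then show ?case unfolding proper_def
    by unfold_locales (auto simp: sets_eta)
qed

lemma AE_counts:
  assumes "cells \<mu> \<A>"
  shows "AE \<omega> in M. \<forall>A\<in>\<A>. emeasure (\<eta> \<omega>) A = of_nat (counts \<A> \<omega> A)"
  by (rule AE_finite_allI) (use assms in \<open>auto simp: cells_def counts_def intro: emeasure_eta_eq_count\<close>)

lemma integral_ker_mixed:
  assumes \<A>: "cells \<mu> \<A>" and k: "k \<le> q" and p: "proper \<omega>"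
    and N: "\<forall>A\<in>\<A>. emeasure (\<eta> \<omega>) A = of_nat (counts \<A> \<omega> A)"
  shows "integrable (mixed \<omega> k q) (ker \<A> q h)"
    "(\<integral>x. ker \<A> q h x \<partial>mixed \<omega> k q) = wsum \<A> (\<lambda>_. 1) q (\<lambda>z. h z *
      (charlier (\<lambda>_. 0) (take k z) (counts \<A> \<omega>) * prod_list (map (measure \<mu>) (drop k z))))"
proof -
  interpret e: enumerated_measure \<mu> "\<eta> \<omega>" using p by (simp add: proper_def)
  have fin: "finite \<A>" using \<A> by (simp add: cells_def)
  have c: "emeasure (mixed \<omega> k q) (PiE {..<q} (\<lambda>j. z ! j)) =
      ennreal (charlier (\<lambda>_. 0) (take k z) (counts \<A> \<omega>) * prod_list (map (measure \<mu>) (drop k z))) \<and>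
      charlier (\<lambda>_. 0) (take k z) (counts \<A> \<omega>) * prod_list (map (measure \<mu>) (drop k z)) \<ge> 0"
    if "set z \<subseteq> \<A>" "length z = q" for z
    using e.emeasure_mixed_cell[OF \<A> that k, of "counts \<A> \<omega>"] N
    by (auto intro!: mult_nonneg_nonneg prod_list_nonneg)
  have s: "PiE {..<q} (\<lambda>j. z ! j) \<in> sets (mixed \<omega> k q)" if "set z \<subseteq> \<A>" "length z = q" for z
    using cells_box_sets[OF \<A> that] by simp
  show "integrable (mixed \<omega> k q) (ker \<A> q h)"
    by (rule integral_ker(1)[OF fin s c])
  show "(\<integral>x. ker \<A> q h x \<partial>mixed \<omega> k q) = wsum \<A> (\<lambda>_. 1) q (\<lambda>z. h z *
      (charlier (\<lambda>_. 0) (take k z) (counts \<A> \<omega>) * prod_list (map (measure \<mu>) (drop k z))))"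
    by (rule integral_ker(2)[OF fin s c])
qed

lemma pathwise_integral_mixed:
  assumes p: "proper \<omega>" and f: "\<And>k. k \<le> q \<Longrightarrow> integrable (mixed \<omega> k q) f"
  shows "pathwise_integral \<mu> \<eta> q f \<omega>
    = (\<Sum>k\<le>q. (- 1) ^ (q - k) * real (q choose k) * (\<integral>x. f x \<partial>mixed \<omega> k q))"
proof -
  interpret e: enumerated_measure \<mu> "\<eta> \<omega>" using p by (simp add: proper_def)
  show ?thesis
    unfolding pathwise_integral_def by (intro sum.cong refl) (simp add: e.integral_mixed f)
qed

text \<open>The bridge from the definition of the multiple integral to the discrete calculus:
  evaluated box by box, the pathwise formula becomes the inclusion-exclusion form of the chaos
  polynomial.\<close>

lemma pathwise_integral_ker:
  assumes \<A>: "cells \<mu> \<A>" and h: "sym_kernel h"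
  shows "AE \<omega> in M. pathwise_integral \<mu> \<eta> q (ker \<A> q h) \<omega> = chaos \<A> (measure \<mu>) q h (counts \<A> \<omega>)"
  using AE_proper AE_counts[OF \<A>]
proof eventually_elim
  case (elim \<omega>)
  have "pathwise_integral \<mu> \<eta> q (ker \<A> q h) \<omega>
      = (\<Sum>k\<le>q. (- 1) ^ (q - k) * real (q choose k) * (\<integral>x. ker \<A> q h x \<partial>mixed \<omega> k q))"
    by (rule pathwise_integral_mixed[OF elim(1)]) (rule integral_ker_mixed(1)[OF \<A> _ elim])
  also have "\<dots> = chaos \<A> (measure \<mu>) q h (counts \<A> \<omega>)"
    unfolding chaos_inclusion_exclusion[OF h]
    by (intro sum.cong refl) (simp add: integral_ker_mixed(2)[OF \<A> _ elim] mult.assoc)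
  finally show ?case .
qed

end

section \<open>The mean of the factorial measures\<close>

text \<open>Factorial moments: the Mecke equation removes one letter at a time.\<close>

lemma (in poisson_vector) expectation_falling:
  "set z \<subseteq> I \<Longrightarrow> E (charlier (\<lambda>_. 0) z) = prod_list (map lam z)"
proof (induction z)
  case (Cons i z)
  have "E (charlier (\<lambda>_. 0) (i # z)) = E (\<lambda>x. real (x i) * charlier (\<lambda>_. 0) z (lower i x))"
    by (simp add: create_def[abs_def])
  also have "\<dots> = lam i * E (charlier (\<lambda>_. 0) z)"
    using Cons.prems by (intro mecke tempered_charlier finite_I) auto
  finally show ?case using Cons by simp
qed simp

lemma (in poisson_vector) expectation_wsum:
  assumes "\<And>z. set z \<subseteq> I \<Longrightarrow> length z = n \<Longrightarrow> tempered I (f z)"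
  shows "E (\<lambda>x. wsum I (\<lambda>_. 1) n (\<lambda>z. f z x)) = wsum I (\<lambda>_. 1) n (\<lambda>z. E (f z))"
    and "tempered I (\<lambda>x. wsum I (\<lambda>_. 1) n (\<lambda>z. f z x))"
  unfolding wsum_const_one[OF finite_I]
  using assms by (auto intro!: Bochner_Integration.integral_sum integrable_tempered tempered_sum)

text \<open>The sides of the box may overlap or coincide; on a common refinement of the sides the
  box is a union of boxes of cells.\<close>

lemma box_ker:
  assumes "\<And>j. j < q \<Longrightarrow> B j \<in> sets \<mu> \<and> emeasure \<mu> (B j) < \<infinity>"
  shows "\<exists>\<C> h. cells \<mu> \<C> \<and> (\<forall>z. h z \<ge> 0) \<and> (\<forall>x. indicator (PiE {..<q} B) x = ker \<C> q h x)"
proof -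
  obtain \<C> where \<C>: "cells \<mu> \<C>" "subdivides \<C> (B ` {..<q})"
    using ex_refinement[of "B ` {..<q}" \<mu>] assms by auto
  define h where "h z = (if \<forall>j<q. z ! j \<subseteq> B j then 1 else 0 :: real)" for z
  have "indicator (PiE {..<q} B) x = ker \<C> q h x" for x
  proof (cases "x \<in> PiE {..<q} B")
    case True
    have "\<exists>C\<in>\<C>. C \<subseteq> B j \<and> x j \<in> C" if "j < q" for j
    proof -
      have "B j \<subseteq> \<Union>{C\<in>\<C>. C \<subseteq> B j}" using \<C>(2) that unfolding subdivides_def by blast
      moreover have "x j \<in> B j" using True that by auto
      ultimately show ?thesis by blast
    qed
    then obtain c where c: "\<And>j. j < q \<Longrightarrow> c j \<in> \<C> \<and> c j \<subseteq> B j \<and> x j \<in> c j" by metis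
    have z: "set (map c [0..<q]) \<subseteq> \<C>" "length (map c [0..<q]) = q" "x \<in> PiE {..<q} (\<lambda>j. map c [0..<q] ! j)"
      using c True by (auto simp: PiE_iff)
    have "h (map c [0..<q]) = 1" using c by (simp add: h_def)
    then show ?thesis using ker_cell[OF \<C>(1) z] True by simp
  next
    case False
    show ?thesis
    proof (cases "\<exists>z. set z \<subseteq> \<C> \<and> length z = q \<and> x \<in> PiE {..<q} (\<lambda>j. z ! j)")
      case True
      then obtain z where z: "set z \<subseteq> \<C>" "length z = q" "x \<in> PiE {..<q} (\<lambda>j. z ! j)" by blast
      have "\<not> (\<forall>j<q. z ! j \<subseteq> B j)"
      proof
        assume "\<forall>j<q. z ! j \<subseteq> B j"
        then have "PiE {..<q} (\<lambda>j. z ! j) \<subseteq> PiE {..<q} B" by (intro PiE_mono) auto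
        then show False using z False by blast
      qed
      then show ?thesis using ker_cell[OF \<C>(1) z] False by (simp add: h_def)
    next
      case F: False
      then have "ker \<C> q h x = 0" by (intro ker_outside) blast
      then show ?thesis using False by simp
    qed
  qed
  then show ?thesis using \<C>(1) by (intro exI[of _ \<C>] exI[of _ h]) (simp add: h_def)
qed

text \<open>Dynkin's principle: boxes are stable under intersection and generate, so closure under
  complements and countable disjoint unions suffices.\<close>

lemma power_measure_induct [consumes 1, case_names box empty compl union]:
  assumes "S \<in> sets (power_measure \<mu> q)"
    and box: "\<And>X. (\<And>j. X j \<in> sets \<mu>) \<Longrightarrow> P (PiE {..<q} X)"
    and empty: "P {}"
    and compl: "\<And>A. A \<in> sets (power_measure \<mu> q) \<Longrightarrow> P A \<Longrightarrow> P (space (power_measure \<mu> q) - A)"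
    and union: "\<And>A. disjoint_family A \<Longrightarrow> range A \<subseteq> sets (power_measure \<mu> q) \<Longrightarrow> (\<And>i. P (A i)) \<Longrightarrow> P (\<Union>i::nat. A i)"
  shows "P S"
proof -
  define G where "G = {PiE {..<q} X | X. \<forall>j. X j \<in> sets \<mu>}"
  have Gs: "G \<subseteq> Pow (space (power_measure \<mu> q))"
  proof
    fix A assume "A \<in> G"
    then obtain X where X: "A = PiE {..<q} X" "\<And>j. X j \<in> sets \<mu>" by (auto simp: G_def)
    have "PiE {..<q} X \<subseteq> PiE {..<q} (\<lambda>_. space \<mu>)"
      by (rule PiE_mono) (rule sets.sets_into_space[OF X(2)])
    then show "A \<in> Pow (space (power_measure \<mu> q))" by (simp add: X(1) space_PiM)
  qed
  have eq: "sets (power_measure \<mu> q) = sigma_sets (space (power_measure \<mu> q)) G"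
  proof -
    have "sets (power_measure \<mu> q) = sigma_sets (space (power_measure \<mu> q)) (prod_algebra {..<q} (\<lambda>_. \<mu>))"
      by (simp add: sets_PiM space_PiM)
    also have "prod_algebra {..<q} (\<lambda>_. \<mu>) = G"
      unfolding G_def prod_algebra_eq_finite[OF finite_lessThan]
    proof (intro set_eqI iffI)
      fix A assume "A \<in> {Pi\<^sub>E {..<q} X |X. X \<in> (\<Pi> j\<in>{..<q}. sets \<mu>)}"
      then obtain X where X: "A = PiE {..<q} X" "\<And>j. j < q \<Longrightarrow> X j \<in> sets \<mu>" by auto
      have "A = PiE {..<q} (\<lambda>j. if j < q then X j else {})" unfolding X(1) by (rule PiE_cong) simp
      then show "A \<in> {Pi\<^sub>E {..<q} X |X. \<forall>j. X j \<in> sets \<mu>}"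
        using X(2) by (intro CollectI exI[of _ "\<lambda>j. if j < q then X j else {}"]) simp
    qed auto
    finally show ?thesis .
  qed
  have int: "Int_stable G"
  proof (rule Int_stableI)
    fix a b assume "a \<in> G" "b \<in> G"
    then obtain X Y where XY: "a = PiE {..<q} X" "b = PiE {..<q} Y" "\<forall>j. X j \<in> sets \<mu>" "\<forall>j. Y j \<in> sets \<mu>"
      by (auto simp: G_def)
    then show "a \<inter> b \<in> G"
      unfolding G_def by (intro CollectI exI[of _ "\<lambda>j. X j \<inter> Y j"]) (auto simp: PiE_Int)
  qed
  show ?thesis
    using int Gs assms(1)[unfolded eq]
  proof (induction rule: sigma_sets_induct_disjoint)
    case (basic A)
    then show ?case using box by (auto simp: G_def)
  next
    case (compl A)
    then show ?case using assms(4)[of A] by (simp add: eq)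
  next
    case (union A)
    then show ?case using assms(5)[of A] by (simp add: eq)
  qed (rule empty)
qed

context poisson_random_measure
begin

text \<open>The mean of the mixed measure is the power measure. A measurable \<open>\<Phi>\<close>
  stands in for the inner integral, because the latter goes through a choice of enumeration for each
  \<open>\<omega>\<close> and so its measurability in \<open>\<omega>\<close> is not
  immediate.\<close>

definition mean_eq :: "nat \<Rightarrow> nat \<Rightarrow> ((nat \<Rightarrow> 'z) \<Rightarrow> ennreal) \<Rightarrow> bool" where
  "mean_eq k q f \<longleftrightarrow> (\<exists>\<Phi>\<in>borel_measurable M. (AE \<omega> in M. (\<integral>\<^sup>+x. f x \<partial>mixed \<omega> k q) = \<Phi> \<omega>) \<and>
     (\<integral>\<^sup>+\<omega>. \<Phi> \<omega> \<partial>M) = (\<integral>\<^sup>+x. f x \<partial>power_measure \<mu> q))"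

lemma mixed_proper:
  assumes "proper \<omega>"
  shows "sets (mixed \<omega> k q) = sets (power_measure \<mu> q)"
    "space (mixed \<omega> k q) = space (power_measure \<mu> q)"
    "measurable (mixed \<omega> k q) N = measurable (power_measure \<mu> q) N"
proof -
  interpret e: enumerated_measure \<mu> "\<eta> \<omega>" using assms by (simp add: proper_def)
  show "sets (mixed \<omega> k q) = sets (power_measure \<mu> q)" by simp
  then show "space (mixed \<omega> k q) = space (power_measure \<mu> q)" by (rule sets_eq_imp_space_eq)
  show "measurable (mixed \<omega> k q) N = measurable (power_measure \<mu> q) N" by simp
qed

lemma mean_eqE:
  assumes "mean_eq k q f"
  obtains \<Phi> where "\<Phi> \<in> borel_measurable M" "AE \<omega> in M. proper \<omega> \<and> (\<integral>\<^sup>+x. f x \<partial>mixed \<omega> k q) = \<Phi> \<omega>"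
    "(\<integral>\<^sup>+\<omega>. \<Phi> \<omega> \<partial>M) = (\<integral>\<^sup>+x. f x \<partial>power_measure \<mu> q)"
  using assms AE_proper unfolding mean_eq_def by auto

lemma mean_eqI:
  assumes "\<Phi> \<in> borel_measurable M" "AE \<omega> in M. proper \<omega> \<longrightarrow> (\<integral>\<^sup>+x. f x \<partial>mixed \<omega> k q) = \<Phi> \<omega>"
    "(\<integral>\<^sup>+\<omega>. \<Phi> \<omega> \<partial>M) = (\<integral>\<^sup>+x. f x \<partial>power_measure \<mu> q)"
  shows "mean_eq k q f"
  unfolding mean_eq_def using assms AE_proper by (intro bexI[of _ \<Phi>]) auto

lemma mean_eq_cong:
  assumes "\<And>x. x \<in> space (power_measure \<mu> q) \<Longrightarrow> f x = g x" "mean_eq k q f"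
  shows "mean_eq k q g"
proof -
  obtain \<Phi> where \<Phi>: "\<Phi> \<in> borel_measurable M" "AE \<omega> in M. proper \<omega> \<and> (\<integral>\<^sup>+x. f x \<partial>mixed \<omega> k q) = \<Phi> \<omega>"
    "(\<integral>\<^sup>+\<omega>. \<Phi> \<omega> \<partial>M) = (\<integral>\<^sup>+x. f x \<partial>power_measure \<mu> q)" using mean_eqE[OF assms(2)] .
  have "(\<integral>\<^sup>+x. f x \<partial>power_measure \<mu> q) = (\<integral>\<^sup>+x. g x \<partial>power_measure \<mu> q)"
    using assms(1) by (rule nn_integral_cong)
  moreover have "(\<integral>\<^sup>+x. f x \<partial>mixed \<omega> k q) = (\<integral>\<^sup>+x. g x \<partial>mixed \<omega> k q)" if "proper \<omega>" for \<omega>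
    by (rule nn_integral_cong) (simp add: mixed_proper[OF that] assms(1))
  ultimately show ?thesis using \<Phi> by (intro mean_eqI[of \<Phi>]) auto
qed

text \<open>For a simple kernel the inner integral is almost surely a polynomial in the counts,
  whose mean consists of factorial moments.\<close>

lemma mean_eq_ker:
  assumes \<A>: "cells \<mu> \<A>" and h: "\<And>z. h z \<ge> 0" and k: "k \<le> q"
  shows "mean_eq k q (\<lambda>x. ennreal (ker \<A> q h x))"
proof -
  interpret P: poisson_vector "counts_pmf \<A>" \<A> "measure \<mu>" by (rule poisson_vector_counts[OF \<A>])
  define W where "W x = wsum \<A> (\<lambda>_. 1) q (\<lambda>z. h z *
      (charlier (\<lambda>_. 0) (take k z) x * prod_list (map (measure \<mu>) (drop k z))))" for x
  have kpos: "ker \<A> q h x \<ge> 0" for x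
    unfolding ker_def by (intro wsum_nonneg) (use h in auto)
  have t: "tempered \<A> (\<lambda>x. h z * (charlier (\<lambda>_. 0) (take k z) x * prod_list (map (measure \<mu>) (drop k z))))"
    if "set z \<subseteq> \<A>" for z
    using that set_take_subset[of k z]
    by (intro tempered_scale tempered_mult tempered_charlier tempered_const P.finite_I) auto
  have tW: "tempered \<A> W" unfolding W_def[abs_def] by (rule P.expectation_wsum(2)) (rule t)
  have EW: "P.E W = wsum \<A> (measure \<mu>) q h"
  proof -
    have "P.E W = wsum \<A> (\<lambda>_. 1) q (\<lambda>z. P.E (\<lambda>x. h z * (charlier (\<lambda>_. 0) (take k z) x * prod_list (map (measure \<mu>) (drop k z)))))"
      unfolding W_def[abs_def] by (rule P.expectation_wsum(1)) (rule t)
    also have "\<dots> = wsum \<A> (\<lambda>_. 1) q (\<lambda>z. prod_list (map (measure \<mu>) z) * h z)"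
    proof (rule wsum_cong)
      fix z assume z: "set z \<subseteq> \<A>" "length z = q"
      then have "P.E (charlier (\<lambda>_. 0) (take k z)) = prod_list (map (measure \<mu>) (take k z))"
        using set_take_subset[of k z] by (intro P.expectation_falling) auto
      moreover have "prod_list (map (measure \<mu>) (take k z)) * prod_list (map (measure \<mu>) (drop k z)) = prod_list (map (measure \<mu>) z)"
        by (metis append_take_drop_id map_append prod_list.append)
      ultimately show "P.E (\<lambda>x. h z * (charlier (\<lambda>_. 0) (take k z) x * prod_list (map (measure \<mu>) (drop k z))))
        = prod_list (map (measure \<mu>) z) * h z" by (simp add: ac_simps)
    qed
    finally show ?thesis by (simp add: wsum_weight[of _ "measure \<mu>"])
  qed
  have mixed_W: "AE \<omega> in M. integrable (mixed \<omega> k q) (ker \<A> q h) \<and> (\<integral>x. ker \<A> q h x \<partial>mixed \<omega> k q) = W (counts \<A> \<omega>)"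
    using AE_proper AE_counts[OF \<A>]
  proof eventually_elim
    case (elim \<omega>)
    then show ?case unfolding W_def using integral_ker_mixed[OF \<A> k elim] by simp
  qed
  have nn: "AE \<omega> in M. (\<integral>\<^sup>+x. ennreal (ker \<A> q h x) \<partial>mixed \<omega> k q) = ennreal (W (counts \<A> \<omega>))"
    using mixed_W by eventually_elim (simp add: nn_integral_eq_integral kpos)
  have Wpos: "AE \<omega> in M. 0 \<le> W (counts \<A> \<omega>)"
    using mixed_W
  proof eventually_elim
    case (elim \<omega>)
    have "0 \<le> (\<integral>x. ker \<A> q h x \<partial>mixed \<omega> k q)"
      by (rule Bochner_Integration.integral_nonneg) (rule kpos)
    then show ?case using elim by simp
  qed
  have "(\<integral>\<^sup>+\<omega>. ennreal (W (counts \<A> \<omega>)) \<partial>M) = ennreal (expectation (\<lambda>\<omega>. W (counts \<A> \<omega>)))"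
    using Wpos P.integrable_tempered[OF tW] by (intro nn_integral_eq_integral) (auto simp: integrable_counts[OF \<A>])
  also have "expectation (\<lambda>\<omega>. W (counts \<A> \<omega>)) = wsum \<A> (measure \<mu>) q h"
    using EW expectation_counts[OF \<A>, of W] by simp
  also have "ennreal \<dots> = (\<integral>\<^sup>+x. ennreal (ker \<A> q h x) \<partial>power_measure \<mu> q)"
    using control.integral_ker_power[OF \<A>, of q h] kpos by (simp add: nn_integral_eq_integral)
  finally have EE: "(\<integral>\<^sup>+\<omega>. ennreal (W (counts \<A> \<omega>)) \<partial>M) = (\<integral>\<^sup>+x. ennreal (ker \<A> q h x) \<partial>power_measure \<mu> q)" .
  have "(\<lambda>\<omega>. W (counts \<A> \<omega>)) \<in> borel_measurable M"
    using measurable_compose[OF counts_measurable[OF \<A>], of W borel] by simp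
  then show ?thesis
    using nn EE by (intro mean_eqI[of "\<lambda>\<omega>. ennreal (W (counts \<A> \<omega>))"]) auto
qed

text \<open>Finiteness permits subtraction in \<open>[0,\<infinity>]\<close>; this is why
  complements are later taken inside sets of finite measure.\<close>

lemma mean_eq_diff:
  assumes f: "f \<in> borel_measurable (power_measure \<mu> q)" and g: "g \<in> borel_measurable (power_measure \<mu> q)"
    and le: "\<And>x. g x \<le> f x" and fin: "(\<integral>\<^sup>+x. f x \<partial>power_measure \<mu> q) < \<infinity>"
    and mf: "mean_eq k q f" and mg: "mean_eq k q g"
  shows "mean_eq k q (\<lambda>x. f x - g x)"
proof -
  obtain \<Phi> where \<Phi>: "\<Phi> \<in> borel_measurable M" "AE \<omega> in M. proper \<omega> \<and> (\<integral>\<^sup>+x. f x \<partial>mixed \<omega> k q) = \<Phi> \<omega>"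
    "(\<integral>\<^sup>+\<omega>. \<Phi> \<omega> \<partial>M) = (\<integral>\<^sup>+x. f x \<partial>power_measure \<mu> q)" using mean_eqE[OF mf] .
  obtain \<Psi> where \<Psi>: "\<Psi> \<in> borel_measurable M" "AE \<omega> in M. proper \<omega> \<and> (\<integral>\<^sup>+x. g x \<partial>mixed \<omega> k q) = \<Psi> \<omega>"
    "(\<integral>\<^sup>+\<omega>. \<Psi> \<omega> \<partial>M) = (\<integral>\<^sup>+x. g x \<partial>power_measure \<mu> q)" using mean_eqE[OF mg] .
  have "(\<integral>\<^sup>+x. g x \<partial>power_measure \<mu> q) \<le> (\<integral>\<^sup>+x. f x \<partial>power_measure \<mu> q)" using le by (intro nn_integral_mono)
  then have gfin: "(\<integral>\<^sup>+x. g x \<partial>power_measure \<mu> q) < \<infinity>" using fin by simp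
  then have "AE \<omega> in M. \<Psi> \<omega> \<noteq> \<infinity>"
    using \<Psi>(1,3) by (intro nn_integral_PInf_AE) auto
  with \<Phi>(2) \<Psi>(2) have AE: "AE \<omega> in M. (\<integral>\<^sup>+x. f x - g x \<partial>mixed \<omega> k q) = \<Phi> \<omega> - \<Psi> \<omega> \<and> \<Psi> \<omega> \<le> \<Phi> \<omega>"
  proof eventually_elim
    case (elim \<omega>)
    then have p: "proper \<omega>" by simp
    have "(\<integral>\<^sup>+x. f x - g x \<partial>mixed \<omega> k q) = (\<integral>\<^sup>+x. f x \<partial>mixed \<omega> k q) - (\<integral>\<^sup>+x. g x \<partial>mixed \<omega> k q)"
      using elim le f g by (intro nn_integral_diff) (auto simp: mixed_proper[OF p])
    moreover have "(\<integral>\<^sup>+x. g x \<partial>mixed \<omega> k q) \<le> (\<integral>\<^sup>+x. f x \<partial>mixed \<omega> k q)" using le by (intro nn_integral_mono)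
    ultimately show ?case using elim by simp
  qed
  have "(\<integral>\<^sup>+\<omega>. \<Phi> \<omega> - \<Psi> \<omega> \<partial>M) = (\<integral>\<^sup>+\<omega>. \<Phi> \<omega> \<partial>M) - (\<integral>\<^sup>+\<omega>. \<Psi> \<omega> \<partial>M)"
    using AE \<Phi>(1) \<Psi>(1,3) gfin by (intro nn_integral_diff) auto
  also have "\<dots> = (\<integral>\<^sup>+x. f x - g x \<partial>power_measure \<mu> q)"
    unfolding \<Phi>(3) \<Psi>(3) using f g gfin le by (intro nn_integral_diff[symmetric]) auto
  finally show ?thesis
    using AE \<Phi>(1) \<Psi>(1) by (intro mean_eqI[of "\<lambda>\<omega>. \<Phi> \<omega> - \<Psi> \<omega>"]) auto
qed

lemma mean_eq_add:
  assumes f: "f \<in> borel_measurable (power_measure \<mu> q)" and g: "g \<in> borel_measurable (power_measure \<mu> q)"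
    and mf: "mean_eq k q f" and mg: "mean_eq k q g"
  shows "mean_eq k q (\<lambda>x. f x + g x)"
proof -
  obtain \<Phi> where \<Phi>: "\<Phi> \<in> borel_measurable M" "AE \<omega> in M. proper \<omega> \<and> (\<integral>\<^sup>+x. f x \<partial>mixed \<omega> k q) = \<Phi> \<omega>"
    "(\<integral>\<^sup>+\<omega>. \<Phi> \<omega> \<partial>M) = (\<integral>\<^sup>+x. f x \<partial>power_measure \<mu> q)" using mean_eqE[OF mf] .
  obtain \<Psi> where \<Psi>: "\<Psi> \<in> borel_measurable M" "AE \<omega> in M. proper \<omega> \<and> (\<integral>\<^sup>+x. g x \<partial>mixed \<omega> k q) = \<Psi> \<omega>"
    "(\<integral>\<^sup>+\<omega>. \<Psi> \<omega> \<partial>M) = (\<integral>\<^sup>+x. g x \<partial>power_measure \<mu> q)" using mean_eqE[OF mg] .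
  have "AE \<omega> in M. (\<integral>\<^sup>+x. f x + g x \<partial>mixed \<omega> k q) = \<Phi> \<omega> + \<Psi> \<omega>"
    using \<Phi>(2) \<Psi>(2)
  proof eventually_elim
    case (elim \<omega>)
    then have p: "proper \<omega>" by simp
    show ?case using elim f g by (subst nn_integral_add) (auto simp: mixed_proper[OF p])
  qed
  then show ?thesis
    using f g \<Phi>(1,3) \<Psi>(1,3) by (intro mean_eqI[of "\<lambda>\<omega>. \<Phi> \<omega> + \<Psi> \<omega>"]) (auto simp: nn_integral_add)
qed

lemma mean_eq_cmult:
  assumes f: "f \<in> borel_measurable (power_measure \<mu> q)" and mf: "mean_eq k q f"
  shows "mean_eq k q (\<lambda>x. c * f x)"
proof -
  obtain \<Phi> where \<Phi>: "\<Phi> \<in> borel_measurable M" "AE \<omega> in M. proper \<omega> \<and> (\<integral>\<^sup>+x. f x \<partial>mixed \<omega> k q) = \<Phi> \<omega>"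
    "(\<integral>\<^sup>+\<omega>. \<Phi> \<omega> \<partial>M) = (\<integral>\<^sup>+x. f x \<partial>power_measure \<mu> q)" using mean_eqE[OF mf] .
  have "AE \<omega> in M. (\<integral>\<^sup>+x. c * f x \<partial>mixed \<omega> k q) = c * \<Phi> \<omega>"
    using \<Phi>(2)
  proof eventually_elim
    case (elim \<omega>)
    then have p: "proper \<omega>" by simp
    show ?case using elim f by (subst nn_integral_cmult) (auto simp: mixed_proper[OF p])
  qed
  then show ?thesis
    using f \<Phi>(1,3) by (intro mean_eqI[of "\<lambda>\<omega>. c * \<Phi> \<omega>"]) (auto simp: nn_integral_cmult)
qed

lemma mean_eq_SUP:
  assumes f: "\<And>i. f i \<in> borel_measurable (power_measure \<mu> q)" and inc: "incseq f"
    and mf: "\<And>i. mean_eq k q (f i)"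
  shows "mean_eq k q (\<lambda>x. SUP i :: nat. f i x)"
proof -
  have "\<forall>i. \<exists>\<Phi>. \<Phi> \<in> borel_measurable M \<and> (AE \<omega> in M. proper \<omega> \<and> (\<integral>\<^sup>+x. f i x \<partial>mixed \<omega> k q) = \<Phi> \<omega>) \<and>
     (\<integral>\<^sup>+\<omega>. \<Phi> \<omega> \<partial>M) = (\<integral>\<^sup>+x. f i x \<partial>power_measure \<mu> q)"
  proof
    fix i
    show "\<exists>\<Phi>. \<Phi> \<in> borel_measurable M \<and> (AE \<omega> in M. proper \<omega> \<and> (\<integral>\<^sup>+x. f i x \<partial>mixed \<omega> k q) = \<Phi> \<omega>) \<and>
     (\<integral>\<^sup>+\<omega>. \<Phi> \<omega> \<partial>M) = (\<integral>\<^sup>+x. f i x \<partial>power_measure \<mu> q)"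
      by (rule mean_eqE[OF mf[of i]]) (intro exI conjI)
  qed
  from choice[OF this] obtain \<Phi> where \<Phi>: "\<And>i. \<Phi> i \<in> borel_measurable M"
    "\<And>i. AE \<omega> in M. proper \<omega> \<and> (\<integral>\<^sup>+x. f i x \<partial>mixed \<omega> k q) = \<Phi> i \<omega>"
    "\<And>i. (\<integral>\<^sup>+\<omega>. \<Phi> i \<omega> \<partial>M) = (\<integral>\<^sup>+x. f i x \<partial>power_measure \<mu> q)" by blast
  have all: "AE \<omega> in M. \<forall>i. proper \<omega> \<and> (\<integral>\<^sup>+x. f i x \<partial>mixed \<omega> k q) = \<Phi> i \<omega>"
    using \<Phi>(2) by (simp add: AE_all_countable)
  have mono: "AE \<omega> in M. \<Phi> i \<omega> \<le> \<Phi> (Suc i) \<omega>" for i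
    using all
  proof eventually_elim
    case (elim \<omega>)
    have "(\<integral>\<^sup>+x. f i x \<partial>mixed \<omega> k q) \<le> (\<integral>\<^sup>+x. f (Suc i) x \<partial>mixed \<omega> k q)"
      using inc by (intro nn_integral_mono) (auto simp: incseq_Suc_iff le_fun_def)
    then show ?case using elim by metis
  qed
  have "AE \<omega> in M. (\<integral>\<^sup>+x. (SUP i. f i x) \<partial>mixed \<omega> k q) = (SUP i. \<Phi> i \<omega>)"
    using all
  proof eventually_elim
    case (elim \<omega>)
    then have p: "proper \<omega>" by simp
    have "(\<integral>\<^sup>+x. (SUP i. f i x) \<partial>mixed \<omega> k q) = (SUP i. \<integral>\<^sup>+x. f i x \<partial>mixed \<omega> k q)"
      using inc f by (intro nn_integral_monotone_convergence_SUP) (auto simp: mixed_proper[OF p])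
    then show ?case using elim by simp
  qed
  moreover have "(\<integral>\<^sup>+\<omega>. (SUP i. \<Phi> i \<omega>) \<partial>M) = (SUP i. \<integral>\<^sup>+\<omega>. \<Phi> i \<omega> \<partial>M)"
    by (rule nn_integral_monotone_convergence_SUP_AE) (rule mono \<Phi>(1))+
  moreover have "(SUP i. \<integral>\<^sup>+\<omega>. \<Phi> i \<omega> \<partial>M) = (\<integral>\<^sup>+x. (SUP i. f i x) \<partial>power_measure \<mu> q)"
    unfolding \<Phi>(3) using inc f by (intro nn_integral_monotone_convergence_SUP[symmetric]) auto
  ultimately show ?thesis
    using \<Phi>(1) by (intro mean_eqI[of "\<lambda>\<omega>. SUP i. \<Phi> i \<omega>"]) auto
qed

lemma mean_eq_suminf:
  assumes f: "\<And>i. f i \<in> borel_measurable (power_measure \<mu> q)" and mf: "\<And>i. mean_eq k q (f i)"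
  shows "mean_eq k q (\<lambda>x. \<Sum>i. f i x)"
proof -
  have "mean_eq k q (\<lambda>x. \<Sum>i<n. f i x)" for n
  proof (induction n)
    case 0
    show ?case by (rule mean_eqI[of "\<lambda>_. 0"]) auto
  next
    case (Suc n)
    then show ?case using f mf by (simp add: mean_eq_add)
  qed
  moreover have "incseq (\<lambda>n x. \<Sum>i<n. f i x)"
    by (intro incseq_SucI le_funI) simp
  ultimately have "mean_eq k q (\<lambda>x. SUP n. \<Sum>i<n. f i x)"
    using mean_eq_SUP[of "\<lambda>n x. \<Sum>i<n. f i x" q k] f by simp
  then show ?thesis by (simp add: suminf_eq_SUP)
qed

text \<open>A Mecke-type formula for mixed measures of any order \<open>k\<close>. Complements are
  handled inside the boxes \<open>V n\<close> of finite measure, monotone limits remove this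
  localization, and measurable functions follow by the standard induction.\<close>

lemma mean_eq_all:
  assumes k: "k \<le> q" and f: "f \<in> borel_measurable (power_measure \<mu> q)"
  shows "mean_eq k q f"
proof -
  obtain W :: "nat \<Rightarrow> 'z set" where W: "range W \<subseteq> sets \<mu>" "(\<Union>i. W i) = space \<mu>"
    "\<And>i. emeasure \<mu> (W i) \<noteq> \<infinity>" "incseq W"
    using control.sigma_finite_incseq by blast
  define V where "V n = PiE {..<q} (\<lambda>_. W n)" for n
  have W': "W n \<in> sets \<mu>" "emeasure \<mu> (W n) < \<infinity>" for n using W(1,3) by (auto simp: less_top)
  have Vs: "V n \<in> sets (power_measure \<mu> q)" for n
    unfolding V_def using W' by (intro sets_PiM_I_finite) auto
  have box: "mean_eq k q (indicator (PiE {..<q} B))" and box_fin: "(\<integral>\<^sup>+x. indicator (PiE {..<q} B) x \<partial>power_measure \<mu> q) < \<infinity>"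
    if B: "\<And>j. j < q \<Longrightarrow> B j \<in> sets \<mu> \<and> emeasure \<mu> (B j) < \<infinity>" for B
  proof -
    obtain \<C> h where Ch: "cells \<mu> \<C>" "\<And>z. h z \<ge> 0" "\<And>x. indicator (PiE {..<q} B) x = ker \<C> q h x"
      using box_ker[of q B \<mu>, OF B] by blast
    have eq: "(indicator (PiE {..<q} B) :: _ \<Rightarrow> ennreal) = (\<lambda>x. ennreal (ker \<C> q h x))"
      by (rule ext) (metis Ch(3) ennreal_indicator)
    have kpos: "0 \<le> ker \<C> q h x" for x unfolding Ch(3)[symmetric] by simp
    show "mean_eq k q (indicator (PiE {..<q} B))"
      unfolding eq by (rule mean_eq_ker[OF Ch(1,2) k])
    show "(\<integral>\<^sup>+x. indicator (PiE {..<q} B) x \<partial>power_measure \<mu> q) < \<infinity>"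
      unfolding eq using control.integral_ker_power(1)[OF Ch(1), of q h] kpos
      by (simp add: nn_integral_eq_integral)
  qed
  have mV: "mean_eq k q (indicator (V n))" and fV: "(\<integral>\<^sup>+x. indicator (V n) x \<partial>power_measure \<mu> q) < \<infinity>" for n
    unfolding V_def by (rule box box_fin; use W'[of n] in simp)+
  have set: "mean_eq k q (indicator (S \<inter> V n))" if "S \<in> sets (power_measure \<mu> q)" for S n
    using that
  proof (induction rule: power_measure_induct)
    case (box X)
    have "PiE {..<q} X \<inter> V n = PiE {..<q} (\<lambda>j. X j \<inter> W n)" unfolding V_def by (rule PiE_Int)
    moreover have "X j \<inter> W n \<in> sets \<mu> \<and> emeasure \<mu> (X j \<inter> W n) < \<infinity>" for j
      using box W'[of n] emeasure_mono[of "X j \<inter> W n" "W n" \<mu>] by (auto intro: le_less_trans)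
    ultimately show ?case using \<open>\<And>B. (\<And>j. j < q \<Longrightarrow> B j \<in> sets \<mu> \<and> emeasure \<mu> (B j) < \<infinity>) \<Longrightarrow> mean_eq k q (indicator (PiE {..<q} B))\<close> by simp
  next
    case empty
    have "mean_eq k q (\<lambda>x. 0)" by (rule mean_eqI[of "\<lambda>_. 0"]) auto
    then show ?case by (simp add: indicator_def[abs_def])
  next
    case (compl A)
    have "mean_eq k q (\<lambda>x. indicator (V n) x - indicator (A \<inter> V n) x)"
      using compl Vs by (intro mean_eq_diff mV fV compl) (auto simp: indicator_def split: if_splits)
    moreover have "indicator (V n) x - indicator (A \<inter> V n) x = (indicator ((space (power_measure \<mu> q) - A) \<inter> V n) x :: ennreal)"
      if "x \<in> space (power_measure \<mu> q)" for x
      using that by (auto simp: indicator_def)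
    ultimately show ?case by (rule mean_eq_cong[rotated])
  next
    case (union A)
    have "mean_eq k q (\<lambda>x. \<Sum>i. indicator (A i \<inter> V n) x)"
      using union Vs by (intro mean_eq_suminf) auto
    moreover have "(\<Sum>i. indicator (A i \<inter> V n) x) = (indicator ((\<Union>i. A i) \<inter> V n) x :: ennreal)" for x
    proof -
      have "disjoint_family (\<lambda>i. A i \<inter> V n)" using union(1) by (auto simp: disjoint_family_on_def)
      then have "(\<Sum>i. indicator (A i \<inter> V n) x) = (indicator (\<Union>i. A i \<inter> V n) x :: ennreal)"
        by (rule suminf_indicator)
      then show ?thesis by (simp add: Int_UN_distrib2)
    qed
    ultimately show ?case by simp
  qed
  have incV: "incseq V"
    unfolding V_def using W(4) by (auto simp: incseq_def intro!: PiE_mono)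
  have UV: "(\<Union>n. V n) = space (power_measure \<mu> q)"
  proof (intro equalityI subsetI)
    fix x assume x: "x \<in> space (power_measure \<mu> q)"
    have "\<exists>n. x j \<in> W n" if "j < q" for j using x that W(2) by (auto simp: space_PiM PiE_iff)
    then obtain n where n: "\<And>j. j < q \<Longrightarrow> x j \<in> W (n j)" by metis
    have "x j \<in> W (Max (n ` {..<q}))" if "j < q" for j
    proof -
      have "W (n j) \<subseteq> W (Max (n ` {..<q}))"
        by (rule incseqD[OF W(4)], rule Max_ge) (use that in auto)
      then show ?thesis using n[OF that] by blast
    qed
    then show "x \<in> (\<Union>n. V n)" using x by (auto simp: V_def space_PiM PiE_iff)
  qed (use Vs sets.sets_into_space in blast)
  have set': "mean_eq k q (indicator S)" if S: "S \<in> sets (power_measure \<mu> q)" for S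
  proof -
    have "incseq (\<lambda>n x. indicator (S \<inter> V n) x :: ennreal)"
      using incV by (auto simp: incseq_def le_fun_def indicator_def)
    then have "mean_eq k q (\<lambda>x. SUP n. indicator (S \<inter> V n) x)"
      using mean_eq_SUP[of "\<lambda>n x. indicator (S \<inter> V n) x" q k] S Vs set[OF S] by simp
    moreover have "(SUP n. indicator (S \<inter> V n) x) = (indicator S x :: ennreal)" if x: "x \<in> space (power_measure \<mu> q)" for x
    proof -
      obtain n where "x \<in> V n" using x UV by blast
      then show ?thesis
        by (intro antisym SUP_least SUP_upper2[of n]) (auto simp: indicator_def)
    qed
    ultimately show ?thesis by (rule mean_eq_cong[rotated])
  qed
  show ?thesis
    using f
  proof (induction rule: borel_measurable_induct)
    case (cong f g)
    then show ?case by (intro mean_eq_cong[of q g f]) auto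
  next
    case (set A)
    then show ?case by (rule set')
  next
    case (mult u c)
    then show ?case by (intro mean_eq_cmult)
  next
    case (add u v)
    then show ?case by (intro mean_eq_add)
  next
    case (seq U)
    then show ?case
      using mean_eq_SUP[of U q k] by (simp add: image_comp SUP_apply[abs_def])
  qed
qed

text \<open>Transfers finiteness from the power measure to almost every realization, which is what
  makes pathwise integrals accessible to approximation.\<close>

lemma AE_mixed_finite:
  assumes "k \<le> q" "f \<in> borel_measurable (power_measure \<mu> q)" "(\<integral>\<^sup>+x. f x \<partial>power_measure \<mu> q) < \<infinity>"
  shows "AE \<omega> in M. (\<integral>\<^sup>+x. f x \<partial>mixed \<omega> k q) < \<infinity>"
proof -
  obtain \<Phi> where \<Phi>: "\<Phi> \<in> borel_measurable M" "AE \<omega> in M. proper \<omega> \<and> (\<integral>\<^sup>+x. f x \<partial>mixed \<omega> k q) = \<Phi> \<omega>"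
    "(\<integral>\<^sup>+\<omega>. \<Phi> \<omega> \<partial>M) = (\<integral>\<^sup>+x. f x \<partial>power_measure \<mu> q)"
    using mean_eqE[OF mean_eq_all[OF assms(1,2)]] .
  then have "AE \<omega> in M. \<Phi> \<omega> \<noteq> \<infinity>"
    using assms(3) by (intro nn_integral_PInf_AE) auto
  then show ?thesis using \<Phi>(2) by eventually_elim (auto simp: less_top)
qed

end

section \<open>Density of simple kernels\<close>

text \<open>Controls the distances in \<open>L\<^sup>1\<close> and in \<open>L\<^sup>2\<close> at the same time.\<close>

definition dev :: "'a measure \<Rightarrow> ('a \<Rightarrow> real) \<Rightarrow> ennreal" where
  "dev N u = (\<integral>\<^sup>+x. ennreal (\<bar>u x\<bar> + (u x)\<^sup>2) \<partial>N)"

lemma two_mult_ennreal: "2 * ennreal a = ennreal (2 * a)"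
  using ennreal_mult'[of 2 a] by simp

lemma two_mult_ennreal_add:
  "0 \<le> a \<Longrightarrow> 0 \<le> b \<Longrightarrow> 2 * ennreal a + 2 * ennreal b = ennreal (2 * a + 2 * b)"
  by (simp add: two_mult_ennreal)

lemma dev_cong: "(\<And>x. x \<in> space N \<Longrightarrow> u x = v x) \<Longrightarrow> dev N u = dev N v"
  unfolding dev_def by (intro nn_integral_cong) simp

lemma dev_add:
  assumes [measurable]: "u \<in> borel_measurable N" "v \<in> borel_measurable N"
  shows "dev N (\<lambda>x. u x + v x) \<le> 2 * dev N u + 2 * dev N v"
proof -
  have "dev N (\<lambda>x. u x + v x) \<le> (\<integral>\<^sup>+x. 2 * ennreal (\<bar>u x\<bar> + (u x)\<^sup>2) + 2 * ennreal (\<bar>v x\<bar> + (v x)\<^sup>2) \<partial>N)"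
    unfolding dev_def
  proof (rule nn_integral_mono)
    fix x
    have "2 * (u x * v x) \<le> (u x)\<^sup>2 + (v x)\<^sup>2" using sum_squares_bound[of "u x" "v x"] by simp
    then have "\<bar>u x + v x\<bar> + (u x + v x)\<^sup>2 \<le> 2 * (\<bar>u x\<bar> + (u x)\<^sup>2) + 2 * (\<bar>v x\<bar> + (v x)\<^sup>2)"
      unfolding power2_sum by simp
    then have "ennreal (\<bar>u x + v x\<bar> + (u x + v x)\<^sup>2) \<le> ennreal (2 * (\<bar>u x\<bar> + (u x)\<^sup>2) + 2 * (\<bar>v x\<bar> + (v x)\<^sup>2))"
      by (rule ennreal_leI)
    also have "\<dots> = 2 * ennreal (\<bar>u x\<bar> + (u x)\<^sup>2) + 2 * ennreal (\<bar>v x\<bar> + (v x)\<^sup>2)"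
      by (simp add: ennreal_mult)
    finally show "ennreal (\<bar>u x + v x\<bar> + (u x + v x)\<^sup>2) \<le> \<dots>" .
  qed
  also have "\<dots> = 2 * dev N u + 2 * dev N v"
    unfolding dev_def by (subst nn_integral_add) (simp_all add: nn_integral_cmult del: ennreal_plus)
  finally show ?thesis .
qed

lemma dev_scale:
  assumes [measurable]: "u \<in> borel_measurable N"
  shows "dev N (\<lambda>x. c * u x) \<le> ennreal (\<bar>c\<bar> + c\<^sup>2) * dev N u"
proof -
  have "dev N (\<lambda>x. c * u x) \<le> (\<integral>\<^sup>+x. ennreal (\<bar>c\<bar> + c\<^sup>2) * ennreal (\<bar>u x\<bar> + (u x)\<^sup>2) \<partial>N)"
    unfolding dev_def
  proof (rule nn_integral_mono)
    fix x
    have "\<bar>c * u x\<bar> + (c * u x)\<^sup>2 \<le> (\<bar>c\<bar> + c\<^sup>2) * (\<bar>u x\<bar> + (u x)\<^sup>2)"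
      by (simp add: distrib_left distrib_right abs_mult power_mult_distrib)
    then have "ennreal (\<bar>c * u x\<bar> + (c * u x)\<^sup>2) \<le> ennreal ((\<bar>c\<bar> + c\<^sup>2) * (\<bar>u x\<bar> + (u x)\<^sup>2))"
      by (rule ennreal_leI)
    then show "ennreal (\<bar>c * u x\<bar> + (c * u x)\<^sup>2) \<le> ennreal (\<bar>c\<bar> + c\<^sup>2) * ennreal (\<bar>u x\<bar> + (u x)\<^sup>2)"
      by (simp add: ennreal_mult)
  qed
  then show ?thesis by (simp add: dev_def nn_integral_cmult)
qed

lemma dev_indicator:
  assumes "S \<in> sets N"
  shows "dev N (indicator S) = 2 * emeasure N S"
proof -
  have "dev N (indicator S) = (\<integral>\<^sup>+x. 2 * indicator S x \<partial>N)"
    unfolding dev_def by (rule nn_integral_cong) (simp add: indicator_def)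
  then show ?thesis using assms by (simp add: nn_integral_cmult)
qed

section \<open>Functions approximable by simple kernels\<close>

definition approximable :: "'z measure \<Rightarrow> nat \<Rightarrow> ((nat \<Rightarrow> 'z) \<Rightarrow> real) \<Rightarrow> bool" where
  "approximable \<mu> q u \<longleftrightarrow> u \<in> borel_measurable (power_measure \<mu> q) \<and>
     (\<forall>e>0. \<exists>\<A> h. cells \<mu> \<A> \<and> dev (power_measure \<mu> q) (\<lambda>x. u x - ker \<A> q h x) \<le> ennreal e)"

text \<open>The approximable functions form a closed class; the quarters of \<open>e\<close>
  compensate the factors 2 in \<open>dev_add\<close>.\<close>

lemma approximable_limit:
  assumes u: "u \<in> borel_measurable (power_measure \<mu> q)"
    and v: "\<And>e. e > 0 \<Longrightarrow> \<exists>v. approximable \<mu> q v \<and> dev (power_measure \<mu> q) (\<lambda>x. u x - v x) \<le> ennreal e"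
  shows "approximable \<mu> q u"
  unfolding approximable_def
proof (intro conjI allI impI u)
  fix e :: real assume e: "e > 0"
  obtain v where v: "approximable \<mu> q v" "dev (power_measure \<mu> q) (\<lambda>x. u x - v x) \<le> ennreal (e / 4)"
    using v[of "e / 4"] e by auto
  obtain \<A> h where Ah: "cells \<mu> \<A>" "dev (power_measure \<mu> q) (\<lambda>x. v x - ker \<A> q h x) \<le> ennreal (e / 4)"
    using v(1) e unfolding approximable_def by (meson divide_pos_pos zero_less_numeral)
  have vm: "v \<in> borel_measurable (power_measure \<mu> q)" using v(1) by (simp add: approximable_def)
  have "dev (power_measure \<mu> q) (\<lambda>x. u x - ker \<A> q h x)
      = dev (power_measure \<mu> q) (\<lambda>x. (u x - v x) + (v x - ker \<A> q h x))" by simp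
  also have "\<dots> \<le> 2 * dev (power_measure \<mu> q) (\<lambda>x. u x - v x) + 2 * dev (power_measure \<mu> q) (\<lambda>x. v x - ker \<A> q h x)"
    using u vm ker_measurable[OF Ah(1)] by (intro dev_add) auto
  also have "\<dots> \<le> 2 * ennreal (e / 4) + 2 * ennreal (e / 4)"
    using v(2) Ah(2) by (intro add_mono mult_left_mono) auto
  also have "\<dots> = ennreal (2 * (e / 4) + 2 * (e / 4))"
    using e by (intro two_mult_ennreal_add) auto
  also have "\<dots> = ennreal e" by simp
  finally show "\<exists>\<A> h. cells \<mu> \<A> \<and> dev (power_measure \<mu> q) (\<lambda>x. u x - ker \<A> q h x) \<le> ennreal e"
    using Ah(1) by blast
qed

lemma approximable_cong:
  assumes "\<And>x. x \<in> space (power_measure \<mu> q) \<Longrightarrow> u x = v x" "approximable \<mu> q u"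
  shows "approximable \<mu> q v"
proof -
  have "v \<in> borel_measurable (power_measure \<mu> q)"
    using assms measurable_cong[of "power_measure \<mu> q" u v borel] by (simp add: approximable_def)
  moreover have "dev (power_measure \<mu> q) (\<lambda>x. v x - ker \<A> q h x) = dev (power_measure \<mu> q) (\<lambda>x. u x - ker \<A> q h x)" for \<A> h
    using assms(1) by (intro dev_cong) simp
  ultimately show ?thesis using assms(2) by (simp add: approximable_def)
qed

lemma approximable_ker: "cells \<mu> \<A> \<Longrightarrow> approximable \<mu> q (ker \<A> q h)"
  unfolding approximable_def
  by (auto intro!: exI[of _ \<A>] exI[of _ h] ker_measurable simp: dev_def)

lemma approximable_add:
  assumes "approximable \<mu> q u" "approximable \<mu> q v"
  shows "approximable \<mu> q (\<lambda>x. u x + v x)"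
proof (rule approximable_limit)
  have um: "u \<in> borel_measurable (power_measure \<mu> q)" and vm: "v \<in> borel_measurable (power_measure \<mu> q)"
    using assms by (simp_all add: approximable_def)
  then show "(\<lambda>x. u x + v x) \<in> borel_measurable (power_measure \<mu> q)" by simp
  fix e :: real assume e: "e > 0"
  obtain \<A> h where A: "cells \<mu> \<A>" "dev (power_measure \<mu> q) (\<lambda>x. u x - ker \<A> q h x) \<le> ennreal (e / 4)"
    using assms(1) e unfolding approximable_def by (meson divide_pos_pos zero_less_numeral)
  obtain \<B> k where B: "cells \<mu> \<B>" "dev (power_measure \<mu> q) (\<lambda>x. v x - ker \<B> q k x) \<le> ennreal (e / 4)"
    using assms(2) e unfolding approximable_def by (meson divide_pos_pos zero_less_numeral)
  obtain \<C> h' k' where C: "cells \<mu> \<C>" "\<And>x. ker \<A> q h x = ker \<C> q h' x" "\<And>x. ker \<B> q k x = ker \<C> q k' x"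
    using ker_common_refinement[OF A(1) B(1)] by metis
  let ?w = "ker \<C> q (\<lambda>z. h' z + k' z)"
  have "dev (power_measure \<mu> q) (\<lambda>x. u x + v x - ?w x)
      = dev (power_measure \<mu> q) (\<lambda>x. (u x - ker \<A> q h x) + (v x - ker \<B> q k x))"
    by (simp add: ker_add C algebra_simps)
  also have "\<dots> \<le> 2 * dev (power_measure \<mu> q) (\<lambda>x. u x - ker \<A> q h x) + 2 * dev (power_measure \<mu> q) (\<lambda>x. v x - ker \<B> q k x)"
    using um vm ker_measurable[OF A(1)] ker_measurable[OF B(1)] by (intro dev_add) auto
  also have "\<dots> \<le> 2 * ennreal (e / 4) + 2 * ennreal (e / 4)"
    using A(2) B(2) by (intro add_mono mult_left_mono) auto
  also have "\<dots> = ennreal (2 * (e / 4) + 2 * (e / 4))"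
    using e by (intro two_mult_ennreal_add) auto
  also have "\<dots> = ennreal e" by simp
  finally show "\<exists>w. approximable \<mu> q w \<and> dev (power_measure \<mu> q) (\<lambda>x. u x + v x - w x) \<le> ennreal e"
    using approximable_ker[OF C(1)] by blast
qed

lemma approximable_scale:
  assumes "approximable \<mu> q u"
  shows "approximable \<mu> q (\<lambda>x. c * u x)"
proof (rule approximable_limit)
  have um: "u \<in> borel_measurable (power_measure \<mu> q)" using assms by (simp add: approximable_def)
  then show "(\<lambda>x. c * u x) \<in> borel_measurable (power_measure \<mu> q)" by simp
  fix e :: real assume e: "e > 0"
  let ?c = "\<bar>c\<bar> + c\<^sup>2 + 1"
  have c: "?c > 0" by (simp add: add_nonneg_pos)
  then have ec: "e / ?c > 0" using e by (intro divide_pos_pos)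
  obtain \<A> h where A: "cells \<mu> \<A>" "dev (power_measure \<mu> q) (\<lambda>x. u x - ker \<A> q h x) \<le> ennreal (e / ?c)"
    using assms ec unfolding approximable_def by meson
  have "dev (power_measure \<mu> q) (\<lambda>x. c * u x - ker \<A> q (\<lambda>z. c * h z) x)
      = dev (power_measure \<mu> q) (\<lambda>x. c * (u x - ker \<A> q h x))"
    by (simp add: ker_scale algebra_simps)
  also have "\<dots> \<le> ennreal (\<bar>c\<bar> + c\<^sup>2) * dev (power_measure \<mu> q) (\<lambda>x. u x - ker \<A> q h x)"
    using um ker_measurable[OF A(1)] by (intro dev_scale) auto
  also have "\<dots> \<le> ennreal ?c * ennreal (e / ?c)"
    using A(2) by (intro mult_mono ennreal_leI) auto
  also have "\<dots> = ennreal (?c * (e / ?c))" using c ec by (intro ennreal_mult[symmetric]) linarith+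
  also have "\<dots> = ennreal e" using c by simp
  finally show "\<exists>w. approximable \<mu> q w \<and> dev (power_measure \<mu> q) (\<lambda>x. c * u x - w x) \<le> ennreal e"
    using approximable_ker[OF A(1)] by blast
qed

lemma approximable_zero: "approximable \<mu> q (\<lambda>x. 0)"
proof -
  have "cells \<mu> {}" by (simp add: cells_def)
  from approximable_scale[OF approximable_ker[OF this], of q 0] show ?thesis by simp
qed

lemma approximable_sum:
  "(\<And>j. j \<in> J \<Longrightarrow> approximable \<mu> q (f j)) \<Longrightarrow> approximable \<mu> q (\<lambda>x. \<Sum>j\<in>J. f j x)"
  by (induction J rule: infinite_finite_induct) (simp_all add: approximable_zero approximable_add)

lemma approximable_minus:
  "approximable \<mu> q u \<Longrightarrow> approximable \<mu> q v \<Longrightarrow> approximable \<mu> q (\<lambda>x. u x - v x)"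
  using approximable_add[of \<mu> q u "\<lambda>x. -1 * v x"] approximable_scale[of \<mu> q v "-1"] by simp

text \<open>The sets \<open>S - T n\<close> decrease to the empty set, so their finite measures tend
  to 0, and \<open>dev\<close> of an indicator is twice the measure of the set.\<close>

lemma approximable_decreasing_limit:
  assumes S: "S \<in> sets (power_measure \<mu> q)" and T: "\<And>n. T n \<in> sets (power_measure \<mu> q)"
    and ap: "\<And>n. approximable \<mu> q (indicator (T n))"
    and sub: "\<And>n. T n \<subseteq> S" and inc: "incseq T" and un: "(\<Union>n. T n) = S"
    and fin: "emeasure (power_measure \<mu> q) S \<noteq> \<infinity>"
  shows "approximable \<mu> q (indicator S)"
proof (rule approximable_limit)
  show "indicator S \<in> borel_measurable (power_measure \<mu> q)" using S by simp
  fix e :: real assume e: "e > 0"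
  have "(\<lambda>n. emeasure (power_measure \<mu> q) (S - T n)) \<longlonglongrightarrow> emeasure (power_measure \<mu> q) (\<Inter>n. S - T n)"
  proof (rule Lim_emeasure_decseq)
    show "range (\<lambda>n. S - T n) \<subseteq> sets (power_measure \<mu> q)" using S T by auto
    show "decseq (\<lambda>n. S - T n)" using inc by (auto simp: decseq_def incseq_def)
    show "emeasure (power_measure \<mu> q) (S - T n) \<noteq> \<infinity>" for n
      using fin S emeasure_mono[of "S - T n" S "power_measure \<mu> q"] by (auto simp: top_unique)
  qed
  moreover have empty: "(\<Inter>n. S - T n) = {}" using un by auto
  ultimately have "(\<lambda>n. emeasure (power_measure \<mu> q) (S - T n)) \<longlonglongrightarrow> 0"
    unfolding empty by simp
  then have "\<forall>\<^sub>F n in sequentially. emeasure (power_measure \<mu> q) (S - T n) < ennreal (e / 2)"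
    using e by (intro order_tendstoD(2)) auto
  then obtain n where n: "emeasure (power_measure \<mu> q) (S - T n) < ennreal (e / 2)"
    by (auto simp: eventually_sequentially)
  have "dev (power_measure \<mu> q) (\<lambda>x. indicator S x - indicator (T n) x) = dev (power_measure \<mu> q) (indicator (S - T n))"
    using sub[of n] by (intro dev_cong) (auto simp: indicator_def)
  also have "\<dots> = 2 * emeasure (power_measure \<mu> q) (S - T n)" using S T by (intro dev_indicator) auto
  also have "\<dots> \<le> 2 * ennreal (e / 2)" using n by (intro mult_left_mono) auto
  also have "\<dots> = ennreal (2 * (e / 2))" using e by (simp add: ennreal_mult'' del: times_divide_eq_right) 
  also have "\<dots> = ennreal e" by simp
  finally show "\<exists>v. approximable \<mu> q v \<and> dev (power_measure \<mu> q) (\<lambda>x. indicator S x - v x) \<le> ennreal e"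
    using ap[of n] by blast
qed

context sigma_finite_measure
begin

text \<open>Dynkin's principle inside boxes of finite measure; a countable disjoint union is reached
  through its finite parts, and exhausting the space removes the boxes.\<close>

lemma approximable_indicator:
  assumes S: "S \<in> sets (power_measure M q)" and fin: "emeasure (power_measure M q) S \<noteq> \<infinity>"
  shows "approximable M q (indicator S)"
proof -
  obtain W :: "nat \<Rightarrow> 'a set" where W: "range W \<subseteq> sets M" "(\<Union>i. W i) = space M"
    "\<And>i. emeasure M (W i) \<noteq> \<infinity>" "incseq W"
    using sigma_finite_incseq by blast
  define V where "V n = PiE {..<q} (\<lambda>_. W n)" for n
  have W': "W n \<in> sets M" "emeasure M (W n) < \<infinity>" for n using W(1,3) by (auto simp: less_top)
  have Vs: "V n \<in> sets (power_measure M q)" for n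
    unfolding V_def using W' by (intro sets_PiM_I_finite) auto
  have box: "approximable M q (indicator (PiE {..<q} B))"
    if B: "\<And>j. j < q \<Longrightarrow> B j \<in> sets M \<and> emeasure M (B j) < \<infinity>" for B
  proof -
    obtain \<C> h where Ch: "cells M \<C>" "\<And>x. indicator (PiE {..<q} B) x = ker \<C> q h x"
      using box_ker[of q B M, OF B] by blast
    then have "indicator (PiE {..<q} B) = ker \<C> q h" by (intro ext)
    then show ?thesis using approximable_ker[OF Ch(1)] by simp
  qed
  have aV: "approximable M q (indicator (V n))" for n
    unfolding V_def by (rule box) (use W' in auto)
  interpret P: product_sigma_finite "\<lambda>_ :: nat. M"
    by (rule product_sigma_finite.intro) (rule sigma_finite_measure_axioms)
  have Vfin: "emeasure (power_measure M q) (V n) \<noteq> \<infinity>" for n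
  proof -
    have "emeasure (power_measure M q) (V n) = (\<Prod>j<q. emeasure M (W n))"
      unfolding V_def by (rule P.emeasure_PiM) (use W' in auto)
    then show ?thesis using W(3)[of n] by (simp add: power_eq_top_ennreal)
  qed
  have VS_fin: "emeasure (power_measure M q) (A \<inter> V n) \<noteq> \<infinity>" for A n
    using Vfin[of n] emeasure_mono[of "A \<inter> V n" "V n" "power_measure M q"] Vs[of n] by (auto simp: top_unique)
  have set: "approximable M q (indicator (S \<inter> V n))" if "S \<in> sets (power_measure M q)" for S n
    using that
  proof (induction rule: power_measure_induct)
    case (box X)
    have "PiE {..<q} X \<inter> V n = PiE {..<q} (\<lambda>j. X j \<inter> W n)" unfolding V_def by (rule PiE_Int)
    moreover have "X j \<inter> W n \<in> sets M \<and> emeasure M (X j \<inter> W n) < \<infinity>" for j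
      using box W'[of n] emeasure_mono[of "X j \<inter> W n" "W n" M] by (auto intro: le_less_trans)
    ultimately show ?case
      using \<open>\<And>B. (\<And>j. j < q \<Longrightarrow> B j \<in> sets M \<and> emeasure M (B j) < \<infinity>) \<Longrightarrow> approximable M q (indicator (PiE {..<q} B))\<close> by simp
  next
    case empty
    show ?case using approximable_zero by (simp add: indicator_def[abs_def])
  next
    case (compl A)
    have "approximable M q (\<lambda>x. indicator (V n) x - indicator (A \<inter> V n) x)"
      by (intro approximable_minus aV compl)
    moreover have "indicator (V n) x - indicator (A \<inter> V n) x = (indicator ((space (power_measure M q) - A) \<inter> V n) x :: real)"
      if "x \<in> space (power_measure M q)" for x
      using that by (auto simp: indicator_def)
    ultimately show ?case by (rule approximable_cong[rotated])
  next
    case (union A)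
    have As: "A i \<in> sets (power_measure M q)" for i using union(2) by auto
    show ?case
    proof (rule approximable_decreasing_limit)
      show "(\<Union>i. A i) \<inter> V n \<in> sets (power_measure M q)" using As Vs by auto
      show "emeasure (power_measure M q) ((\<Union>i. A i) \<inter> V n) \<noteq> \<infinity>" by (rule VS_fin)
      show "(\<Union>i<m. A i) \<inter> V n \<in> sets (power_measure M q)" for m using As Vs by auto
      show "incseq (\<lambda>m. (\<Union>i<m. A i) \<inter> V n)" by (auto simp: incseq_def) (meson lessThan_iff order_less_le_trans)
      show "(\<Union>m. (\<Union>i<m. A i) \<inter> V n) = (\<Union>i. A i) \<inter> V n" by (auto intro: lessI)
      fix m
      have "approximable M q (\<lambda>x. \<Sum>i<m. indicator (A i \<inter> V n) x)"
        by (intro approximable_sum union)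
      moreover have "(\<Sum>i<m. indicator (A i \<inter> V n) x) = (indicator ((\<Union>i<m. A i) \<inter> V n) x :: real)" for x
      proof -
        have "disjoint_family_on (\<lambda>i. A i \<inter> V n) {..<m}"
          using union(1) by (auto simp: disjoint_family_on_def)
        then have "indicator (\<Union>i<m. A i \<inter> V n) x = (\<Sum>i<m. indicator (A i \<inter> V n) x :: real)"
          by (intro indicator_UN_disjoint) auto
        then show ?thesis by (simp add: Int_UN_distrib2)
      qed
      ultimately show "approximable M q (indicator ((\<Union>i<m. A i) \<inter> V n))" by simp
    qed auto
  qed
  show ?thesis
  proof (rule approximable_decreasing_limit[OF S _ set[OF S] _ _ _ fin])
    show "S \<inter> V n \<in> sets (power_measure M q)" for n using S Vs by auto
    show "incseq (\<lambda>n. S \<inter> V n)"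
      unfolding V_def incseq_def
    proof (intro allI impI)
      fix m n :: nat assume "m \<le> n"
      then have "W m \<subseteq> W n" by (rule incseqD[OF W(4)])
      then have "PiE {..<q} (\<lambda>_. W m) \<subseteq> PiE {..<q} (\<lambda>_. W n)" by (intro PiE_mono)
      then show "S \<inter> PiE {..<q} (\<lambda>_. W m) \<subseteq> S \<inter> PiE {..<q} (\<lambda>_. W n)" by blast
    qed
    show "(\<Union>n. S \<inter> V n) = S"
    proof (intro equalityI subsetI)
      fix x assume x: "x \<in> S"
      then have xs: "x \<in> space (power_measure M q)" using sets.sets_into_space[OF S] by blast
      have "\<exists>n. x j \<in> W n" if "j < q" for j using xs that W(2) by (auto simp: space_PiM PiE_iff)
      then obtain n where n: "\<And>j. j < q \<Longrightarrow> x j \<in> W (n j)" by metis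
      have "x j \<in> W (Max (n ` {..<q}))" if "j < q" for j
      proof -
        have "W (n j) \<subseteq> W (Max (n ` {..<q}))"
          by (rule incseqD[OF W(4)], rule Max_ge) (use that in auto)
        then show ?thesis using n[OF that] by blast
      qed
      then show "x \<in> (\<Union>n. S \<inter> V n)" using x xs by (auto simp: V_def space_PiM PiE_iff)
    qed auto
  qed auto
qed

lemma approximable_simple:
  assumes s: "simple_function (power_measure M q) s"
    and fin: "(\<integral>\<^sup>+x. ennreal \<bar>s x\<bar> \<partial>power_measure M q) < \<infinity>"
  shows "approximable M q s"
proof -
  let ?N = "power_measure M q"
  let ?S = "\<lambda>y. s -` {y} \<inter> space ?N"
  have Sm: "?S y \<in> sets ?N" for y using s by (rule simple_functionD)
  have each: "approximable M q (\<lambda>x. y * indicator (?S y) x)" for y :: real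
  proof (cases "y = 0")
    case True
    then show ?thesis by (simp add: approximable_zero)
  next
    case False
    have "ennreal \<bar>y\<bar> * emeasure ?N (?S y) = (\<integral>\<^sup>+x. ennreal \<bar>y\<bar> * indicator (?S y) x \<partial>?N)"
      using Sm[of y] by (simp add: nn_integral_cmult_indicator)
    also have "\<dots> \<le> (\<integral>\<^sup>+x. ennreal \<bar>s x\<bar> \<partial>?N)"
      by (rule nn_integral_mono) (auto simp: indicator_def)
    finally have "ennreal \<bar>y\<bar> * emeasure ?N (?S y) < \<infinity>" using fin by (rule le_less_trans)
    then have "emeasure ?N (?S y) \<noteq> \<infinity>" using False by (auto simp: ennreal_mult_less_top)
    then show ?thesis by (intro approximable_scale approximable_indicator Sm)
  qed
  have "approximable M q (\<lambda>x. \<Sum>y\<in>s ` space ?N. y * indicator (?S y) x)"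
    by (intro approximable_sum each)
  moreover have "(\<Sum>y\<in>s ` space ?N. y * indicator (?S y) x) = s x" if "x \<in> space ?N" for x
  proof -
    have "finite (s ` space ?N)" using s by (rule simple_functionD)
    moreover have "(\<Sum>y\<in>s ` space ?N. y * indicator (?S y) x) = (\<Sum>y\<in>s ` space ?N. if y = s x then s x else 0)"
      using that by (intro sum.cong refl) (auto simp: indicator_def)
    ultimately show ?thesis using that by (simp add: sum.delta')
  qed
  ultimately show ?thesis by (rule approximable_cong[rotated])
qed

lemma approximable_all:
  assumes u [measurable]: "u \<in> borel_measurable (power_measure M q)" and fin: "dev (power_measure M q) u < \<infinity>"
  shows "approximable M q u"
proof (rule approximable_limit[OF u])
  fix e :: real assume e: "e > 0"
  let ?N = "power_measure M q"
  obtain s where s: "\<And>i. simple_function ?N (s i)" "\<And>x. x \<in> space ?N \<Longrightarrow> (\<lambda>i. s i x) \<longlonglongrightarrow> u x"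
    "\<And>i x. x \<in> space ?N \<Longrightarrow> dist (s i x) 0 \<le> 2 * dist (u x) 0"
    using borel_measurable_implies_sequence_metric[OF u, of 0] by blast
  have sm [measurable]: "s i \<in> borel_measurable ?N" for i by (rule borel_measurable_simple_function[OF s(1)])
  have sb: "\<bar>s i x\<bar> \<le> 2 * \<bar>u x\<bar>" if "x \<in> space ?N" for i x using s(3)[OF that] by simp
  have "(\<lambda>i. (\<integral>\<^sup>+x. ennreal (\<bar>u x - s i x\<bar> + (u x - s i x)\<^sup>2) \<partial>?N)) \<longlonglongrightarrow> (\<integral>\<^sup>+x. 0 \<partial>?N)"
  \<comment> \<open>From \<open>\<bar>s i x\<bar> \<le> 2 * \<bar>u x\<bar>\<close> the error is at
    most three times \<open>\<bar>u x\<bar>\<close>, and its square at most nine times the square of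
    \<open>u x\<close>.\<close>
  proof (rule nn_integral_dominated_convergence[where w = "\<lambda>x. 9 * ennreal (\<bar>u x\<bar> + (u x)\<^sup>2)"])
    show "AE x in ?N. ennreal (\<bar>u x - s i x\<bar> + (u x - s i x)\<^sup>2) \<le> 9 * ennreal (\<bar>u x\<bar> + (u x)\<^sup>2)" for i
    proof (rule AE_I2)
      fix x assume "x \<in> space ?N"
      from sb[OF this, of i] have 1: "\<bar>u x - s i x\<bar> \<le> 3 * \<bar>u x\<bar>" by linarith
      then have "(u x - s i x)\<^sup>2 \<le> (3 * \<bar>u x\<bar>)\<^sup>2" by (intro abs_le_square_iff[THEN iffD1]) simp
      then have "\<bar>u x - s i x\<bar> + (u x - s i x)\<^sup>2 \<le> 9 * (\<bar>u x\<bar> + (u x)\<^sup>2)"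
        using 1 by (simp add: power_mult_distrib)
      then have "ennreal (\<bar>u x - s i x\<bar> + (u x - s i x)\<^sup>2) \<le> ennreal (9 * (\<bar>u x\<bar> + (u x)\<^sup>2))" by (rule ennreal_leI)
      then show "ennreal (\<bar>u x - s i x\<bar> + (u x - s i x)\<^sup>2) \<le> 9 * ennreal (\<bar>u x\<bar> + (u x)\<^sup>2)"
        by (simp add: ennreal_mult)
    qed
    show "(\<integral>\<^sup>+x. 9 * ennreal (\<bar>u x\<bar> + (u x)\<^sup>2) \<partial>?N) < \<infinity>"
      using fin by (simp add: nn_integral_cmult dev_def ennreal_mult_less_top del: ennreal_plus)
    show "AE x in ?N. (\<lambda>i. ennreal (\<bar>u x - s i x\<bar> + (u x - s i x)\<^sup>2)) \<longlonglongrightarrow> 0"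
    proof (rule AE_I2)
      fix x assume "x \<in> space ?N"
      have "(\<lambda>i. \<bar>u x - s i x\<bar> + (u x - s i x)\<^sup>2) \<longlonglongrightarrow> \<bar>u x - u x\<bar> + (u x - u x)\<^sup>2"
        by (intro tendsto_intros s(2)) fact+
      then show "(\<lambda>i. ennreal (\<bar>u x - s i x\<bar> + (u x - s i x)\<^sup>2)) \<longlonglongrightarrow> 0"
        using tendsto_ennrealI by fastforce
    qed
  qed auto
  then have "(\<lambda>i. dev ?N (\<lambda>x. u x - s i x)) \<longlonglongrightarrow> 0" by (simp add: dev_def)
  then have "\<forall>\<^sub>F i in sequentially. dev ?N (\<lambda>x. u x - s i x) < ennreal e"
    using e by (intro order_tendstoD(2)) auto
  then obtain i where i: "dev ?N (\<lambda>x. u x - s i x) < ennreal e" by (auto simp: eventually_sequentially)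
  have "(\<integral>\<^sup>+x. ennreal \<bar>s i x\<bar> \<partial>?N) \<le> (\<integral>\<^sup>+x. 2 * ennreal (\<bar>u x\<bar> + (u x)\<^sup>2) \<partial>?N)"
  proof (rule nn_integral_mono)
    fix x assume "x \<in> space ?N"
    from sb[OF this, of i] have "\<bar>s i x\<bar> \<le> 2 * (\<bar>u x\<bar> + (u x)\<^sup>2)" by (simp add: add_increasing2)
    then have "ennreal \<bar>s i x\<bar> \<le> ennreal (2 * (\<bar>u x\<bar> + (u x)\<^sup>2))" by (rule ennreal_leI)
    then show "ennreal \<bar>s i x\<bar> \<le> 2 * ennreal (\<bar>u x\<bar> + (u x)\<^sup>2)" by (simp add: ennreal_mult)
  qed
  also have "\<dots> < \<infinity>" using fin by (simp add: nn_integral_cmult dev_def ennreal_mult_less_top del: ennreal_plus)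
  finally have "approximable M q (s i)" by (rule approximable_simple[OF s(1)])
  then show "\<exists>v. approximable M q v \<and> dev ?N (\<lambda>x. u x - v x) \<le> ennreal e"
    using i by (intro exI[of _ "s i"]) auto
qed

section \<open>Permuting and averaging the arguments of kernels\<close>

text \<open>The two measures agree on boxes, where a permutation only reorders the factors of a
  product.\<close>

lemma permute_power_measure:
  assumes \<pi>: "\<pi> permutes {..<q}"
  shows "(\<lambda>x. x \<circ> \<pi>) \<in> measurable (power_measure M q) (power_measure M q)"
    and "distr (power_measure M q) (power_measure M q) (\<lambda>x. x \<circ> \<pi>) = power_measure M q"
proof -
  interpret P: product_sigma_finite "\<lambda>_ :: nat. M"
    by (rule product_sigma_finite.intro) (rule sigma_finite_measure_axioms)
  have ran: "\<pi> j < q \<longleftrightarrow> j < q" for j using permutes_in_image[OF \<pi>, of j] by simp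
  have ext: "x \<circ> \<pi> \<in> extensional {..<q}" if "x \<in> extensional {..<q}" for x :: "nat \<Rightarrow> 'a"
    using that permutes_not_in[OF \<pi>] by (simp add: extensional_def)
  show meas: "(\<lambda>x. x \<circ> \<pi>) \<in> measurable (power_measure M q) (power_measure M q)"
  proof (rule measurable_PiM_single')
    show "(\<lambda>x. (x \<circ> \<pi>) j) \<in> measurable (power_measure M q) M" if "j \<in> {..<q}" for j
      unfolding comp_def using that ran by (intro measurable_component_singleton) simp
    show "(\<lambda>x. x \<circ> \<pi>) \<in> space (power_measure M q) \<rightarrow> {..<q} \<rightarrow>\<^sub>E space M"
      using ext ran by (auto simp: space_PiM PiE_def)
  qed
  show "distr (power_measure M q) (power_measure M q) (\<lambda>x. x \<circ> \<pi>) = power_measure M q"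
  proof (rule P.PiM_eqI)
    fix A assume A: "\<And>i. i \<in> {..<q} \<Longrightarrow> A i \<in> sets M"
    let ?i = "inv \<pi>"
    have inv: "?i permutes {..<q}" by (rule permutes_inv[OF \<pi>])
    have inv_lt: "?i j < q \<longleftrightarrow> j < q" for j using permutes_in_image[OF inv, of j] by simp
    have pi: "\<pi> (?i j) = j" "?i (\<pi> j) = j" for j using permutes_inverses[OF \<pi>] by auto
    have "(\<lambda>x. x \<circ> \<pi>) -` PiE {..<q} A \<inter> space (power_measure M q) = PiE {..<q} (\<lambda>j. A (?i j))"
    proof (intro set_eqI iffI)
      fix x assume x: "x \<in> (\<lambda>x. x \<circ> \<pi>) -` PiE {..<q} A \<inter> space (power_measure M q)"
      have "x j \<in> A (?i j)" if "j < q" for j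
      proof -
        have "x \<circ> \<pi> \<in> PiE {..<q} A" using x by simp
        from PiE_mem[OF this, of "?i j"] have "(x \<circ> \<pi>) (?i j) \<in> A (?i j)" using that inv_lt by simp
        then show ?thesis by (simp add: pi)
      qed
      moreover have "x \<in> extensional {..<q}" using x by (simp add: space_PiM PiE_iff)
      ultimately show "x \<in> PiE {..<q} (\<lambda>j. A (?i j))" by (simp add: PiE_iff)
    next
      fix x assume x: "x \<in> PiE {..<q} (\<lambda>j. A (?i j))"
      have "x j \<in> space M" if "j < q" for j
      proof -
        have "x j \<in> A (?i j)" using PiE_mem[OF x, of j] that by simp
        moreover have "A (?i j) \<in> sets M" using A inv_lt that by simp
        ultimately show ?thesis using sets.sets_into_space by blast
      qed
      moreover have "(x \<circ> \<pi>) j \<in> A j" if "j < q" for j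
      proof -
        have "x (\<pi> j) \<in> A (?i (\<pi> j))" using PiE_mem[OF x, of "\<pi> j"] that ran by simp
        then show ?thesis by (simp add: pi)
      qed
      ultimately show "x \<in> (\<lambda>x. x \<circ> \<pi>) -` PiE {..<q} A \<inter> space (power_measure M q)"
        using x ext[of x] by (simp add: space_PiM PiE_iff)
    qed
    then have "emeasure (distr (power_measure M q) (power_measure M q) (\<lambda>x. x \<circ> \<pi>)) (PiE {..<q} A)
        = emeasure (power_measure M q) (PiE {..<q} (\<lambda>j. A (?i j)))"
      using meas A by (subst emeasure_distr) (auto intro!: sets_PiM_I_finite)
    also have "\<dots> = (\<Prod>j<q. emeasure M (A (?i j)))"
      by (rule P.emeasure_PiM) (use A inv_lt in auto)
    also have "\<dots> = (\<Prod>j<q. emeasure M (A j))"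
      using prod.permute[OF inv, of "\<lambda>j. emeasure M (A j)"] by (simp add: comp_def)
    finally show "emeasure (distr (power_measure M q) (power_measure M q) (\<lambda>x. x \<circ> \<pi>)) (PiE {..<q} A)
        = (\<Prod>j\<in>{..<q}. emeasure M (A j))" .
  qed simp_all
qed

lemma dev_permute:
  assumes \<pi>: "\<pi> permutes {..<q}" and [measurable]: "u \<in> borel_measurable (power_measure M q)"
  shows "dev (power_measure M q) (\<lambda>x. u (x \<circ> \<pi>)) = dev (power_measure M q) u"
proof -
  have "dev (power_measure M q) u
      = (\<integral>\<^sup>+x. ennreal (\<bar>u x\<bar> + (u x)\<^sup>2) \<partial>distr (power_measure M q) (power_measure M q) (\<lambda>x. x \<circ> \<pi>))"
    by (simp add: dev_def permute_power_measure(2)[OF \<pi>])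
  also have "\<dots> = dev (power_measure M q) (\<lambda>x. u (x \<circ> \<pi>))"
    unfolding dev_def by (rule nn_integral_distr[OF permute_power_measure(1)[OF \<pi>]]) simp
  finally show ?thesis by simp
qed

end

lemma box_permute:
  assumes \<pi>: "\<pi> permutes {..<q}" and w: "length w = q" and x: "x \<in> PiE {..<q} (\<lambda>j. w ! j)"
  shows "x \<circ> \<pi> \<in> PiE {..<q} (\<lambda>j. permute_list \<pi> w ! j)"
proof (rule PiE_I)
  fix j assume "j \<in> {..<q}"
  then have "\<pi> j < q" using permutes_in_image[OF \<pi>, of j] by simp
  then show "(x \<circ> \<pi>) j \<in> permute_list \<pi> w ! j"
    using x w \<pi> \<open>j \<in> {..<q}\<close> by (auto simp: permute_list_nth)
next
  fix j assume "j \<notin> {..<q}"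
  then show "(x \<circ> \<pi>) j = undefined"
    using permutes_not_in[OF \<pi>, of j] x by (auto simp: PiE_iff extensional_def)
qed

lemma ker_permute:
  assumes \<A>: "cells \<mu> \<A>" and \<pi>: "\<pi> permutes {..<q}"
  shows "ker \<A> q h (x \<circ> \<pi>) = ker \<A> q (\<lambda>w. h (permute_list \<pi> w)) x"
proof (cases "\<exists>w. set w \<subseteq> \<A> \<and> length w = q \<and> x \<in> PiE {..<q} (\<lambda>j. w ! j)")
  case True
  then obtain w where w: "set w \<subseteq> \<A>" "length w = q" "x \<in> PiE {..<q} (\<lambda>j. w ! j)" by blast
  have "set (permute_list \<pi> w) \<subseteq> \<A>" "length (permute_list \<pi> w) = q" using w \<pi> by auto
  from ker_cell[OF \<A> this box_permute[OF \<pi> w(2,3)]] ker_cell[OF \<A> w]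
  show ?thesis by simp
next
  case False
  have "x \<circ> \<pi> \<notin> PiE {..<q} (\<lambda>j. z ! j)" if z: "set z \<subseteq> \<A>" "length z = q" for z
  proof
    assume *: "x \<circ> \<pi> \<in> PiE {..<q} (\<lambda>j. z ! j)"
    have inv: "inv \<pi> permutes {..<q}" by (rule permutes_inv[OF \<pi>])
    have "(x \<circ> \<pi>) \<circ> inv \<pi> \<in> PiE {..<q} (\<lambda>j. permute_list (inv \<pi>) z ! j)"
      by (rule box_permute[OF inv z(2) *])
    moreover have "(x \<circ> \<pi>) \<circ> inv \<pi> = x" using permutes_inv_o(1)[OF \<pi>] by (simp add: comp_assoc)
    moreover have "set (permute_list (inv \<pi>) z) \<subseteq> \<A>" "length (permute_list (inv \<pi>) z) = q"
      using z inv by auto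
    ultimately show False using False by metis
  qed
  then have "ker \<A> q h (x \<circ> \<pi>) = 0" by (intro ker_outside) blast
  moreover have "ker \<A> q (\<lambda>w. h (permute_list \<pi> w)) x = 0" using False by (intro ker_outside) blast
  ultimately show ?thesis by simp
qed

text \<open>Words of other lengths get 0, since permutations of \<open>{..<q}\<close> are meant to
  act on words of length \<open>q\<close>; this keeps the result symmetric on all lists.\<close>

definition symmetrize :: "nat \<Rightarrow> ('a list \<Rightarrow> real) \<Rightarrow> 'a list \<Rightarrow> real" where
  "symmetrize q h z = (if length z = q then (\<Sum>\<pi> | \<pi> permutes {..<q}. h (permute_list \<pi> z)) / fact q else 0)"

text \<open>Rearrangements of a word differ by one fixed permutation, and composing with it only
  reindexes the sum.\<close>

lemma sym_kernel_symmetrize: "sym_kernel (symmetrize q h)"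
  unfolding sym_kernel_def
proof (intro allI impI)
  fix z z' :: "'a list" assume m: "mset z = mset z'"
  then have len: "length z = length z'" by (rule mset_eq_length)
  show "symmetrize q h z = symmetrize q h z'"
  proof (cases "length z' = q")
    case True
    obtain \<rho> where \<rho>: "\<rho> permutes {..<q}" "permute_list \<rho> z' = z"
      using mset_eq_permutation[OF m] True by metis
    have "(\<Sum>\<pi> | \<pi> permutes {..<q}. h (permute_list \<pi> z')) = (\<Sum>\<pi> | \<pi> permutes {..<q}. h (permute_list (\<rho> \<circ> \<pi>) z'))"
      by (rule setum_permutations_compose_left[OF \<rho>(1)])
    also have "\<dots> = (\<Sum>\<pi> | \<pi> permutes {..<q}. h (permute_list \<pi> z))"
      by (intro sum.cong refl) (simp add: permute_list_compose True \<rho>(2))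
    finally show ?thesis using len True by (simp add: symmetrize_def)
  qed (simp add: symmetrize_def len)
qed

lemma ker_symmetrize:
  assumes \<A>: "cells \<mu> \<A>"
  shows "ker \<A> q (symmetrize q h) x = (\<Sum>\<pi> | \<pi> permutes {..<q}. ker \<A> q h (x \<circ> \<pi>)) / fact q"
proof (cases "\<exists>w. set w \<subseteq> \<A> \<and> length w = q \<and> x \<in> PiE {..<q} (\<lambda>j. w ! j)")
  case True
  then obtain w where w: "set w \<subseteq> \<A>" "length w = q" "x \<in> PiE {..<q} (\<lambda>j. w ! j)" by blast
  then show ?thesis
    using ker_cell[OF \<A> w] by (simp add: ker_permute[OF \<A>] symmetrize_def)
next
  case False
  then have "ker \<A> q k x = 0" for k by (intro ker_outside) blast
  then show ?thesis by (simp add: ker_permute[OF \<A>])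
qed

text \<open>A symmetric \<open>u\<close> is its own symmetrization, and averaging over permutations
  does not increase \<open>dev\<close>, by convexity and by invariance of the power measure.\<close>

lemma (in sigma_finite_measure) symmetric_approximation:
  assumes u [measurable]: "u \<in> borel_measurable (power_measure M q)" and fin: "dev (power_measure M q) u < \<infinity>"
    and sym: "symmetric_kernel M q u" and e: "e > 0"
  shows "\<exists>\<A> h. cells M \<A> \<and> sym_kernel h \<and> dev (power_measure M q) (\<lambda>x. u x - ker \<A> q h x) \<le> ennreal e"
proof -
  let ?N = "power_measure M q" and ?P = "{\<pi>. \<pi> permutes {..<q}}"
  obtain \<A> h where A: "cells M \<A>" "dev ?N (\<lambda>x. u x - ker \<A> q h x) \<le> ennreal e"
    using approximable_all[OF u fin] e unfolding approximable_def by blast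
  let ?v = "\<lambda>x. u x - ker \<A> q h x"
  have v [measurable]: "?v \<in> borel_measurable ?N" using u ker_measurable[OF A(1)] by auto
  have vp: "(\<lambda>x. ?v (x \<circ> \<pi>)) \<in> borel_measurable ?N" if "\<pi> permutes {..<q}" for \<pi>
    using measurable_compose[OF permute_power_measure(1)[OF that] v] .
  have card: "card ?P = fact q" using card_permutations[of "{..<q}" q] by simp
  have "dev ?N (\<lambda>x. u x - ker \<A> q (symmetrize q h) x)
      \<le> (\<integral>\<^sup>+x. (\<Sum>\<pi>\<in>?P. ennreal (1 / fact q) * ennreal (\<bar>?v (x \<circ> \<pi>)\<bar> + (?v (x \<circ> \<pi>))\<^sup>2)) \<partial>?N)"
    unfolding dev_def
  proof (rule nn_integral_mono)
    fix x assume x: "x \<in> space ?N"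
    have "u x = (\<Sum>\<pi>\<in>?P. u (x \<circ> \<pi>)) / fact q"
      using sym x by (simp add: symmetric_kernel_def card)
    then have eq: "u x - ker \<A> q (symmetrize q h) x = (\<Sum>\<pi>\<in>?P. ?v (x \<circ> \<pi>)) / fact q"
      unfolding ker_symmetrize[OF A(1)] by (simp add: sum_subtractf diff_divide_distrib)
    have 1: "\<bar>(\<Sum>\<pi>\<in>?P. ?v (x \<circ> \<pi>)) / fact q\<bar> \<le> (\<Sum>\<pi>\<in>?P. \<bar>?v (x \<circ> \<pi>)\<bar>) / fact q"
      unfolding abs_divide by (simp add: divide_right_mono sum_abs)
    have "(\<Sum>\<pi>\<in>?P. ?v (x \<circ> \<pi>))\<^sup>2 \<le> (\<Sum>\<pi>\<in>?P. (?v (x \<circ> \<pi>))\<^sup>2) * fact q"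
      using sum_squared_le_sum_of_squares[of "\<lambda>\<pi>. ?v (x \<circ> \<pi>)" ?P] card by simp
    then have 2: "((\<Sum>\<pi>\<in>?P. ?v (x \<circ> \<pi>)) / fact q)\<^sup>2 \<le> (\<Sum>\<pi>\<in>?P. (?v (x \<circ> \<pi>))\<^sup>2) / fact q"
      by (simp add: power_divide divide_le_eq power2_eq_square mult.commute)
    have "\<bar>u x - ker \<A> q (symmetrize q h) x\<bar> + (u x - ker \<A> q (symmetrize q h) x)\<^sup>2
        \<le> (\<Sum>\<pi>\<in>?P. 1 / fact q * (\<bar>?v (x \<circ> \<pi>)\<bar> + (?v (x \<circ> \<pi>))\<^sup>2))"
      unfolding eq using add_mono[OF 1 2]
      by (simp add: sum_divide_distrib sum.distrib add_divide_distrib)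
    then have "ennreal (\<bar>u x - ker \<A> q (symmetrize q h) x\<bar> + (u x - ker \<A> q (symmetrize q h) x)\<^sup>2)
        \<le> ennreal (\<Sum>\<pi>\<in>?P. 1 / fact q * (\<bar>?v (x \<circ> \<pi>)\<bar> + (?v (x \<circ> \<pi>))\<^sup>2))" by (rule ennreal_leI)
    also have "\<dots> = (\<Sum>\<pi>\<in>?P. ennreal (1 / fact q * (\<bar>?v (x \<circ> \<pi>)\<bar> + (?v (x \<circ> \<pi>))\<^sup>2)))"
      by (rule sum_ennreal[symmetric]) (intro mult_nonneg_nonneg add_nonneg_nonneg, auto)
    also have "\<dots> = (\<Sum>\<pi>\<in>?P. ennreal (1 / fact q) * ennreal (\<bar>?v (x \<circ> \<pi>)\<bar> + (?v (x \<circ> \<pi>))\<^sup>2))"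
      by (intro sum.cong refl ennreal_mult) auto
    finally show "ennreal (\<bar>u x - ker \<A> q (symmetrize q h) x\<bar> + (u x - ker \<A> q (symmetrize q h) x)\<^sup>2)
        \<le> (\<Sum>\<pi>\<in>?P. ennreal (1 / fact q) * ennreal (\<bar>?v (x \<circ> \<pi>)\<bar> + (?v (x \<circ> \<pi>))\<^sup>2))" .
  qed
  also have "\<dots> = (\<Sum>\<pi>\<in>?P. \<integral>\<^sup>+x. ennreal (1 / fact q) * ennreal (\<bar>?v (x \<circ> \<pi>)\<bar> + (?v (x \<circ> \<pi>))\<^sup>2) \<partial>?N)"
    by (rule nn_integral_sum) (use vp in measurable)
  also have "\<dots> = (\<Sum>\<pi>\<in>?P. ennreal (1 / fact q) * dev ?N ?v)"
  proof (intro sum.cong refl)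
    fix \<pi> assume "\<pi> \<in> ?P"
    then have p: "\<pi> permutes {..<q}" by simp
    have "(\<integral>\<^sup>+x. ennreal (1 / fact q) * ennreal (\<bar>?v (x \<circ> \<pi>)\<bar> + (?v (x \<circ> \<pi>))\<^sup>2) \<partial>?N)
        = ennreal (1 / fact q) * (\<integral>\<^sup>+x. ennreal (\<bar>?v (x \<circ> \<pi>)\<bar> + (?v (x \<circ> \<pi>))\<^sup>2) \<partial>?N)"
      by (rule nn_integral_cmult) (use vp[OF p] in measurable)
    also have "\<dots> = ennreal (1 / fact q) * dev ?N ?v"
      using dev_permute[OF p v] unfolding dev_def by simp
    finally show "(\<integral>\<^sup>+x. ennreal (1 / fact q) * ennreal (\<bar>?v (x \<circ> \<pi>)\<bar> + (?v (x \<circ> \<pi>))\<^sup>2) \<partial>?N)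
        = ennreal (1 / fact q) * dev ?N ?v" .
  qed
  also have "\<dots> = (of_nat (fact q) * ennreal (1 / fact q)) * dev ?N ?v"
    by (simp add: card mult.assoc)
  also have "of_nat (fact q) * ennreal (1 / fact q) = 1"
    by (simp add: ennreal_of_nat_eq_real_of_nat ennreal_mult[symmetric])
  finally have "dev ?N (\<lambda>x. u x - ker \<A> q (symmetrize q h) x) \<le> ennreal e" using A(2) by simp
  then show ?thesis using A(1) sym_kernel_symmetrize by blast
qed

section \<open>Simple chaos variables are dense in the chaos\<close>

lemma chaos_minus: "chaos I lam n (\<lambda>z. h z - k z) x = chaos I lam n h x - chaos I lam n k x"
  by (simp add: chaos_wsum wsum_minus left_diff_distrib)

lemma sym_kernel_minus: "sym_kernel h \<Longrightarrow> sym_kernel k \<Longrightarrow> sym_kernel (\<lambda>z. h z - k z)"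
  unfolding sym_kernel_def by metis

lemma nn_square_le_dev: "(\<integral>\<^sup>+x. ennreal ((u x)\<^sup>2) \<partial>N) \<le> dev N u"
  unfolding dev_def by (intro nn_integral_mono ennreal_leI) simp

lemma nn_abs_le_dev: "(\<integral>\<^sup>+x. ennreal \<bar>u x\<bar> \<partial>N) \<le> dev N u"
  unfolding dev_def by (intro nn_integral_mono ennreal_leI) simp

lemma nn_square_add:
  assumes [measurable]: "u \<in> borel_measurable N" "v \<in> borel_measurable N"
  shows "(\<integral>\<^sup>+x. ennreal ((u x + v x)\<^sup>2) \<partial>N)
    \<le> 2 * (\<integral>\<^sup>+x. ennreal ((u x)\<^sup>2) \<partial>N) + 2 * (\<integral>\<^sup>+x. ennreal ((v x)\<^sup>2) \<partial>N)"
proof -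
  have "(\<integral>\<^sup>+x. ennreal ((u x + v x)\<^sup>2) \<partial>N) \<le> (\<integral>\<^sup>+x. 2 * ennreal ((u x)\<^sup>2) + 2 * ennreal ((v x)\<^sup>2) \<partial>N)"
  proof (rule nn_integral_mono)
    fix x
    have "(u x + v x)\<^sup>2 \<le> 2 * (u x)\<^sup>2 + 2 * (v x)\<^sup>2"
      using sum_squares_bound[of "u x" "v x"] by (simp add: power2_sum)
    then show "ennreal ((u x + v x)\<^sup>2) \<le> 2 * ennreal ((u x)\<^sup>2) + 2 * ennreal ((v x)\<^sup>2)"
      by (simp add: two_mult_ennreal_add ennreal_leI del: ennreal_plus)
  qed
  also have "\<dots> = 2 * (\<integral>\<^sup>+x. ennreal ((u x)\<^sup>2) \<partial>N) + 2 * (\<integral>\<^sup>+x. ennreal ((v x)\<^sup>2) \<partial>N)"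
    by (subst nn_integral_add) (simp_all add: nn_integral_cmult)
  finally show ?thesis .
qed

context poisson_random_measure
begin

definition simple_chaos :: "'z set set \<Rightarrow> nat \<Rightarrow> ('z set list \<Rightarrow> real) \<Rightarrow> 'w \<Rightarrow> real" where
  "simple_chaos \<A> q h \<omega> = chaos \<A> (measure \<mu>) q h (counts \<A> \<omega>)"

lemma simple_chaos_measurable [measurable]:
  assumes "cells \<mu> \<A>"
  shows "simple_chaos \<A> q h \<in> borel_measurable M"
  unfolding simple_chaos_def[abs_def]
  using measurable_compose[OF counts_measurable[OF assms], of "chaos \<A> (measure \<mu>) q h" borel] by simp

text \<open>Both variables agree almost surely with the pathwise integral of the same function, so
  the chosen cells do not matter.\<close>

lemma simple_chaos_AE_eq:
  assumes "cells \<mu> \<A>" "cells \<mu> \<C>" "sym_kernel h" "sym_kernel h'" "\<And>x. ker \<A> q h x = ker \<C> q h' x"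
  shows "AE \<omega> in M. simple_chaos \<A> q h \<omega> = simple_chaos \<C> q h' \<omega>"
proof -
  have "ker \<A> q h = ker \<C> q h'" using assms(5) by (intro ext)
  then show ?thesis
    using pathwise_integral_ker[OF assms(1,3), of q] pathwise_integral_ker[OF assms(2,4), of q]
    unfolding simple_chaos_def by auto
qed

lemma nn_simple_chaos_square:
  assumes \<A>: "cells \<mu> \<A>" and h: "sym_kernel h"
  shows "(\<integral>\<^sup>+\<omega>. ennreal ((simple_chaos \<A> q h \<omega>)\<^sup>2) \<partial>M)
    = ennreal (fact q) * (\<integral>\<^sup>+x. ennreal ((ker \<A> q h x)\<^sup>2) \<partial>power_measure \<mu> q)"
proof -
  interpret P: poisson_vector "counts_pmf \<A>" \<A> "measure \<mu>" by (rule poisson_vector_counts[OF \<A>])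
  let ?c = "chaos \<A> (measure \<mu>) q h"
  have t: "tempered \<A> (\<lambda>x. (?c x)\<^sup>2)" by (rule tempered_power[OF tempered_chaos[OF P.finite_I]])
  have "(\<integral>\<^sup>+\<omega>. ennreal ((simple_chaos \<A> q h \<omega>)\<^sup>2) \<partial>M) = ennreal (expectation (\<lambda>\<omega>. (?c (counts \<A> \<omega>))\<^sup>2))"
    unfolding simple_chaos_def using P.integrable_tempered[OF t]
    by (intro nn_integral_eq_integral) (auto simp: integrable_counts[OF \<A>])
  also have "expectation (\<lambda>\<omega>. (?c (counts \<A> \<omega>))\<^sup>2) = P.E (\<lambda>x. ?c x * ?c x)"
    using expectation_counts[OF \<A>, of "\<lambda>x. (?c x)\<^sup>2"] by (simp add: power2_eq_square)
  also have "\<dots> = fact q * wsum \<A> (measure \<mu>) q (\<lambda>z. h z * h z)" by (rule P.chaos_inner[OF h h])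
  also have "wsum \<A> (measure \<mu>) q (\<lambda>z. h z * h z) = (\<integral>x. (ker \<A> q h x)\<^sup>2 \<partial>power_measure \<mu> q)"
    using control.integral_ker_power(2)[OF \<A>, of q "\<lambda>z. h z * h z"]
    by (simp add: ker_mult[OF \<A>] power2_eq_square)
  also have "ennreal (fact q * \<dots>) = ennreal (fact q) * (\<integral>\<^sup>+x. ennreal ((ker \<A> q h x)\<^sup>2) \<partial>power_measure \<mu> q)"
  proof -
    have "ker \<A> q (\<lambda>z. h z * h z) = (\<lambda>x. (ker \<A> q h x)\<^sup>2)"
      by (rule ext) (simp add: ker_mult[OF \<A>] power2_eq_square)
    then have "integrable (power_measure \<mu> q) (\<lambda>x. (ker \<A> q h x)\<^sup>2)"
      using control.integral_ker_power(1)[OF \<A>, of q "\<lambda>z. h z * h z"] by simp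
    then show ?thesis by (subst nn_integral_eq_integral) (auto simp: ennreal_mult)
  qed
  finally show ?thesis .
qed

lemma nn_simple_chaos_dist:
  assumes \<A>: "cells \<mu> \<A>" "sym_kernel h" and \<B>: "cells \<mu> \<B>" "sym_kernel k"
  shows "(\<integral>\<^sup>+\<omega>. ennreal ((simple_chaos \<A> q h \<omega> - simple_chaos \<B> q k \<omega>)\<^sup>2) \<partial>M)
    = ennreal (fact q) * (\<integral>\<^sup>+x. ennreal ((ker \<A> q h x - ker \<B> q k x)\<^sup>2) \<partial>power_measure \<mu> q)"
proof -
  obtain \<C> h' k' where C: "cells \<mu> \<C>" "\<And>x. ker \<A> q h x = ker \<C> q h' x" "\<And>x. ker \<B> q k x = ker \<C> q k' x"
    "sym_kernel h \<Longrightarrow> sym_kernel h'" "sym_kernel k \<Longrightarrow> sym_kernel k'"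
    using ker_common_refinement[OF \<A>(1) \<B>(1), of q h k] by metis
  have s: "sym_kernel h'" "sym_kernel k'" using C(4,5) \<A>(2) \<B>(2) by auto
  have "AE \<omega> in M. simple_chaos \<A> q h \<omega> - simple_chaos \<B> q k \<omega> = simple_chaos \<C> q (\<lambda>z. h' z - k' z) \<omega>"
    using simple_chaos_AE_eq[OF \<A>(1) C(1) \<A>(2) s(1) C(2)] simple_chaos_AE_eq[OF \<B>(1) C(1) \<B>(2) s(2) C(3)]
    by eventually_elim (simp add: simple_chaos_def chaos_minus)
  then have "(\<integral>\<^sup>+\<omega>. ennreal ((simple_chaos \<A> q h \<omega> - simple_chaos \<B> q k \<omega>)\<^sup>2) \<partial>M)
      = (\<integral>\<^sup>+\<omega>. ennreal ((simple_chaos \<C> q (\<lambda>z. h' z - k' z) \<omega>)\<^sup>2) \<partial>M)"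
    by (intro nn_integral_cong_AE) auto
  also have "\<dots> = ennreal (fact q) * (\<integral>\<^sup>+x. ennreal ((ker \<C> q (\<lambda>z. h' z - k' z) x)\<^sup>2) \<partial>power_measure \<mu> q)"
    by (rule nn_simple_chaos_square[OF C(1) sym_kernel_minus[OF s]])
  finally show ?thesis by (simp add: ker_minus C(2,3))
qed

text \<open>Errors that are summable for the power measure are summable along almost every
  realization, by the mean formula. The integrals then converge for each mixed measure, and the
  pathwise formula is a finite combination of them.\<close>

lemma pathwise_limit:
  assumes g: "g \<in> borel_measurable (power_measure \<mu> q)"
    and A: "\<And>j. cells \<mu> (\<A> j)" and h: "\<And>j. sym_kernel (h j)"
    and d: "\<And>j. dev (power_measure \<mu> q) (\<lambda>x. g x - ker (\<A> j) q (h j) x) \<le> ennreal ((1 / 2) ^ j)"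
  shows "AE \<omega> in M. (\<lambda>j. simple_chaos (\<A> j) q (h j) \<omega>) \<longlonglongrightarrow> pathwise_integral \<mu> \<eta> q g \<omega>"
proof -
  let ?N = "power_measure \<mu> q"
  let ?b = "\<lambda>j. ker (\<A> j) q (h j)"
  let ?f = "\<lambda>x. \<Sum>j. ennreal \<bar>g x - ?b j x\<bar>"
  have bm: "?b j \<in> borel_measurable ?N" for j by (rule ker_measurable[OF A])
  have fm: "(\<lambda>x. ennreal \<bar>g x - ?b j x\<bar>) \<in> borel_measurable ?N" for j using g bm by measurable
  have "(\<integral>\<^sup>+x. ?f x \<partial>?N) = (\<Sum>j. \<integral>\<^sup>+x. ennreal \<bar>g x - ?b j x\<bar> \<partial>?N)"
    by (rule nn_integral_suminf[OF fm])
  also have "\<dots> \<le> (\<Sum>j. ennreal ((1 / 2) ^ j))"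
    using order_trans[OF nn_abs_le_dev d] by (intro suminf_le) auto
  also have "\<dots> = ennreal (\<Sum>j. (1 / 2) ^ j)"
    by (intro suminf_ennreal2) (auto intro: summable_geometric)
  finally have fin: "(\<integral>\<^sup>+x. ?f x \<partial>?N) < \<infinity>" by (simp add: le_less_trans)
  have fin_mixed: "AE \<omega> in M. \<forall>k\<in>{..q}. (\<integral>\<^sup>+x. ?f x \<partial>mixed \<omega> k q) < \<infinity>"
  proof (rule AE_finite_allI)
    fix k assume "k \<in> {..q}"
    then have "k \<le> q" by simp
    moreover have "?f \<in> borel_measurable ?N" by (rule borel_measurable_suminf_order[OF fm])
    ultimately show "AE \<omega> in M. (\<integral>\<^sup>+x. ?f x \<partial>mixed \<omega> k q) < \<infinity>" using fin by (rule AE_mixed_finite)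
  qed simp
  have cnt: "AE \<omega> in M. \<forall>j. \<forall>B\<in>\<A> j. emeasure (\<eta> \<omega>) B = of_nat (counts (\<A> j) \<omega> B)"
    using AE_counts[OF A] by (simp add: AE_all_countable)
  have pw: "AE \<omega> in M. \<forall>j. pathwise_integral \<mu> \<eta> q (?b j) \<omega> = simple_chaos (\<A> j) q (h j) \<omega>"
    unfolding simple_chaos_def AE_all_countable by (intro allI pathwise_integral_ker A h)
  show ?thesis
    using fin_mixed cnt pw AE_proper
  proof eventually_elim
    case (elim \<omega>)
    note p = elim(4)
    have lim: "integrable (mixed \<omega> k q) g \<and> (\<lambda>j. \<integral>x. ?b j x \<partial>mixed \<omega> k q) \<longlonglongrightarrow> (\<integral>x. g x \<partial>mixed \<omega> k q)"
      if k: "k \<le> q" for k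
    proof -
      let ?X = "mixed \<omega> k q"
      have gm: "g \<in> borel_measurable ?X" and bm': "?b j \<in> borel_measurable ?X" for j
        using g bm by (simp_all add: mixed_proper[OF p])
      have ib: "integrable ?X (?b j)" for j by (rule integral_ker_mixed(1)[OF A k p]) (use elim(2) in blast)
      have "(\<integral>\<^sup>+x. ?f x \<partial>?X) = (\<Sum>j. \<integral>\<^sup>+x. ennreal \<bar>g x - ?b j x\<bar> \<partial>?X)"
        by (rule nn_integral_suminf) (use gm bm' in measurable)
      moreover have "(\<integral>\<^sup>+x. ?f x \<partial>?X) < \<infinity>" by (rule bspec[OF elim(1)]) (rule atMost_iff[THEN iffD2, OF k])
      ultimately have sfin: "(\<Sum>j. \<integral>\<^sup>+x. ennreal \<bar>g x - ?b j x\<bar> \<partial>?X) \<noteq> \<infinity>" by simp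
      have each: "(\<integral>\<^sup>+x. ennreal \<bar>g x - ?b j x\<bar> \<partial>?X) < \<infinity>" for j
      proof -
        have "(\<integral>\<^sup>+x. ennreal \<bar>g x - ?b j x\<bar> \<partial>?X) \<le> (\<Sum>j. \<integral>\<^sup>+x. ennreal \<bar>g x - ?b j x\<bar> \<partial>?X)"
          using sum_le_suminf[of "\<lambda>j. \<integral>\<^sup>+x. ennreal \<bar>g x - ?b j x\<bar> \<partial>?X" "{j}"] by simp
        then show ?thesis using sfin by (auto simp: less_top[symmetric] top_unique)
      qed
      have idiff: "integrable ?X (\<lambda>x. g x - ?b j x)" for j
        by (rule integrableI_bounded) (use gm bm' each[of j] in auto)
      have ig: "integrable ?X g"
        using Bochner_Integration.integrable_add[OF idiff[of 0] ib[of 0]] by simp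
      define r where "r j = (\<integral>x. \<bar>g x - ?b j x\<bar> \<partial>?X)" for j
      have r: "(\<integral>\<^sup>+x. ennreal \<bar>g x - ?b j x\<bar> \<partial>?X) = ennreal (r j)" for j
        unfolding r_def using idiff[of j] by (intro nn_integral_eq_integral) auto
      have "summable r"
        using sfin unfolding r by (intro summable_suminf_not_top) (auto simp: r_def)
      then have r0: "r \<longlonglongrightarrow> 0" by (rule summable_LIMSEQ_zero)
      have "(\<lambda>j. (\<integral>x. ?b j x \<partial>?X) - (\<integral>x. g x \<partial>?X)) \<longlonglongrightarrow> 0"
      proof (rule Lim_null_comparison[OF _ r0])
        have "norm ((\<integral>x. ?b j x \<partial>?X) - (\<integral>x. g x \<partial>?X)) \<le> r j" for j
        proof -
          have "(\<integral>x. g x \<partial>?X) - (\<integral>x. ?b j x \<partial>?X) = (\<integral>x. g x - ?b j x \<partial>?X)" using ig ib by simp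
          then show ?thesis
            using integral_abs_bound[of ?X "\<lambda>x. g x - ?b j x"]
            by (simp add: r_def abs_minus_commute)
        qed
        then show "\<forall>\<^sub>F j in sequentially. norm ((\<integral>x. ?b j x \<partial>?X) - (\<integral>x. g x \<partial>?X)) \<le> r j" by simp
      qed
      then show ?thesis using ig by (simp add: LIM_zero_iff)
    qed
    have ib: "integrable (mixed \<omega> k q) (?b j)" if "k \<le> q" for k j
      by (rule integral_ker_mixed(1)[OF A that p]) (use elim(2) in blast)
    have "(\<lambda>j. pathwise_integral \<mu> \<eta> q (?b j) \<omega>) \<longlonglongrightarrow> pathwise_integral \<mu> \<eta> q g \<omega>"
    proof -
      have pwg: "pathwise_integral \<mu> \<eta> q g \<omega> = (\<Sum>k\<le>q. (- 1) ^ (q - k) * real (q choose k) * (\<integral>x. g x \<partial>mixed \<omega> k q))"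
        by (rule pathwise_integral_mixed[OF p conjunct1[OF lim]])
      have pwb: "pathwise_integral \<mu> \<eta> q (?b j) \<omega> = (\<Sum>k\<le>q. (- 1) ^ (q - k) * real (q choose k) * (\<integral>x. ?b j x \<partial>mixed \<omega> k q))" for j
        by (rule pathwise_integral_mixed[OF p ib])
      show ?thesis
        unfolding pwg pwb by (intro tendsto_sum tendsto_mult tendsto_const conjunct2[OF lim]) simp
    qed
    then show ?case using elim(3) by simp
  qed
qed

text \<open>The limit \<open>U\<close> of simple variables provides a measurable version of the
  pathwise integral. Fatou's lemma, together with the isometry for differences of simple variables,
  bounds its distance to them.\<close>

lemma pathwise_approximation:
  assumes g: "symmetric_kernel \<mu> q g" "integrable (power_measure \<mu> q) g" "g \<in> L2 (power_measure \<mu> q)"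
  shows "\<exists>U\<in>borel_measurable M. (AE \<omega> in M. pathwise_integral \<mu> \<eta> q g \<omega> = U \<omega>) \<and>
    (\<forall>e>0. \<exists>\<A> h. cells \<mu> \<A> \<and> sym_kernel h \<and>
      (\<integral>\<^sup>+\<omega>. ennreal ((simple_chaos \<A> q h \<omega> - U \<omega>)\<^sup>2) \<partial>M) \<le> ennreal e)"
proof -
  let ?N = "power_measure \<mu> q"
  have gm [measurable]: "g \<in> borel_measurable ?N" using g(2) by (rule borel_measurable_integrable)
  have "dev ?N g = (\<integral>\<^sup>+x. ennreal \<bar>g x\<bar> \<partial>?N) + (\<integral>\<^sup>+x. ennreal ((g x)\<^sup>2) \<partial>?N)"
    unfolding dev_def by (subst nn_integral_add[symmetric]) simp_all
  also have "\<dots> < \<infinity>"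
    using g(2,3) by (auto simp: L2_def integrable_iff_bounded)
  finally have fin: "dev ?N g < \<infinity>" .
  have "\<forall>j. \<exists>\<A>h. cells \<mu> (fst \<A>h) \<and> sym_kernel (snd \<A>h) \<and> dev ?N (\<lambda>x. g x - ker (fst \<A>h) q (snd \<A>h) x) \<le> ennreal ((1 / 2) ^ j)"
  proof
    fix j :: nat
    have "(0::real) < (1 / 2) ^ j" by simp
    from control.symmetric_approximation[OF gm fin g(1) this] obtain \<A> h
      where "cells \<mu> \<A>" "sym_kernel h" "dev ?N (\<lambda>x. g x - ker \<A> q h x) \<le> ennreal ((1 / 2) ^ j)" by blast
    then show "\<exists>\<A>h. cells \<mu> (fst \<A>h) \<and> sym_kernel (snd \<A>h) \<and> dev ?N (\<lambda>x. g x - ker (fst \<A>h) q (snd \<A>h) x) \<le> ennreal ((1 / 2) ^ j)"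
      by (intro exI[of _ "(\<A>, h)"]) simp
  qed
  from choice[OF this] obtain \<A>h where \<A>h: "\<And>j. cells \<mu> (fst (\<A>h j))" "\<And>j. sym_kernel (snd (\<A>h j))"
    "\<And>j. dev ?N (\<lambda>x. g x - ker (fst (\<A>h j)) q (snd (\<A>h j)) x) \<le> ennreal ((1 / 2) ^ j)" by blast
  define X where "X j = simple_chaos (fst (\<A>h j)) q (snd (\<A>h j))" for j
  let ?b = "\<lambda>j. ker (fst (\<A>h j)) q (snd (\<A>h j))"
  have Xm [measurable]: "X j \<in> borel_measurable M" for j unfolding X_def by (rule simple_chaos_measurable[OF \<A>h(1)])
  have bm [measurable]: "?b j \<in> borel_measurable ?N" for j by (rule ker_measurable[OF \<A>h(1)])
  define U where "U \<omega> = lim (\<lambda>j. X j \<omega>)" for \<omega>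
  have Um [measurable]: "U \<in> borel_measurable M" unfolding U_def[abs_def] by measurable
  have lim: "AE \<omega> in M. (\<lambda>j. X j \<omega>) \<longlonglongrightarrow> pathwise_integral \<mu> \<eta> q g \<omega>"
    unfolding X_def by (rule pathwise_limit[OF gm \<A>h])
  then have eq: "AE \<omega> in M. pathwise_integral \<mu> \<eta> q g \<omega> = U \<omega>"
    by eventually_elim (simp add: U_def limI)
  have limU: "AE \<omega> in M. (\<lambda>j. X j \<omega>) \<longlonglongrightarrow> U \<omega>" using lim eq by eventually_elim simp
  have bound: "(\<integral>\<^sup>+\<omega>. ennreal ((X j \<omega> - U \<omega>)\<^sup>2) \<partial>M) \<le> ennreal (4 * fact q * (1 / 2) ^ j)" for j
  proof -
    have "(\<integral>\<^sup>+\<omega>. ennreal ((X j \<omega> - U \<omega>)\<^sup>2) \<partial>M) = (\<integral>\<^sup>+\<omega>. liminf (\<lambda>i. ennreal ((X j \<omega> - X i \<omega>)\<^sup>2)) \<partial>M)"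
    proof (rule nn_integral_cong_AE)
      show "AE \<omega> in M. ennreal ((X j \<omega> - U \<omega>)\<^sup>2) = liminf (\<lambda>i. ennreal ((X j \<omega> - X i \<omega>)\<^sup>2))"
        using limU
      proof eventually_elim
        case (elim \<omega>)
        have "(\<lambda>i. ennreal ((X j \<omega> - X i \<omega>)\<^sup>2)) \<longlonglongrightarrow> ennreal ((X j \<omega> - U \<omega>)\<^sup>2)"
          by (intro tendsto_ennrealI tendsto_intros elim)
        from lim_imp_Liminf[OF _ this] show ?case by simp
      qed
    qed
    also have "\<dots> \<le> liminf (\<lambda>i. \<integral>\<^sup>+\<omega>. ennreal ((X j \<omega> - X i \<omega>)\<^sup>2) \<partial>M)"
      by (rule nn_integral_liminf) simp
    also have "\<dots> \<le> limsup (\<lambda>i. \<integral>\<^sup>+\<omega>. ennreal ((X j \<omega> - X i \<omega>)\<^sup>2) \<partial>M)"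
      by (rule Liminf_le_Limsup) simp
    also have "\<dots> \<le> ennreal (4 * fact q * (1 / 2) ^ j)"
    proof (rule Limsup_bounded)
      have "(\<integral>\<^sup>+\<omega>. ennreal ((X j \<omega> - X i \<omega>)\<^sup>2) \<partial>M) \<le> ennreal (4 * fact q * (1 / 2) ^ j)" if "j \<le> i" for i
      proof -
        have neg: "dev ?N (\<lambda>x. ?b j x - g x) = dev ?N (\<lambda>x. g x - ?b j x)"
          unfolding dev_def by (simp add: abs_minus_commute power2_commute)
        have "(\<integral>\<^sup>+x. ennreal ((?b j x - ?b i x)\<^sup>2) \<partial>?N) \<le> dev ?N (\<lambda>x. ?b j x - ?b i x)" by (rule nn_square_le_dev)
        also have "\<dots> = dev ?N (\<lambda>x. (?b j x - g x) + (g x - ?b i x))" by simp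
        also have "\<dots> \<le> 2 * dev ?N (\<lambda>x. ?b j x - g x) + 2 * dev ?N (\<lambda>x. g x - ?b i x)"
          by (rule dev_add) measurable
        also have "\<dots> \<le> 2 * ennreal ((1 / 2) ^ j) + 2 * ennreal ((1 / 2) ^ i)"
          unfolding neg by (intro add_mono mult_left_mono \<A>h(3)) auto
        also have "\<dots> = ennreal (2 * (1 / 2) ^ j + 2 * (1 / 2) ^ i)" by (rule two_mult_ennreal_add) auto
        also have "\<dots> \<le> ennreal (4 * (1 / 2) ^ j)"
        proof (rule ennreal_leI)
          have "(1 / 2 :: real) ^ i \<le> (1 / 2) ^ j" by (rule power_decreasing[OF that]) auto
          then show "2 * (1 / 2) ^ j + 2 * (1 / 2) ^ i \<le> (4 * (1 / 2) ^ j :: real)" by linarith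
        qed
        finally have "(\<integral>\<^sup>+x. ennreal ((?b j x - ?b i x)\<^sup>2) \<partial>?N) \<le> ennreal (4 * (1 / 2) ^ j)" .
        then have "(\<integral>\<^sup>+\<omega>. ennreal ((X j \<omega> - X i \<omega>)\<^sup>2) \<partial>M) \<le> ennreal (fact q) * ennreal (4 * (1 / 2) ^ j)"
          unfolding X_def nn_simple_chaos_dist[OF \<A>h(1,2) \<A>h(1,2)] by (intro mult_left_mono) auto
        also have "\<dots> = ennreal (fact q * (4 * (1 / 2) ^ j))" by (rule ennreal_mult[symmetric]) auto
        also have "fact q * (4 * (1 / 2) ^ j) = 4 * fact q * (1 / 2 :: real) ^ j" by (simp only: ac_simps)
        finally show ?thesis .
      qed
      then show "\<forall>\<^sub>F i in sequentially. (\<integral>\<^sup>+\<omega>. ennreal ((X j \<omega> - X i \<omega>)\<^sup>2) \<partial>M) \<le> ennreal (4 * fact q * (1 / 2) ^ j)"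
        unfolding eventually_sequentially by blast
    qed
    finally show ?thesis .
  qed
  have "\<exists>\<A> h. cells \<mu> \<A> \<and> sym_kernel h \<and> (\<integral>\<^sup>+\<omega>. ennreal ((simple_chaos \<A> q h \<omega> - U \<omega>)\<^sup>2) \<partial>M) \<le> ennreal e"
    if e: "e > 0" for e
  proof -
    have "(\<lambda>j. 4 * fact q * (1 / 2 :: real) ^ j) \<longlonglongrightarrow> 4 * fact q * 0"
      by (intro tendsto_mult tendsto_const LIMSEQ_power_zero) simp
    then have "\<forall>\<^sub>F j in sequentially. 4 * fact q * (1 / 2 :: real) ^ j < e"
      using e by (intro order_tendstoD(2)) auto
    then obtain j where j: "4 * fact q * (1 / 2 :: real) ^ j < e" by (auto simp: eventually_sequentially)
    then have "(\<integral>\<^sup>+\<omega>. ennreal ((X j \<omega> - U \<omega>)\<^sup>2) \<partial>M) \<le> ennreal e"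
      by (intro order_trans[OF bound[of j]] ennreal_leI) simp
    then show ?thesis using \<A>h(1,2) unfolding X_def by blast
  qed
  then show ?thesis using eq Um by blast
qed

text \<open>A chaos variable is by definition a limit of pathwise integrals, and these are limits of
  simple variables by \<open>pathwise_approximation\<close>.\<close>

lemma simple_chaos_dense:
  assumes "F \<in> poisson_chaos M \<mu> \<eta> q" "e > 0"
  shows "\<exists>\<A> h. cells \<mu> \<A> \<and> sym_kernel h \<and>
    (\<integral>\<^sup>+\<omega>. ennreal ((simple_chaos \<A> q h \<omega> - F \<omega>)\<^sup>2) \<partial>M) \<le> ennreal e"
proof -
  obtain f g where F: "F \<in> L2 M"
    and g: "\<And>n. symmetric_kernel \<mu> q (g n)" "\<And>n. integrable (power_measure \<mu> q) (g n)" "\<And>n. g n \<in> L2 (power_measure \<mu> q)"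
    and lim: "(\<lambda>n. \<integral>\<^sup>+\<omega>. ennreal ((pathwise_integral \<mu> \<eta> q (g n) \<omega> - F \<omega>)\<^sup>2) \<partial>M) \<longlonglongrightarrow> 0"
    using assms(1) unfolding poisson_chaos_def has_multiple_integral_def by blast
  have Fm [measurable]: "F \<in> borel_measurable M" using F by (simp add: L2_def)
  have "\<forall>\<^sub>F n in sequentially. (\<integral>\<^sup>+\<omega>. ennreal ((pathwise_integral \<mu> \<eta> q (g n) \<omega> - F \<omega>)\<^sup>2) \<partial>M) < ennreal (e / 4)"
    using assms(2) by (intro order_tendstoD(2)[OF lim]) auto
  then obtain n where n: "(\<integral>\<^sup>+\<omega>. ennreal ((pathwise_integral \<mu> \<eta> q (g n) \<omega> - F \<omega>)\<^sup>2) \<partial>M) < ennreal (e / 4)"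
    by (auto simp: eventually_sequentially)
  obtain U where U [measurable]: "U \<in> borel_measurable M"
    and eq: "AE \<omega> in M. pathwise_integral \<mu> \<eta> q (g n) \<omega> = U \<omega>"
    and ap: "\<And>e. e > 0 \<Longrightarrow> \<exists>\<A> h. cells \<mu> \<A> \<and> sym_kernel h \<and>
      (\<integral>\<^sup>+\<omega>. ennreal ((simple_chaos \<A> q h \<omega> - U \<omega>)\<^sup>2) \<partial>M) \<le> ennreal e"
    using pathwise_approximation[OF g] by blast
  have UF: "(\<integral>\<^sup>+\<omega>. ennreal ((U \<omega> - F \<omega>)\<^sup>2) \<partial>M) \<le> ennreal (e / 4)"
  proof -
    have "(\<integral>\<^sup>+\<omega>. ennreal ((U \<omega> - F \<omega>)\<^sup>2) \<partial>M) = (\<integral>\<^sup>+\<omega>. ennreal ((pathwise_integral \<mu> \<eta> q (g n) \<omega> - F \<omega>)\<^sup>2) \<partial>M)"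
      using eq by (intro nn_integral_cong_AE) auto
    then show ?thesis using n by simp
  qed
  have "e / 4 > 0" using assms(2) by simp
  from ap[OF this] obtain \<A> h where A: "cells \<mu> \<A>" "sym_kernel h"
    "(\<integral>\<^sup>+\<omega>. ennreal ((simple_chaos \<A> q h \<omega> - U \<omega>)\<^sup>2) \<partial>M) \<le> ennreal (e / 4)" by blast
  have "(\<integral>\<^sup>+\<omega>. ennreal ((simple_chaos \<A> q h \<omega> - F \<omega>)\<^sup>2) \<partial>M)
      = (\<integral>\<^sup>+\<omega>. ennreal (((simple_chaos \<A> q h \<omega> - U \<omega>) + (U \<omega> - F \<omega>))\<^sup>2) \<partial>M)" by simp
  also have "\<dots> \<le> 2 * (\<integral>\<^sup>+\<omega>. ennreal ((simple_chaos \<A> q h \<omega> - U \<omega>)\<^sup>2) \<partial>M) + 2 * (\<integral>\<^sup>+\<omega>. ennreal ((U \<omega> - F \<omega>)\<^sup>2) \<partial>M)"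
    using simple_chaos_measurable[OF A(1)] by (intro nn_square_add) auto
  also have "\<dots> \<le> 2 * ennreal (e / 4) + 2 * ennreal (e / 4)"
    using A(3) UF by (intro add_mono mult_left_mono) auto
  also have "\<dots> = ennreal e" using assms(2) by (subst two_mult_ennreal_add) auto
  finally show ?thesis using A by blast
qed

end

section \<open>Projection onto a finite family of cells\<close>

text \<open>On a refinement this recovers the coarse counts from the fine ones almost surely, as
  \<open>counts_aggregate\<close> shows.\<close>

definition aggregate :: "'z set set \<Rightarrow> 'z set set \<Rightarrow> ('z set \<Rightarrow> nat) \<Rightarrow> 'z set \<Rightarrow> nat" where
  "aggregate \<A> \<C> x B = (if B \<in> \<A> then \<Sum>C | C \<in> \<C> \<and> C \<subseteq> B. x C else 0)"

lemma aggregate_raise: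
  assumes \<A>: "cells \<mu> \<A>" and \<C>: "cells \<mu> \<C>" and C: "C \<in> \<C>"
  shows "aggregate \<A> \<C> (raise C x)
    = (if \<exists>A\<in>\<A>. C \<subseteq> A then raise (parent \<A> C) (aggregate \<A> \<C> x) else aggregate \<A> \<C> x)"
proof (rule ext)
  fix B
  have fin: "finite \<C>" and ne: "C \<noteq> {}" using \<C> C by (auto simp: cells_def)
  have fin': "finite {C \<in> \<C>. C \<subseteq> B}" using fin by simp
  have sum: "(\<Sum>D | D \<in> \<C> \<and> D \<subseteq> B. raise C x D) = (\<Sum>D | D \<in> \<C> \<and> D \<subseteq> B. x D) + (if C \<subseteq> B then 1 else 0)"
  proof -
    have "(\<Sum>D | D \<in> \<C> \<and> D \<subseteq> B. raise C x D) = (\<Sum>D | D \<in> \<C> \<and> D \<subseteq> B. x D + (if D = C then 1 else 0))"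
      by (intro sum.cong refl) (simp add: raise_apply)
    also have "\<dots> = (\<Sum>D | D \<in> \<C> \<and> D \<subseteq> B. x D) + (if C \<subseteq> B then 1 else 0)"
      using fin' C by (simp add: sum.distrib sum.delta)
    finally show ?thesis .
  qed
  have ag: "aggregate \<A> \<C> (raise C x) B = aggregate \<A> \<C> x B + (if B \<in> \<A> \<and> C \<subseteq> B then 1 else 0)"
    unfolding aggregate_def sum by simp
  show "aggregate \<A> \<C> (raise C x) B
    = (if \<exists>A\<in>\<A>. C \<subseteq> A then raise (parent \<A> C) (aggregate \<A> \<C> x) else aggregate \<A> \<C> x) B"
  proof (cases "\<exists>A\<in>\<A>. C \<subseteq> A")
    case True
    then obtain A where A: "A \<in> \<A>" "C \<subseteq> A" by blast
    have par: "parent \<A> C = A" by (rule parent_eq[OF \<A> ne A])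
    have "B \<in> \<A> \<and> C \<subseteq> B \<longleftrightarrow> B = A" using parent_eq[OF \<A> ne, of B] par A by auto
    then show ?thesis using True par by (simp add: ag raise_apply)
  next
    case False
    then show ?thesis by (auto simp: ag)
  qed
qed

text \<open>A point added in a fine cell is a point added in its parent, or else invisible to the
  coarse counts. So differences along fine cells become differences along parents or vanish.\<close>

lemma fold_diff_aggregate:
  assumes \<A>: "cells \<mu> \<A>" and \<C>: "cells \<mu> \<C>" and z: "set z \<subseteq> \<C>"
  shows "fold diff z (\<lambda>x. u (aggregate \<A> \<C> x))
    = (\<lambda>x. if has_parents \<A> z then fold diff (map (parent \<A>) z) u (aggregate \<A> \<C> x) else 0)"
  using z
proof (induction z arbitrary: u)
  case Nil
  show ?case by (simp add: has_parents_def)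
next
  case (Cons C z)
  show ?case
  proof (cases "\<exists>A\<in>\<A>. C \<subseteq> A")
    case True
    then have "diff C (\<lambda>x. u (aggregate \<A> \<C> x)) = (\<lambda>x. diff (parent \<A> C) u (aggregate \<A> \<C> x))"
      using aggregate_raise[OF \<A> \<C>] Cons.prems by (simp add: diff_def[abs_def])
    moreover have "has_parents \<A> (C # z) = has_parents \<A> z" using True by (simp add: has_parents_def)
    ultimately show ?thesis using Cons.IH[of "diff (parent \<A> C) u"] Cons.prems by (simp cong: if_cong)
  next
    case False
    then have 1: "diff C (\<lambda>x. u (aggregate \<A> \<C> x)) = (\<lambda>x. 0)"
      using aggregate_raise[OF \<A> \<C>] Cons.prems by (simp add: diff_def[abs_def])
    have "\<not> has_parents \<A> (C # z)" using False by (simp add: has_parents_def)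
    moreover have "fold diff z (\<lambda>x. 0) = (\<lambda>x. 0)" by (induction z) (simp_all add: diff_const)
    ultimately show ?thesis using 1 by simp
  qed
qed

lemma tempered_aggregate:
  assumes \<A>: "cells \<mu> \<A>" and \<C>: "cells \<mu> \<C>" and u: "tempered \<A> u"
  shows "tempered \<C> (\<lambda>x. u (aggregate \<A> \<C> x))"
proof -
  obtain K k where K: "K \<ge> 0" "\<And>x. \<bar>u x\<bar> \<le> K * (1 + (\<Sum>A\<in>\<A>. real (x A))) ^ k"
    using temperedE[OF u] by blast
  have "\<bar>u (aggregate \<A> \<C> x)\<bar> \<le> K * (1 + (\<Sum>C\<in>\<C>. real (x C))) ^ k" for x
  proof -
    have fin: "finite \<A>" "finite \<C>" using \<A> \<C> by (auto simp: cells_def)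
    have "(\<Sum>A\<in>\<A>. real (aggregate \<A> \<C> x A)) = (\<Sum>A\<in>\<A>. \<Sum>C | C \<in> \<C> \<and> C \<subseteq> A. real (x C))"
      by (intro sum.cong refl) (simp add: aggregate_def)
    also have "\<dots> = (\<Sum>C\<in>(\<Union>A\<in>\<A>. {C \<in> \<C>. C \<subseteq> A}). real (x C))"
    proof (rule sum.UNION_disjoint[symmetric])
      show "\<forall>i\<in>\<A>. \<forall>j\<in>\<A>. i \<noteq> j \<longrightarrow> {C \<in> \<C>. C \<subseteq> i} \<inter> {C \<in> \<C>. C \<subseteq> j} = {}"
      proof (intro ballI impI)
        fix A B assume AB: "A \<in> \<A>" "B \<in> \<A>" "A \<noteq> B"
        have "{} \<notin> \<C>" using \<C> by (simp add: cells_def)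
        moreover have "C = {}" if "C \<subseteq> A" "C \<subseteq> B" for C
          using Int_greatest[OF that] cells_disjoint[OF \<A> AB] by simp
        ultimately show "{C \<in> \<C>. C \<subseteq> A} \<inter> {C \<in> \<C>. C \<subseteq> B} = {}" by auto
      qed
    qed (use fin in auto)
    also have "\<dots> \<le> (\<Sum>C\<in>\<C>. real (x C))"
      using fin by (intro sum_mono2) auto
    finally have "K * (1 + (\<Sum>A\<in>\<A>. real (aggregate \<A> \<C> x A))) ^ k \<le> K * (1 + (\<Sum>C\<in>\<C>. real (x C))) ^ k"
      using K(1) by (intro mult_left_mono power_mono) (simp_all add: sum_nonneg)
    then show ?thesis using K(2)[of "aggregate \<A> \<C> x"] by linarith
  qed
  then show ?thesis unfolding tempered_def by blast
qed

lemma prod_list_map_mset: "mset z = mset z' \<Longrightarrow> prod_list (map f z) = (prod_list (map f z') :: real)"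
  by (metis mset_map prod_mset_prod_list)

lemma fold_diff_wsum:
  "fold diff b (\<lambda>x. wsum I (\<lambda>_. 1) n (\<lambda>a. f a x)) = (\<lambda>x. wsum I (\<lambda>_. 1) n (\<lambda>a. fold diff b (f a) x))"
proof (induction n arbitrary: f)
  case (Suc n)
  then show ?case by (simp add: fold_diff_sum)
qed simp

lemma (in prob_space) L2_tendsto:
  fixes X :: "nat \<Rightarrow> 'a \<Rightarrow> real"
  assumes X: "\<And>j. X j \<in> borel_measurable M" "\<And>j. integrable M (\<lambda>\<omega>. (X j \<omega>)\<^sup>2)"
    and F: "F \<in> borel_measurable M" "integrable M (\<lambda>\<omega>. (F \<omega>)\<^sup>2)"
    and G: "G \<in> borel_measurable M" "integrable M (\<lambda>\<omega>. (G \<omega>)\<^sup>2)"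
    and lim: "(\<lambda>j. expectation (\<lambda>\<omega>. (X j \<omega> - F \<omega>)\<^sup>2)) \<longlonglongrightarrow> 0"
  shows "(\<lambda>j. expectation (\<lambda>\<omega>. X j \<omega> * G \<omega>)) \<longlonglongrightarrow> expectation (\<lambda>\<omega>. F \<omega> * G \<omega>)"
proof -
  note [measurable] = X(1) F(1) G(1)
  have prod: "integrable M (\<lambda>\<omega>. u \<omega> * v \<omega>)"
    if [measurable]: "u \<in> borel_measurable M" "v \<in> borel_measurable M"
      and uv: "integrable M (\<lambda>\<omega>. (u \<omega>)\<^sup>2)" "integrable M (\<lambda>\<omega>. (v \<omega>)\<^sup>2)" for u v :: "'a \<Rightarrow> real"
  proof (rule Bochner_Integration.integrable_bound[OF Bochner_Integration.integrable_add[OF uv]])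
    show "AE \<omega> in M. norm (u \<omega> * v \<omega>) \<le> norm ((u \<omega>)\<^sup>2 + (v \<omega>)\<^sup>2)"
    proof (rule AE_I2)
      fix \<omega>
      have "2 * (\<bar>u \<omega>\<bar> * \<bar>v \<omega>\<bar>) \<le> (u \<omega>)\<^sup>2 + (v \<omega>)\<^sup>2" using sum_squares_bound[of "\<bar>u \<omega>\<bar>" "\<bar>v \<omega>\<bar>"] by simp
      moreover have "0 \<le> \<bar>u \<omega>\<bar> * \<bar>v \<omega>\<bar>" by simp
      ultimately have "\<bar>u \<omega>\<bar> * \<bar>v \<omega>\<bar> \<le> (u \<omega>)\<^sup>2 + (v \<omega>)\<^sup>2" by linarith
      then show "norm (u \<omega> * v \<omega>) \<le> norm ((u \<omega>)\<^sup>2 + (v \<omega>)\<^sup>2)" by (simp add: abs_mult)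
    qed
  qed simp
  have XF: "integrable M (\<lambda>\<omega>. (X j \<omega> - F \<omega>)\<^sup>2)" for j
  proof -
    have "integrable M (\<lambda>\<omega>. (X j \<omega>)\<^sup>2 + (F \<omega>)\<^sup>2 - 2 * (X j \<omega> * F \<omega>))"
      using X F prod[OF X(1) F(1) X(2) F(2)] by auto
    then show ?thesis by (simp add: power2_diff mult.assoc)
  qed
  define a where "a j = expectation (\<lambda>\<omega>. (X j \<omega> - F \<omega>)\<^sup>2)" for j
  \<comment> \<open>The summand \<open>1 / real (Suc j)\<close> keeps the weight positive when the
    distance is 0 and disappears in the limit.\<close>
  define d where "d j = sqrt (a j) + 1 / real (Suc j)" for j
  define K where "K = expectation (\<lambda>\<omega>. (G \<omega>)\<^sup>2)"
  have a0: "a j \<ge> 0" for j by (simp add: a_def)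
  have d0: "d j > 0" for j using a0[of j] by (simp add: d_def add_nonneg_pos)
  have ad: "a j \<le> (d j)\<^sup>2" for j
  proof -
    have "sqrt (a j) \<le> d j" by (simp add: d_def)
    then have "(sqrt (a j))\<^sup>2 \<le> (d j)\<^sup>2" using a0 by (intro power_mono) auto
    then show ?thesis using a0 by simp
  qed
  have bound: "\<bar>expectation (\<lambda>\<omega>. X j \<omega> * G \<omega>) - expectation (\<lambda>\<omega>. F \<omega> * G \<omega>)\<bar> \<le> d j * (1 + K) / 2" for j
  proof -
    have "expectation (\<lambda>\<omega>. X j \<omega> * G \<omega>) - expectation (\<lambda>\<omega>. F \<omega> * G \<omega>) = expectation (\<lambda>\<omega>. (X j \<omega> - F \<omega>) * G \<omega>)"
      using prod[OF X(1) G(1) X(2) G(2)] prod[OF F(1) G(1) F(2) G(2)] by (simp add: left_diff_distrib)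
    then have "\<bar>expectation (\<lambda>\<omega>. X j \<omega> * G \<omega>) - expectation (\<lambda>\<omega>. F \<omega> * G \<omega>)\<bar> \<le> expectation (\<lambda>\<omega>. \<bar>(X j \<omega> - F \<omega>) * G \<omega>\<bar>)"
      by simp
    also have "\<dots> \<le> expectation (\<lambda>\<omega>. 1 / (2 * d j) * (X j \<omega> - F \<omega>)\<^sup>2 + d j / 2 * (G \<omega>)\<^sup>2)"
    proof (rule integral_mono)
      show "integrable M (\<lambda>\<omega>. \<bar>(X j \<omega> - F \<omega>) * G \<omega>\<bar>)" using prod[OF _ G(1) XF G(2)] by simp
      show "integrable M (\<lambda>\<omega>. 1 / (2 * d j) * (X j \<omega> - F \<omega>)\<^sup>2 + d j / 2 * (G \<omega>)\<^sup>2)" using XF G by simp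
      fix \<omega>
      define p r where "p = \<bar>X j \<omega> - F \<omega>\<bar>" and "r = \<bar>G \<omega>\<bar>"
      have "2 * p * (d j * r) \<le> p\<^sup>2 + (d j * r)\<^sup>2" by (rule sum_squares_bound)
      then have "p * r \<le> 1 / (2 * d j) * p\<^sup>2 + d j / 2 * r\<^sup>2"
        using d0[of j] by (simp add: field_simps power2_eq_square)
      then show "\<bar>(X j \<omega> - F \<omega>) * G \<omega>\<bar> \<le> 1 / (2 * d j) * (X j \<omega> - F \<omega>)\<^sup>2 + d j / 2 * (G \<omega>)\<^sup>2"
        by (simp add: p_def r_def abs_mult)
    qed
    also have "\<dots> = a j / (2 * d j) + d j / 2 * K"
      using XF G by (simp add: a_def K_def)
    also have "\<dots> \<le> d j / 2 + d j / 2 * K"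
      using ad[of j] d0[of j] by (simp add: field_simps power2_eq_square)
    finally show ?thesis by (simp add: algebra_simps add_divide_distrib)
  qed
  have "(\<lambda>j. sqrt (a j) + inverse (real (Suc j))) \<longlonglongrightarrow> sqrt 0 + 0"
    using lim unfolding a_def[symmetric]
    by (intro tendsto_add tendsto_real_sqrt LIMSEQ_inverse_real_of_nat)
  then have "d \<longlonglongrightarrow> 0" by (simp add: d_def[abs_def] inverse_eq_divide)
  then have "(\<lambda>j. d j * (1 + K) / 2) \<longlonglongrightarrow> 0" by (auto intro!: tendsto_eq_intros)
  then have "(\<lambda>j. expectation (\<lambda>\<omega>. X j \<omega> * G \<omega>) - expectation (\<lambda>\<omega>. F \<omega> * G \<omega>)) \<longlonglongrightarrow> 0"
    by (rule Lim_null_comparison[rotated]) (intro always_eventually allI, simp only: real_norm_def bound)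
  then show ?thesis by (simp add: LIM_zero_iff)
qed

context poisson_random_measure
begin

lemma counts_compose_measurable:
  fixes v :: "('z set \<Rightarrow> nat) \<Rightarrow> real"
  shows "cells \<mu> \<A> \<Longrightarrow> (\<lambda>\<omega>. v (counts \<A> \<omega>)) \<in> borel_measurable M"
  using measurable_compose[OF counts_measurable, of \<A> v borel] by simp

lemma counts_aggregate:
  assumes \<A>: "cells \<mu> \<A>" and \<C>: "cells \<mu> \<C>" and r: "subdivides \<C> \<A>"
  shows "AE \<omega> in M. counts \<A> \<omega> = aggregate \<A> \<C> (counts \<C> \<omega>)"
  using AE_counts[OF \<C>] AE_space
proof eventually_elim
  case (elim \<omega>)
  show ?case
  proof (rule ext)
    fix B
    show "counts \<A> \<omega> B = aggregate \<A> \<C> (counts \<C> \<omega>) B"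
    proof (cases "B \<in> \<A>")
      case True
      let ?S = "{C \<in> \<C>. C \<subseteq> B}"
      have S: "finite ?S" "?S \<subseteq> sets (\<eta> \<omega>)" using \<C> elim(2) by (auto simp: cells_def sets_eta)
      have "B = \<Union>?S" using r True unfolding subdivides_def by blast
      then have "emeasure (\<eta> \<omega>) B = emeasure (\<eta> \<omega>) (\<Union>C\<in>?S. C)" by simp
      also have "\<dots> = (\<Sum>C\<in>?S. emeasure (\<eta> \<omega>) C)"
        using S cells_disjoint[OF \<C>] by (intro sum_emeasure[symmetric]) (auto simp: disjoint_family_on_def)
      also have "\<dots> = of_nat (\<Sum>C\<in>?S. counts \<C> \<omega> C)"
        using elim(1) by simp
      finally have "count \<omega> B = (\<Sum>C\<in>?S. counts \<C> \<omega> C)" by (rule count_of_nat)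
      then show ?thesis using True by (simp add: counts_def[of \<A>] aggregate_def)
    qed (simp add: counts_def aggregate_def)
  qed
qed

text \<open>The Charlier coefficients of \<open>F\<close>: for a symmetric kernel, pairing its chaos
  with the Charlier polynomial of a word gives the value of the kernel there times
  \<open>fact q\<close> times the weight of the word. On words of zero weight the polynomial
  vanishes almost surely, and the coefficient is set to 0.\<close>

definition projection :: "'z set set \<Rightarrow> nat \<Rightarrow> ('w \<Rightarrow> real) \<Rightarrow> 'z set list \<Rightarrow> real" where
  "projection \<A> q F a = (if length a = q \<and> set a \<subseteq> \<A> \<and> prod_list (map (measure \<mu>) a) \<noteq> 0
     then expectation (\<lambda>\<omega>. F \<omega> * charlier (measure \<mu>) a (counts \<A> \<omega>)) / (fact q * prod_list (map (measure \<mu>) a)) else 0)"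

lemma sym_kernel_projection: "sym_kernel (projection \<A> q F)"
  unfolding sym_kernel_def
proof (intro allI impI)
  fix z z' :: "'z set list" assume m: "mset z = mset z'"
  then show "projection \<A> q F z = projection \<A> q F z'"
    using mset_eq_length[OF m] mset_eq_setD[OF m] charlier_mset[OF m] prod_list_map_mset[OF m]
    by (simp add: projection_def)
qed

text \<open>The pairing of the projected variable with a function of the counts, written out so that
  only finitely many expectations linear in \<open>F\<close> occur; this makes continuity in
  \<open>F\<close> evident.\<close>

definition projected_pairing :: "'z set set \<Rightarrow> nat \<Rightarrow> ('w \<Rightarrow> real) \<Rightarrow> (('z set \<Rightarrow> nat) \<Rightarrow> real) \<Rightarrow> real" where
  "projected_pairing \<A> q F u = wsum \<A> (\<lambda>_. 1) q (\<lambda>a. if prod_list (map (measure \<mu>) a) = 0 then 0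
     else expectation (\<lambda>\<omega>. F \<omega> * charlier (measure \<mu>) a (counts \<A> \<omega>))
       * expectation (\<lambda>\<omega>. fold diff a u (counts \<A> \<omega>)) / fact q)"

lemma expectation_projection:
  assumes \<A>: "cells \<mu> \<A>" and u: "tempered \<A> u"
  shows "expectation (\<lambda>\<omega>. simple_chaos \<A> q (projection \<A> q F) \<omega> * u (counts \<A> \<omega>))
    = projected_pairing \<A> q F u"
proof -
  interpret P: poisson_vector "counts_pmf \<A>" \<A> "measure \<mu>" by (rule poisson_vector_counts[OF \<A>])
  have "expectation (\<lambda>\<omega>. simple_chaos \<A> q (projection \<A> q F) \<omega> * u (counts \<A> \<omega>))
      = P.E (\<lambda>x. chaos \<A> (measure \<mu>) q (projection \<A> q F) x * u x)"
    unfolding simple_chaos_def by (rule expectation_counts[OF \<A>, symmetric])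
  also have "\<dots> = wsum \<A> (measure \<mu>) q (\<lambda>a. projection \<A> q F a * P.E (fold diff a u))"
    by (rule P.expectation_chaos_mult[OF u])
  also have "\<dots> = wsum \<A> (\<lambda>_. 1) q (\<lambda>a. prod_list (map (measure \<mu>) a) * (projection \<A> q F a * P.E (fold diff a u)))"
    by (rule wsum_weight)
  also have "\<dots> = projected_pairing \<A> q F u"
    unfolding projected_pairing_def
    by (rule wsum_cong) (simp add: projection_def expectation_counts[OF \<A>])
  finally show ?thesis .
qed

text \<open>The coarse counts are almost surely functions of the fine ones, so duality on the fine
  family leads to differences along parents.\<close>

lemma expectation_simple_chaos:
  assumes \<A>: "cells \<mu> \<A>" and \<C>: "cells \<mu> \<C>" and r: "subdivides \<C> \<A>" and u: "tempered \<A> u"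
  shows "expectation (\<lambda>\<omega>. simple_chaos \<C> q h \<omega> * u (counts \<A> \<omega>))
    = wsum \<C> (measure \<mu>) q (\<lambda>z. h z *
        (if has_parents \<A> z then expectation (\<lambda>\<omega>. fold diff (map (parent \<A>) z) u (counts \<A> \<omega>)) else 0))"
proof -
  interpret P: poisson_vector "counts_pmf \<C>" \<C> "measure \<mu>" by (rule poisson_vector_counts[OF \<C>])
  have tu: "tempered \<C> (\<lambda>x. u (aggregate \<A> \<C> x))" by (rule tempered_aggregate[OF \<A> \<C> u])
  have agg: "P.E (\<lambda>x. v (aggregate \<A> \<C> x)) = expectation (\<lambda>\<omega>. v (counts \<A> \<omega>))" for v :: "_ \<Rightarrow> real"
  proof -
    have "P.E (\<lambda>x. v (aggregate \<A> \<C> x)) = expectation (\<lambda>\<omega>. v (aggregate \<A> \<C> (counts \<C> \<omega>)))"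
      by (rule expectation_counts[OF \<C>])
    also have "\<dots> = expectation (\<lambda>\<omega>. v (counts \<A> \<omega>))"
      using counts_aggregate[OF \<A> \<C> r]
      by (intro integral_cong_AE counts_compose_measurable[OF \<A>]
          counts_compose_measurable[OF \<C>, of "\<lambda>x. v (aggregate \<A> \<C> x)"]) auto
    finally show ?thesis .
  qed
  have "expectation (\<lambda>\<omega>. simple_chaos \<C> q h \<omega> * u (counts \<A> \<omega>))
      = expectation (\<lambda>\<omega>. chaos \<C> (measure \<mu>) q h (counts \<C> \<omega>) * u (aggregate \<A> \<C> (counts \<C> \<omega>)))"
    unfolding simple_chaos_def
    using counts_aggregate[OF \<A> \<C> r]
    by (intro integral_cong_AE borel_measurable_times counts_compose_measurable[OF \<A>]
        counts_compose_measurable[OF \<C>, of "chaos \<C> (measure \<mu>) q h"]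
        counts_compose_measurable[OF \<C>, of "\<lambda>x. u (aggregate \<A> \<C> x)"]) auto
  also have "\<dots> = P.E (\<lambda>x. chaos \<C> (measure \<mu>) q h x * u (aggregate \<A> \<C> x))"
    by (rule expectation_counts[OF \<C>, symmetric])
  also have "\<dots> = wsum \<C> (measure \<mu>) q (\<lambda>z. h z * P.E (fold diff z (\<lambda>x. u (aggregate \<A> \<C> x))))"
    by (rule P.expectation_chaos_mult[OF tu])
  also have "\<dots> = wsum \<C> (measure \<mu>) q (\<lambda>z. h z *
        (if has_parents \<A> z then expectation (\<lambda>\<omega>. fold diff (map (parent \<A>) z) u (counts \<A> \<omega>)) else 0))"
    by (rule wsum_cong) (simp add: fold_diff_aggregate[OF \<A> \<C>] agg)
  finally show ?thesis .
qed

text \<open>On both sides \<open>u\<close> enters through its mean differences along words of coarse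
  cells. These form a symmetric kernel, and the top differences of a chaos reproduce its kernel up
  to \<open>fact q\<close>, so inserting the projection changes nothing.\<close>

lemma projected_pairing_simple:
  assumes \<A>: "cells \<mu> \<A>" and \<B>: "cells \<mu> \<B>" and h: "sym_kernel h" and u: "tempered \<A> u"
  shows "expectation (\<lambda>\<omega>. simple_chaos \<B> q h \<omega> * u (counts \<A> \<omega>))
    = projected_pairing \<A> q (simple_chaos \<B> q h) u"
proof -
  interpret P: poisson_vector "counts_pmf \<A>" \<A> "measure \<mu>" by (rule poisson_vector_counts[OF \<A>])
  obtain \<C> h' k' where C: "cells \<mu> \<C>" "\<And>x. ker \<B> q h x = ker \<C> q h' x" "\<And>x. ker \<A> q h x = ker \<C> q k' x"
    "sym_kernel h \<Longrightarrow> sym_kernel h'" "sym_kernel h \<Longrightarrow> sym_kernel k'" "subdivides \<C> \<B>" "subdivides \<C> \<A>"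
    using ker_common_refinement[OF \<B> \<A>, of q h h] by metis
  have AE: "AE \<omega> in M. simple_chaos \<B> q h \<omega> = simple_chaos \<C> q h' \<omega>"
    by (rule simple_chaos_AE_eq[OF \<B> C(1) h C(4)[OF h] C(2)])
  have eqH: "expectation (\<lambda>\<omega>. simple_chaos \<B> q h \<omega> * v (counts \<A> \<omega>))
      = expectation (\<lambda>\<omega>. simple_chaos \<C> q h' \<omega> * v (counts \<A> \<omega>))" for v :: "_ \<Rightarrow> real"
    using AE
    by (intro integral_cong_AE borel_measurable_times simple_chaos_measurable[OF \<B>]
        simple_chaos_measurable[OF C(1)] counts_compose_measurable[OF \<A>]) auto
  define \<psi> where "\<psi> a = expectation (\<lambda>\<omega>. fold diff a u (counts \<A> \<omega>))" for a
  define wt where "wt a = prod_list (map (measure \<mu>) a)" for a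
  \<comment> \<open>Words of zero weight are dropped, in accordance with the convention in
    \<open>projected_pairing\<close>.\<close>
  define k where "k a = (if wt a = 0 then 0 else \<psi> a)" for a
  have k: "sym_kernel k"
    unfolding sym_kernel_def k_def \<psi>_def wt_def using fold_diff_mset prod_list_map_mset by metis
  have inner: "wsum \<A> (\<lambda>_. 1) q (\<lambda>a. k a * expectation (\<lambda>\<omega>. fold diff b (charlier (measure \<mu>) a) (counts \<A> \<omega>))) = fact q * k b"
    if b: "set b \<subseteq> \<A>" "length b = q" for b
  proof -
    have "wsum \<A> (\<lambda>_. 1) q (\<lambda>a. k a * expectation (\<lambda>\<omega>. fold diff b (charlier (measure \<mu>) a) (counts \<A> \<omega>)))
        = wsum \<A> (\<lambda>_. 1) q (\<lambda>a. P.E (\<lambda>x. k a * fold diff b (charlier (measure \<mu>) a) x))"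
      by (simp add: expectation_counts[OF \<A>])
    also have "\<dots> = P.E (\<lambda>x. wsum \<A> (\<lambda>_. 1) q (\<lambda>a. k a * fold diff b (charlier (measure \<mu>) a) x))"
      by (rule P.expectation_wsum(1)[symmetric])
        (intro tempered_scale tempered_fold_diff tempered_charlier P.finite_I b)
    also have "(\<lambda>x. wsum \<A> (\<lambda>_. 1) q (\<lambda>a. k a * fold diff b (charlier (measure \<mu>) a) x)) = fold diff b (chaos \<A> (measure \<mu>) q k)"
      unfolding chaos_wsum[abs_def] fold_diff_wsum fold_diff_scale ..
    also have "\<dots> = (\<lambda>x. fact q * k b)" by (rule fold_diff_chaos[OF P.finite_I k b])
    finally show ?thesis by simp
  qed
  define \<kappa> where "\<kappa> v z = (if has_parents \<A> z then expectation (\<lambda>\<omega>. fold diff (map (parent \<A>) z) v (counts \<A> \<omega>)) else 0)" for v z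
  have EC: "expectation (\<lambda>\<omega>. simple_chaos \<B> q h \<omega> * v (counts \<A> \<omega>)) = wsum \<C> (measure \<mu>) q (\<lambda>z. h' z * \<kappa> v z)"
    if "tempered \<A> v" for v
    unfolding eqH \<kappa>_def by (rule expectation_simple_chaos[OF \<A> C(1,7) that])
  have "projected_pairing \<A> q (simple_chaos \<B> q h) u
      = wsum \<A> (\<lambda>_. 1) q (\<lambda>a. (k a / fact q) * wsum \<C> (measure \<mu>) q (\<lambda>z. h' z * \<kappa> (charlier (measure \<mu>) a) z))"
    unfolding projected_pairing_def
  proof (rule wsum_cong)
    fix a assume "set a \<subseteq> \<A>" "length a = q"
    then have "tempered \<A> (charlier (measure \<mu>) a)" by (intro tempered_charlier P.finite_I)
    from EC[OF this] show "(if prod_list (map (measure \<mu>) a) = 0 then 0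
        else expectation (\<lambda>\<omega>. simple_chaos \<B> q h \<omega> * charlier (measure \<mu>) a (counts \<A> \<omega>))
          * expectation (\<lambda>\<omega>. fold diff a u (counts \<A> \<omega>)) / fact q)
      = (k a / fact q) * wsum \<C> (measure \<mu>) q (\<lambda>z. h' z * \<kappa> (charlier (measure \<mu>) a) z)"
      by (simp add: k_def wt_def \<psi>_def)
  qed
  also have "\<dots> = wsum \<C> (measure \<mu>) q (\<lambda>z. wsum \<A> (\<lambda>_. 1) q (\<lambda>a. (h' z / fact q) * (k a * \<kappa> (charlier (measure \<mu>) a) z)))"
    unfolding wsum_scale[symmetric] wsum_swap[of \<A> "\<lambda>_. 1" q \<C> "measure \<mu>" q] by (simp add: ac_simps)
  also have "\<dots> = wsum \<C> (measure \<mu>) q (\<lambda>z. (h' z / fact q) * wsum \<A> (\<lambda>_. 1) q (\<lambda>a. k a * \<kappa> (charlier (measure \<mu>) a) z))"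
    by (simp only: wsum_scale)
  also have "\<dots> = wsum \<C> (measure \<mu>) q (\<lambda>z. h' z * \<kappa> u z)"
    unfolding wsum_weight[of \<C> "measure \<mu>"]
  proof (rule wsum_cong)
    fix z assume z: "set z \<subseteq> \<C>" "length z = q"
    show "prod_list (map (measure \<mu>) z) * ((h' z / fact q) * wsum \<A> (\<lambda>_. 1) q (\<lambda>a. k a * \<kappa> (charlier (measure \<mu>) a) z))
      = prod_list (map (measure \<mu>) z) * (h' z * \<kappa> u z)"
    proof (cases "has_parents \<A> z \<and> prod_list (map (measure \<mu>) z) \<noteq> 0")
      case True
      let ?b = "map (parent \<A>) z"
      \<comment> \<open>A cell of positive measure has a parent of positive measure, so the words
        that matter here are not among those dropped in \<open>k\<close>.\<close>
      have par: "parent \<A> C \<in> \<A> \<and> measure \<mu> (parent \<A> C) \<noteq> 0" if C: "C \<in> set z" for C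
      proof -
        obtain A where A: "A \<in> \<A>" "C \<subseteq> A" using True C by (auto simp: has_parents_def)
        have "C \<noteq> {}" using C z(1) \<open>cells \<mu> \<C>\<close> by (auto simp: cells_def)
        then have p: "parent \<A> C = A" using parent_eq[OF \<A> _ A] by simp
        have "measure \<mu> C \<noteq> 0" using True C by (auto simp: prod_list_zero_iff)
        moreover have "measure \<mu> C \<le> measure \<mu> A"
          using A \<A> C z(1) \<open>cells \<mu> \<C>\<close>
          by (intro measure_mono_fmeasurable) (auto simp: cells_def fmeasurable_def)
        ultimately have "measure \<mu> A \<noteq> 0" using measure_nonneg[of \<mu> C] by linarith
        then show ?thesis using p A by simp
      qed
      then have "set ?b \<subseteq> \<A>" "wt ?b \<noteq> 0" by (auto simp: wt_def prod_list_zero_iff)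
      then have "wsum \<A> (\<lambda>_. 1) q (\<lambda>a. k a * \<kappa> (charlier (measure \<mu>) a) z) = fact q * \<kappa> u z"
        using inner[of ?b] True z by (simp add: \<kappa>_def k_def \<psi>_def)
      then show ?thesis by simp
    next
      case False
      then consider "prod_list (map (measure \<mu>) z) = 0" | "\<not> has_parents \<A> z" by blast
      then show ?thesis
      proof cases
        case 2
        then have "wsum \<A> (\<lambda>_. 1) q (\<lambda>a. k a * \<kappa> (charlier (measure \<mu>) a) z) = wsum \<A> (\<lambda>_. 1) q (\<lambda>a. 0 * 0)"
          by (intro wsum_cong) (simp add: \<kappa>_def)
        then show ?thesis using 2 unfolding wsum_scale by (simp add: \<kappa>_def)
      qed simp
    qed
  qed
  also have "\<dots> = expectation (\<lambda>\<omega>. simple_chaos \<B> q h \<omega> * u (counts \<A> \<omega>))"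
    by (rule EC[OF u, symmetric])
  finally show ?thesis by simp
qed

lemma simple_chaos_square_integrable:
  assumes "cells \<mu> \<A>" "tempered \<A> u"
  shows "integrable M (\<lambda>\<omega>. u (counts \<A> \<omega>))" "(\<lambda>\<omega>. u (counts \<A> \<omega>)) \<in> borel_measurable M"
proof -
  interpret P: poisson_vector "counts_pmf \<A>" \<A> "measure \<mu>" by (rule poisson_vector_counts[OF assms(1)])
  show "integrable M (\<lambda>\<omega>. u (counts \<A> \<omega>))"
    using P.integrable_tempered[OF assms(2)] integrable_counts[OF assms(1)] by blast
  then show "(\<lambda>\<omega>. u (counts \<A> \<omega>)) \<in> borel_measurable M" by (rule borel_measurable_integrable)
qed

text \<open>This is what identifies the projected variable as the conditional expectation of
  \<open>F\<close> given the counts. It holds for simple variables by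
  \<open>projected_pairing_simple\<close>, and both sides are continuous along their
  \<open>L2\<close> convergence to \<open>F\<close>.\<close>

lemma expectation_projection_eq:
  assumes F: "F \<in> poisson_chaos M \<mu> \<eta> q" and \<A>: "cells \<mu> \<A>" and u: "tempered \<A> u"
  shows "expectation (\<lambda>\<omega>. F \<omega> * u (counts \<A> \<omega>))
    = expectation (\<lambda>\<omega>. simple_chaos \<A> q (projection \<A> q F) \<omega> * u (counts \<A> \<omega>))"
proof -
  interpret P: poisson_vector "counts_pmf \<A>" \<A> "measure \<mu>" by (rule poisson_vector_counts[OF \<A>])
  have F2: "F \<in> borel_measurable M" "integrable M (\<lambda>\<omega>. (F \<omega>)\<^sup>2)"
    using F by (auto simp: poisson_chaos_def has_multiple_integral_def L2_def)
  have "\<forall>j. \<exists>\<B>h. cells \<mu> (fst \<B>h) \<and> sym_kernel (snd \<B>h) \<and>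
      (\<integral>\<^sup>+\<omega>. ennreal ((simple_chaos (fst \<B>h) q (snd \<B>h) \<omega> - F \<omega>)\<^sup>2) \<partial>M) \<le> ennreal (1 / real (Suc j))"
  proof
    fix j
    have "1 / real (Suc j) > 0" by simp
    from simple_chaos_dense[OF F this] obtain \<B> h where "cells \<mu> \<B>" "sym_kernel h"
      "(\<integral>\<^sup>+\<omega>. ennreal ((simple_chaos \<B> q h \<omega> - F \<omega>)\<^sup>2) \<partial>M) \<le> ennreal (1 / real (Suc j))" by blast
    then show "\<exists>\<B>h. cells \<mu> (fst \<B>h) \<and> sym_kernel (snd \<B>h) \<and>
      (\<integral>\<^sup>+\<omega>. ennreal ((simple_chaos (fst \<B>h) q (snd \<B>h) \<omega> - F \<omega>)\<^sup>2) \<partial>M) \<le> ennreal (1 / real (Suc j))"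
      by (intro exI[of _ "(\<B>, h)"]) simp
  qed
  from choice[OF this] obtain \<B>h where \<B>h: "\<And>j. cells \<mu> (fst (\<B>h j))" "\<And>j. sym_kernel (snd (\<B>h j))"
    "\<And>j. (\<integral>\<^sup>+\<omega>. ennreal ((simple_chaos (fst (\<B>h j)) q (snd (\<B>h j)) \<omega> - F \<omega>)\<^sup>2) \<partial>M) \<le> ennreal (1 / real (Suc j))" by blast
  define X where "X j = simple_chaos (fst (\<B>h j)) q (snd (\<B>h j))" for j
  have X: "X j \<in> borel_measurable M" "integrable M (\<lambda>\<omega>. (X j \<omega>)\<^sup>2)" for j
  proof -
    have fin: "finite (fst (\<B>h j))" using \<B>h(1) by (simp add: cells_def)
    show "X j \<in> borel_measurable M" unfolding X_def by (rule simple_chaos_measurable[OF \<B>h(1)])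
    show "integrable M (\<lambda>\<omega>. (X j \<omega>)\<^sup>2)"
      unfolding X_def simple_chaos_def
      by (rule simple_chaos_square_integrable(1)[OF \<B>h(1) tempered_power[OF tempered_chaos[OF fin]]])
  qed
  have le: "expectation (\<lambda>\<omega>. (X j \<omega> - F \<omega>)\<^sup>2) \<le> 1 / real (Suc j)" for j
    using \<B>h(3)[of j] unfolding X_def[symmetric]
    by (subst integral_eq_nn_integral) (use X F2 in \<open>auto intro!: enn2real_leI\<close>)
  have lim: "(\<lambda>j. expectation (\<lambda>\<omega>. (X j \<omega> - F \<omega>)\<^sup>2)) \<longlonglongrightarrow> 0"
  proof (rule tendsto_sandwich[OF _ _ tendsto_const])
    show "(\<lambda>j. 1 / real (Suc j)) \<longlonglongrightarrow> 0" using LIMSEQ_inverse_real_of_nat by (simp add: inverse_eq_divide)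
  qed (use le in auto)
  have conv: "(\<lambda>j. expectation (\<lambda>\<omega>. X j \<omega> * v (counts \<A> \<omega>))) \<longlonglongrightarrow> expectation (\<lambda>\<omega>. F \<omega> * v (counts \<A> \<omega>))"
    if v: "tempered \<A> v" for v
    by (rule L2_tendsto[OF X F2 simple_chaos_square_integrable(2)[OF \<A> v]
          simple_chaos_square_integrable(1)[OF \<A> tempered_power[OF v]] lim])
  have "(\<lambda>j. projected_pairing \<A> q (X j) u) \<longlonglongrightarrow> projected_pairing \<A> q F u"
    unfolding projected_pairing_def wsum_const_one[OF P.finite_I]
  proof (intro tendsto_sum)
    fix a assume a: "a \<in> {w. set w \<subseteq> \<A> \<and> length w = q}"
    have "(\<lambda>j. expectation (\<lambda>\<omega>. X j \<omega> * charlier (measure \<mu>) a (counts \<A> \<omega>)))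
        \<longlonglongrightarrow> expectation (\<lambda>\<omega>. F \<omega> * charlier (measure \<mu>) a (counts \<A> \<omega>))"
      by (rule conv[OF tempered_charlier[OF P.finite_I]]) (use a in simp)
    then show "(\<lambda>j. if prod_list (map (measure \<mu>) a) = 0 then 0
        else expectation (\<lambda>\<omega>. X j \<omega> * charlier (measure \<mu>) a (counts \<A> \<omega>)) *
          expectation (\<lambda>\<omega>. fold diff a u (counts \<A> \<omega>)) / fact q)
      \<longlonglongrightarrow> (if prod_list (map (measure \<mu>) a) = 0 then 0
        else expectation (\<lambda>\<omega>. F \<omega> * charlier (measure \<mu>) a (counts \<A> \<omega>)) *
          expectation (\<lambda>\<omega>. fold diff a u (counts \<A> \<omega>)) / fact q)"
      by (auto intro!: tendsto_intros)
  qed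
  moreover have "projected_pairing \<A> q (X j) u = expectation (\<lambda>\<omega>. X j \<omega> * u (counts \<A> \<omega>))" for j
    unfolding X_def by (rule projected_pairing_simple[OF \<A> \<B>h(1,2) u, symmetric])
  ultimately have "(\<lambda>j. expectation (\<lambda>\<omega>. X j \<omega> * u (counts \<A> \<omega>))) \<longlonglongrightarrow> projected_pairing \<A> q F u" by simp
  from LIMSEQ_unique[OF this conv[OF u]] show ?thesis
    using expectation_projection[OF \<A> u] by simp
qed

end

section \<open>Approximation in the fourth mean and conclusion\<close>

lemma power4_add_le: "((a::real) + b) ^ 4 \<le> 8 * (a ^ 4 + b ^ 4)"
proof -
  have sq: "(x + y)\<^sup>2 \<le> 2 * (x\<^sup>2 + y\<^sup>2)" for x y :: real
    using sum_squares_bound[of x y] by (simp add: power2_sum)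
  have "(a + b) ^ 4 = ((a + b)\<^sup>2)\<^sup>2" by simp
  also have "\<dots> \<le> (2 * (a\<^sup>2 + b\<^sup>2))\<^sup>2" by (intro power_mono sq) simp
  also have "\<dots> = 4 * (a\<^sup>2 + b\<^sup>2)\<^sup>2" unfolding power_mult_distrib by simp
  also have "\<dots> \<le> 4 * (2 * ((a\<^sup>2)\<^sup>2 + (b\<^sup>2)\<^sup>2))" by (intro mult_left_mono sq) simp
  finally show ?thesis by simp
qed

definition clamp :: "real \<Rightarrow> real \<Rightarrow> real" where
  "clamp K x = max (- K) (min K x)"

lemma clamp_bound: "K \<ge> 0 \<Longrightarrow> \<bar>clamp K x\<bar> \<le> K"
  by (auto simp: clamp_def)

lemma clamp_lipschitz: "\<bar>clamp K x - clamp K y\<bar> \<le> \<bar>x - y\<bar>"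
  by (auto simp: clamp_def max_def min_def)

lemma clamp_error: "K \<ge> 0 \<Longrightarrow> \<bar>x - clamp K x\<bar> \<le> \<bar>x\<bar>"
  by (auto simp: clamp_def)

lemma clamp_eq: "\<bar>x\<bar> \<le> K \<Longrightarrow> clamp K x = x"
  by (auto simp: clamp_def)

lemma clamp_measurable [measurable]: "clamp K \<in> borel_measurable borel"
  unfolding clamp_def[abs_def] by measurable

lemma integrable_power4_add:
  fixes u v :: "'a \<Rightarrow> real"
  assumes [measurable]: "u \<in> borel_measurable N" "v \<in> borel_measurable N"
    and "integrable N (\<lambda>x. u x ^ 4)" "integrable N (\<lambda>x. v x ^ 4)"
  shows "integrable N (\<lambda>x. (u x + v x) ^ 4)"
    and "(\<integral>x. (u x + v x) ^ 4 \<partial>N) \<le> 8 * ((\<integral>x. u x ^ 4 \<partial>N) + (\<integral>x. v x ^ 4 \<partial>N))"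
proof -
  have b: "integrable N (\<lambda>x. 8 * (u x ^ 4 + v x ^ 4))" using assms(3,4) by simp
  show i: "integrable N (\<lambda>x. (u x + v x) ^ 4)"
  proof (rule Bochner_Integration.integrable_bound[OF b])
    have "norm ((u x + v x) ^ 4) \<le> norm (8 * (u x ^ 4 + v x ^ 4))" for x
      using power4_add_le[of "u x" "v x"] by (simp only: real_norm_def) (simp add: distrib_left)
    then show "AE x in N. norm ((u x + v x) ^ 4) \<le> norm (8 * (u x ^ 4 + v x ^ 4))" by blast
  qed measurable
  have "(\<integral>x. (u x + v x) ^ 4 \<partial>N) \<le> (\<integral>x. 8 * (u x ^ 4 + v x ^ 4) \<partial>N)"
    by (rule integral_mono[OF i b power4_add_le])
  then show "(\<integral>x. (u x + v x) ^ 4 \<partial>N) \<le> 8 * ((\<integral>x. u x ^ 4 \<partial>N) + (\<integral>x. v x ^ 4 \<partial>N))"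
    using assms(3,4) by simp
qed

lemma (in finite_measure) integrable_of_power4:
  fixes u :: "'a \<Rightarrow> real"
  assumes [measurable]: "u \<in> borel_measurable M" and i: "integrable M (\<lambda>x. u x ^ 4)"
  shows "integrable M u" "integrable M (\<lambda>x. (u x)\<^sup>2)"
proof -
  have b: "integrable M (\<lambda>x. 1 + u x ^ 4)" using i by simp
  have sq: "(u x)\<^sup>2 \<le> 1 + u x ^ 4" for x
  proof -
    have "2 * (u x)\<^sup>2 \<le> 1 + u x ^ 4" using sum_squares_bound[of 1 "(u x)\<^sup>2"] by simp
    moreover have "0 \<le> (u x)\<^sup>2" by simp
    ultimately show ?thesis by linarith
  qed
  show i2: "integrable M (\<lambda>x. (u x)\<^sup>2)"
    by (rule Bochner_Integration.integrable_bound[OF b]) (auto simp: sq)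
  have b2: "integrable M (\<lambda>x. 1 + (u x)\<^sup>2)" using i2 by simp
  have "\<bar>u x\<bar> \<le> 1 + (u x)\<^sup>2" for x
  proof -
    have "2 * \<bar>u x\<bar> \<le> 1 + (u x)\<^sup>2" using sum_squares_bound[of 1 "\<bar>u x\<bar>"] by simp
    then show ?thesis by linarith
  qed
  then show "integrable M u"
    by (intro Bochner_Integration.integrable_bound[OF b2]) auto
qed

text \<open>If \<open>w\<close> is small relative to \<open>p\<close>, every term of the expansion
  contains a factor \<open>w\<close> and is at most \<open>\<theta> * p ^ 4\<close> before its
  coefficient; otherwise both variables are at most \<open>\<bar>w\<bar> / \<theta>\<close> in
  absolute value. The 15 is the sum of the binomial coefficients 4, 6, 4 and 1.\<close>

lemma abs_power4_diff_le:
  fixes p w :: real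
  assumes \<theta>: "0 < \<theta>" "\<theta> \<le> 1"
  shows "\<bar>(p + w) ^ 4 - p ^ 4\<bar> \<le> 15 * \<theta> * p ^ 4 + 15 * w ^ 4 / \<theta> ^ 4"
proof -
  let ?p = "\<bar>p\<bar>" and ?w = "\<bar>w\<bar>"
  have "(p + w) ^ 4 - p ^ 4 = 4 * p ^ 3 * w + 6 * p\<^sup>2 * w\<^sup>2 + 4 * p * w ^ 3 + w ^ 4"
    by (simp add: eval_nat_numeral algebra_simps)
  also have "\<bar>\<dots>\<bar> \<le> \<bar>4 * p ^ 3 * w\<bar> + \<bar>6 * p\<^sup>2 * w\<^sup>2\<bar> + \<bar>4 * p * w ^ 3\<bar> + \<bar>w ^ 4\<bar>" by linarith
  also have "\<dots> = 4 * ?p ^ 3 * ?w + 6 * ?p\<^sup>2 * ?w\<^sup>2 + 4 * ?p * ?w ^ 3 + ?w ^ 4"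
    by (simp add: abs_mult power_abs)
  finally have le: "\<bar>(p + w) ^ 4 - p ^ 4\<bar> \<le> 4 * ?p ^ 3 * ?w + 6 * ?p\<^sup>2 * ?w\<^sup>2 + 4 * ?p * ?w ^ 3 + ?w ^ 4" .
  show ?thesis
  proof (cases "?w \<le> \<theta> * ?p")
    case True
    have wp: "?w \<le> ?p" using True \<theta> mult_left_le_one_le[of ?p \<theta>] by auto
    have t: "?p ^ k * ?w ^ Suc l \<le> \<theta> * ?p ^ 4" if "k + Suc l = 4" for k l
    proof -
      have "?p ^ k * ?w ^ Suc l = ?p ^ k * ?w ^ l * ?w" by simp
      also have "\<dots> \<le> ?p ^ k * ?p ^ l * (\<theta> * ?p)"
        using wp True by (intro mult_mono power_mono) auto
      also have "\<dots> = \<theta> * ?p ^ (k + Suc l)" by (simp add: power_add)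
      finally show ?thesis unfolding that .
    qed
    have "4 * ?p ^ 3 * ?w + 6 * ?p\<^sup>2 * ?w\<^sup>2 + 4 * ?p * ?w ^ 3 + ?w ^ 4 \<le> 15 * (\<theta> * ?p ^ 4)"
      using t[of 3 0] t[of 2 1] t[of 1 2] t[of 0 3] by (simp add: numeral_eq_Suc)
    moreover have "0 \<le> 15 * w ^ 4 / \<theta> ^ 4" using \<theta> by simp
    moreover have "15 * (\<theta> * ?p ^ 4) = 15 * \<theta> * p ^ 4" by (simp add: power_even_abs)
    ultimately show ?thesis using le by linarith
  next
    case False
    define y where "y = ?w / \<theta>"
    have y: "?p \<le> y" "?w \<le> y" "0 \<le> y"
      using False \<theta> mult_left_le_one_le[of ?w \<theta>] by (auto simp: y_def field_simps)
    have t: "?p ^ k * ?w ^ l \<le> y ^ 4" if "k + l = 4" for k l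
    proof -
      have "?p ^ k * ?w ^ l \<le> y ^ k * y ^ l" using y by (intro mult_mono power_mono) auto
      then show ?thesis using that by (simp add: power_add[symmetric])
    qed
    have "4 * ?p ^ 3 * ?w + 6 * ?p\<^sup>2 * ?w\<^sup>2 + 4 * ?p * ?w ^ 3 + ?w ^ 4 \<le> 15 * y ^ 4"
      using t[of 3 1] t[of 2 2] t[of 1 3] t[of 0 4] by simp
    moreover have "y ^ 4 = w ^ 4 / \<theta> ^ 4" by (simp add: y_def power_divide power_even_abs)
    moreover have "0 \<le> 15 * \<theta> * p ^ 4" using \<theta> by simp
    ultimately show ?thesis using le by simp
  qed
qed

lemma abs_cos_sin_diff_le:
  fixes a b :: real
  shows "\<bar>cos a - cos b\<bar> \<le> \<bar>a - b\<bar>" "\<bar>sin a - sin b\<bar> \<le> \<bar>a - b\<bar>"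
proof -
  have "iexp a - iexp b = iexp b * (iexp (a - b) - 1)"
    using iexp_add[of b "a - b"] by (simp add: algebra_simps del: of_real_diff)
  then have le: "cmod (iexp a - iexp b) \<le> \<bar>a - b\<bar>"
    using iexp_approx1[of "a - b" 0] by (simp add: norm_mult del: of_real_diff)
  show "\<bar>cos a - cos b\<bar> \<le> \<bar>a - b\<bar>" using order_trans[OF abs_Re_le_cmod le] by simp
  show "\<bar>sin a - sin b\<bar> \<le> \<bar>a - b\<bar>" using order_trans[OF abs_Im_le_cmod le] by simp
qed

context poisson_random_measure
begin

lemma poisson_chaosD:
  assumes "F \<in> poisson_chaos M \<mu> \<eta> q"
  shows "F \<in> borel_measurable M" "integrable M (\<lambda>\<omega>. (F \<omega>)\<^sup>2)"
  using assms by (auto simp: poisson_chaos_def has_multiple_integral_def L2_def)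

text \<open>The projected variable is the conditional expectation of \<open>F\<close> given the counts, so that it
  is at least as close as \<open>F\<close> to any function of the counts.\<close>

lemma projection_contraction:
  assumes F: "F \<in> poisson_chaos M \<mu> \<eta> q" and F4: "integrable M (\<lambda>\<omega>. F \<omega> ^ 4)"
    and \<A>: "cells \<mu> \<A>" and u: "tempered \<A> u"
  shows "expectation (\<lambda>\<omega>. (simple_chaos \<A> q (projection \<A> q F) \<omega> - u (counts \<A> \<omega>)) ^ 4)
    \<le> expectation (\<lambda>\<omega>. (F \<omega> - u (counts \<A> \<omega>)) ^ 4)"
proof -
  let ?N = "counts \<A>" and ?v = "chaos \<A> (measure \<mu>) q (projection \<A> q F)"
  define G where "G = vimage_algebra (space M) ?N (count_space UNIV)"
  have fin: "finite \<A>" using \<A> by (simp add: cells_def)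
  have Fm: "F \<in> borel_measurable M" by (rule poisson_chaosD(1)[OF F])
  have sub: "subalgebra M G"
    unfolding subalgebra_def G_def
    using measurable_sets[OF counts_measurable[OF \<A>]] by (auto simp: sets_vimage_algebra2)
  interpret G: finite_measure_subalgebra M G by unfold_locales (rule sub)
  have tv: "tempered \<A> ?v" by (rule tempered_chaos[OF fin])
  have tvu: "tempered \<A> (\<lambda>x. ?v x - u x)" by (rule tempered_minus[OF tv u])
  note int = simple_chaos_square_integrable[OF \<A>]
  let ?W = "\<lambda>\<omega>. F \<omega> - u (?N \<omega>)" and ?V = "\<lambda>\<omega>. ?v (?N \<omega>) - u (?N \<omega>)"
  have iF: "integrable M F" by (rule integrable_of_power4(1)[OF Fm F4])
  have W4: "integrable M (\<lambda>\<omega>. ?W \<omega> ^ 4)"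
    using integrable_power4_add(1)[of F M "\<lambda>\<omega>. - u (?N \<omega>)"] Fm F4 int(2)[OF u]
      int(1)[OF tempered_power[OF u, of 4]] by simp
  have iW: "integrable M ?W" using iF int(1)[OF u] by simp
  have iV: "integrable M ?V" using int(1)[OF tvu] .
  have NG: "?N \<in> measurable G (count_space UNIV)"
    unfolding G_def by (rule measurable_vimage_algebra1) auto
  have VG: "?V \<in> borel_measurable G"
    using measurable_compose[OF NG, of "\<lambda>x. ?v x - u x" borel] by simp
  \<comment> \<open>Sets of \<open>G\<close> are events about the counts, and their indicators are
    bounded functions of the counts, so the projection identity applies to them.\<close>
  have ce: "AE \<omega> in M. real_cond_exp M G ?W \<omega> = ?V \<omega>"
  proof (rule G.real_cond_exp_charact[OF _ iW iV VG])
    fix A assume "A \<in> sets G"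
    then obtain X where X: "A = ?N -` X \<inter> space M" by (auto simp: G_def sets_vimage_algebra2)
    have tX: "tempered \<A> (indicator X :: _ \<Rightarrow> real)"
      by (rule tempered_bounded[of _ 1]) (auto simp: indicator_def)
    have ind: "indicator A \<omega> = (indicator X (?N \<omega>) :: real)" if "\<omega> \<in> space M" for \<omega>
      using that by (simp add: X indicator_def)
    have iFX: "integrable M (\<lambda>\<omega>. F \<omega> * indicator X (?N \<omega>))"
      by (rule Bochner_Integration.integrable_bound[OF iF])
        (use Fm int(2)[OF tX] in \<open>auto simp: indicator_def\<close>)
    have iuX: "integrable M (\<lambda>\<omega>. u (?N \<omega>) * indicator X (?N \<omega>))" by (rule int(1)[OF tempered_mult[OF u tX]])
    have ivX: "integrable M (\<lambda>\<omega>. ?v (?N \<omega>) * indicator X (?N \<omega>))" by (rule int(1)[OF tempered_mult[OF tv tX]])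
    have "(\<integral>\<omega>\<in>A. ?W \<omega> \<partial>M) = expectation (\<lambda>\<omega>. F \<omega> * indicator X (?N \<omega>) - u (?N \<omega>) * indicator X (?N \<omega>))"
      unfolding set_lebesgue_integral_def
      by (intro Bochner_Integration.integral_cong refl) (simp add: ind algebra_simps)
    also have "\<dots> = expectation (\<lambda>\<omega>. F \<omega> * indicator X (?N \<omega>)) - expectation (\<lambda>\<omega>. u (?N \<omega>) * indicator X (?N \<omega>))"
      by (rule Bochner_Integration.integral_diff[OF iFX iuX])
    also have "expectation (\<lambda>\<omega>. F \<omega> * indicator X (?N \<omega>)) = expectation (\<lambda>\<omega>. ?v (?N \<omega>) * indicator X (?N \<omega>))"
      using expectation_projection_eq[OF F \<A> tX] by (simp add: simple_chaos_def)
    also have "\<dots> - expectation (\<lambda>\<omega>. u (?N \<omega>) * indicator X (?N \<omega>))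
        = expectation (\<lambda>\<omega>. ?v (?N \<omega>) * indicator X (?N \<omega>) - u (?N \<omega>) * indicator X (?N \<omega>))"
      by (rule Bochner_Integration.integral_diff[OF ivX iuX, symmetric])
    also have "\<dots> = (\<integral>\<omega>\<in>A. ?V \<omega> \<partial>M)"
      unfolding set_lebesgue_integral_def
      by (intro Bochner_Integration.integral_cong refl) (simp add: ind algebra_simps)
    finally show "(\<integral>\<omega>\<in>A. ?W \<omega> \<partial>M) = (\<integral>\<omega>\<in>A. ?V \<omega> \<partial>M)" .
  qed
  have "AE \<omega> in M. (real_cond_exp M G ?W \<omega>) ^ 4 \<le> real_cond_exp M G (\<lambda>\<omega>. ?W \<omega> ^ 4) \<omega>"
    by (rule G.real_cond_exp_jensens_inequality(2)[of ?W UNIV 0 0 "\<lambda>x. x ^ 4"])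
      (use iW W4 in \<open>auto intro!: convex_power_even\<close>)
  with ce have "AE \<omega> in M. ?V \<omega> ^ 4 \<le> real_cond_exp M G (\<lambda>\<omega>. ?W \<omega> ^ 4) \<omega>"
    by eventually_elim simp
  then have "expectation (\<lambda>\<omega>. ?V \<omega> ^ 4) \<le> expectation (real_cond_exp M G (\<lambda>\<omega>. ?W \<omega> ^ 4))"
    by (intro integral_mono_AE int(1)[OF tempered_power[OF tvu]] G.real_cond_exp_int(1) W4)
  also have "\<dots> = expectation (\<lambda>\<omega>. ?W \<omega> ^ 4)" by (rule G.real_cond_exp_int(2)[OF W4])
  finally show ?thesis by (simp add: simple_chaos_def)
qed

text \<open>An approximant in \<open>L2\<close> need not be close in the fourth mean, but its
  truncation at \<open>K\<close> is close to that of \<open>F\<close>: the fourth power of a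
  difference bounded by \<open>2 * K\<close> is at most \<open>4 * K\<^sup>2\<close> times its
  square. Truncation leaves the chaos; by \<open>projection_contraction\<close> the projection of
  \<open>F\<close> lies in it and is as close to the truncated approximant as \<open>F\<close>
  is.\<close>

lemma simple_chaos_dense_L4:
  assumes F: "F \<in> poisson_chaos M \<mu> \<eta> q" and F4: "integrable M (\<lambda>\<omega>. F \<omega> ^ 4)" and e: "e > 0"
  shows "\<exists>\<A> h. cells \<mu> \<A> \<and> sym_kernel h \<and> integrable M (\<lambda>\<omega>. (simple_chaos \<A> q h \<omega> - F \<omega>) ^ 4) \<and>
    expectation (\<lambda>\<omega>. (simple_chaos \<A> q h \<omega> - F \<omega>) ^ 4) \<le> e"
proof -
  have Fm [measurable]: "F \<in> borel_measurable M" by (rule poisson_chaosD(1)[OF F])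
  have "(\<lambda>j. expectation (\<lambda>\<omega>. (F \<omega> - clamp (real j) (F \<omega>)) ^ 4)) \<longlonglongrightarrow> expectation (\<lambda>\<omega>. 0)"
  proof (rule integral_dominated_convergence[OF _ _ F4])
    show "AE \<omega> in M. norm ((F \<omega> - clamp (real j) (F \<omega>)) ^ 4) \<le> F \<omega> ^ 4" for j
    proof (rule AE_I2)
      fix \<omega>
      have "\<bar>F \<omega> - clamp (real j) (F \<omega>)\<bar> ^ 4 \<le> \<bar>F \<omega>\<bar> ^ 4" by (intro power_mono clamp_error) auto
      then show "norm ((F \<omega> - clamp (real j) (F \<omega>)) ^ 4) \<le> F \<omega> ^ 4" by (simp add: power_even_abs)
    qed
    show "AE \<omega> in M. (\<lambda>j. (F \<omega> - clamp (real j) (F \<omega>)) ^ 4) \<longlonglongrightarrow> 0"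
    proof (rule AE_I2)
      fix \<omega>
      obtain n where n: "\<bar>F \<omega>\<bar> \<le> real n" using real_arch_simple by blast
      have "\<forall>\<^sub>F j in sequentially. (F \<omega> - clamp (real j) (F \<omega>)) ^ 4 = 0"
        unfolding eventually_sequentially using n by (intro exI[of _ n]) (auto simp: clamp_eq)
      then show "(\<lambda>j. (F \<omega> - clamp (real j) (F \<omega>)) ^ 4) \<longlonglongrightarrow> 0" by (rule tendsto_eventually)
    qed
  qed auto
  then have "\<forall>\<^sub>F j in sequentially. expectation (\<lambda>\<omega>. (F \<omega> - clamp (real j) (F \<omega>)) ^ 4) < e / 256"
    using e by (intro order_tendstoD(2)) auto
  then have "\<forall>\<^sub>F j in sequentially. expectation (\<lambda>\<omega>. (F \<omega> - clamp (real j) (F \<omega>)) ^ 4) < e / 256 \<and> j \<ge> 1"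
    using eventually_ge_at_top[of 1] by eventually_elim simp
  then obtain j where j: "expectation (\<lambda>\<omega>. (F \<omega> - clamp (real j) (F \<omega>)) ^ 4) < e / 256" "j \<ge> 1"
    by (auto simp: eventually_sequentially)
  define K where "K = real j"
  have K: "K \<ge> 1" using j(2) by (simp add: K_def)
  \<comment> \<open>With the factor 8 of \<open>power4_add_le\<close>, two errors of
    \<open>e / 256\<close> give \<open>e / 16\<close>, and two errors of \<open>e / 16\<close> give
    \<open>e\<close>. Here 1024 is 4 times 256 and absorbs the truncation factor
    \<open>4 * K\<^sup>2\<close>.\<close>
  have "e / (1024 * K\<^sup>2) > 0" using e K by simp
  from simple_chaos_dense[OF F this] obtain \<A> h where A: "cells \<mu> \<A>" "sym_kernel h"
    "(\<integral>\<^sup>+\<omega>. ennreal ((simple_chaos \<A> q h \<omega> - F \<omega>)\<^sup>2) \<partial>M) \<le> ennreal (e / (1024 * K\<^sup>2))" by blast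
  note Hm [measurable] = simple_chaos_measurable[OF A(1), of q h]
  have i2: "integrable M (\<lambda>\<omega>. (simple_chaos \<A> q h \<omega> - F \<omega>)\<^sup>2)"
    by (rule integrableI_bounded) (use A(3) in \<open>auto simp: le_less_trans\<close>)
  have E2: "expectation (\<lambda>\<omega>. (simple_chaos \<A> q h \<omega> - F \<omega>)\<^sup>2) \<le> e / (1024 * K\<^sup>2)"
    using A(3) e K by (subst integral_eq_nn_integral) (auto intro!: enn2real_leI)
  have fin: "finite \<A>" using A(1) by (simp add: cells_def)
  define u where "u x = clamp K (chaos \<A> (measure \<mu>) q h x)" for x
  have tu: "tempered \<A> u" by (rule tempered_bounded[of _ K]) (use K in \<open>auto simp: u_def intro!: clamp_bound\<close>)
  have um [measurable]: "(\<lambda>\<omega>. u (counts \<A> \<omega>)) \<in> borel_measurable M" by (rule counts_compose_measurable[OF A(1)])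
  have eq: "u (counts \<A> \<omega>) = clamp K (simple_chaos \<A> q h \<omega>)" for \<omega> by (simp add: u_def simple_chaos_def)
  have c1: "integrable M (\<lambda>\<omega>. (F \<omega> - clamp K (F \<omega>)) ^ 4)"
  proof (rule Bochner_Integration.integrable_bound[OF F4])
    show "AE \<omega> in M. norm ((F \<omega> - clamp K (F \<omega>)) ^ 4) \<le> norm (F \<omega> ^ 4)"
    proof (rule AE_I2)
      fix \<omega>
      have "\<bar>F \<omega> - clamp K (F \<omega>)\<bar> ^ 4 \<le> \<bar>F \<omega>\<bar> ^ 4" using K by (intro power_mono clamp_error) auto
      then show "norm ((F \<omega> - clamp K (F \<omega>)) ^ 4) \<le> norm (F \<omega> ^ 4)" by (simp add: power_even_abs)
    qed
  qed simp
  have pt: "(clamp K (F \<omega>) - u (counts \<A> \<omega>)) ^ 4 \<le> 4 * K\<^sup>2 * (simple_chaos \<A> q h \<omega> - F \<omega>)\<^sup>2" for \<omega>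
  proof -
    let ?d = "clamp K (F \<omega>) - u (counts \<A> \<omega>)"
    have "\<bar>?d\<bar> \<le> 2 * K" using clamp_bound[of K "F \<omega>"] clamp_bound[of K "simple_chaos \<A> q h \<omega>"] K by (simp add: eq)
    then have "\<bar>?d\<bar>\<^sup>2 \<le> (2 * K)\<^sup>2" by (rule power_mono) simp
    then have 1: "?d\<^sup>2 \<le> (2 * K)\<^sup>2" by (simp only: power2_abs)
    have "\<bar>?d\<bar> \<le> \<bar>F \<omega> - simple_chaos \<A> q h \<omega>\<bar>" unfolding eq by (rule clamp_lipschitz)
    then have 2: "?d\<^sup>2 \<le> (simple_chaos \<A> q h \<omega> - F \<omega>)\<^sup>2" by (simp add: abs_le_square_iff power2_commute)
    have "?d ^ 4 = ?d\<^sup>2 * ?d\<^sup>2" by (simp add: power_add[symmetric])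
    also have "\<dots> \<le> (2 * K)\<^sup>2 * (simple_chaos \<A> q h \<omega> - F \<omega>)\<^sup>2" using 1 2 by (intro mult_mono) auto
    finally show ?thesis by (simp add: power_mult_distrib)
  qed
  have c2: "integrable M (\<lambda>\<omega>. (clamp K (F \<omega>) - u (counts \<A> \<omega>)) ^ 4)"
  proof (rule Bochner_Integration.integrable_bound)
    show "integrable M (\<lambda>\<omega>. 4 * K\<^sup>2 * (simple_chaos \<A> q h \<omega> - F \<omega>)\<^sup>2)" using i2 by simp
    show "AE \<omega> in M. norm ((clamp K (F \<omega>) - u (counts \<A> \<omega>)) ^ 4) \<le> norm (4 * K\<^sup>2 * (simple_chaos \<A> q h \<omega> - F \<omega>)\<^sup>2)"
      using pt by (intro AE_I2) simp
  qed simp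
  have E_c2: "expectation (\<lambda>\<omega>. (clamp K (F \<omega>) - u (counts \<A> \<omega>)) ^ 4) \<le> e / 256"
  proof -
    have "expectation (\<lambda>\<omega>. (clamp K (F \<omega>) - u (counts \<A> \<omega>)) ^ 4)
        \<le> expectation (\<lambda>\<omega>. 4 * K\<^sup>2 * (simple_chaos \<A> q h \<omega> - F \<omega>)\<^sup>2)"
      using i2 by (intro integral_mono c2 pt) simp
    also have "\<dots> \<le> 4 * K\<^sup>2 * (e / (1024 * K\<^sup>2))" using mult_left_mono[OF E2, of "4 * K\<^sup>2"] by simp
    also have "\<dots> = e / 256" using K by (simp add: field_simps)
    finally show ?thesis .
  qed
  have Fu: "integrable M (\<lambda>\<omega>. (F \<omega> - u (counts \<A> \<omega>)) ^ 4)"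
    "expectation (\<lambda>\<omega>. (F \<omega> - u (counts \<A> \<omega>)) ^ 4) \<le> e / 16"
    using integrable_power4_add[of "\<lambda>\<omega>. F \<omega> - clamp K (F \<omega>)" M "\<lambda>\<omega>. clamp K (F \<omega>) - u (counts \<A> \<omega>)", OF _ _ c1 c2]
      j(1) E_c2 by (simp_all add: K_def)
  define V where "V = simple_chaos \<A> q (projection \<A> q F)"
  have V: "V \<in> borel_measurable M" unfolding V_def by (rule simple_chaos_measurable[OF A(1)])
  have Vu: "integrable M (\<lambda>\<omega>. (V \<omega> - u (counts \<A> \<omega>)) ^ 4)"
    unfolding V_def simple_chaos_def
    by (rule simple_chaos_square_integrable(1)[OF A(1) tempered_power[OF tempered_minus[OF tempered_chaos[OF fin] tu]]])
  have EVu: "expectation (\<lambda>\<omega>. (V \<omega> - u (counts \<A> \<omega>)) ^ 4) \<le> e / 16"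
    unfolding V_def by (rule order_trans[OF projection_contraction[OF F F4 A(1) tu] Fu(2)])
  have Fu': "(\<lambda>\<omega>. (u (counts \<A> \<omega>) - F \<omega>) ^ 4) = (\<lambda>\<omega>. (F \<omega> - u (counts \<A> \<omega>)) ^ 4)"
    by (rule ext) (metis power_even_abs abs_minus_commute even_numeral)
  have "integrable M (\<lambda>\<omega>. (V \<omega> - F \<omega>) ^ 4)" "expectation (\<lambda>\<omega>. (V \<omega> - F \<omega>) ^ 4) \<le> e"
    using integrable_power4_add[of "\<lambda>\<omega>. V \<omega> - u (counts \<A> \<omega>)" M "\<lambda>\<omega>. u (counts \<A> \<omega>) - F \<omega>"] V Vu Fu EVu
    unfolding Fu' by simp_all
  then show ?thesis using A(1) sym_kernel_projection unfolding V_def by blast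
qed

text \<open>The numbers \<open>s'\<close> and \<open>K'\<close> are the moments of a simple
  approximant, for which the estimate of the discrete part is available. A single approximant serves
  all \<open>\<alpha>\<close> and \<open>t\<close>.\<close>

lemma chaos_characteristic_bound:
  assumes F: "F \<in> poisson_chaos M \<mu> \<eta> q" and F4: "integrable M (\<lambda>\<omega>. F \<omega> ^ 4)" and q: "q \<ge> 1"
    and s: "s = expectation (\<lambda>\<omega>. (F \<omega>)\<^sup>2)" and K: "K = expectation (\<lambda>\<omega>. F \<omega> ^ 4)"
    and \<theta>: "0 < \<theta>" "\<theta> \<le> 1"
  shows "\<exists>s' K'. \<bar>s' - s\<bar> \<le> \<theta> * (s + 2) \<and> \<bar>K' - K\<bar> \<le> 15 * \<theta> * (K + 1) \<and>
    (\<forall>\<alpha> t. \<alpha> > 0 \<longrightarrow> K' - 3 * s'\<^sup>2 \<le> \<alpha>\<^sup>2 \<longrightarrow>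
      \<bar>expectation (\<lambda>\<omega>. cos (t * F \<omega>)) - exp (- s' * t\<^sup>2 / 2)\<bar> \<le> (\<bar>t\<bar> * \<alpha> + 4 * \<bar>t\<bar> ^ 3 * \<alpha>\<^sup>2) * \<bar>t\<bar> + \<bar>t\<bar> * \<theta> \<and>
      \<bar>expectation (\<lambda>\<omega>. sin (t * F \<omega>))\<bar> \<le> (\<bar>t\<bar> * \<alpha> + 4 * \<bar>t\<bar> ^ 3 * \<alpha>\<^sup>2) * \<bar>t\<bar> + \<bar>t\<bar> * \<theta>)"
proof -
  have Fm [measurable]: "F \<in> borel_measurable M" by (rule poisson_chaosD(1)[OF F])
  have F2: "integrable M (\<lambda>\<omega>. (F \<omega>)\<^sup>2)" by (rule poisson_chaosD(2)[OF F])
  \<comment> \<open>The fifth power leaves one factor \<open>\<theta>\<close> after the division by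
    \<open>\<theta> ^ 4\<close> in \<open>abs_power4_diff_le\<close>. It also bounds the second
    moment of the error by \<open>\<theta>\<^sup>2\<close> and its first absolute moment by
    \<open>\<theta>\<close>.\<close>
  have "\<theta> ^ 5 > 0" using \<theta> by simp
  from simple_chaos_dense_L4[OF F F4 this] obtain \<A> h where A: "cells \<mu> \<A>" "sym_kernel h"
    "integrable M (\<lambda>\<omega>. (simple_chaos \<A> q h \<omega> - F \<omega>) ^ 4)"
    "expectation (\<lambda>\<omega>. (simple_chaos \<A> q h \<omega> - F \<omega>) ^ 4) \<le> \<theta> ^ 5" by blast
  interpret P: poisson_vector "counts_pmf \<A>" \<A> "measure \<mu>" by (rule poisson_vector_counts[OF A(1)])
  let ?c = "chaos \<A> (measure \<mu>) q h"
  define Y where "Y = simple_chaos \<A> q h"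
  have Yc: "Y \<omega> = ?c (counts \<A> \<omega>)" for \<omega> by (simp add: Y_def simple_chaos_def)
  have Ym [measurable]: "Y \<in> borel_measurable M" unfolding Y_def by (rule simple_chaos_measurable[OF A(1)])
  have tc: "tempered \<A> ?c" by (rule tempered_chaos[OF P.finite_I])
  have Yi: "integrable M (\<lambda>\<omega>. Y \<omega> ^ n)" for n
    unfolding Yc by (rule simple_chaos_square_integrable(1)[OF A(1) tempered_power[OF tc]])
  define D where "D \<omega> = Y \<omega> - F \<omega>" for \<omega>
  have Dm [measurable]: "D \<in> borel_measurable M" unfolding D_def[abs_def] by measurable
  have D4: "integrable M (\<lambda>\<omega>. D \<omega> ^ 4)" "expectation (\<lambda>\<omega>. D \<omega> ^ 4) \<le> \<theta> ^ 5"
    using A(3,4) by (simp_all add: D_def Y_def)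
  have D12: "integrable M D" "integrable M (\<lambda>\<omega>. (D \<omega>)\<^sup>2)" using integrable_of_power4[OF Dm D4(1)] by auto
  have ED2: "expectation (\<lambda>\<omega>. (D \<omega>)\<^sup>2) \<le> \<theta>\<^sup>2"
  proof -
    have "(D \<omega>)\<^sup>2 \<le> 1 / (2 * \<theta>\<^sup>2) * D \<omega> ^ 4 + \<theta>\<^sup>2 / 2" for \<omega>
      using abs_le_half_square_add[of "\<theta>\<^sup>2" "(D \<omega>)\<^sup>2"] \<theta> by simp
    then have "expectation (\<lambda>\<omega>. (D \<omega>)\<^sup>2) \<le> expectation (\<lambda>\<omega>. 1 / (2 * \<theta>\<^sup>2) * D \<omega> ^ 4 + \<theta>\<^sup>2 / 2)"
      using D4(1) D12 by (intro integral_mono) auto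
    also have "\<dots> = 1 / (2 * \<theta>\<^sup>2) * expectation (\<lambda>\<omega>. D \<omega> ^ 4) + \<theta>\<^sup>2 / 2"
      using D4(1) by (simp add: prob_space)
    also have "\<dots> \<le> 1 / (2 * \<theta>\<^sup>2) * \<theta> ^ 5 + \<theta>\<^sup>2 / 2"
      using D4(2) by (intro add_right_mono mult_left_mono) auto
    also have "1 / (2 * \<theta>\<^sup>2) * \<theta> ^ 5 = \<theta> * \<theta>\<^sup>2 / 2" using \<theta> by (simp add: field_simps eval_nat_numeral)
    also have "\<theta> * \<theta>\<^sup>2 / 2 + \<theta>\<^sup>2 / 2 \<le> \<theta>\<^sup>2"
    proof -
      have "\<theta> * \<theta>\<^sup>2 \<le> 1 * \<theta>\<^sup>2" by (rule mult_right_mono[OF \<theta>(2)]) simp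
      then show ?thesis by argo
    qed
    finally show ?thesis .
  qed
  have ED1: "expectation (\<lambda>\<omega>. \<bar>D \<omega>\<bar>) \<le> \<theta>"
  proof -
    have "expectation (\<lambda>\<omega>. \<bar>D \<omega>\<bar>) \<le> expectation (\<lambda>\<omega>. 1 / (2 * \<theta>) * (D \<omega>)\<^sup>2 + \<theta> / 2)"
      using D12 abs_le_half_square_add[OF \<theta>(1)] by (intro integral_mono) auto
    also have "\<dots> = 1 / (2 * \<theta>) * expectation (\<lambda>\<omega>. (D \<omega>)\<^sup>2) + \<theta> / 2" using D12 by (simp add: prob_space)
    also have "\<dots> \<le> 1 / (2 * \<theta>) * \<theta>\<^sup>2 + \<theta> / 2" using ED2 \<theta> by (intro add_right_mono mult_left_mono) auto
    also have "\<dots> = \<theta>" using \<theta> by (simp add: power2_eq_square)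
    finally show ?thesis .
  qed
  define s' where "s' = expectation (\<lambda>\<omega>. (Y \<omega>)\<^sup>2)"
  define K' where "K' = expectation (\<lambda>\<omega>. Y \<omega> ^ 4)"
  have s': "\<bar>s' - s\<bar> \<le> \<theta> * (s + 2)"
  proof -
    have "\<bar>s' - s\<bar> = \<bar>expectation (\<lambda>\<omega>. (Y \<omega>)\<^sup>2 - (F \<omega>)\<^sup>2)\<bar>"
      unfolding s'_def s using Yi[of 2] F2 by simp
    also have "\<dots> \<le> expectation (\<lambda>\<omega>. \<bar>(Y \<omega>)\<^sup>2 - (F \<omega>)\<^sup>2\<bar>)" by (rule integral_abs_bound)
    also have "\<dots> \<le> expectation (\<lambda>\<omega>. \<theta> * (F \<omega>)\<^sup>2 + (1 / \<theta> + 1) * (D \<omega>)\<^sup>2)"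
    proof (rule integral_mono)
      show "integrable M (\<lambda>\<omega>. \<bar>(Y \<omega>)\<^sup>2 - (F \<omega>)\<^sup>2\<bar>)" using Yi[of 2] F2 by simp
      show "integrable M (\<lambda>\<omega>. \<theta> * (F \<omega>)\<^sup>2 + (1 / \<theta> + 1) * (D \<omega>)\<^sup>2)" using F2 D12 by simp
      fix \<omega>
      have "(Y \<omega>)\<^sup>2 - (F \<omega>)\<^sup>2 = 2 * F \<omega> * D \<omega> + (D \<omega>)\<^sup>2"
        by (simp add: D_def power2_eq_square algebra_simps)
      then have 1: "\<bar>(Y \<omega>)\<^sup>2 - (F \<omega>)\<^sup>2\<bar> \<le> 2 * (\<bar>F \<omega>\<bar> * \<bar>D \<omega>\<bar>) + (D \<omega>)\<^sup>2"
        using abs_triangle_ineq[of "2 * F \<omega> * D \<omega>" "(D \<omega>)\<^sup>2"] by (simp add: abs_mult)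
      have "2 * (\<theta> * \<bar>F \<omega>\<bar>) * \<bar>D \<omega>\<bar> \<le> (\<theta> * \<bar>F \<omega>\<bar>)\<^sup>2 + \<bar>D \<omega>\<bar>\<^sup>2" by (rule sum_squares_bound)
      then have "2 * (\<bar>F \<omega>\<bar> * \<bar>D \<omega>\<bar>) \<le> \<theta> * (F \<omega>)\<^sup>2 + (1 / \<theta>) * (D \<omega>)\<^sup>2"
        using \<theta> by (simp add: field_simps power2_eq_square)
      then show "\<bar>(Y \<omega>)\<^sup>2 - (F \<omega>)\<^sup>2\<bar> \<le> \<theta> * (F \<omega>)\<^sup>2 + (1 / \<theta> + 1) * (D \<omega>)\<^sup>2"
        using 1 by (simp add: distrib_right)
    qed
    also have "\<dots> = \<theta> * s + (1 / \<theta> + 1) * expectation (\<lambda>\<omega>. (D \<omega>)\<^sup>2)" using F2 D12 by (simp add: s)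
    also have "\<dots> \<le> \<theta> * s + (1 / \<theta> + 1) * \<theta>\<^sup>2" using ED2 \<theta> by (intro add_left_mono mult_left_mono) auto
    also have "(1 / \<theta> + 1) * \<theta>\<^sup>2 = \<theta> + \<theta> * \<theta>" using \<theta> by (simp add: field_simps power2_eq_square)
    also have "\<theta> * s + (\<theta> + \<theta> * \<theta>) \<le> \<theta> * (s + 2)"
      using \<theta> mult_left_le_one_le[of \<theta> \<theta>] by (simp add: distrib_left)
    finally show ?thesis .
  qed
  have K': "\<bar>K' - K\<bar> \<le> 15 * \<theta> * (K + 1)"
  proof -
    have "\<bar>K' - K\<bar> = \<bar>expectation (\<lambda>\<omega>. Y \<omega> ^ 4 - F \<omega> ^ 4)\<bar>"
      unfolding K'_def K using Yi[of 4] F4 by simp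
    also have "\<dots> \<le> expectation (\<lambda>\<omega>. \<bar>Y \<omega> ^ 4 - F \<omega> ^ 4\<bar>)" by (rule integral_abs_bound)
    also have "\<dots> \<le> expectation (\<lambda>\<omega>. 15 * \<theta> * F \<omega> ^ 4 + 15 / \<theta> ^ 4 * D \<omega> ^ 4)"
    proof (rule integral_mono)
      show "integrable M (\<lambda>\<omega>. \<bar>Y \<omega> ^ 4 - F \<omega> ^ 4\<bar>)" using Yi[of 4] F4 by simp
      show "integrable M (\<lambda>\<omega>. 15 * \<theta> * F \<omega> ^ 4 + 15 / \<theta> ^ 4 * D \<omega> ^ 4)" using F4 D4(1) by simp
      show "\<bar>Y \<omega> ^ 4 - F \<omega> ^ 4\<bar> \<le> 15 * \<theta> * F \<omega> ^ 4 + 15 / \<theta> ^ 4 * D \<omega> ^ 4" for \<omega>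
        using abs_power4_diff_le[OF \<theta>, of "F \<omega>" "D \<omega>"] by (simp add: D_def)
    qed
    also have "\<dots> = 15 * \<theta> * K + 15 / \<theta> ^ 4 * expectation (\<lambda>\<omega>. D \<omega> ^ 4)" using F4 D4(1) by (simp add: K)
    also have "\<dots> \<le> 15 * \<theta> * K + 15 / \<theta> ^ 4 * \<theta> ^ 5" using D4(2) by (intro add_left_mono mult_left_mono) auto
    also have "15 / \<theta> ^ 4 * \<theta> ^ 5 = 15 * \<theta>" using \<theta> by (simp add: eval_nat_numeral)
    finally show ?thesis by (simp add: algebra_simps)
  qed
  have bounds: "\<bar>expectation (\<lambda>\<omega>. cos (t * F \<omega>)) - exp (- s' * t\<^sup>2 / 2)\<bar> \<le> (\<bar>t\<bar> * \<alpha> + 4 * \<bar>t\<bar> ^ 3 * \<alpha>\<^sup>2) * \<bar>t\<bar> + \<bar>t\<bar> * \<theta> \<and>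
      \<bar>expectation (\<lambda>\<omega>. sin (t * F \<omega>))\<bar> \<le> (\<bar>t\<bar> * \<alpha> + 4 * \<bar>t\<bar> ^ 3 * \<alpha>\<^sup>2) * \<bar>t\<bar> + \<bar>t\<bar> * \<theta>"
    if \<alpha>: "\<alpha> > 0" "K' - 3 * s'\<^sup>2 \<le> \<alpha>\<^sup>2" for \<alpha> t
  proof -
    have sP: "s' = P.E (\<lambda>x. (?c x)\<^sup>2)" and KP: "K' = P.E (\<lambda>x. ?c x ^ 4)"
      unfolding s'_def K'_def Yc by (simp_all only: expectation_counts[OF A(1)])
    have Ycos: "\<bar>expectation (\<lambda>\<omega>. cos (t * Y \<omega>)) - exp (- s' * t\<^sup>2 / 2)\<bar> \<le> (\<bar>t\<bar> * \<alpha> + 4 * \<bar>t\<bar> ^ 3 * \<alpha>\<^sup>2) * \<bar>t\<bar>"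
      and Ysin: "\<bar>expectation (\<lambda>\<omega>. sin (t * Y \<omega>))\<bar> \<le> (\<bar>t\<bar> * \<alpha> + 4 * \<bar>t\<bar> ^ 3 * \<alpha>\<^sup>2) * \<bar>t\<bar>"
      using P.chaos_cos_sin_bound[OF A(2) q refl sP KP \<alpha>, of t]
      unfolding Yc by (simp_all only: expectation_counts[OF A(1)])
    have close: "\<bar>expectation (\<lambda>\<omega>. g (t * F \<omega>)) - expectation (\<lambda>\<omega>. g (t * Y \<omega>))\<bar> \<le> \<bar>t\<bar> * \<theta>"
      if [measurable]: "g \<in> borel_measurable borel" and g1: "\<And>x. \<bar>g x\<bar> \<le> 1"
        and lip: "\<And>x y. \<bar>g x - g y\<bar> \<le> \<bar>x - y\<bar>" for g :: "real \<Rightarrow> real"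
    proof -
      have ig: "integrable M (\<lambda>\<omega>. g (t * F \<omega>))" "integrable M (\<lambda>\<omega>. g (t * Y \<omega>))"
        using g1 by (auto intro!: integrable_const_bound[of _ 1])
      have "\<bar>expectation (\<lambda>\<omega>. g (t * F \<omega>)) - expectation (\<lambda>\<omega>. g (t * Y \<omega>))\<bar>
          = \<bar>expectation (\<lambda>\<omega>. g (t * F \<omega>) - g (t * Y \<omega>))\<bar>" using ig by simp
      also have "\<dots> \<le> expectation (\<lambda>\<omega>. \<bar>g (t * F \<omega>) - g (t * Y \<omega>)\<bar>)" by (rule integral_abs_bound)
      also have "\<dots> \<le> expectation (\<lambda>\<omega>. \<bar>t\<bar> * \<bar>D \<omega>\<bar>)"
      proof (rule integral_mono)
        show "integrable M (\<lambda>\<omega>. \<bar>g (t * F \<omega>) - g (t * Y \<omega>)\<bar>)" using ig by simp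
        show "integrable M (\<lambda>\<omega>. \<bar>t\<bar> * \<bar>D \<omega>\<bar>)" using D12 by simp
        show "\<bar>g (t * F \<omega>) - g (t * Y \<omega>)\<bar> \<le> \<bar>t\<bar> * \<bar>D \<omega>\<bar>" for \<omega>
          using lip[of "t * F \<omega>" "t * Y \<omega>"]
          by (simp add: D_def right_diff_distrib[symmetric] abs_mult abs_minus_commute)
      qed
      also have "\<dots> \<le> \<bar>t\<bar> * \<theta>" using ED1 by (simp add: mult_left_mono)
      finally show ?thesis .
    qed
    have "\<bar>expectation (\<lambda>\<omega>. cos (t * F \<omega>)) - expectation (\<lambda>\<omega>. cos (t * Y \<omega>))\<bar> \<le> \<bar>t\<bar> * \<theta>"
      "\<bar>expectation (\<lambda>\<omega>. sin (t * F \<omega>)) - expectation (\<lambda>\<omega>. sin (t * Y \<omega>))\<bar> \<le> \<bar>t\<bar> * \<theta>"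
      by (rule close; simp add: abs_cos_sin_diff_le)+
    then show ?thesis using Ycos Ysin by linarith
  qed
  show ?thesis using s' K' bounds by (intro exI[of _ s'] exI[of _ K']) blast
qed

section \<open>Passage to the limit\<close>

lemma chaos_cos_sin_limit:
  fixes F :: "nat \<Rightarrow> 'w \<Rightarrow> real"
  assumes q: "\<And>n. q n \<ge> 1" and F: "\<And>n. F n \<in> poisson_chaos M \<mu> \<eta> (q n)"
    and lim2: "(\<lambda>n. expectation (\<lambda>\<omega>. (F n \<omega>)\<^sup>2)) \<longlonglongrightarrow> 1"
    and lim4: "(\<lambda>n. expectation (\<lambda>\<omega>. F n \<omega> ^ 4)) \<longlonglongrightarrow> 3"
  shows "(\<lambda>n. expectation (\<lambda>\<omega>. cos (t * F n \<omega>))) \<longlonglongrightarrow> exp (- t\<^sup>2 / 2)"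
    and "(\<lambda>n. expectation (\<lambda>\<omega>. sin (t * F n \<omega>))) \<longlonglongrightarrow> 0"
proof -
  define s where "s n = expectation (\<lambda>\<omega>. (F n \<omega>)\<^sup>2)" for n
  define K where "K n = expectation (\<lambda>\<omega>. F n \<omega> ^ 4)" for n
  define \<theta> where "\<theta> n = inverse (real (Suc n))" for n
  have \<theta>: "0 < \<theta> n" "\<theta> n \<le> 1" for n by (auto simp: \<theta>_def inverse_le_1_iff)
  have \<theta>0: "\<theta> \<longlonglongrightarrow> 0" unfolding \<theta>_def[abs_def] by (rule LIMSEQ_inverse_real_of_nat)
  have s1: "s \<longlonglongrightarrow> 1" and K3: "K \<longlonglongrightarrow> 3" using lim2 lim4 by (simp_all add: s_def[abs_def] K_def[abs_def])
  let ?B = "\<lambda>\<alpha> n. (\<bar>t\<bar> * \<alpha> + 4 * \<bar>t\<bar> ^ 3 * \<alpha>\<^sup>2) * \<bar>t\<bar> + \<bar>t\<bar> * \<theta> n"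
  define good where "good n s' K' \<longleftrightarrow> \<bar>s' - s n\<bar> \<le> \<theta> n * (s n + 2) \<and> \<bar>K' - K n\<bar> \<le> 15 * \<theta> n * (K n + 1) \<and>
    (\<forall>\<alpha>. \<alpha> > 0 \<longrightarrow> K' - 3 * s'\<^sup>2 \<le> \<alpha>\<^sup>2 \<longrightarrow>
      \<bar>expectation (\<lambda>\<omega>. cos (t * F n \<omega>)) - exp (- s' * t\<^sup>2 / 2)\<bar> \<le> ?B \<alpha> n \<and>
      \<bar>expectation (\<lambda>\<omega>. sin (t * F n \<omega>))\<bar> \<le> ?B \<alpha> n)" for n s' K'
  \<comment> \<open>A nonintegrable function has Bochner integral 0, so a nonzero fourth moment,
    which is guaranteed eventually, entails integrability.\<close>
  have "\<forall>\<^sub>F n in sequentially. K n > 0" using K3 by (rule order_tendstoD(1)) simp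
  then have ev: "\<forall>\<^sub>F n in sequentially. \<exists>s' K'. good n s' K'"
  proof eventually_elim
    case (elim n)
    have F4: "integrable M (\<lambda>\<omega>. F n \<omega> ^ 4)"
      using elim not_integrable_integral_eq[of M "\<lambda>\<omega>. F n \<omega> ^ 4"] by (auto simp: K_def)
    from chaos_characteristic_bound[OF F F4 q s_def K_def \<theta>]
    show ?case unfolding good_def by blast
  qed
  \<comment> \<open>A good pair exists only eventually; at the other indices the choice is arbitrary
    and has no bearing on limits.\<close>
  define s' where "s' n = fst (SOME p. good n (fst p) (snd p))" for n
  define K' where "K' n = snd (SOME p. good n (fst p) (snd p))" for n
  have ev: "\<forall>\<^sub>F n in sequentially. good n (s' n) (K' n)"
    using ev
  proof eventually_elim
    case (elim n)
    then obtain a b where "good n a b" by blast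
    then show ?case
      unfolding s'_def K'_def by (intro someI[of "\<lambda>p. good n (fst p) (snd p)" "(a, b)"]) simp
  qed
  have s'1: "s' \<longlonglongrightarrow> 1"
  proof -
    have "(\<lambda>n. s' n - s n) \<longlonglongrightarrow> 0"
    proof (rule Lim_null_comparison)
      show "\<forall>\<^sub>F n in sequentially. norm (s' n - s n) \<le> \<theta> n * (s n + 2)"
        using ev by eventually_elim (simp add: good_def)
      show "(\<lambda>n. \<theta> n * (s n + 2)) \<longlonglongrightarrow> 0" using \<theta>0 s1 by (auto intro!: tendsto_eq_intros)
    qed
    from tendsto_add[OF this s1] show ?thesis by simp
  qed
  have K'3: "K' \<longlonglongrightarrow> 3"
  proof -
    have "(\<lambda>n. K' n - K n) \<longlonglongrightarrow> 0"
    proof (rule Lim_null_comparison)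
      show "\<forall>\<^sub>F n in sequentially. norm (K' n - K n) \<le> 15 * \<theta> n * (K n + 1)"
        using ev by eventually_elim (simp add: good_def)
      show "(\<lambda>n. 15 * \<theta> n * (K n + 1)) \<longlonglongrightarrow> 0" using \<theta>0 K3 by (auto intro!: tendsto_eq_intros)
    qed
    from tendsto_add[OF this K3] show ?thesis by simp
  qed
  \<comment> \<open>The summand \<open>\<theta> n\<close> makes \<open>\<alpha> n\<close> positive
    even when the excess vanishes.\<close>
  define \<alpha> where "\<alpha> n = sqrt \<bar>K' n - 3 * (s' n)\<^sup>2\<bar> + \<theta> n" for n
  have \<alpha>0: "\<alpha> \<longlonglongrightarrow> 0"
  proof -
    have "\<alpha> \<longlonglongrightarrow> sqrt \<bar>3 - 3 * 1\<^sup>2\<bar> + 0"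
      unfolding \<alpha>_def[abs_def] by (intro tendsto_intros s'1 K'3 \<theta>0)
    then show ?thesis by simp
  qed
  have \<alpha>: "\<alpha> n > 0" "K' n - 3 * (s' n)\<^sup>2 \<le> (\<alpha> n)\<^sup>2" for n
  proof -
    show "\<alpha> n > 0" using \<theta>(1)[of n] by (simp add: \<alpha>_def add_nonneg_pos)
    have "(sqrt \<bar>K' n - 3 * (s' n)\<^sup>2\<bar>)\<^sup>2 \<le> (\<alpha> n)\<^sup>2"
      using \<theta>(1)[of n] by (intro power_mono) (auto simp: \<alpha>_def)
    then show "K' n - 3 * (s' n)\<^sup>2 \<le> (\<alpha> n)\<^sup>2" by simp
  qed
  have B0: "(\<lambda>n. ?B (\<alpha> n) n) \<longlonglongrightarrow> 0" using \<alpha>0 \<theta>0 by (auto intro!: tendsto_eq_intros)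
  have bound: "\<forall>\<^sub>F n in sequentially.
      \<bar>expectation (\<lambda>\<omega>. cos (t * F n \<omega>)) - exp (- s' n * t\<^sup>2 / 2)\<bar> \<le> ?B (\<alpha> n) n \<and>
      \<bar>expectation (\<lambda>\<omega>. sin (t * F n \<omega>))\<bar> \<le> ?B (\<alpha> n) n"
    using ev
  proof eventually_elim
    case (elim n)
    then show ?case using \<alpha>[of n] unfolding good_def by blast
  qed
  show "(\<lambda>n. expectation (\<lambda>\<omega>. sin (t * F n \<omega>))) \<longlonglongrightarrow> 0"
    by (rule Lim_null_comparison[OF _ B0]) (use bound in \<open>eventually_elim, simp\<close>)
  have "(\<lambda>n. expectation (\<lambda>\<omega>. cos (t * F n \<omega>)) - exp (- s' n * t\<^sup>2 / 2)) \<longlonglongrightarrow> 0"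
    by (rule Lim_null_comparison[OF _ B0]) (use bound in \<open>eventually_elim, simp\<close>)
  moreover have "(\<lambda>n. exp (- s' n * t\<^sup>2 / 2)) \<longlonglongrightarrow> exp (- 1 * t\<^sup>2 / 2)"
    by (intro tendsto_intros s'1) simp
  ultimately have "(\<lambda>n. (expectation (\<lambda>\<omega>. cos (t * F n \<omega>)) - exp (- s' n * t\<^sup>2 / 2)) + exp (- s' n * t\<^sup>2 / 2))
      \<longlonglongrightarrow> 0 + exp (- 1 * t\<^sup>2 / 2)" by (rule tendsto_add)
  then show "(\<lambda>n. expectation (\<lambda>\<omega>. cos (t * F n \<omega>))) \<longlonglongrightarrow> exp (- t\<^sup>2 / 2)" by simp
qed

lemma char_distr_cos_sin:
  assumes [measurable]: "F \<in> borel_measurable M"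
  shows "char (distr M borel F) t
    = Complex (expectation (\<lambda>\<omega>. cos (t * F \<omega>))) (expectation (\<lambda>\<omega>. sin (t * F \<omega>)))"
proof -
  have "char (distr M borel F) t = (CLINT \<omega>|M. iexp (t * F \<omega>))"
    unfolding char_def by (subst integral_distr) auto
  moreover have "integrable M (\<lambda>\<omega>. iexp (t * F \<omega>))"
    by (rule integrable_const_bound[of _ 1]) auto
  ultimately show ?thesis
    by (simp add: complex_eq_iff integral_Re[symmetric] integral_Im[symmetric] del: integral_Re integral_Im of_real_mult)
qed

end

theorem corollary1p3:
  fixes M :: "'w measure" and \<mu> :: "'z measure" and \<eta> :: "'w \<Rightarrow> 'z measure"
    and q :: "nat \<Rightarrow> nat" and F :: "nat \<Rightarrow> 'w \<Rightarrow> real"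
  assumes "poisson_random_measure M \<mu> \<eta>"
    and "\<And>n. n \<ge> 1 \<Longrightarrow> q n \<ge> 1"
    and "\<And>n. n \<ge> 1 \<Longrightarrow> F n \<in> poisson_chaos M \<mu> \<eta> (q n)"
    and "(\<lambda>n. prob_space.expectation M (\<lambda>\<omega>. (F n \<omega>) ^ 2)) \<longlonglongrightarrow> 1"
    and "(\<lambda>n. prob_space.expectation M (\<lambda>\<omega>. (F n \<omega>) ^ 4)) \<longlonglongrightarrow> 3"
  shows "weak_conv_m (\<lambda>n. distr M borel (F n)) std_normal_distribution"
proof -
  interpret poisson_random_measure M \<mu> \<eta> by (rule assms(1))
  \<comment> \<open>The assumptions on the order and the chaos start at index 1, so Levy's theorem
    is applied to the shifted sequence and the shift is undone at the end.\<close>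
  have q: "q (Suc n) \<ge> 1" and F: "F (Suc n) \<in> poisson_chaos M \<mu> \<eta> (q (Suc n))" for n
    using assms(2,3) by auto
  have Fm: "F (Suc n) \<in> borel_measurable M" for n by (rule poisson_chaosD(1)[OF F])
  have "weak_conv_m (\<lambda>n. distr M borel (F (Suc n))) std_normal_distribution"
  proof (rule levy_continuity)
    show "real_distribution (distr M borel (F (Suc n)))" for n
      by (rule real_distribution_distr[OF Fm])
    show "real_distribution std_normal_distribution" by (rule real_dist_normal_dist)
    fix t
    have "(\<lambda>n. Complex (expectation (\<lambda>\<omega>. cos (t * F (Suc n) \<omega>))) (expectation (\<lambda>\<omega>. sin (t * F (Suc n) \<omega>))))
        \<longlonglongrightarrow> Complex (exp (- t\<^sup>2 / 2)) 0"
      by (intro tendsto_Complex chaos_cos_sin_limit[OF q F LIMSEQ_Suc[OF assms(4)] LIMSEQ_Suc[OF assms(5)]])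
    then show "(\<lambda>n. char (distr M borel (F (Suc n))) t) \<longlonglongrightarrow> char std_normal_distribution t"
      by (simp add: char_distr_cos_sin[OF Fm] char_std_normal_distribution complex_of_real_def)
  qed
  then show ?thesis
    unfolding weak_conv_m_def weak_conv_def by (subst filterlim_sequentially_Suc[symmetric])
qed

end
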